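(* Let $a>0$ and $\theta\in\mathbb R$. Suppose the log-Sobolev assumption (LSI) holds. Then there is $\kappa>0$ such that, for each $T>0$, there is $C(T)>0$ with $$\mathcal F(f_t\,|\,\nu^n_g,\kappa)+\int_0^t\mathscr G_n(f_s;\nu^n_g)\,ds\;\le\;C(T)\,\mathcal F(f_0\,|\,\nu^n_g,\kappa)+C(T)\sqrt n$$ for all $n$, all $t\in[0,T]$ and all initial probability measures $\mu_n$ on $\Omega_n$, where $f_t=\frac{d\,\mu_nS^n(t)}{d\nu^n_g}$.
   Context: Setting. $\mathbb T=\mathbb R/\mathbb Z$, $\mathbb T_n=\mathbb Z/n\mathbb Z$, $\Omega_n=\{0,1\}^{\mathbb T_n}$; indices are modulo $n$. For $\eta\in\Omega_n$: $\eta^{i,j}$ is $\eta$ with the values at $i,j$ exchanged, $\eta^i$ is $\eta$ with $\eta_i$ replaced by $1-\eta_i$, $\bar\eta_i=\eta_i-\tfrac12$, $\sigma_i=2\eta_i-1$. Parameters: $a>0$, $\theta\in\mathbb R$, $\gamma=\gamma_n=\frac12\big(1-\frac{\theta}{\sqrt n}\big)$; only $n\ge3$ with $n>\theta^2$ are considered, so that $\gamma_n\in(0,1)$. Jump rates: $c(\tau_i\eta)=1-\gamma\sigma_i(\sigma_{i-1}+\sigma_{i+1})+\gamma^2\sigma_{i-1}\sigma_{i+1}$. Generator: $$L_nf(\eta)=n^2\sum_{i\in\mathbb T_n}[f(\eta^{i,i+1})-f(\eta)]+a\sum_{i\in\mathbb T_n}c(\tau_i\eta)[f(\eta^i)-f(\eta)].$$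 $S^n(t)$ is the semigroup of the Markov chain on $\Omega_n$ with generator $\mathscr L_n=\sqrt n\,L_n$. $\nu^n_{1/2}$ is the uniform measure on $\Omega_n$. Define $g=g_n:\mathbb T\to\mathbb R$ by $$g(x)=\min\{4,8\gamma\}+\sum_{\ell\ge1}\lambda_\ell\,2\cos(2\pi\ell x),\qquad \lambda_\ell=\frac{4\pi^2\ell^2+2a(1+2\gamma)-|4\pi^2\ell^2+2a(1-2\gamma)|}{a+2\pi^2\ell^2},$$ and $\nu^n_g(\eta)=\frac1{Z^n_g}\exp\big[\frac1{2n}\sum_{i\ne j}\bar\eta_i\bar\eta_j\,g(\tfrac{i-j}n)\big]\nu^n_{1/2}(\eta)$. For a density $h$ with respect to $\nu$: $H_n(h|\nu)=\int h\log h\,d\nu$, $\mathscr G_n(h;\nu)=\int\frac12\{\mathscr L_nh-2\sqrt h\,\mathscr L_n\sqrt h\}\,d\nu$, and, with $\mathcal Y^n(\eta)=n^{-3/4}\sum_i\bar\eta_i$, the free energy is $$\mathcal F(h\,|\,\nu^n_g,\kappa)=H_n(h|\nu^n_g)+\kappa\sqrt n\int(\mathcal Y^n)^2\,h\,d\nu^n_g.$$ Assumption (LSI). Let $\nu^{n,m}_g=\nu^n_g(\cdot\,|\sum_i\eta_i=m)$ on $\Omega_{n,m}=\{\eta\in\Omega_n:\sum_i\eta_i=m\}$, $\mathrm{Ent}_\nu(F)=\nu(F\log F)-\nu(F)\log\nu(F)$, $\nabla_{i,j}F(\eta)=F(\eta^{i,j})-F(\eta)$. (LSI) states: for any $a>0$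 there is $\mathfrak c_{LS}=\mathfrak c_{LS}(a)>0$ such that for all $n$, $0\le m\le n$ and $F:\Omega_{n,m}\to\mathbb R_+$, $$\mathrm{Ent}_{\nu^{n,m}_g}(F)\le\mathfrak c_{LS}\,n^2\cdot\tfrac12\sum_{i\in\mathbb T_n}\nu^{n,m}_g\big([\nabla_{i,i+1}\sqrt F]^2\big),$$ $$\mathrm{Ent}_{\nu^{n,m}_g}(F)\le\mathfrak c_{LS}\log\Big(\frac{n^2}{m(n-m)}\Big)\,\nu^{n,m}_g\Big(\frac1n\sum_{i,j\in\mathbb T_n}[\nabla_{i,j}\sqrt F]^2\Big)$$ (the second is void for $m\in\{0,n\}$). *)

theory Defs
  imports "HOL-Probability.Probability"
begin

text \<open>
  The discrete torus with \<open>n\<close> sites is \<open>{..<n}\<close>, with neighbours taken modulo \<open>n\<close>.  A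
  configuration is extended by \<^term>\<open>undefined\<close> outside the torus (extensional function space), so
  that the configuration space is a finite set with exactly \<open>2 ^ n\<close> elements.
\<close>

type_synonym conf = "nat \<Rightarrow> nat"

definition Omega :: "nat \<Rightarrow> conf set" where
  "Omega n = {..<n} \<rightarrow>\<^sub>E {0, 1}"

definition Omega_level :: "nat \<Rightarrow> nat \<Rightarrow> conf set" where
  "Omega_level n m = {\<eta> \<in> Omega n. (\<Sum>i<n. \<eta> i) = m}"

definition succ_site :: "nat \<Rightarrow> nat \<Rightarrow> nat" where
  "succ_site n i = (i + 1) mod n"

definition pred_site :: "nat \<Rightarrow> nat \<Rightarrow> nat" where
  "pred_site n i = (i + n - 1) mod n"

definition exchange :: "conf \<Rightarrow> nat \<Rightarrow> nat \<Rightarrow> conf" where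
  "exchange \<eta> i j = \<eta>(i := \<eta> j, j := \<eta> i)"

definition flip :: "conf \<Rightarrow> nat \<Rightarrow> conf" where
  "flip \<eta> i = \<eta>(i := 1 - \<eta> i)"

definition centred :: "conf \<Rightarrow> nat \<Rightarrow> real" where
  "centred \<eta> i = real (\<eta> i) - 1 / 2"

definition spin :: "conf \<Rightarrow> nat \<Rightarrow> real" where
  "spin \<eta> i = 2 * real (\<eta> i) - 1"

definition admissible :: "real \<Rightarrow> nat \<Rightarrow> bool" where
  "admissible \<theta> n \<longleftrightarrow> 3 \<le> n \<and> \<theta>\<^sup>2 < real n"

definition gam :: "real \<Rightarrow> nat \<Rightarrow> real" where
  "gam \<theta> n = 1 / 2 * (1 - \<theta> / sqrt (real n))"


subsection \<open>The dynamics\<close>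

definition flip_rate :: "real \<Rightarrow> nat \<Rightarrow> conf \<Rightarrow> nat \<Rightarrow> real" where
  "flip_rate \<theta> n \<eta> i =
     1 - gam \<theta> n * spin \<eta> i * (spin \<eta> (pred_site n i) + spin \<eta> (succ_site n i))
       + (gam \<theta> n)\<^sup>2 * spin \<eta> (pred_site n i) * spin \<eta> (succ_site n i)"

definition gen_L :: "real \<Rightarrow> real \<Rightarrow> nat \<Rightarrow> (conf \<Rightarrow> real) \<Rightarrow> conf \<Rightarrow> real" where
  "gen_L a \<theta> n f \<eta> =
     (real n)\<^sup>2 * (\<Sum>i<n. f (exchange \<eta> i (succ_site n i)) - f \<eta>)
     + a * (\<Sum>i<n. flip_rate \<theta> n \<eta> i * (f (flip \<eta> i) - f \<eta>))"

definition gen :: "real \<Rightarrow> real \<Rightarrow> nat \<Rightarrow> (conf \<Rightarrow> real) \<Rightarrow> conf \<Rightarrow> real" where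
  "gen a \<theta> n f \<eta> = sqrt (real n) * gen_L a \<theta> n f \<eta>"

text \<open>
  The state space is finite, so the semigroup is the exponential of \<open>t\<close> times the generator,
  written as its power series (which converges, see \<open>summable_semigroup\<close> below).
\<close>

definition semigroup_S :: "real \<Rightarrow> real \<Rightarrow> nat \<Rightarrow> real \<Rightarrow> (conf \<Rightarrow> real) \<Rightarrow> conf \<Rightarrow> real" where
  "semigroup_S a \<theta> n t f \<eta> = (\<Sum>k. t ^ k / fact k * (gen a \<theta> n ^^ k) f \<eta>)"

definition law_at :: "real \<Rightarrow> real \<Rightarrow> nat \<Rightarrow> conf measure \<Rightarrow> real \<Rightarrow> conf measure" where
  "law_at a \<theta> n \<mu> t =
     point_measure (Omega n)
       (\<lambda>\<eta>. ennreal (\<integral>\<xi>. semigroup_S a \<theta> n t (indicator {\<eta>}) \<xi> \<partial>\<mu>))"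


subsection \<open>The reference measures\<close>

definition nu_half :: "nat \<Rightarrow> conf measure" where
  "nu_half n = uniform_count_measure (Omega n)"

definition lam :: "real \<Rightarrow> real \<Rightarrow> nat \<Rightarrow> nat \<Rightarrow> real" where
  "lam a \<theta> n l =
     (4 * pi\<^sup>2 * (real l)\<^sup>2 + 2 * a * (1 + 2 * gam \<theta> n)
        - \<bar>4 * pi\<^sup>2 * (real l)\<^sup>2 + 2 * a * (1 - 2 * gam \<theta> n)\<bar>)
     / (a + 2 * pi\<^sup>2 * (real l)\<^sup>2)"

text \<open>A function on the continuous torus is given by its 1-periodic lift to the reals.\<close>

definition gfun :: "real \<Rightarrow> real \<Rightarrow> nat \<Rightarrow> real \<Rightarrow> real" where
  "gfun a \<theta> n x =
     min 4 (8 * gam \<theta> n)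
     + (\<Sum>l. lam a \<theta> n (Suc l) * (2 * cos (2 * pi * real (Suc l) * x)))"

definition gibbs_weight :: "real \<Rightarrow> real \<Rightarrow> nat \<Rightarrow> conf \<Rightarrow> real" where
  "gibbs_weight a \<theta> n \<eta> =
     exp (1 / (2 * real n) *
       (\<Sum>i<n. \<Sum>j\<in>{..<n} - {i}.
          centred \<eta> i * centred \<eta> j * gfun a \<theta> n ((real i - real j) / real n)))"

definition part_fun :: "real \<Rightarrow> real \<Rightarrow> nat \<Rightarrow> real" where
  "part_fun a \<theta> n = (\<integral>\<eta>. gibbs_weight a \<theta> n \<eta> \<partial>nu_half n)"

definition nu_g :: "real \<Rightarrow> real \<Rightarrow> nat \<Rightarrow> conf measure" where
  "nu_g a \<theta> n =
     density (nu_half n) (\<lambda>\<eta>. ennreal (gibbs_weight a \<theta> n \<eta> / part_fun a \<theta> n))"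

text \<open>
  \<^const>\<open>uniform_measure\<close> is conditioning on an event; the result is carried by
  \<^term>\<open>Omega_level n m\<close> but keeps \<^term>\<open>Omega n\<close> as underlying space.
\<close>

definition nu_g_level :: "real \<Rightarrow> real \<Rightarrow> nat \<Rightarrow> nat \<Rightarrow> conf measure" where
  "nu_g_level a \<theta> n m = uniform_measure (nu_g a \<theta> n) (Omega_level n m)"

definition dens_at :: "real \<Rightarrow> real \<Rightarrow> nat \<Rightarrow> conf measure \<Rightarrow> real \<Rightarrow> conf \<Rightarrow> real" where
  "dens_at a \<theta> n \<mu> t \<eta> = enn2real (RN_deriv (nu_g a \<theta> n) (law_at a \<theta> n \<mu> t) \<eta>)"


subsection \<open>Entropy, carre du champ, free energy\<close>

text \<open>The convention \<open>0 log 0 = 0\<close> is met because of the vanishing factor \<open>h \<eta>\<close>.\<close>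

definition rel_entropy :: "conf measure \<Rightarrow> (conf \<Rightarrow> real) \<Rightarrow> real" where
  "rel_entropy \<nu> h = (\<integral>\<eta>. h \<eta> * ln (h \<eta>) \<partial>\<nu>)"

definition carre :: "real \<Rightarrow> real \<Rightarrow> nat \<Rightarrow> conf measure \<Rightarrow> (conf \<Rightarrow> real) \<Rightarrow> real" where
  "carre a \<theta> n \<nu> h =
     (\<integral>\<eta>. 1 / 2 * (gen a \<theta> n h \<eta>
                 - 2 * sqrt (h \<eta>) * gen a \<theta> n (\<lambda>\<xi>. sqrt (h \<xi>)) \<eta>) \<partial>\<nu>)"

definition magnet :: "nat \<Rightarrow> conf \<Rightarrow> real" where
  "magnet n \<eta> = real n powr (- 3 / 4) * (\<Sum>i<n. centred \<eta> i)"

definition free_energy :: "nat \<Rightarrow> conf measure \<Rightarrow> real \<Rightarrow> (conf \<Rightarrow> real) \<Rightarrow> real" where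
  "free_energy n \<nu> \<kappa> h =
     rel_entropy \<nu> h + \<kappa> * sqrt (real n) * (\<integral>\<eta>. (magnet n \<eta>)\<^sup>2 * h \<eta> \<partial>\<nu>)"


subsection \<open>The log-Sobolev assumption\<close>

definition Ent :: "conf measure \<Rightarrow> (conf \<Rightarrow> real) \<Rightarrow> real" where
  "Ent \<nu> F =
     (\<integral>\<eta>. F \<eta> * ln (F \<eta>) \<partial>\<nu>) - (\<integral>\<eta>. F \<eta> \<partial>\<nu>) * ln (\<integral>\<eta>. F \<eta> \<partial>\<nu>)"

definition nabla :: "nat \<Rightarrow> nat \<Rightarrow> (conf \<Rightarrow> real) \<Rightarrow> conf \<Rightarrow> real" where
  "nabla i j F \<eta> = F (exchange \<eta> i j) - F \<eta>"

text \<open>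
  The constant may depend on \<open>a\<close> and on the fixed parameter \<open>\<theta>\<close>, but not on \<open>n\<close>, \<open>m\<close> or \<open>F\<close>.
\<close>

definition LSI :: "real \<Rightarrow> bool" where
  "LSI \<theta> \<longleftrightarrow>
     (\<forall>a>0. \<exists>c>0. \<forall>n m F. admissible \<theta> n \<and> m \<le> n \<and> (\<forall>\<eta>\<in>Omega_level n m. 0 \<le> F \<eta>) \<longrightarrow>
        Ent (nu_g_level a \<theta> n m) F
          \<le> c * (real n)\<^sup>2 * (1 / 2) *
              (\<Sum>i<n. \<integral>\<eta>. (nabla i (succ_site n i) (\<lambda>\<xi>. sqrt (F \<xi>)) \<eta>)\<^sup>2 \<partial>nu_g_level a \<theta> n m)
        \<and> (0 < m \<and> m < n \<longrightarrow>
             Ent (nu_g_level a \<theta> n m) F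
               \<le> c * ln ((real n)\<^sup>2 / (real m * (real n - real m))) *
                   (\<integral>\<eta>. 1 / real n *
                      (\<Sum>i<n. \<Sum>j<n. (nabla i j (\<lambda>\<xi>. sqrt (F \<xi>)) \<eta>)\<^sup>2) \<partial>nu_g_level a \<theta> n m)))"


subsection \<open>The objects above are well defined\<close>

lemma finite_Omega: "finite (Omega n)" unfolding Omega_def by (intro finite_PiE) auto
lemma Omega_ne: "Omega n \<noteq> {}" unfolding Omega_def by (auto simp: PiE_eq_empty_iff)

lemma site: "i < n \<Longrightarrow> succ_site n i < n" "i < n \<Longrightarrow> pred_site n i < n"
  by (auto simp: succ_site_def pred_site_def)

lemma exchange_Omega: "\<eta> \<in> Omega n \<Longrightarrow> i < n \<Longrightarrow> j < n \<Longrightarrow> exchange \<eta> i j \<in> Omega n"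
  unfolding Omega_def exchange_def by (auto simp: PiE_iff extensional_def) 

lemma flip_Omega: "\<eta> \<in> Omega n \<Longrightarrow> i < n \<Longrightarrow> flip \<eta> i \<in> Omega n"
  unfolding Omega_def flip_def by (auto simp: PiE_iff extensional_def)

lemma gen_bound:
  "\<exists>B\<ge>0. \<forall>f M. (\<forall>\<eta>\<in>Omega n. \<bar>f \<eta>\<bar> \<le> M) \<longrightarrow> (\<forall>\<eta>\<in>Omega n. \<bar>gen a \<theta> n f \<eta>\<bar> \<le> B * M)"
proof -
  define R where "R = (\<Sum>\<eta>\<in>Omega n. \<Sum>i<n. \<bar>flip_rate \<theta> n \<eta> i\<bar>)"
  define B where "B = sqrt (real n) * ((real n)\<^sup>2 * (real n * 2) + \<bar>a\<bar> * (R * 2))"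
  have R0: "R \<ge> 0" unfolding R_def by (intro sum_nonneg) auto
  have "\<bar>gen a \<theta> n f \<eta>\<bar> \<le> B * M" if f: "\<forall>\<eta>\<in>Omega n. \<bar>f \<eta>\<bar> \<le> M" and e: "\<eta> \<in> Omega n" for f M \<eta>
  proof -
    have M0: "M \<ge> 0" using f e by force
    have 1: "\<bar>\<Sum>i<n. f (exchange \<eta> i (succ_site n i)) - f \<eta>\<bar> \<le> real n * (2 * M)"
    proof -
      have "\<bar>f (exchange \<eta> i (succ_site n i)) - f \<eta>\<bar> \<le> 2 * M" if "i < n" for i
        using f[rule_format, OF e] f[rule_format, OF exchange_Omega[OF e that site(1)[OF that]]] by linarith
      hence "(\<Sum>i<n. \<bar>f (exchange \<eta> i (succ_site n i)) - f \<eta>\<bar>) \<le> (\<Sum>i<n. 2 * M)"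
        by (intro sum_mono) auto
      thus ?thesis using order_trans[OF sum_abs] by simp
    qed
    have 2: "\<bar>\<Sum>i<n. flip_rate \<theta> n \<eta> i * (f (flip \<eta> i) - f \<eta>)\<bar> \<le> R * (2 * M)"
    proof -
      have "\<bar>f (flip \<eta> i) - f \<eta>\<bar> \<le> 2 * M" if "i < n" for i
        using f[rule_format, OF e] f[rule_format, OF flip_Omega[OF e that]] by linarith
      hence "(\<Sum>i<n. \<bar>flip_rate \<theta> n \<eta> i * (f (flip \<eta> i) - f \<eta>)\<bar>)
          \<le> (\<Sum>i<n. \<bar>flip_rate \<theta> n \<eta> i\<bar> * (2 * M))"
        by (intro sum_mono) (auto simp: abs_mult intro!: mult_left_mono)
      also have "\<dots> = (\<Sum>i<n. \<bar>flip_rate \<theta> n \<eta> i\<bar>) * (2 * M)" by (simp add: sum_distrib_right)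
      also have "\<dots> \<le> R * (2 * M)" unfolding R_def using M0
        by (intro mult_right_mono member_le_sum[OF e]) (auto intro!: sum_nonneg finite_Omega)
      finally show ?thesis using sum_abs[of "\<lambda>i. flip_rate \<theta> n \<eta> i * (f (flip \<eta> i) - f \<eta>)" "{..<n}"] by linarith
    qed
    have "\<bar>gen_L a \<theta> n f \<eta>\<bar> \<le> (real n)\<^sup>2 * (real n * (2 * M)) + \<bar>a\<bar> * (R * (2 * M))"
      unfolding gen_L_def
      by (rule order_trans[OF abs_triangle_ineq], rule add_mono)
         (auto simp only: abs_mult abs_power2 abs_of_nat intro!: mult_left_mono 1 2, auto)
    hence "sqrt (real n) * \<bar>gen_L a \<theta> n f \<eta>\<bar> \<le> sqrt (real n) * ((real n)\<^sup>2 * (real n * (2 * M)) + \<bar>a\<bar> * (R * (2 * M)))"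
      by (intro mult_left_mono) auto
    thus ?thesis unfolding gen_def B_def by (simp add: abs_mult algebra_simps)
  qed
  moreover have "B \<ge> 0" unfolding B_def using R0 by simp
  ultimately show ?thesis by blast
qed

lemma summable_semigroup:
  assumes "\<eta> \<in> Omega n"
  shows "summable (\<lambda>k. t ^ k / fact k * (gen a \<theta> n ^^ k) f \<eta>)"
proof -
  obtain B where B: "B \<ge> 0" "\<And>f M. (\<forall>\<eta>\<in>Omega n. \<bar>f \<eta>\<bar> \<le> M) \<Longrightarrow> (\<forall>\<eta>\<in>Omega n. \<bar>gen a \<theta> n f \<eta>\<bar> \<le> B * M)"
    using gen_bound[of n a \<theta>] by blast
  define M where "M = (\<Sum>\<eta>\<in>Omega n. \<bar>f \<eta>\<bar>)"
  have "\<forall>\<eta>\<in>Omega n. \<bar>(gen a \<theta> n ^^ k) f \<eta>\<bar> \<le> B ^ k * M" for k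
  proof (induction k)
    case 0 show ?case unfolding M_def by (auto intro!: member_le_sum finite_Omega)
  next
    case (Suc k) from B(2)[OF this] show ?case by (simp add: mult.assoc)
  qed
  hence b: "norm (t ^ k / fact k * (gen a \<theta> n ^^ k) f \<eta>) \<le> inverse (fact k) * (\<bar>t\<bar> * B) ^ k * M" for k
  proof -
    have "\<bar>t\<bar> ^ k / fact k * \<bar>(gen a \<theta> n ^^ k) f \<eta>\<bar> \<le> \<bar>t\<bar> ^ k / fact k * (B ^ k * M)"
      using \<open>\<forall>\<eta>\<in>Omega n. \<bar>(gen a \<theta> n ^^ k) f \<eta>\<bar> \<le> B ^ k * M\<close> assms by (intro mult_left_mono) auto
    thus ?thesis by (simp add: abs_mult power_abs power_mult_distrib field_simps)
  qed
  show ?thesis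
    by (rule summable_comparison_test[OF _ summable_mult2[OF summable_exp[of "\<bar>t\<bar> * B"], of M]]) (use b in auto)
qed

lemma part_fun_pos: "part_fun a \<theta> n > 0"
  unfolding part_fun_def nu_half_def uniform_count_measure_def
  using finite_Omega[of n] Omega_ne[of n]
  by (subst lebesgue_integral_point_measure_finite)
     (auto intro!: sum_pos divide_pos_pos simp: gibbs_weight_def card_gt_0_iff)

lemma nu_g_point_measure:
  "nu_g a \<theta> n = point_measure (Omega n)
     (\<lambda>\<eta>. ennreal (gibbs_weight a \<theta> n \<eta> / part_fun a \<theta> n / real (card (Omega n))))"
proof (rule measure_eqI)
  fix A assume "A \<in> sets (nu_g a \<theta> n)"
  hence A: "A \<subseteq> Omega n" "finite A"
    using finite_subset[OF _ finite_Omega] 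
    by (auto simp: nu_g_def nu_half_def uniform_count_measure_def sets_point_measure)
  have w: "gibbs_weight a \<theta> n \<eta> / part_fun a \<theta> n \<ge> 0" for \<eta>
    using part_fun_pos[of a \<theta> n] by (simp add: gibbs_weight_def)
  have "emeasure (nu_g a \<theta> n) A
      = (\<Sum>\<eta>\<in>Omega n. ennreal (1 / real (card (Omega n))) *
          (ennreal (gibbs_weight a \<theta> n \<eta> / part_fun a \<theta> n) * indicator A \<eta>))"
    using A unfolding nu_g_def nu_half_def uniform_count_measure_def
    by (subst emeasure_density)
       (auto simp: sets_point_measure nn_integral_point_measure_finite[OF finite_Omega])
  also have "\<dots> = (\<Sum>\<eta>\<in>Omega n. if \<eta> \<in> A then
      ennreal (gibbs_weight a \<theta> n \<eta> / part_fun a \<theta> n / real (card (Omega n))) else 0)"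
    by (intro sum.cong) (auto simp: ennreal_mult'[symmetric] w mult.commute)
  also have "\<dots> = (\<Sum>\<eta>\<in>A. ennreal (gibbs_weight a \<theta> n \<eta> / part_fun a \<theta> n / real (card (Omega n))))"
    using A finite_Omega[of n] by (simp add: sum.If_cases Int_absorb1)
  finally show "emeasure (nu_g a \<theta> n) A = emeasure (point_measure (Omega n)
     (\<lambda>\<eta>. ennreal (gibbs_weight a \<theta> n \<eta> / part_fun a \<theta> n / real (card (Omega n))))) A"
    using A by (simp add: emeasure_point_measure_finite2)
qed (simp add: nu_g_def nu_half_def uniform_count_measure_def sets_point_measure)

lemma prob_nu_g: "prob_space (nu_g a \<theta> n)"
proof
  have p: "part_fun a \<theta> n = (\<Sum>\<eta>\<in>Omega n. gibbs_weight a \<theta> n \<eta> / real (card (Omega n)))"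
    unfolding part_fun_def nu_half_def uniform_count_measure_def
    using finite_Omega[of n] by (subst lebesgue_integral_point_measure_finite) auto
  have "(\<Sum>\<eta>\<in>Omega n. gibbs_weight a \<theta> n \<eta> / part_fun a \<theta> n / real (card (Omega n)))
      = (\<Sum>\<eta>\<in>Omega n. gibbs_weight a \<theta> n \<eta> / real (card (Omega n))) / part_fun a \<theta> n"
    by (simp add: sum_divide_distrib divide_divide_eq_left mult.commute)
  also have "\<dots> = 1" using p part_fun_pos[of a \<theta> n] by simp
  finally show "emeasure (nu_g a \<theta> n) (space (nu_g a \<theta> n)) = 1"
    using part_fun_pos[of a \<theta> n] finite_Omega[of n] unfolding nu_g_point_measure
    by (simp add: space_point_measure emeasure_point_measure_finite gibbs_weight_def)
qed

lemma dens_at_eq_quotient: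
  assumes "\<eta> \<in> Omega n"
  shows "dens_at a \<theta> n \<mu> t \<eta>
           = measure (law_at a \<theta> n \<mu> t) {\<eta>} / measure (nu_g a \<theta> n) {\<eta>}"
proof -
  let ?N = "nu_g a \<theta> n" and ?L = "law_at a \<theta> n \<mu> t"
  interpret prob_space ?N by (rule prob_nu_g)
  have sets: "sets ?N = Pow (Omega n)" "sets ?L = Pow (Omega n)"
    by (simp_all add: nu_g_point_measure law_at_def sets_point_measure)
  have pos: "emeasure ?N {\<xi>} > 0" if "\<xi> \<in> Omega n" for \<xi>
    using that part_fun_pos[of a \<theta> n] finite_Omega[of n]
    by (auto simp: nu_g_point_measure emeasure_point_measure_finite gibbs_weight_def card_gt_0_iff
        intro!: divide_pos_pos mult_pos_pos)
  have ac: "absolutely_continuous ?N ?L"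
  proof -
    have "A = {}" if "A \<in> null_sets ?N" for A
    proof (rule ccontr)
      assume "A \<noteq> {}"
      then obtain \<xi> where \<xi>: "\<xi> \<in> A" by blast
      have "\<xi> \<in> Omega n" using that \<xi> sets by auto
      moreover have "emeasure ?N {\<xi>} \<le> emeasure ?N A"
        using that \<xi> by (intro emeasure_mono) auto
      ultimately show False using pos[of \<xi>] that by auto
    qed
    thus ?thesis unfolding absolutely_continuous_def by force
  qed
  have "emeasure ?L {\<eta>} = emeasure (density ?N (RN_deriv ?N ?L)) {\<eta>}"
    using density_RN_deriv[OF ac] sets by simp
  also have "\<dots> = (\<integral>\<^sup>+\<xi>. RN_deriv ?N ?L \<xi> * indicator {\<eta>} \<xi> \<partial>?N)"
    using assms sets by (intro emeasure_density) auto
  also have "\<dots> = RN_deriv ?N ?L \<eta> * emeasure ?N {\<eta>}"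
    using assms sets by (intro nn_integral_indicator_singleton) auto
  finally have "measure ?L {\<eta>} = dens_at a \<theta> n \<mu> t \<eta> * measure ?N {\<eta>}"
    unfolding measure_def dens_at_def by (simp add: enn2real_mult)
  moreover have "measure ?N {\<eta>} > 0"
    using pos[OF assms] by (simp add: emeasure_eq_measure)
  ultimately show ?thesis by simp
qed

lemma law_at_0:
  assumes "prob_space \<mu>" "sets \<mu> = Pow (Omega n)"
  shows "law_at a \<theta> n \<mu> 0 = \<mu>"
proof (rule measure_eqI_finite[OF _ assms(2) finite_Omega])
  interpret prob_space \<mu> by fact
  fix \<eta> assume e: "\<eta> \<in> Omega n"
  have "semigroup_S a \<theta> n 0 f \<xi> = f \<xi>" for f \<xi>
    unfolding semigroup_S_def using powser_zero[of "\<lambda>k. (gen a \<theta> n ^^ k) f \<xi> / fact k"]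
    by (simp add: field_simps)
  thus "emeasure (law_at a \<theta> n \<mu> 0) {\<eta>} = emeasure \<mu> {\<eta>}"
    using e assms(2) finite_Omega[of n]
    by (simp add: law_at_def emeasure_point_measure_finite emeasure_eq_measure)
qed (simp add: law_at_def sets_point_measure)

lemma summable_gfun:
  assumes "a > 0"
  shows "summable (\<lambda>l. lam a \<theta> n (Suc l) * (2 * cos (2 * pi * real (Suc l) * x)))"
proof -
  define K where "K = 2 * a * \<bar>1 + 2 * gam \<theta> n\<bar> + 2 * a * \<bar>1 - 2 * gam \<theta> n\<bar>"
  have K: "K \<ge> 0" using assms by (simp add: K_def)
  have bound: "norm (lam a \<theta> n (Suc l) * (2 * cos (2 * pi * real (Suc l) * x)))
      \<le> K * inverse (real (Suc l) ^ 2)" for l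
  proof -
    define q where "q = pi\<^sup>2 * (real (Suc l))\<^sup>2"
    have pi1: "1 \<le> pi\<^sup>2" using pi_gt3 by (intro one_le_power) auto
    have q: "(real (Suc l))\<^sup>2 \<le> q" "0 < q"
      unfolding q_def using mult_right_mono[OF pi1, of "(real (Suc l))\<^sup>2"] by auto
    have num: "\<bar>4 * q + 2 * a * (1 + 2 * gam \<theta> n) - \<bar>4 * q + 2 * a * (1 - 2 * gam \<theta> n)\<bar>\<bar> \<le> K"
    proof -
      have "2 * a * \<bar>1 + 2 * gam \<theta> n\<bar> = \<bar>2 * a * (1 + 2 * gam \<theta> n)\<bar>"
           "2 * a * \<bar>1 - 2 * gam \<theta> n\<bar> = \<bar>2 * a * (1 - 2 * gam \<theta> n)\<bar>"
        using assms by (simp_all add: abs_mult)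
      moreover have "\<bar>4 * q + u - \<bar>4 * q + v\<bar>\<bar> \<le> \<bar>u\<bar> + \<bar>v\<bar>" for u v
        using q(2) by linarith
      ultimately show ?thesis unfolding K_def by metis
    qed
    have l: "\<bar>lam a \<theta> n (Suc l)\<bar> \<le> K / (2 * q)"
      unfolding lam_def mult.assoc[of _ "pi\<^sup>2"] q_def[symmetric] abs_divide
      using num q assms by (intro frac_le) auto
    have "\<bar>lam a \<theta> n (Suc l)\<bar> * (2 * \<bar>cos (2 * pi * real (Suc l) * x)\<bar>) \<le> K / (2 * q) * 2"
      using l q K by (intro mult_mono) auto
    also have "K / (2 * q) * 2 = K / q"
      by simp
    also have "\<dots> \<le> K / (real (Suc l))\<^sup>2"
      using q K by (intro frac_le) auto
    also have "\<dots> = K * inverse (real (Suc l) ^ 2)"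
      by (rule divide_inverse)
    finally show ?thesis by (simp only: real_norm_def abs_mult abs_numeral)
  qed
  have "summable (\<lambda>l. inverse (real (Suc l) ^ 2))"
    using inverse_power_summable[of 2, where 'a = real]
      summable_Suc_iff[of "\<lambda>l. inverse (real l ^ 2)"] by blast
  hence "summable (\<lambda>l. K * inverse (real (Suc l) ^ 2))"
    by (rule summable_mult)
  thus ?thesis
    by (rule summable_comparison_test'[where N = 0]) (rule bound)
qed

end

theory Submission
  imports Defs
begin

text \<open>
  The Lyapunov functional is the entropy relative to the Curie--Weiss weight \<open>exp (n m^2 / 2)\<close>, \<open>m\<close> being the mean
  spin, plus a quadratic form in the spins: a multiple of \<open>n m^2\<close>, negative Sobolev norms \<open>P1\<close> and \<open>P3\<close>, and the
  variance \<open>P2\<close> of block averages.  The Curie--Weiss weight is not invariant, and the error in the entropy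
  production consists of sums of products of two and three neighbouring spins.  The exchange Dirichlet form
  allows one to replace these spins by averages over macroscopically small blocks (mesoscopic ones for the cubic term), after
  which the quadratic form dissipates enough to absorb them, and Gronwall's inequality applies.

  Passing to the free energy relative to \<open>nu_g\<close> costs an error of order \<open>sqrt n\<close>.  The interaction of \<open>nu_g\<close> is a positive
  semidefinite kernel of total mass \<open>4 + O(n powr (- 1/2))\<close>, nonnegative up to a small error by the maximum
  principle.  It is therefore a contraction up to this error, and integrating out one spin at a time bounds its mean energy.
  Doubling \<open>a\<close> increases all modes except the zero mode, so that the entropy controls strictly more than the
  energy of the nonzero modes, while the zero mode is the magnetisation term of the free energy.
\<close>

section \<open>Periodic sequences and cyclic convolutions\<close>

text \<open>At the critical point the linear relaxation rate of the magnetisation is proportional to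
  \<open>1 - 2 * gam\<close>, of order \<open>n powr (- 1/2)\<close>; the acceleration by
  \<open>sqrt n\<close> makes it of order one. Hence every error in the entropy production must be
  dissipated, or be at most a constant plus the functional divided by \<open>sqrt n\<close>. The
  Curie--Weiss weight is constant along exchanges and its flip ratios depend only on the spin and on
  \<open>m\<close>, so its error is an explicit polynomial. The leading part, a sum of two-point
  products minus \<open>n m^2\<close>, is cancelled exactly by what the exchanges do to
  \<open>P1\<close>, weighted by \<open>a * gam\<close>. The exchanges turn \<open>P3\<close> into
  \<open>- P1\<close> and \<open>P2\<close> into minus the gradient energy of the block averages,
  and the flips turn \<open>n m^2\<close> into a sink of order \<open>n m^4\<close>. Each functional
  also brings a cubic term through the flip rates. For \<open>P2\<close>, with its large coefficient
  \<open>K\<close>, this term has the right sign up to errors that vanish with the block size,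
  because the cube is monotone; so \<open>K\<close> can be fixed before the block size is chosen
  small.\<close>

definition per :: "nat => (int => 'b) => bool" where
  "per n f \<longleftrightarrow> (\<forall>i. f (i + int n) = f i)"

definition tsum :: "nat => (int => real) => real" where
  "tsum n f = (\<Sum>i\<in>{0..<int n}. f i)"

text \<open>\<open>cv n U\<close> is a correlation and \<open>cva n U\<close> a convolution with the
  same kernel; they are adjoint (\<open>cv_adj\<close>). Both occur because the sawtooth and the
  block kernels are not even, and \<open>cva n U (cv n U x)\<close> is half the gradient of the
  square norm of \<open>cv n U x\<close>.\<close>

definition cv :: "nat => (int => real) => (int => real) => int => real" where
  "cv n U x i = tsum n (%j. U (j - i) * x j)"

definition cva :: "nat => (int => real) => (int => real) => int => real" where
  "cva n U f i = tsum n (%l. U (i - l) * f l)"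

definition cind :: "nat => int => int => real" where
  "cind n b j = (if (j - b) mod int n = 0 then 1 else 0)"

lemma per_mult_nat: "per n f ==> f (i + int k * int n) = f i"
proof (induction k arbitrary: i)
  case (Suc k)
  have "f (i + int (Suc k) * int n) = f ((i + int k * int n) + int n)" by (simp add: algebra_simps)
  also have "... = f (i + int k * int n)" using Suc.prems unfolding per_def by blast
  finally show ?case using Suc by simp
qed simp

lemma per_mult: assumes "per n f" shows "f (i + k * int n) = f i"
proof (cases "k \<ge> 0")
  case True
  then show ?thesis using per_mult_nat[OF assms, of i "nat k"] by simp
next
  case False
  then show ?thesis using per_mult_nat[OF assms, of "i + k * int n" "nat (-k)"] by simp
qed

lemma per_mod: assumes "per n f" shows "f (i mod int n) = f i"
  using per_mult[OF assms, of "i mod int n" "i div int n"] by (simp add: mult.commute)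

lemma perI: "(!!i. f (i + int n) = f i) ==> per n f" unfolding per_def by blast
lemma perD: "per n f ==> f (i + int n) = f i" unfolding per_def by blast
lemma perD3: "per n f ==> f (i - int n) = f i" using perD[of n f "i - int n"] by simp

lemma per_shift: "per n f ==> per n (%i. f (i + k))"
  unfolding per_def by (metis add.commute add.left_commute)
lemma per_shift': "per n f ==> per n (%i. f (i - k))"
  using per_shift[of n f "-k"] by simp
lemma per_refl: "per n f ==> per n (%i. f (k - i))"
proof (rule perI)
  fix i assume "per n f"
  from perD3[OF this, of "k - i"] show "f (k - (i + int n)) = f (k - i)" by (simp add: algebra_simps)
qed
lemma per_bin: "per n f ==> per n g ==> per n (%i. h (f i) (g i))"
  unfolding per_def by simp
lemma per_un: "per n f ==> per n (%i. h (f i))"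
  unfolding per_def by simp
lemma per_const: "per n (%i. c)" unfolding per_def by simp
lemma per_sum: "(!!k. k \<in> K ==> per n (f k)) ==> per n (%i. \<Sum>k\<in>K. f k i)"
  unfolding per_def by (auto intro!: sum.cong)
lemma per_prod2: "per n (f::int => real) ==> per n g ==> per n (%i. f i * g i)" by (rule per_bin)
lemma per_diff: "per n (f::int => real) ==> per n g ==> per n (%i. f i - g i)" by (rule per_bin)
lemma per_add: "per n (f::int => real) ==> per n g ==> per n (%i. f i + g i)" by (rule per_bin)
lemma per_pow: "per n (f::int => real) ==> per n (%i. (f i)^k)" by (rule per_un)
lemma per_abs: "per n (f::int => real) ==> per n (%i. \<bar>f i\<bar>)" by (rule per_un)
lemma per_cmult: "per n (f::int => real) ==> per n (%i. c * f i)" by (rule per_un)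
lemma per_cdiff: "per n (f::int => real) ==> per n (%i. f i - c)" by (rule per_un)
lemmas per_intros = per_prod2 per_diff per_add per_pow per_abs per_const per_shift per_shift' per_refl per_cmult per_cdiff

lemma tsum_add: "tsum n (%i. f i + g i) = tsum n f + tsum n g" by (simp add: tsum_def sum.distrib)
lemma tsum_diff: "tsum n (%i. f i - g i) = tsum n f - tsum n g" by (simp add: tsum_def sum_subtractf)
lemma tsum_cmult: "tsum n (%i. c * f i) = c * tsum n f" by (simp add: tsum_def sum_distrib_left)
lemma tsum_cmult2: "tsum n (%i. f i * c) = tsum n f * c" by (simp add: tsum_def sum_distrib_right)
lemma tsum_cdiv: "tsum n (%i. f i / c) = tsum n f / c" by (simp add: tsum_def sum_divide_distrib)
lemma tsum_uminus: "tsum n (%i. - f i) = - tsum n f" by (simp add: tsum_def sum_negf)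
lemma tsum_const: "tsum n (%i. c) = real n * c" by (simp add: tsum_def)
lemma tsum_cong: "(!!i. f i = g i) ==> tsum n f = tsum n g" by (simp add: tsum_def)
lemma tsum_mono: "(!!i. 0 \<le> i ==> i < int n ==> f i \<le> g i) ==> tsum n f \<le> tsum n g" by (auto simp: tsum_def intro: sum_mono)
lemma tsum_nonneg: "(!!i. 0 \<le> f i) ==> 0 \<le> tsum n f" by (auto simp: tsum_def intro: sum_nonneg)
lemma tsum_abs_le: "\<bar>tsum n f\<bar> \<le> tsum n (%i. \<bar>f i\<bar>)" by (simp add: tsum_def sum_abs)
lemma tsum_swap: "tsum n (%i. tsum m (%j. f i j)) = tsum m (%j. tsum n (%i. f i j))"
  unfolding tsum_def by (rule sum.swap)
lemma tsum_sum: "tsum n (%i. \<Sum>k\<in>K. f i k) = (\<Sum>k\<in>K. tsum n (%i. f i k))"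
  unfolding tsum_def by (rule sum.swap)
lemma tsum_0: "tsum n (%i. 0) = 0" by (simp add: tsum_def)

lemma tsum_nat: "(\<Sum>i<n. h i) = tsum n (%i. h (nat i))"
  unfolding tsum_def
  by (rule sum.reindex_bij_witness[of _ nat int]) auto

lemma tsum_bij:
  assumes "per n f" "bij_betw (%i. g i mod int n) {0..<int n} {0..<int n}"
  shows "tsum n (%i. f (g i)) = tsum n f"
proof -
  have "tsum n (%i. f (g i)) = (\<Sum>i\<in>{0..<int n}. f (g i mod int n))"
    unfolding tsum_def by (simp add: per_mod[OF assms(1)])
  also have "... = tsum n f" unfolding tsum_def
    by (rule sum.reindex_bij_betw[OF assms(2)])
  finally show ?thesis .
qed

lemma tsum_shift: assumes "per n f" shows "tsum n (%i. f (i + k)) = tsum n f"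
proof (cases "n = 0")
  case False
  have "bij_betw (%i. (i + k) mod int n) {0..<int n} {0..<int n}"
    by (rule bij_betw_byWitness[where f' = "%i. (i - k) mod int n"]) (use False in \<open>auto simp: mod_simps\<close>)
  then show ?thesis by (rule tsum_bij[OF assms])
qed (simp add: tsum_def)

lemma tsum_shift': "per n f ==> tsum n (%i. f (i - k)) = tsum n f"
  using tsum_shift[of n f "-k"] by simp

lemma tsum_reflect: assumes "per n f" shows "tsum n (%i. f (k - i)) = tsum n f"
proof (cases "n = 0")
  case False
  have "bij_betw (%i. (k - i) mod int n) {0..<int n} {0..<int n}"
    by (rule bij_betw_byWitness[where f' = "%i. (k - i) mod int n"]) (use False in \<open>auto simp: mod_simps\<close>)
  then show ?thesis by (rule tsum_bij[OF assms])
qed (simp add: tsum_def)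

lemma tsum_cind: assumes "per n f" "n > 0" shows "tsum n (%j. f j * cind n b j) = f b"
proof -
  have "(j - b) mod int n = 0 \<longleftrightarrow> j = b mod int n" if "j \<in> {0..<int n}" for j
  proof -
    have "(j - b) mod int n = 0 \<longleftrightarrow> j mod int n = b mod int n"
      by (simp add: mod_eq_dvd_iff mod_eq_0_iff_dvd)
    then show ?thesis using that by simp
  qed
  then have "tsum n (%j. f j * cind n b j) = (\<Sum>j\<in>{0..<int n}. if j = b mod int n then f j else 0)"
    unfolding tsum_def cind_def by (intro sum.cong) auto
  also have "... = f b" using assms(2) by (simp add: per_mod[OF assms(1)])
  finally show ?thesis .
qed

lemma tsum_ge_term: assumes "per n f" "!!i. 0 \<le> f i" "n > 0" shows "f i \<le> tsum n f"
proof -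
  have "f (i mod int n) \<le> tsum n f" unfolding tsum_def
    by (rule member_le_sum) (use assms in auto)
  then show ?thesis by (simp add: per_mod[OF assms(1)])
qed

lemma tsum_CS: "(tsum n (%i. f i * g i))^2 \<le> tsum n (%i. (f i)^2) * tsum n (%i. (g i)^2)"
  unfolding tsum_def by (rule Cauchy_Schwarz_ineq_sum)

lemma tsum_telescope: assumes "per n f" shows "tsum n (%i. f (i + 1) - f i) = 0"
  using tsum_shift[OF assms, of 1] by (simp add: tsum_diff)

lemma per_cind: "per n (cind n b)" 
proof (rule perI)
  fix i
  have "(i + int n - b) mod int n = (i - b) mod int n"
    by (metis add_diff_eq diff_add_eq mod_add_self2)
  then show "cind n b (i + int n) = cind n b i" unfolding cind_def by simp
qed

lemma per_cv: assumes "per n U" shows "per n (cv n U x)"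
proof (rule perI)
  fix i
  have "U (j - (i + int n)) = U (j - i)" for j using perD3[OF assms, of "j - i"] by (simp add: algebra_simps)
  then show "cv n U x (i + int n) = cv n U x i" unfolding cv_def by simp
qed

lemma cv_alt: assumes "per n U" "per n x" shows "cv n U x i = tsum n (%d. U d * x (i + d))"
proof -
  have "per n (%d. U d * x (i + d))" using assms
    by (auto intro!: per_intros simp: add.commute[of i])
  from tsum_shift'[OF this, of i] show ?thesis unfolding cv_def by simp
qed

lemma cva_alt: assumes "per n U" "per n f" shows "cva n U f i = tsum n (%d. U d * f (i - d))"
proof -
  have "per n (%d. U d * f (i - d))" using assms
    by (auto intro!: per_intros)
  from tsum_reflect[OF this, of i] show ?thesis unfolding cva_def by simp
qed

lemma cv_shift: assumes "per n U" "per n x" shows "cv n U x (i + k) = cv n U (%j. x (j + k)) i"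
  using cv_alt[OF assms, of "i+k"] cv_alt[OF assms(1) per_shift[OF assms(2)], of k i]
  by (simp add: algebra_simps)

lemma cv_diff: "cv n U (%j. x j - y j) i = cv n U x i - cv n U y i"
  by (simp add: cv_def tsum_diff[symmetric] algebra_simps)
lemma cv_cmult: "cv n U (%j. c * x j) i = c * cv n U x i"
  by (simp add: cv_def tsum_cmult[symmetric] algebra_simps)

lemma cv_adj: "tsum n (%i. x i * cva n U f i) = tsum n (%l. f l * cv n U x l)"
  unfolding cv_def cva_def tsum_cmult[symmetric]
  by (subst tsum_swap) (simp add: algebra_simps)

lemma tsum_parts: assumes "per n f" "per n g"
  shows "tsum n (%b. (f (b + 1) - f b) * g b) = tsum n (%b. f b * (g (b - 1) - g b))"
proof -
  have "per n (%b. f b * g (b - 1))" by (intro per_intros assms)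
  from tsum_shift[OF this, of 1] have "tsum n (%b. f (b + 1) * g b) = tsum n (%b. f b * g (b - 1))" by simp
  then show ?thesis by (simp add: algebra_simps tsum_diff)
qed

section \<open>Square norms of convolved fields under exchanges and flips\<close>

definition Qf :: "nat => (int => real) => (int => real) => real" where
  "Qf n U x = tsum n (%i. (cv n U x i)^2)"

definition grad2 :: "nat => (int => real) => real" where
  "grad2 n f = tsum n (%i. (f (i + 1) - f i)^2)"

lemma grad2_nonneg: "0 \<le> grad2 n f" unfolding grad2_def by (rule tsum_nonneg) simp
lemma Qf_nonneg: "0 \<le> Qf n U f" unfolding Qf_def by (rule tsum_nonneg) simp

lemma tsum_lap: assumes "per n f"
  shows "tsum n (%i. f i * (2 * f i - f (i - 1) - f (i + 1))) = grad2 n f"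
proof -
  have p: "per n (%i. (f i)^2)" "per n (%i. f (i - 1) * f i)"  using assms by (auto intro!: per_intros)
  have "grad2 n f = tsum n (%i. (f (i + 1))^2) + tsum n (%i. (f i)^2) - 2 * tsum n (%i. f i * f (i + 1))"
    unfolding grad2_def tsum_cmult[symmetric] tsum_add[symmetric] tsum_diff[symmetric]
    by (rule tsum_cong) (simp add: power2_eq_square algebra_simps)
  moreover have "tsum n (%i. (f (i + 1))^2) = tsum n (%i. (f i)^2)" using tsum_shift[OF p(1), of 1] by simp
  moreover have "tsum n (%i. f i * f (i + 1)) = tsum n (%i. f (i - 1) * f i)" using tsum_shift[OF p(2), of 1] by simp
  moreover have "tsum n (%i. f i * (2 * f i - f (i - 1) - f (i + 1)))
     = 2 * tsum n (%i. (f i)^2) - tsum n (%i. f (i - 1) * f i) - tsum n (%i. f i * f (i + 1))"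
    unfolding tsum_cmult[symmetric] tsum_add[symmetric] tsum_diff[symmetric]
    by (rule tsum_cong) (simp add: power2_eq_square algebra_simps)
  ultimately show ?thesis by simp
qed

lemma cv_swap:
  assumes "per n U" "per n x" "n > 0" "!!j. y j = x j + c * (cind n b j - cind n (b + 1) j)"
  shows "cv n U y i = cv n U x i + c * (U (b - i) - U (b + 1 - i))"
proof -
  have p: "per n (%j. U (j - i))" by (intro per_intros assms)
  have "cv n U y i = tsum n (%j. U (j - i) * x j) + c * (tsum n (%j. U (j - i) * cind n b j) - tsum n (%j. U (j - i) * cind n (b+1) j))"
    unfolding cv_def tsum_diff[symmetric] tsum_cmult[symmetric] tsum_add[symmetric]
    by (rule tsum_cong) (simp add: assms(4) algebra_simps)
  then show ?thesis by (simp add: tsum_cind[OF p assms(3)] cv_def)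
qed

lemma cv_single:
  assumes "per n U" "per n x" "n > 0" "!!j. y j = x j + c * cind n b j"
  shows "cv n U y i = cv n U x i + c * U (b - i)"
proof -
  have p: "per n (%j. U (j - i))" by (intro per_intros assms)
  have "cv n U y i = tsum n (%j. U (j - i) * x j) + c * tsum n (%j. U (j - i) * cind n b j)"
    unfolding cv_def tsum_diff[symmetric] tsum_cmult[symmetric] tsum_add[symmetric]
    by (rule tsum_cong) (simp add: assms(4) algebra_simps)
  then show ?thesis by (simp add: tsum_cind[OF p assms(3)] cv_def)
qed

text \<open>The exchange adds a dipole at the bond. The terms linear in it, summed over bonds,
  become by parts the discrete Laplacian of \<open>cv n U x\<close> and give minus twice its
  gradient energy. The quadratic terms factorise, as the increment of the kernel has the same square
  norm at every bond.\<close>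

lemma Qf_exchange:
  assumes U: "per n U" and x: "per n x" and n: "n > 0"
    and y: "!!b j. y b j = x j + (x (b + 1) - x b) * (cind n b j - cind n (b + 1) j)"
  shows "tsum n (%b. Qf n U (y b) - Qf n U x)
    = - 2 * grad2 n (cv n U x) + grad2 n U * grad2 n x"
proof -
  define f where "f = cv n U x"
  have pf: "per n f" unfolding f_def by (rule per_cv[OF U])
  have "Qf n U (y b) - Qf n U x = tsum n (%i. 2 * f i * ((x (b+1) - x b) * (U (b - i) - U (b + 1 - i)))) 
      + tsum n (%i. (x (b+1) - x b)^2 * (U (b + 1 - i) - U (b - i))^2)" for b
    unfolding Qf_def cv_swap[OF U x n y] tsum_diff[symmetric] f_def[symmetric] tsum_add[symmetric]
    by (rule tsum_cong) (simp add: power2_eq_square algebra_simps)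
  then have 1: "tsum n (%b. Qf n U (y b) - Qf n U x)
     = tsum n (%b. tsum n (%i. 2 * f i * ((x (b+1) - x b) * (U (b - i) - U (b + 1 - i)))))
     + tsum n (%b. tsum n (%i. (x (b+1) - x b)^2 * (U (b + 1 - i) - U (b - i))^2))"
    by (simp add: tsum_add)
  have "tsum n (%i. (U (b + 1 - i) - U (b - i))^2) = grad2 n U" for b
  proof -
    have "per n (%d. (U (d + 1) - U d)^2)" using U by (auto intro!: per_intros)
    from tsum_reflect[OF this, of b] show ?thesis unfolding grad2_def by (simp add: algebra_simps)
  qed
  then have 2: "tsum n (%b. tsum n (%i. (x (b+1) - x b)^2 * (U (b + 1 - i) - U (b - i))^2)) = grad2 n U * grad2 n x"
    by (simp add: tsum_cmult tsum_cmult2 grad2_def)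
  have "tsum n (%b. (x (b+1) - x b) * (U (b - i) - U (b + 1 - i))) = f (i - 1) + f (i + 1) - 2 * f i" for i
  proof -
    have "tsum n (%b. (x (b+1) - x b) * (U (b - i) - U (b + 1 - i)))
       = tsum n (%b. x b * ((U (b - 1 - i) - U (b - i)) - (U (b - i) - U (b + 1 - i))))"
    proof -
      have "per n (%b. U (b - i))" "per n (%b. U (b + 1 - i))"
        using per_shift'[OF U, of i] per_shift[OF U, of "1 - i"] by (simp_all add: algebra_simps)
      from tsum_parts[OF x per_diff[OF this]] show ?thesis by simp
    qed
    also have "... = tsum n (%j. U (j - (i + 1)) * x j) + tsum n (%j. U (j - (i - 1)) * x j) - 2 * tsum n (%j. U (j - i) * x j)"
      unfolding tsum_cmult[symmetric] tsum_add[symmetric] tsum_diff[symmetric]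
      by (rule tsum_cong) (simp add: algebra_simps)
    finally show ?thesis unfolding f_def cv_def by simp
  qed
  note lap = this
  have "tsum n (%b. tsum n (%i. 2 * f i * ((x (b+1) - x b) * (U (b - i) - U (b + 1 - i)))))
    = tsum n (%i. 2 * f i * (f (i - 1) + f (i + 1) - 2 * f i))"
    by (subst tsum_swap) (simp only: tsum_cmult lap)
  also have "... = - 2 * tsum n (%i. f i * (2 * f i - f (i - 1) - f (i + 1)))"
    unfolding tsum_cmult[symmetric] by (rule tsum_cong) (simp add: algebra_simps)
  also have "... = - 2 * grad2 n f" by (simp only: tsum_lap[OF pf])
  finally show ?thesis using 1 2 f_def by simp
qed

text \<open>\<open>2 * cva n U (cv n U x) b\<close> is the derivative of \<open>Qf n U\<close> in
  the spin at \<open>b\<close>, and the flip changes this spin by \<open>- 2 * x b\<close>; the last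
  term comes from the diagonal entry of the form.\<close>

lemma Qf_flip:
  assumes U: "per n U" and x: "per n x" and n: "n > 0"
    and y: "!!j. y j = x j + (- 2 * x b) * cind n b j"
  shows "Qf n U y - Qf n U x = - 4 * x b * cva n U (cv n U x) b + 4 * (x b)^2 * tsum n (%d. (U d)^2)"
proof -
  define f where "f = cv n U x"
  have "Qf n U y - Qf n U x = tsum n (%i. (- 4 * x b) * (U (b - i) * f i)) 
      + tsum n (%i. 4 * (x b)^2 * (U (b - i))^2)"
    unfolding Qf_def cv_single[OF U x n y] tsum_diff[symmetric] f_def[symmetric] tsum_add[symmetric]
    by (rule tsum_cong) (simp add: power2_eq_square algebra_simps)
  moreover have "tsum n (%i. (U (b - i))^2) = tsum n (%d. (U d)^2)"
    by (rule tsum_reflect) (intro per_intros U)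
  ultimately show ?thesis by (simp only: tsum_cmult cva_def f_def)
qed

text \<open>The polynomial is spin times flip rate (\<open>x_crate\<close>). Translations commute
  with the convolutions, so the nearest-neighbour part produces correlations of
  \<open>cv n U x\<close> with its two shifts, that is, twice the square norm minus the gradient
  energy. This leaves the coefficient \<open>1 - 2 * g\<close>, which is small at
  criticality.\<close>

lemma Qf_flip_linear:
  assumes U: "per n U" and x: "per n x" and n: "n > 0"
  shows "tsum n (%i. (x i - g * (x (i - 1) + x (i + 1)) + g^2 * (x (i - 1) * x i * x (i + 1))) * cva n U (cv n U x) i)
   = (1 - 2 * g) * Qf n U x + g * grad2 n (cv n U x) + g^2 * tsum n (%i. x (i - 1) * x i * x (i + 1) * cva n U (cv n U x) i)"
proof -
  define f where "f = cv n U x"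
  have pf: "per n f" unfolding f_def by (rule per_cv[OF U])
  define z where "z = cva n U f"
  have a: "tsum n (%i. x i * z i) = Qf n U x" unfolding z_def cv_adj Qf_def f_def by (simp add: power2_eq_square)
  have s: "tsum n (%i. x (i + k) * z i) = tsum n (%l. f l * f (l + k))" for k
    unfolding z_def using cv_adj[of n "%i. x (i + k)" U f] cv_shift[OF U x, of _ k] by (simp add: f_def)
  have "Qf n U x = tsum n (%l. f l * f l)" unfolding Qf_def f_def by (simp add: power2_eq_square)
  then have "2 * Qf n U x - tsum n (%l. f l * f (l + (-1))) - tsum n (%l. f l * f (l + 1)) = grad2 n f"
    unfolding tsum_lap[OF pf, symmetric] tsum_cmult[symmetric] tsum_diff[symmetric] 
    by (simp only: tsum_cmult[symmetric] tsum_diff[symmetric]) (rule tsum_cong, simp add: algebra_simps)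
  then have b: "tsum n (%i. x (i - 1) * z i) + tsum n (%i. x (i + 1) * z i) = 2 * Qf n U x - grad2 n f"
    using s[of "-1"] s[of 1] by simp
  have "tsum n (%i. (x i - g * (x (i - 1) + x (i + 1)) + g^2 * (x (i - 1) * x i * x (i + 1))) * z i)
    = tsum n (%i. x i * z i) - g * (tsum n (%i. x (i - 1) * z i) + tsum n (%i. x (i + 1) * z i))
     + g^2 * tsum n (%i. x (i - 1) * x i * x (i + 1) * z i)"
    unfolding tsum_cmult[symmetric] tsum_add[symmetric] tsum_diff[symmetric]
    by (rule tsum_cong) (simp add: algebra_simps)
  moreover have "P - g * (2 * P - N) + g^2 * R = (1 - 2 * g) * P + g * N + g^2 * R" for P N R :: real
    by (simp add: algebra_simps)
  ultimately show ?thesis unfolding a b unfolding z_def f_def by presburger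
qed

text \<open>Cauchy--Schwarz with the weight given by the modulus of \<open>U\<close> shared evenly
  between the two factors.\<close>

lemma Young: assumes U: "per n U" and f: "per n f" and n: "n > 0"
  shows "tsum n (%i. (cva n U f i)^2) \<le> (tsum n (%d. \<bar>U d\<bar>))^2 * tsum n (%i. (f i)^2)"
proof -
  define N where "N = tsum n (%d. \<bar>U d\<bar>)"
  have pt: "(cva n U f i)^2 \<le> N * tsum n (%d. \<bar>U d\<bar> * (f (i - d))^2)" for i
  proof -
    have "(cva n U f i)^2 \<le> (tsum n (%d. sqrt \<bar>U d\<bar> * (sqrt \<bar>U d\<bar> * \<bar>f (i - d)\<bar>)))^2"
    proof -
      have "\<bar>cva n U f i\<bar> \<le> tsum n (%d. sqrt \<bar>U d\<bar> * (sqrt \<bar>U d\<bar> * \<bar>f (i - d)\<bar>))"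
        unfolding cva_alt[OF U f] using tsum_abs_le[of n "%d. U d * f (i - d)"]
        by (simp add: abs_mult mult.assoc[symmetric])
      then show ?thesis by (metis abs_ge_zero power2_abs power_mono)
    qed
    also have "... \<le> tsum n (%d. (sqrt \<bar>U d\<bar>)^2) * tsum n (%d. (sqrt \<bar>U d\<bar> * \<bar>f (i - d)\<bar>)^2)"
      by (rule tsum_CS)
    finally show ?thesis unfolding N_def by (simp add: power_mult_distrib)
  qed
  have "tsum n (%i. (cva n U f i)^2) \<le> tsum n (%i. N * tsum n (%d. \<bar>U d\<bar> * (f (i - d))^2))"
    by (rule tsum_mono) (rule pt)
  also have "... = N * tsum n (%d. \<bar>U d\<bar> * tsum n (%i. (f (i - d))^2))"
    unfolding tsum_cmult[symmetric] by (subst tsum_swap) simp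
  also have "... = N * tsum n (%d. \<bar>U d\<bar> * tsum n (%i. (f i)^2))"
  proof -
    have "tsum n (%i. (f (i - d))^2) = tsum n (%i. (f i)^2)" for d
      using tsum_shift'[OF per_pow[OF f, of 2], of d] .
    then show ?thesis by simp
  qed
  also have "... = N^2 * tsum n (%i. (f i)^2)" by (simp add: tsum_cmult2 power2_eq_square N_def)
  finally show ?thesis unfolding N_def .
qed

lemma cva_diff: "cva n U (%j. x j - y j) i = cva n U x i - cva n U y i"
  by (simp add: cva_def tsum_diff[symmetric] algebra_simps)

lemma cv_as_cva: assumes "per n U" "per n f" shows "cv n U f i = cva n (%d. U (- d)) f i"
  unfolding cv_def cva_def by simp

lemma Young': assumes U: "per n U" and f: "per n f" and n: "n > 0"
  shows "tsum n (%i. (cv n U f i)^2) \<le> (tsum n (%d. \<bar>U d\<bar>))^2 * tsum n (%i. (f i)^2)"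
proof -
  have p: "per n (%d. U (- d))" using per_refl[OF U, of 0] by simp
  have "tsum n (%d. \<bar>U (- d)\<bar>) = tsum n (%d. \<bar>U d\<bar>)"
    using tsum_reflect[OF per_abs[OF U], of 0] by simp
  then show ?thesis using Young[OF p f n] cv_as_cva[OF U f] by simp
qed

section \<open>Spin fields and the generator\<close>

text \<open>Functions on the discrete torus are \<open>n\<close>-periodic functions on the integers.\<close>

definition fld :: "nat => conf => int => real" where
  "fld n cf i = spin cf (nat (i mod int n))"

definition exc :: "nat => conf => int => conf" where
  "exc n cf b = exchange cf (nat (b mod int n)) (succ_site n (nat (b mod int n)))"

definition flp :: "nat => conf => int => conf" where
  "flp n cf b = flip cf (nat (b mod int n))"

definition crate :: "real => (int => real) => int => real" where
  "crate g x i = 1 - g * x i * (x (i - 1) + x (i + 1)) + g^2 * x (i - 1) * x (i + 1)"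

lemma per_fld: "per n (fld n cf)" by (rule perI) (simp add: fld_def)

lemma nat_mod_lt: "n > 0 ==> nat (i mod int n) < n" by (simp add: nat_less_iff)

lemma fld_nat: "i < n ==> fld n cf (int i) = spin cf i" by (simp add: fld_def)

lemma fld_values: assumes "cf \<in> Omega n" "n > 0" shows "fld n cf i = 1 \<or> fld n cf i = - 1"
proof -
  have "cf (nat (i mod int n)) \<in> {0, 1}" using assms nat_mod_lt[of n i] unfolding Omega_def by (auto simp: PiE_iff)
  then show ?thesis unfolding fld_def spin_def by auto
qed

lemma fld_sq: "cf \<in> Omega n ==> n > 0 ==> (fld n cf i)^2 = 1"
  using fld_values[of cf n i] by auto

lemma fld_abs: "cf \<in> Omega n ==> n > 0 ==> \<bar>fld n cf i\<bar> = 1"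
  using fld_values[of cf n i] by auto

lemma succ_site_int: "n > 0 ==> int (succ_site n (nat (b mod int n))) = (b + 1) mod int n"
  unfolding succ_site_def by (simp add: zmod_int mod_simps add.commute)

lemma succ_site_nat: "n > 0 ==> succ_site n (nat (b mod int n)) = nat ((b + 1) mod int n)"
  using succ_site_int[of n b] by simp

lemma pred_site_nat: assumes "n > 0" shows "pred_site n (nat (b mod int n)) = nat ((b - 1) mod int n)"
proof -
  define c where "c = nat (b mod int n)"
  have c: "int c = b mod int n" using assms by (simp add: c_def)
  have "int (pred_site n c) = (int c + int n - 1) mod int n"
    unfolding pred_site_def using assms by (subst zmod_int) (simp add: of_nat_diff)
  also have "... = (b - 1) mod int n" unfolding c
    by (metis add_diff_eq diff_add_eq mod_add_self2 mod_diff_left_eq)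
  finally show ?thesis using c_def by (metis nat_int)
qed

lemma cind_mod: "cind n b j = (if j mod int n = b mod int n then 1 else 0)"
  unfolding cind_def by (simp add: mod_eq_dvd_iff mod_eq_0_iff_dvd)

lemma mod_succ_ne: assumes "n \<ge> 2" shows "(b + 1) mod int n \<noteq> b mod int n"
proof
  assume "(b + 1) mod int n = b mod int n"
  then have "int n dvd 1" by (simp add: mod_eq_dvd_iff)
  then show False using assms by simp
qed

lemma nat_mod_eq_iff: "n > 0 ==> nat (i mod int n) = nat (j mod int n) \<longleftrightarrow> i mod int n = j mod int n"
  by (simp add: nat_eq_iff)

text \<open>Writing the exchange as a dipole at the bond, rather than as an update, makes every
  convolution of the field change by a difference of two kernel values
  (\<open>cv_swap\<close>).\<close>

lemma fld_exc:
  assumes "n \<ge> 2"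
  shows "fld n (exc n cf b) j = fld n cf j + (fld n cf (b + 1) - fld n cf b) * (cind n b j - cind n (b + 1) j)"
proof -
  have n: "n > 0" using assms by simp
  have eq: "fld n cf j = fld n cf k" if "j mod int n = k mod int n" for k using that by (simp add: fld_def)
  show ?thesis
    unfolding cind_mod exc_def succ_site_nat[OF n] exchange_def fld_def[of n "_(_ := _, _ := _)"] spin_def
    using mod_succ_ne[OF assms, of b] n eq[of b] eq[of "b+1"]
    by (auto simp: nat_mod_eq_iff[OF n] fld_def spin_def)
qed

lemma fld_flp:
  assumes "n > 0" "cf \<in> Omega n"
  shows "fld n (flp n cf b) j = fld n cf j + (- 2 * fld n cf b) * cind n b j"
proof -
  have "cf (nat (b mod int n)) \<in> {0, 1}" using assms nat_mod_lt[of n b] unfolding Omega_def by (auto simp: PiE_iff)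
  moreover have eq: "fld n cf j = fld n cf k" if "j mod int n = k mod int n" for k using that by (simp add: fld_def)
  ultimately show ?thesis
    unfolding cind_mod flp_def flip_def fld_def[of n "_(_ := _)"] spin_def
    using eq[of b] assms(1)
    by (auto simp: nat_mod_eq_iff fld_def spin_def)
qed

lemma exc_Omega: "cf \<in> Omega n ==> n > 0 ==> exc n cf b \<in> Omega n"
  unfolding exc_def by (intro exchange_Omega site nat_mod_lt) auto

lemma flp_Omega: "cf \<in> Omega n ==> n > 0 ==> flp n cf b \<in> Omega n"
  unfolding flp_def by (intro flip_Omega nat_mod_lt) auto

lemma exc_exc: "exc n (exc n cf b) b = cf"
  unfolding exc_def exchange_def by auto

lemma flp_flp: assumes "cf \<in> Omega n" "n > 0" shows "flp n (flp n cf b) b = cf"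
proof -
  have "cf (nat (b mod int n)) \<in> {0, 1}" using assms nat_mod_lt[of n b] unfolding Omega_def by (auto simp: PiE_iff)
  then show ?thesis unfolding flp_def flip_def by auto
qed

lemma exc_per: "exc n cf (b + int n) = exc n cf b" unfolding exc_def by simp
lemma sum_exc: assumes "n > 0" shows "(\<Sum>cf\<in>Omega n. F (exc n cf b)) = (\<Sum>cf\<in>Omega n. F cf)"
  by (rule sum.reindex_bij_witness[of _ "%cf. exc n cf b" "%cf. exc n cf b"])
     (auto simp: exc_exc exc_Omega assms)

lemma sum_flp: assumes "n > 0" shows "(\<Sum>cf\<in>Omega n. F (flp n cf b)) = (\<Sum>cf\<in>Omega n. F cf)"
  by (rule sum.reindex_bij_witness[of _ "%cf. flp n cf b" "%cf. flp n cf b"])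
     (auto simp: flp_flp flp_Omega assms)

section \<open>The generator as sums over the torus, and its action on square norms\<close>

lemma flip_rate_crate: assumes "0 \<le> i" "i < int n"
  shows "flip_rate vt n cf (nat i) = crate (gam vt n) (fld n cf) i"
proof -
  have n: "n > 0" using assms by simp
  have "i mod int n = i" using assms by simp
  then show ?thesis
    unfolding flip_rate_def crate_def fld_def
    using succ_site_nat[OF n, of i] pred_site_nat[OF n, of i] by simp
qed

lemma gen_L_tsum:
  "gen_L a vt n f cf = (real n)^2 * tsum n (%b. f (exc n cf b) - f cf)
     + a * tsum n (%i. crate (gam vt n) (fld n cf) i * (f (flp n cf i) - f cf))"
proof -
  have "(\<Sum>i<n. f (exchange cf i (succ_site n i)) - f cf) = tsum n (%b. f (exc n cf b) - f cf)"
    unfolding tsum_nat unfolding tsum_def by (intro sum.cong refl) (simp add: exc_def)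
  moreover have "(\<Sum>i<n. flip_rate vt n cf i * (f (flip cf i) - f cf))
      = tsum n (%i. crate (gam vt n) (fld n cf) i * (f (flp n cf i) - f cf))"
    unfolding tsum_nat unfolding tsum_def by (intro sum.cong refl) (simp add: flp_def flip_rate_crate)
  ultimately show ?thesis unfolding gen_L_def by simp
qed

lemma gen_L_add: "gen_L a vt n (%cf. f cf + g cf) cf = gen_L a vt n f cf + gen_L a vt n g cf"
proof -
  have "tsum n (%b. f (exc n cf b) + g (exc n cf b) - (f cf + g cf)) = tsum n (%b. f (exc n cf b) - f cf) + tsum n (%b. g (exc n cf b) - g cf)"
    unfolding tsum_add[symmetric] by (rule tsum_cong) simp
  moreover have "tsum n (%i. c i * (f (flp n cf i) + g (flp n cf i) - (f cf + g cf)))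
     = tsum n (%i. c i * (f (flp n cf i) - f cf)) + tsum n (%i. c i * (g (flp n cf i) - g cf))" for c
    unfolding tsum_add[symmetric] by (rule tsum_cong) (simp add: algebra_simps)
  ultimately show ?thesis unfolding gen_L_tsum by (simp only: distrib_left add.assoc add.left_commute)
qed

lemma gen_L_cmult: "gen_L a vt n (%cf. k * f cf) cf = k * gen_L a vt n f cf"
proof -
  have "tsum n (%b. k * f (exc n cf b) - k * f cf) = k * tsum n (%b. f (exc n cf b) - f cf)"
    unfolding tsum_cmult[symmetric] by (rule tsum_cong) (simp add: algebra_simps)
  moreover have "tsum n (%i. c i * (k * f (flp n cf i) - k * f cf)) = k * tsum n (%i. c i * (f (flp n cf i) - f cf))" for c
    unfolding tsum_cmult[symmetric] by (rule tsum_cong) (simp add: algebra_simps)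
  ultimately show ?thesis unfolding gen_L_tsum by (simp only: distrib_left mult.left_commute)
qed

text \<open>Squares of spins equal one, so the rate factorises over the two neighbours; for
  \<open>0 <= g <= 1\<close> each factor lies between 0 and 2.\<close>

lemma crate_prod: assumes "cf \<in> Omega n" "n > 0"
  shows "crate g (fld n cf) i = (1 - g * fld n cf i * fld n cf (i - 1)) * (1 - g * fld n cf i * fld n cf (i + 1))"
proof -
  have "(fld n cf i)^2 = 1" using fld_sq assms by blast
  moreover have "(1 - g * u * v) * (1 - g * u * w) = 1 - g * u * (v + w) + g^2 * u^2 * v * w" for u v w :: real
    by (simp add: algebra_simps power2_eq_square)
  ultimately show ?thesis unfolding crate_def by simp
qed

lemma crate_bounds: assumes "cf \<in> Omega n" "n > 0" "0 \<le> g" "g \<le> 1"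
  shows "0 \<le> crate g (fld n cf) i" "crate g (fld n cf) i \<le> 4"
proof -
  have b: "0 \<le> 1 - g * fld n cf i * fld n cf j" "1 - g * fld n cf i * fld n cf j \<le> 2" for j
    using fld_values[OF assms(1,2), of i] fld_values[OF assms(1,2), of j] assms(3,4) by auto
  show "0 \<le> crate g (fld n cf) i" unfolding crate_prod[OF assms(1,2)] using b by simp
  have "(1 - g * fld n cf i * fld n cf (i - 1)) * (1 - g * fld n cf i * fld n cf (i + 1)) \<le> 2 * 2"
    by (rule mult_mono) (use b in auto)
  then show "crate g (fld n cf) i \<le> 4" unfolding crate_prod[OF assms(1,2)] by simp
qed

lemma x_crate: assumes "x i * x i = (1::real)"
  shows "x i * crate g x i = x i - g * (x (i - 1) + x (i + 1)) + g^2 * (x (i - 1) * x i * x (i + 1))"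
proof -
  have "x i * crate g x i = x i - g * (x i * x i) * (x (i - 1) + x (i + 1)) + g^2 * (x (i - 1) * x i * x (i + 1))"
    unfolding crate_def by (simp add: algebra_simps)
  then show ?thesis unfolding assms by simp
qed

definition cub :: "nat => (int => real) => (int => real) => real" where
  "cub n x z = tsum n (%i. x (i - 1) * x i * x (i + 1) * z i)"

lemma gen_L_Qf:
  fixes vt :: real
  assumes "n \<ge> 2" "per n U" "cf \<in> Omega n"
  defines "x \<equiv> fld n cf" and "g \<equiv> gam vt n"
  shows "gen_L a vt n (%\<xi>. Qf n U (fld n \<xi>)) cf =
     (real n)^2 * (- 2 * grad2 n (cv n U x) + grad2 n U * grad2 n x)
   + a * (- 4 * ((1 - 2 * g) * Qf n U x + g * grad2 n (cv n U x) + g^2 * cub n x (cva n U (cv n U x)))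
         + 4 * tsum n (%d. (U d)^2) * tsum n (crate g x))"
proof -
  have n: "n > 0" using assms(1) by simp
  have px: "per n x" unfolding x_def by (rule per_fld)
  have sq: "(x i)^2 = 1" for i unfolding x_def using fld_sq[OF assms(3) n] .
  then have sq': "x i * x i = 1" for i by (simp add: power2_eq_square)
  have 1: "tsum n (%b. Qf n U (fld n (exc n cf b)) - Qf n U (fld n cf)) = - 2 * grad2 n (cv n U x) + grad2 n U * grad2 n x"
    unfolding x_def[symmetric]
    by (rule Qf_exchange[OF assms(2) px n]) (simp add: fld_exc[OF assms(1)] x_def)
  have f: "Qf n U (fld n (flp n cf i)) - Qf n U x = - 4 * x i * cva n U (cv n U x) i + 4 * tsum n (%d. (U d)^2)" for i
    using Qf_flip[OF assms(2) px n fld_flp[OF n assms(3), of i, folded x_def]] by (simp add: sq)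
  have "tsum n (%i. crate g x i * (Qf n U (fld n (flp n cf i)) - Qf n U x))
     = - 4 * tsum n (%i. (x i * crate g x i) * cva n U (cv n U x) i) + 4 * tsum n (%d. (U d)^2) * tsum n (crate g x)"
  proof -
    define T where "T = tsum n (%d. (U d)^2)"
    have "crate g x i * (Qf n U (fld n (flp n cf i)) - Qf n U x)
       = (- 4) * ((x i * crate g x i) * cva n U (cv n U x) i) + (4 * T) * crate g x i" for i
      unfolding f T_def[symmetric] by (simp add: algebra_simps)
    then show ?thesis unfolding T_def[symmetric] by (simp only: tsum_add tsum_cmult)
  qed
  also have "tsum n (%i. (x i * crate g x i) * cva n U (cv n U x) i) = 
      (1 - 2 * g) * Qf n U x + g * grad2 n (cv n U x) + g^2 * cub n x (cva n U (cv n U x))"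
    unfolding x_crate[of x, OF sq'] cub_def by (rule Qf_flip_linear[OF assms(2) px n])
  finally show ?thesis unfolding gen_L_tsum g_def[symmetric] x_def[symmetric] 1[folded x_def] by simp
qed

lemma tsum_crate_le: assumes "cf \<in> Omega n" "n > 0" "0 \<le> g" "g \<le> 1"
  shows "tsum n (crate g (fld n cf)) \<le> 4 * real n"
proof -
  have "tsum n (crate g (fld n cf)) \<le> tsum n (%i. 4)" by (rule tsum_mono) (use crate_bounds assms in auto)
  then show ?thesis by (simp add: tsum_const)
qed

lemma grad2_fld_le: assumes "cf \<in> Omega n" "n > 0" shows "grad2 n (fld n cf) \<le> 4 * real n"
proof -
  have "(fld n cf (i+1) - fld n cf i)^2 \<le> 4" for i
    using fld_values[OF assms, of i] fld_values[OF assms, of "i+1"] by auto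
  then have "grad2 n (fld n cf) \<le> tsum n (%i. 4)" unfolding grad2_def by (intro tsum_mono)
  then show ?thesis by (simp add: tsum_const)
qed

text \<open>The flips contribute a multiple of the gradient energy of \<open>cv n U\<close> with a
  favourable sign. It is dropped, being of lower order than the same quantity produced by the
  exchanges, which carries \<open>n^2\<close>. The total flip rate is bounded by
  \<open>4 * n\<close>.\<close>

lemma gen_L_Qf_le:
  assumes "n \<ge> 2" "per n U" "cf \<in> Omega n" "a \<ge> 0" "0 \<le> gam vt n" "gam vt n \<le> 1"
  shows "gen_L a vt n (%\<xi>. Qf n U (fld n \<xi>)) cf \<le>
     (real n)^2 * (- 2 * grad2 n (cv n U (fld n cf)) + grad2 n U * grad2 n (fld n cf))
   - 4 * a * (1 - 2 * gam vt n) * Qf n U (fld n cf) 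
   - 4 * a * (gam vt n)^2 * cub n (fld n cf) (cva n U (cv n U (fld n cf)))
   + 16 * a * real n * tsum n (%d. (U d)^2)"
proof -
  have n: "n > 0" using assms(1) by simp
  have "tsum n (%d. (U d)^2) * tsum n (crate (gam vt n) (fld n cf)) \<le> tsum n (%d. (U d)^2) * (4 * real n)"
    by (rule mult_left_mono[OF tsum_crate_le]) (use assms n in \<open>auto intro: tsum_nonneg\<close>)
  then have "a * (4 * tsum n (%d. (U d)^2) * tsum n (crate (gam vt n) (fld n cf))) \<le> a * (4 * (tsum n (%d. (U d)^2) * (4 * real n)))"
    using assms(4) by (intro mult_left_mono, linarith) auto
  moreover have "0 \<le> a * (gam vt n * grad2 n (cv n U (fld n cf)))" using assms grad2_nonneg by simp
  moreover have "X + a * (- 4 * ((1 - 2 * g) * Q + g * G + g2 * Cb) + 4 * T * C)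
      \<le> X - 4 * a * (1 - 2 * g) * Q - 4 * a * g2 * Cb + 16 * a * N * T"
    if "a * (4 * T * C) \<le> a * (4 * (T * (4 * N)))" "0 \<le> a * (g * G)" for X g Q G g2 Cb T C N :: real
    using that by (simp add: algebra_simps)
  ultimately show ?thesis unfolding gen_L_Qf[OF assms(1-3)] by blast
qed

section \<open>Moving a spin along exchange bonds\<close>

definition EE :: "nat => (conf => real) => (conf => real) => real" where
  "EE n p F = (\<Sum>cf\<in>Omega n. p cf * F cf)"

definition dex :: "nat => (conf => real) => int => real" where
  "dex n p b = (\<Sum>cf\<in>Omega n. (sqrt (p (exc n cf b)) - sqrt (p cf))^2)"

definition Dex :: "nat => (conf => real) => real" where
  "Dex n p = (real n)^2 * tsum n (dex n p)"

lemma EE_add: "EE n p (%cf. F cf + G cf) = EE n p F + EE n p G"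
  by (simp add: EE_def sum.distrib algebra_simps)
lemma EE_diff: "EE n p (%cf. F cf - G cf) = EE n p F - EE n p G"
  by (simp add: EE_def sum_subtractf algebra_simps)
lemma EE_cmult: "EE n p (%cf. c * F cf) = c * EE n p F"
  by (simp add: EE_def sum_distrib_left algebra_simps)
lemma EE_uminus: "EE n p (%cf. - F cf) = - EE n p F"
  by (simp add: EE_def sum_negf)
lemma EE_sum: "EE n p (%cf. \<Sum>k\<in>K. F k cf) = (\<Sum>k\<in>K. EE n p (F k))"
  unfolding EE_def sum_distrib_left by (rule sum.swap)
lemma EE_tsum: "EE n p (%cf. tsum m (%i. F i cf)) = tsum m (%i. EE n p (F i))"
  unfolding tsum_def by (rule EE_sum)
lemma EE_mono: "(!!cf. cf \<in> Omega n ==> 0 \<le> p cf) ==> (!!cf. cf \<in> Omega n ==> F cf \<le> G cf) ==> EE n p F \<le> EE n p G"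
  unfolding EE_def by (intro sum_mono mult_left_mono)
lemma EE_nonneg: "(!!cf. cf \<in> Omega n ==> 0 \<le> p cf) ==> (!!cf. cf \<in> Omega n ==> 0 \<le> F cf) ==> 0 \<le> EE n p F"
  unfolding EE_def by (intro sum_nonneg mult_nonneg_nonneg)
lemma EE_cong: "(!!cf. cf \<in> Omega n ==> F cf = G cf) ==> EE n p F = EE n p G"
  unfolding EE_def by (intro sum.cong) auto
lemma EE_const: "(\<Sum>cf\<in>Omega n. p cf) = 1 ==> EE n p (%cf. c) = c"
  unfolding EE_def by (simp add: sum_distrib_right[symmetric])

lemma dex_nonneg: "0 \<le> dex n p b" unfolding dex_def by (simp add: sum_nonneg)
lemma Dex_nonneg: "0 \<le> Dex n p" unfolding Dex_def by (simp add: dex_nonneg tsum_nonneg)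
lemma per_dex: "per n (dex n p)" by (rule perI) (simp add: dex_def exc_per)

lemma fld_exc_bond: assumes "n \<ge> 2"
  shows "fld n (exc n cf b) b = fld n cf (b + 1)" "fld n (exc n cf b) (b + 1) = fld n cf b"
proof -
  have "cind n b b = 1" "cind n (b+1) (b+1) = 1" "cind n b (b+1) = 0" "cind n (b+1) b = 0"
    using mod_succ_ne[OF assms, of b] by (auto simp: cind_mod)
  then show "fld n (exc n cf b) b = fld n cf (b + 1)" "fld n (exc n cf b) (b + 1) = fld n cf b"
    by (simp_all add: fld_exc[OF assms])
qed

text \<open>\<open>p - q\<close> is factored through square roots and the product split by the
  arithmetic-geometric inequality with weight \<open>l\<close>, so as to expose the integrand of the
  Dirichlet form.\<close>

lemma sqrt_ineq:
  fixes A p q l :: real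
  assumes "0 \<le> p" "0 \<le> q" "l > 0"
  shows "\<bar>A * (p - q)\<bar> \<le> l * (sqrt q - sqrt p)^2 + (1 / (2 * l)) * (A^2 * (p + q))"
proof -
  define u v where "u = sqrt p" and "v = sqrt q"
  have pq: "p = u^2" "q = v^2" "u \<ge> 0" "v \<ge> 0" using assms by (auto simp: u_def v_def)
  define s where "s = \<bar>A\<bar> * (u + v)"
  have s0: "s \<ge> 0" using pq by (simp add: s_def)
  have 1: "\<bar>A * (p - q)\<bar> = s * \<bar>v - u\<bar>"
  proof -
    have "p - q = (u - v) * (u + v)" by (simp add: pq power2_eq_square algebra_simps)
    then have "\<bar>A * (p - q)\<bar> = \<bar>A\<bar> * (\<bar>u - v\<bar> * \<bar>u + v\<bar>)" by (simp only: abs_mult)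
    moreover have "\<bar>u + v\<bar> = u + v" using pq by simp
    ultimately show ?thesis by (simp add: s_def abs_minus_commute[of u v])
  qed
  have "0 \<le> (2 * l * \<bar>v - u\<bar> - s)^2" by simp
  then have 2: "4 * l * (s * \<bar>v - u\<bar>) \<le> 4 * l * (l * (v - u)^2) + s^2"
    by (simp add: power2_eq_square algebra_simps flip: abs_mult)
  have 3: "s^2 \<le> 2 * (A^2 * (p + q))"
  proof -
    have "0 \<le> A^2 * (u - v)^2" by simp
    then show ?thesis unfolding s_def pq by (simp add: power2_eq_square algebra_simps)
  qed
  have "4 * l * (s * \<bar>v - u\<bar>) \<le> 4 * l * (l * (v - u)^2) + 2 * (A^2 * (p + q))" using 2 3 by linarith
  then have "4 * l * (s * \<bar>v - u\<bar>) \<le> 4 * l * (l * (v - u)^2 + (1 / (2 * l)) * (A^2 * (p + q)))"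
  proof -
    have "4 * l * ((1 / (2 * l)) * (A^2 * (p + q))) = 2 * (A^2 * (p + q))" using assms(3) by simp
    with \<open>4 * l * (s * \<bar>v - u\<bar>) \<le> 4 * l * (l * (v - u)^2) + 2 * (A^2 * (p + q))\<close>
    show ?thesis unfolding distrib_left[of "4 * l"] by linarith
  qed
  then have "s * \<bar>v - u\<bar> \<le> l * (v - u)^2 + (1 / (2 * l)) * (A^2 * (p + q))"
    using assms(3) by simp
  then show ?thesis unfolding 1 u_def v_def .
qed

text \<open>The difference of the two spins is antisymmetric under the swap. Symmetrising the
  expectation therefore turns it into a difference of \<open>p\<close> along the bond, treated by
  \<open>sqrt_ineq\<close>, and a difference of \<open>A\<close>, bounded by \<open>e\<close>. The
  parameter \<open>l\<close> balances Dirichlet form against second moment.\<close>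

lemma move1:
  assumes n: "n \<ge> 2" and p: "!!cf. cf \<in> Omega n ==> 0 \<le> p cf" and l: "l > 0"
    and A1: "!!cf. cf \<in> Omega n ==> (A cf)^2 \<le> G cf"
    and A2: "!!cf. cf \<in> Omega n ==> (A (exc n cf b))^2 \<le> G cf"
    and A3: "!!cf. cf \<in> Omega n ==> \<bar>A (exc n cf b) - A cf\<bar> \<le> e cf"
  shows "\<bar>EE n p (%cf. A cf * (fld n cf b - fld n cf (b + 1)))\<bar> \<le> l * dex n p b + (1 / l) * EE n p G + EE n p e"
proof -
  have n0: "n > 0" using n by simp
  define s where "s cf = fld n cf b - fld n cf (b + 1)" for cf
  let ?T = "%cf. exc n cf b"
  have sT: "s (?T cf) = - s cf" for cf unfolding s_def using fld_exc_bond[OF n] by simp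
  have s2: "\<bar>s cf\<bar> \<le> 2" if "cf \<in> Omega n" for cf
    using fld_values[OF that n0, of b] fld_values[OF that n0, of "b+1"] unfolding s_def by auto
  define X where "X = EE n p (%cf. A cf * s cf)"
  have "2 * X = (\<Sum>cf\<in>Omega n. p cf * (A cf * s cf)) + (\<Sum>cf\<in>Omega n. p (?T cf) * (A (?T cf) * s (?T cf)))"
    unfolding sum_exc[OF n0, of "%cf. p cf * (A cf * s cf)"] X_def EE_def by simp
  also have "... = (\<Sum>cf\<in>Omega n. s cf * (A cf * (p cf - p (?T cf))) + s cf * (p (?T cf) * (A cf - A (?T cf))))"
    unfolding sum.distrib[symmetric] by (rule sum.cong) (simp_all add: sT algebra_simps)
  finally have "\<bar>2 * X\<bar> \<le> (\<Sum>cf\<in>Omega n. \<bar>s cf * (A cf * (p cf - p (?T cf))) + s cf * (p (?T cf) * (A cf - A (?T cf)))\<bar>)"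
    by (simp add: sum_abs)
  also have "... \<le> (\<Sum>cf\<in>Omega n. 2 * (l * (sqrt (p (?T cf)) - sqrt (p cf))^2) + (1 / l) * ((A cf)^2 * p cf + (A cf)^2 * p (?T cf)) + 2 * (p (?T cf) * e (?T cf)))"
  proof (rule sum_mono)
    fix cf assume e: "cf \<in> Omega n"
    have eT: "?T cf \<in> Omega n" using exc_Omega[OF e n0] .
    have "\<bar>A cf * (p cf - p (?T cf))\<bar> \<le> l * (sqrt (p (?T cf)) - sqrt (p cf))^2 + (1 / (2 * l)) * ((A cf)^2 * (p cf + p (?T cf)))"
      by (rule sqrt_ineq[OF p[OF e] p[OF eT] l])
    moreover have "\<bar>s cf * (A cf * (p cf - p (?T cf)))\<bar> \<le> 2 * \<bar>A cf * (p cf - p (?T cf))\<bar>"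
      unfolding abs_mult[of "s cf"] by (rule mult_right_mono[OF s2[OF e]]) simp
    moreover have "\<bar>p (?T cf) * (A cf - A (?T cf))\<bar> \<le> p (?T cf) * e (?T cf)"
      unfolding abs_mult using A3[OF eT] p[OF eT] by (simp add: exc_exc mult_left_mono)
    moreover have "\<bar>s cf * (p (?T cf) * (A cf - A (?T cf)))\<bar> \<le> 2 * \<bar>p (?T cf) * (A cf - A (?T cf))\<bar>"
      unfolding abs_mult[of "s cf"] by (rule mult_right_mono[OF s2[OF e]]) simp
    moreover have "2 * ((1 / (2 * l)) * ((A cf)^2 * (p cf + p (?T cf)))) = (1 / l) * ((A cf)^2 * p cf + (A cf)^2 * p (?T cf))"
      using l by (simp add: field_simps)
    ultimately show "\<bar>s cf * (A cf * (p cf - p (?T cf))) + s cf * (p (?T cf) * (A cf - A (?T cf)))\<bar>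
       \<le> 2 * (l * (sqrt (p (?T cf)) - sqrt (p cf))^2) + (1 / l) * ((A cf)^2 * p cf + (A cf)^2 * p (?T cf)) + 2 * (p (?T cf) * e (?T cf))"
      by linarith
  qed
  also have "... = 2 * (l * dex n p b) + (1 / l) * ((\<Sum>cf\<in>Omega n. (A cf)^2 * p cf) + (\<Sum>cf\<in>Omega n. (A cf)^2 * p (?T cf)))
      + 2 * (\<Sum>cf\<in>Omega n. p (?T cf) * e (?T cf))"
    unfolding dex_def sum.distrib[symmetric] sum_distrib_left by simp
  also have "(\<Sum>cf\<in>Omega n. p (?T cf) * e (?T cf)) = EE n p e"
    using sum_exc[OF n0, of "%cf. p cf * e cf"] by (simp add: EE_def)
  also have "(\<Sum>cf\<in>Omega n. (A cf)^2 * p (?T cf)) = (\<Sum>cf\<in>Omega n. (A (?T cf))^2 * p cf)"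
    using sum_exc[OF n0, of "%cf. (A cf)^2 * p (?T cf)" b] by (simp add: exc_exc)
  finally have main: "\<bar>2 * X\<bar> \<le> 2 * (l * dex n p b) + (1 / l) * ((\<Sum>cf\<in>Omega n. (A cf)^2 * p cf) + (\<Sum>cf\<in>Omega n. (A (?T cf))^2 * p cf)) + 2 * EE n p e" .
  have "(\<Sum>cf\<in>Omega n. (A cf)^2 * p cf) \<le> EE n p G" "(\<Sum>cf\<in>Omega n. (A (?T cf))^2 * p cf) \<le> EE n p G"
    unfolding EE_def mult.commute[of _ "p _"] by (intro sum_mono mult_left_mono A1 A2 p; assumption)+
  then have "(1 / l) * ((\<Sum>cf\<in>Omega n. (A cf)^2 * p cf) + (\<Sum>cf\<in>Omega n. (A (?T cf))^2 * p cf)) \<le> (1 / l) * (2 * EE n p G)"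
    using l by (intro mult_left_mono) auto
  then have "\<bar>2 * X\<bar> \<le> 2 * (l * dex n p b) + (1 / l) * (2 * EE n p G) + 2 * EE n p e" using main by linarith
  then have "\<bar>X\<bar> \<le> l * dex n p b + (1 / l) * EE n p G + EE n p e" by simp
  then show ?thesis unfolding X_def s_def .
qed

text \<open>Swapping the two ends of a bond costs one term of the exchange Dirichlet form \<open>Dex\<close>, plus the variation of
  the prefactor \<open>A\<close>; chaining swaps replaces a spin by a spin, or a block average, at distance up to \<open>W\<close>.\<close>

locale movable =
  fixes n :: nat and p :: "conf => real" and A G e :: "int => conf => real" and J :: "int set" 
  assumes n2: "n \<ge> 2" and p0: "!!cf. cf \<in> Omega n ==> 0 \<le> p cf"
    and AG: "!!i cf. cf \<in> Omega n ==> (A i cf)^2 \<le> G i cf"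
    and AG': "!!i cf c. cf \<in> Omega n ==> c \<in> J ==> (A i (exc n cf (i + c)))^2 \<le> G i cf"
    and Ae: "!!i cf c. cf \<in> Omega n ==> c \<in> J ==> \<bar>A i (exc n cf (i + c)) - A i cf\<bar> \<le> e i cf"
    and e0: "!!i cf. cf \<in> Omega n ==> 0 \<le> e i cf"
begin

lemma G0: "cf \<in> Omega n ==> 0 \<le> G i cf" using AG[of cf i] by (meson order_trans zero_le_power2)

text \<open>A displacement is a telescoping sum over bonds. After summation over the base point
  \<open>i\<close> every bond is used \<open>k\<close> times, so the cost is \<open>k\<close> copies
  of the full Dirichlet form.\<close>

lemma move_k:
  assumes W: "k \<le> W" "W > 0" and \<beta>: "\<beta> > 0" and J: "{o'..<o' + int k} \<subseteq> J"
  shows "\<bar>EE n p (%cf. tsum n (%i. A i cf * (fld n cf (i + o') - fld n cf (i + (o' + int k)))))\<bar>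
     \<le> \<beta> * Dex n p + (real W)^2 / (\<beta> * (real n)^2) * EE n p (%cf. tsum n (%i. G i cf)) + real W * EE n p (%cf. tsum n (%i. e i cf))"
proof -
  \<comment> \<open>With this weight \<open>W\<close> copies of the Dirichlet sum cost exactly
    \<open>\<beta> * Dex n p\<close>.\<close>
  define l where "l = \<beta> * (real n)^2 / real W"
  have l: "l > 0" using assms n2 by (simp add: l_def)
  define S1 where "S1 = tsum n (dex n p)"
  define S2 where "S2 = tsum n (%i. EE n p (G i))"
  define S3 where "S3 = tsum n (%i. EE n p (e i))"
  have pos: "S1 \<ge> 0" "S2 \<ge> 0" "S3 \<ge> 0"
    unfolding S1_def S2_def S3_def by (auto intro!: tsum_nonneg EE_nonneg dex_nonneg p0 G0 e0)
  have tel: "fld n cf (i + o') - fld n cf (i + (o' + int k)) = (\<Sum>j<k. fld n cf (i + (o' + int j)) - fld n cf (i + (o' + int j) + 1))" for cf i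
    by (induction k) (auto simp: algebra_simps)
  define LH where "LH = EE n p (%cf. tsum n (%i. A i cf * (fld n cf (i + o') - fld n cf (i + (o' + int k)))))"
  have LH: "LH = tsum n (%i. \<Sum>j<k. EE n p (%cf. A i cf * (fld n cf (i + (o' + int j)) - fld n cf (i + (o' + int j) + 1))))"
    unfolding LH_def tel EE_tsum sum_distrib_left EE_sum ..
  have "\<bar>LH\<bar> \<le> tsum n (%i. \<Sum>j<k. l * dex n p (i + (o' + int j)) + (1 / l) * EE n p (G i) + EE n p (e i))"
    unfolding LH
  proof (rule order_trans[OF tsum_abs_le], rule tsum_mono, rule order_trans[OF sum_abs], rule sum_mono)
    fix i j assume "j \<in> {..<k}"
    then have c: "o' + int j \<in> J" using J by auto
    have h1: "(A i cf)^2 \<le> G i cf" "(A i (exc n cf (i + (o' + int j))))^2 \<le> G i cf"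
       "\<bar>A i (exc n cf (i + (o' + int j))) - A i cf\<bar> \<le> e i cf" if "cf \<in> Omega n" for cf
      by (rule AG[OF that], rule AG'[OF that c], rule Ae[OF that c])
    show "\<bar>EE n p (%cf. A i cf * (fld n cf (i + (o' + int j)) - fld n cf (i + (o' + int j) + 1)))\<bar>
       \<le> l * dex n p (i + (o' + int j)) + (1 / l) * EE n p (G i) + EE n p (e i)"
      using move1[where A = "A i" and G = "G i" and e = "e i" and b = "i + (o' + int j)", OF n2 _ l h1] p0 by blast
  qed
  also have "... = (\<Sum>j<k. l * S1 + (1 / l) * S2 + S3)"
  proof -
    have sh: "tsum n (%i. dex n p (i + c)) = S1" for c unfolding S1_def by (rule tsum_shift[OF per_dex])
    have "tsum n (%i. l * dex n p (i + (o' + int j)) + (1 / l) * EE n p (G i) + EE n p (e i)) = l * S1 + (1 / l) * S2 + S3" for j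
      using sh[of "o' + int j"] by (simp only: tsum_add tsum_cmult S2_def S3_def)
    then show ?thesis unfolding tsum_sum by simp
  qed
  also have "... = (real k * l) * S1 + (real k / l) * S2 + real k * S3" by (simp add: algebra_simps)
  also have "... \<le> \<beta> * (real n)^2 * S1 + (real W)^2 / (\<beta> * (real n)^2) * S2 + real W * S3"
  proof (intro add_mono mult_right_mono pos)
    have "real k * l \<le> real W * l" using W l by simp
    then show "real k * l \<le> \<beta> * (real n)^2" using W by (simp add: l_def)
    have "real k / l \<le> real W / l" using W l by (simp add: divide_right_mono)
    also have "... = (real W)^2 / (\<beta> * (real n)^2)" using W by (simp add: l_def power2_eq_square)
    finally show "real k / l \<le> (real W)^2 / (\<beta> * (real n)^2)" .
  qed (use W in auto)
  finally show ?thesis unfolding LH_def Dex_def EE_tsum S1_def S2_def S3_def by (simp add: mult.assoc)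
qed

text \<open>Convexity: an average of displaced spins obeys the bound valid for each single
  displacement. A displacement to the left is read backwards, as one to the right from the other
  end.\<close>

lemma move_avg:
  assumes T: "finite T" "!!t. t \<in> T ==> 0 \<le> w t" "(\<Sum>t\<in>T. w t) = 1" and W: "W > 0" and \<beta>: "\<beta> > 0"
    and r: "!!t. t \<in> T ==> \<bar>r t\<bar> \<le> int W"
    and J: "!!t. t \<in> T ==> {o'..<o' + r t} \<union> {o' + r t..<o'} \<subseteq> J"
  shows "\<bar>EE n p (%cf. tsum n (%i. A i cf * (fld n cf (i + o') - (\<Sum>t\<in>T. w t * fld n cf (i + (o' + r t))))))\<bar>
     \<le> \<beta> * Dex n p + (real W)^2 / (\<beta> * (real n)^2) * EE n p (%cf. tsum n (%i. G i cf)) + real W * EE n p (%cf. tsum n (%i. e i cf))"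
    (is "_ \<le> ?R")
proof -
  define X where "X t = EE n p (%cf. tsum n (%i. A i cf * (fld n cf (i + o') - fld n cf (i + (o' + r t)))))" for t
  have each: "\<bar>X t\<bar> \<le> ?R" if t: "t \<in> T" for t
  proof (cases "r t \<ge> 0")
    case True
    then have "int (nat (r t)) = r t" by simp
    then show ?thesis using move_k[OF _ W \<beta>, of "nat (r t)" o'] J[OF t] r[OF t] True unfolding X_def by auto
  next
    case False
    define k where "k = nat (- r t)"
    have k: "int k = - r t" using False by (simp add: k_def)
    have "X t = - EE n p (%cf. tsum n (%i. A i cf * (fld n cf (i + (o' + r t)) - fld n cf (i + ((o' + r t) + int k)))))"
      unfolding X_def EE_uminus[symmetric] tsum_uminus[symmetric] k by (simp add: algebra_simps)
    then have "\<bar>X t\<bar> = \<bar>EE n p (%cf. tsum n (%i. A i cf * (fld n cf (i + (o' + r t)) - fld n cf (i + ((o' + r t) + int k)))))\<bar>"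
      by (simp only: abs_minus_cancel)
    also have "... \<le> ?R" by (rule move_k[OF _ W \<beta>]) (use J[OF t] r[OF t] k in auto)
    finally show ?thesis .
  qed
  have "fld n cf (i + o') - (\<Sum>t\<in>T. w t * fld n cf (i + (o' + r t))) = (\<Sum>t\<in>T. w t * (fld n cf (i + o') - fld n cf (i + (o' + r t))))" for cf i
  proof -
    have "(\<Sum>t\<in>T. w t * fld n cf (i + o')) = fld n cf (i + o')" unfolding sum_distrib_right[symmetric] T(3) by simp
    then show ?thesis unfolding right_diff_distrib sum_subtractf by simp
  qed
  then have "A i cf * (fld n cf (i + o') - (\<Sum>t\<in>T. w t * fld n cf (i + (o' + r t))))
     = (\<Sum>t\<in>T. w t * (A i cf * (fld n cf (i + o') - fld n cf (i + (o' + r t)))))" for cf i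
    by (simp add: sum_distrib_left mult.left_commute)
  then have LH: "EE n p (%cf. tsum n (%i. A i cf * (fld n cf (i + o') - (\<Sum>t\<in>T. w t * fld n cf (i + (o' + r t)))))) = (\<Sum>t\<in>T. w t * X t)"
    unfolding X_def by (simp only: tsum_sum EE_sum tsum_cmult EE_cmult)
  have "\<bar>\<Sum>t\<in>T. w t * X t\<bar> \<le> (\<Sum>t\<in>T. w t * ?R)"
    by (rule order_trans[OF sum_abs], rule sum_mono) (use T(2) each in \<open>auto simp: abs_mult intro!: mult_left_mono\<close>)
  also have "... = ?R" unfolding sum_distrib_right[symmetric] T(3) by simp
  finally show ?thesis unfolding LH .
qed

end

section \<open>Averaging kernels\<close>

definition mg :: "nat => (int => real) => real" where "mg n x = tsum n x / real n"

text \<open>A twofold box average, so that the kernel is triangular: its increments are of order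
  \<open>1 / w^2\<close> at every site (\<open>grad_tentker_abs\<close>), whereas a single box would
  jump by \<open>1 / w\<close> at its ends. This keeps the effect of an exchange on a block average
  at \<open>2 / w^2\<close>.\<close>

definition tent :: "nat => (int => real) => int => real" where
  "tent w x i = (1 / (real w)^2) * (\<Sum>j<w. \<Sum>k<w. x (i + int j + int k))"

text \<open>The mirror image and adjoint of \<open>tent\<close> (\<open>cva_tentker\<close>); it
  lets a left-hand factor be averaged away from the factors to its right.\<close>

definition tentl :: "nat => (int => real) => int => real" where
  "tentl w x i = (1 / (real w)^2) * (\<Sum>j<w. \<Sum>k<w. x (i - int j - int k))"

definition tentker :: "nat => nat => int => real" where
  "tentker n w d = (1 / (real w)^2) * (\<Sum>j<w. \<Sum>k<w. cind n (int j + int k) d)"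

definition tentker0 :: "nat => nat => int => real" where
  "tentker0 n w d = tentker n w d - 1 / real n"

text \<open>The discrete primitive of \<open>1 / n\<close> minus a point mass, hence a discrete inverse of the gradient on mean-zero
  functions; \<open>saw2\<close> inverts the Laplacian up to sign and shift.\<close>

definition saw :: "nat => int => real" where
  "saw n d = real_of_int (d mod int n) / real n - (real n - 1) / (2 * real n)"

definition saw2 :: "nat => int => real" where
  "saw2 n d = tsum n (%e. saw n e * saw n (d - e))"

lemma cind_shift: "cind n b (j - i) = cind n (b + i) j"
  unfolding cind_def by (simp add: algebra_simps)

lemma cind_shift': "cind n b (j + i) = cind n (b - i) j"
  unfolding cind_def by (simp add: algebra_simps)

lemma cind_nonneg: "0 \<le> cind n b j" by (simp add: cind_def)

lemma per_tentker: "per n (tentker n w)"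
  unfolding tentker_def by (intro per_cmult per_sum per_cind)

lemma per_tentker0: "per n (tentker0 n w)"
  unfolding tentker0_def by (intro per_cdiff per_tentker)

lemma per_saw: "per n (saw n)" by (rule perI) (simp add: saw_def)

lemma per_saw2: "per n (saw2 n)"
proof (rule perI)
  fix i
  have "saw n (i + int n - e) = saw n (i - e)" for e using perD[OF per_saw, of n "i - e"] by (simp add: algebra_simps)
  then show "saw2 n (i + int n) = saw2 n i" unfolding saw2_def by simp
qed

lemma cv_tentker: assumes "n > 0" "per n x" shows "cv n (tentker n w) x i = tent w x i"
proof -
  have "tentker n w (j - i) * x j = (1 / (real w)^2) * (\<Sum>a<w. \<Sum>b<w. x j * cind n (i + int a + int b) j)" for j
    unfolding tentker_def cind_shift by (simp add: sum_distrib_left sum_distrib_right algebra_simps)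
  then have "cv n (tentker n w) x i = (1 / (real w)^2) * (\<Sum>a<w. \<Sum>b<w. tsum n (%j. x j * cind n (i + int a + int b) j))"
    unfolding cv_def by (simp only: tsum_cmult tsum_sum)
  then show ?thesis unfolding tent_def tsum_cind[OF assms(2,1)] .
qed

lemma cva_tentker: assumes "n > 0" "per n x" shows "cva n (tentker n w) x i = tentl w x i"
proof -
  have c: "cind n b (i - l) = cind n (i - b) l" for b l
    unfolding cind_mod by (auto simp: mod_eq_dvd_iff dvd_diff_commute algebra_simps)
  have "tentker n w (i - j) * x j = (1 / (real w)^2) * (\<Sum>a<w. \<Sum>b<w. x j * cind n (i - int a - int b) j)" for j
    unfolding tentker_def c by (simp add: sum_distrib_left sum_distrib_right algebra_simps)
  then have "cva n (tentker n w) x i = (1 / (real w)^2) * (\<Sum>a<w. \<Sum>b<w. tsum n (%j. x j * cind n (i - int a - int b) j))"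
    unfolding cva_def by (simp only: tsum_cmult tsum_sum)
  then show ?thesis unfolding tentl_def tsum_cind[OF assms(2,1)] .
qed

lemma cv_const: "cv n (%d. c) x i = c * tsum n x" unfolding cv_def tsum_cmult ..
lemma cva_const: "cva n (%d. c) x i = c * tsum n x" unfolding cva_def tsum_cmult ..

lemma cv_Udiff: "cv n (%d. U d - V d) x i = cv n U x i - cv n V x i"
  by (simp add: cv_def tsum_diff[symmetric] algebra_simps)
lemma cva_Udiff: "cva n (%d. U d - V d) x i = cva n U x i - cva n V x i"
  by (simp add: cva_def tsum_diff[symmetric] algebra_simps)

lemma cv_tentker0: assumes "n > 0" "per n x" shows "cv n (tentker0 n w) x i = tent w x i - mg n x"
  using assms unfolding tentker0_def cv_Udiff cv_tentker[OF assms] cv_const mg_def by simp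

lemma cva_tentker0: assumes "n > 0" "per n x" shows "cva n (tentker0 n w) x i = tentl w x i - mg n x"
  using assms unfolding tentker0_def cva_Udiff cva_tentker[OF assms] cva_const mg_def by simp

lemma cind_sum_le1: assumes "w \<le> n" shows "(\<Sum>k<w. cind n (c + int k) d) \<le> 1"
proof (cases "\<exists>k<w. cind n (c + int k) d = 1")
  case False
  then have "(\<Sum>k<w. cind n (c + int k) d) = (\<Sum>k<w. 0)" by (intro sum.cong refl) (auto simp: cind_def)
  then show ?thesis by simp
next
  case True
  then obtain k0 where k0: "k0 < w" "cind n (c + int k0) d = 1" by blast
  have "cind n (c + int k) d = 0" if "k < w" "k \<noteq> k0" for k
  proof (rule ccontr)
    assume "cind n (c + int k) d \<noteq> 0"
    then have "(d - (c + int k)) mod int n = (d - (c + int k0)) mod int n"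
      using k0(2) by (simp add: cind_def split: if_splits)
    then have "int n dvd (int k0 - int k)" by (simp add: mod_eq_dvd_iff algebra_simps)
    moreover have "\<bar>int k0 - int k\<bar> < int n" using that k0 assms by auto
    ultimately show False using that zdvd_imp_le[of "int n" "\<bar>int k0 - int k\<bar>"] by auto
  qed
  then have "(\<Sum>k<w. cind n (c + int k) d) = (\<Sum>k<w. if k = k0 then 1 else 0)"
    using k0 by (intro sum.cong) auto
  then show ?thesis using k0 by simp
qed

lemma tsum_cind1: "n > 0 ==> tsum n (cind n b) = 1"
  using tsum_cind[of n "%_. 1" b] by (simp add: per_const)

text \<open>Telescoping in one of the two sums leaves the difference of two adjacent windows; by
  \<open>cind_sum_le1\<close> a window of length at most \<open>n\<close> covers each residue at
  most once.\<close>

lemma grad_tentker: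
  assumes "w > 0"
  shows "tentker n w (d + 1) - tentker n w d = (1 / (real w)^2) * ((\<Sum>k<w. cind n (- 1 + int k) d) - (\<Sum>k<w. cind n (int w - 1 + int k) d))"
proof -
  have tel: "(\<Sum>k<w. cind n (int j + int k) (d + 1)) - (\<Sum>k<w. cind n (int j + int k) d) = cind n (int j - 1) d - cind n (int j + int w - 1) d" for j
  proof -
    have "(\<Sum>k<w. cind n (int j + int k) (d + 1)) - (\<Sum>k<w. cind n (int j + int k) d)
      = (\<Sum>k<w. cind n (int j + int k - 1) d - cind n (int j + int (Suc k) - 1) d)"
      unfolding sum_subtractf[symmetric] cind_shift' by (rule sum.cong) (simp_all add: algebra_simps)
    also have "... = cind n (int j + int 0 - 1) d - cind n (int j + int w - 1) d"
      using sum_lessThan_telescope'[of "%k. cind n (int j + int k - 1) d" w] by simp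
    finally show ?thesis by simp
  qed
  have "tentker n w (d + 1) - tentker n w d = (1 / (real w)^2) * (\<Sum>j<w. (\<Sum>k<w. cind n (int j + int k) (d + 1)) - (\<Sum>k<w. cind n (int j + int k) d))"
    unfolding tentker_def by (simp add: sum_subtractf right_diff_distrib)
  also have "... = (1 / (real w)^2) * ((\<Sum>k<w. cind n (- 1 + int k) d) - (\<Sum>k<w. cind n (int w - 1 + int k) d))"
    unfolding tel sum_subtractf by (simp add: algebra_simps)
  finally show ?thesis .
qed

lemma grad_tentker_abs:
  assumes "w > 0" "w \<le> n"
  shows "\<bar>tentker n w (d + 1) - tentker n w d\<bar> \<le> 1 / (real w)^2"
proof -
  have s0: "0 \<le> (\<Sum>k<w. cind n (c + int k) d)" for c by (intro sum_nonneg cind_nonneg)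
  have s1: "(\<Sum>k<w. cind n (c + int k) d) \<le> 1" for c by (rule cind_sum_le1[OF assms(2)])
  have "\<bar>(\<Sum>k<w. cind n (- 1 + int k) d) - (\<Sum>k<w. cind n (int w - 1 + int k) d)\<bar> \<le> 1"
    using s0[of "-1"] s1[of "-1"] s0[of "int w - 1"] s1[of "int w - 1"] by linarith
  then show ?thesis unfolding grad_tentker[OF assms(1)] abs_mult by (simp add: divide_right_mono)
qed

lemma sq_diff_le: fixes a b :: real assumes "0 \<le> a" "a \<le> 1" "0 \<le> b" "b \<le> 1"
  shows "(a - b)^2 \<le> a + b"
proof -
  have "a * a \<le> a" "b * b \<le> b" "0 \<le> a * b" using assms by (simp_all add: mult_left_le)
  then show ?thesis by (simp add: power2_eq_square algebra_simps)
qed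

lemma grad2_tentker0:
  assumes "w > 0" "w \<le> n"
  shows "grad2 n (tentker0 n w) \<le> 2 / (real w)^3"
proof -
  define s where "s c d = (\<Sum>k<w. cind n (c + int k) d)" for c d
  have s0: "0 \<le> s c d" for c d unfolding s_def by (intro sum_nonneg cind_nonneg)
  have s1: "s c d \<le> 1" for c d unfolding s_def by (rule cind_sum_le1[OF assms(2)])
  have "(tentker0 n w (d + 1) - tentker0 n w d)^2 \<le> (1 / (real w)^4) * (s (-1) d + s (int w - 1) d)" for d
  proof -
    have "(s (-1) d - s (int w - 1) d)^2 \<le> s (-1) d + s (int w - 1) d"
      by (rule sq_diff_le[OF s0 s1 s0 s1])
    moreover have "(tentker0 n w (d + 1) - tentker0 n w d)^2 = (1 / (real w)^4) * (s (-1) d - s (int w - 1) d)^2"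
      unfolding tentker0_def using grad_tentker[OF assms(1), of n d] unfolding s_def
      by (simp add: power_divide)
    ultimately show ?thesis by (simp add: divide_right_mono)
  qed
  then have "grad2 n (tentker0 n w) \<le> tsum n (%d. (1 / (real w)^4) * (s (-1) d + s (int w - 1) d))"
    unfolding grad2_def by (rule tsum_mono)
  also have "... = (1 / (real w)^4) * (real w + real w)"
    unfolding tsum_cmult tsum_add s_def tsum_sum using tsum_cind1 assms by simp
  also have "... = 2 / (real w)^3" using assms by (simp add: field_simps power_eq_if)
  finally show ?thesis .
qed

lemma tentker_nonneg: "0 \<le> tentker n w d" unfolding tentker_def by (intro mult_nonneg_nonneg sum_nonneg cind_nonneg) auto

lemma tsum_tentker: assumes "w > 0" "n > 0" shows "tsum n (tentker n w) = 1"
  unfolding tentker_def tsum_cmult tsum_sum using tsum_cind1[OF assms(2)] assms by (simp add: power2_eq_square)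

lemma tentker_le: assumes "w > 0" "w \<le> n" shows "tentker n w d \<le> 1 / real w"
proof -
  have "(\<Sum>j<w. \<Sum>k<w. cind n (int j + int k) d) \<le> (\<Sum>j<w. 1)"
    by (intro sum_mono cind_sum_le1 assms)
  then have "tentker n w d \<le> (1 / (real w)^2) * real w"
    unfolding tentker_def by (intro mult_left_mono) auto
  then show ?thesis using assms by (simp add: power2_eq_square)
qed

lemma tsum_tentker0: assumes "w > 0" "n > 0" shows "tsum n (tentker0 n w) = 0"
  unfolding tentker0_def tsum_diff tsum_tentker[OF assms] tsum_const using assms by simp

lemma tsum_abs_tentker0: assumes "w > 0" "n > 0" shows "tsum n (%d. \<bar>tentker0 n w d\<bar>) \<le> 2"
proof -
  have "tsum n (%d. \<bar>tentker0 n w d\<bar>) \<le> tsum n (%d. tentker n w d + 1 / real n)"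
    unfolding tentker0_def by (intro tsum_mono) (use tentker_nonneg[of n w] in \<open>auto simp: abs_le_iff intro: add_increasing2\<close>)
  also have "... = 2" unfolding tsum_add tsum_tentker[OF assms] tsum_const using assms by simp
  finally show ?thesis .
qed

lemma tsum_sq_tentker0: assumes "w > 0" "w \<le> n" shows "tsum n (%d. (tentker0 n w d)^2) \<le> 1 / real w"
proof -
  have n: "n > 0" using assms by simp
  have "(tentker0 n w d)^2 \<le> (1 / real w) * tentker n w d - (2 / real n) * tentker n w d + (1 / real n)^2" for d
  proof -
    have "tentker n w d * tentker n w d \<le> (1 / real w) * tentker n w d"
      by (intro mult_right_mono tentker_le assms tentker_nonneg)
    moreover have "(t - u)^2 \<le> v * t - (2 * u) * t + u^2" if "t * t \<le> v * t" for t u v :: real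
      using that by (simp add: power2_diff power2_eq_square algebra_simps)
    ultimately show ?thesis unfolding tentker0_def
      by (metis mult.right_neutral times_divide_eq_right)
  qed
  then have "tsum n (%d. (tentker0 n w d)^2) \<le> tsum n (%d. (1 / real w) * tentker n w d - (2 / real n) * tentker n w d + (1 / real n)^2)"
    by (rule tsum_mono)
  also have "... = 1 / real w - 2 / real n + real n * (1 / real n)^2"
    unfolding tsum_add tsum_diff tsum_cmult tsum_tentker[OF assms(1) n] tsum_const by simp
  also have "... \<le> 1 / real w" using n by (simp add: power2_eq_square)
  finally show ?thesis .
qed

section \<open>The sawtooth kernel and its self-convolution\<close>

lemma grad_saw: assumes "n > 0" shows "saw n (d + 1) - saw n d = 1 / real n - cind n (- 1) d"
proof -
  define r where "r = d mod int n"
  have r: "0 \<le> r" "r < int n" using assms by (auto simp: r_def)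
  have d1: "(d + 1) mod int n = (r + 1) mod int n" unfolding r_def by (simp add: mod_simps)
  show ?thesis
  proof (cases "r = int n - 1")
    case True
    then have "(d + 1) mod int n = 0" using d1 by simp
    then have "cind n (- 1) d = 1" by (simp add: cind_def)
    then show ?thesis unfolding saw_def \<open>(d + 1) mod int n = 0\<close> r_def[symmetric] True using assms by (simp add: field_simps of_nat_diff)
  next
    case False
    then have "(d + 1) mod int n = r + 1" using d1 r by simp
    moreover from this have "cind n (- 1) d = 0" using r by (simp add: cind_def)
    ultimately show ?thesis unfolding saw_def r_def[symmetric] using assms by (simp add: field_simps)
  qed
qed

lemma saw_abs: assumes "n > 0" shows "\<bar>saw n d\<bar> \<le> 1 / 2"
proof -
  define r where "r = d mod int n"
  have r: "0 \<le> r" "r \<le> int n - 1" using assms by (auto simp: r_def)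
  then have "0 \<le> real_of_int r" "real_of_int r \<le> real n - 1" by linarith+
  then have "real_of_int r / real n \<le> (real n - 1) / real n" "0 \<le> real_of_int r / real n" "(real n - 1) / real n \<le> 1"
    using assms by (auto simp: divide_right_mono)
  moreover have "(real n - 1) / (2 * real n) = ((real n - 1) / real n) / 2" by simp
  ultimately show ?thesis unfolding saw_def r_def[symmetric] by (intro abs_leI) linarith+
qed

lemma tsum_id: "tsum n (%d. real_of_int d) = real n * (real n - 1) / 2"
proof (induction n)
  case (Suc n)
  have "{0..<int (Suc n)} = insert (int n) {0..<int n}" by auto
  then have "tsum (Suc n) (%d. real_of_int d) = real n + tsum n (%d. real_of_int d)"
    unfolding tsum_def by simp
  then show ?case using Suc by (simp add: field_simps)
qed (simp add: tsum_def)

lemma tsum_saw: assumes "n > 0" shows "tsum n (saw n) = 0"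
proof -
  have "tsum n (saw n) = tsum n (%d. real_of_int d / real n - (real n - 1) / (2 * real n))"
    unfolding tsum_def saw_def by (intro sum.cong) auto
  also have "... = 0" unfolding tsum_diff tsum_cdiv tsum_id tsum_const using assms by (simp add: field_simps)
  finally show ?thesis .
qed

lemma tsum_abs_saw: assumes "n > 0" shows "tsum n (%d. \<bar>saw n d\<bar>) \<le> real n / 2"
proof -
  have "tsum n (%d. \<bar>saw n d\<bar>) \<le> tsum n (%d. 1 / 2)" by (intro tsum_mono saw_abs assms)
  then show ?thesis by (simp add: tsum_const)
qed

lemma tsum_sq_saw: assumes "n > 0" shows "tsum n (%d. (saw n d)^2) \<le> real n / 4"
proof -
  have "(saw n d)^2 \<le> 1 / 4" for d
    using power_mono[OF saw_abs[OF assms, of d], of 2] by (simp add: power_divide)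
  then have "tsum n (%d. (saw n d)^2) \<le> tsum n (%d. 1 / 4)" by (intro tsum_mono)
  then show ?thesis by (simp add: tsum_const)
qed

lemma grad2_saw: assumes "n > 0" shows "grad2 n (saw n) = 1 - 1 / real n"
proof -
  have "(saw n (d + 1) - saw n d)^2 = (1 / real n)^2 - (2 / real n) * cind n (- 1) d + cind n (-1) d" for d
  proof -
    have "cind n (- 1) d * cind n (- 1) d = cind n (- 1) d" by (simp add: cind_def)
    moreover have "(u - c)^2 = u^2 - (2 * u) * c + c" if "c * c = c" for u c :: real
      using that by (simp add: power2_diff power2_eq_square algebra_simps)
    ultimately show ?thesis unfolding grad_saw[OF assms] by (metis mult.right_neutral times_divide_eq_right)
  qed
  then have "grad2 n (saw n) = real n * (1 / real n)^2 - (2 / real n) * 1 + 1"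
    by (simp only: grad2_def tsum_add tsum_diff tsum_cmult tsum_const tsum_cind1[OF assms])
  then show ?thesis using assms by (simp add: power2_eq_square)
qed

lemma grad_cv_saw: assumes "n > 0" "per n x"
  shows "cv n (saw n) x (i + 1) - cv n (saw n) x i = x i - mg n x"
proof -
  have "saw n (j - (i + 1)) * x j - saw n (j - i) * x j = x j * cind n i j - (1 / real n) * x j" for j
  proof -
    have c: "cind n (- 1) (j - i - 1) = cind n i j" using cind_shift[of n "-1" j "i+1"] by (simp add: algebra_simps)
    have "saw n (j - (i + 1)) - saw n (j - i) = cind n i j - 1 / real n"
      using grad_saw[OF assms(1), of "j - i - 1"] unfolding c by (simp add: algebra_simps)
    then have "(saw n (j - (i + 1)) - saw n (j - i)) * x j = (cind n i j - 1 / real n) * x j" by simp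
    then show ?thesis by (simp only: left_diff_distrib mult.commute[of "x j"])
  qed
  then have "cv n (saw n) x (i + 1) - cv n (saw n) x i = tsum n (%j. x j * cind n i j) - (1 / real n) * tsum n x"
    unfolding cv_def tsum_diff[symmetric] tsum_cmult[symmetric] by simp
  then show ?thesis unfolding tsum_cind[OF assms(2,1)] mg_def by simp
qed

lemma tsum_cv: assumes "per n U" shows "tsum n (cv n U x) = tsum n U * tsum n x"
proof -
  have "tsum n (cv n U x) = tsum n (%j. tsum n (%i. U (j - i)) * x j)"
    unfolding cv_def tsum_cmult2[symmetric] by (rule tsum_swap)
  also have "... = tsum n (%j. tsum n U * x j)" by (simp only: tsum_reflect[OF assms])
  finally show ?thesis by (simp add: tsum_cmult)
qed

lemma tsum_cva: assumes "per n U" shows "tsum n (cva n U x) = tsum n U * tsum n x"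
proof -
  have "tsum n (cva n U x) = tsum n (%j. tsum n (%i. U (i - j)) * x j)"
    unfolding cva_def tsum_cmult2[symmetric] by (rule tsum_swap)
  also have "... = tsum n (%j. tsum n U * x j)" by (simp only: tsum_shift'[OF assms])
  finally show ?thesis by (simp add: tsum_cmult)
qed

lemma cv_saw2: assumes "n > 0" "per n x"
  shows "cv n (saw2 n) x i = cv n (saw n) (cv n (saw n) x) i"
proof -
  have "saw2 n (j - i) = tsum n (%k. saw n (k - i) * saw n (j - k))" for j
  proof -
    have "per n (%e. saw n e * saw n (j - i - e))" by (intro per_intros per_saw)
    from tsum_shift'[OF this, of i] show ?thesis unfolding saw2_def by (simp add: algebra_simps)
  qed
  then have "cv n (saw2 n) x i = tsum n (%j. tsum n (%k. saw n (k - i) * (saw n (j - k) * x j)))"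
    unfolding cv_def by (simp add: tsum_cmult2[symmetric] mult.assoc)
  also have "... = tsum n (%k. saw n (k - i) * tsum n (%j. saw n (j - k) * x j))"
    by (subst tsum_swap) (simp only: tsum_cmult)
  finally show ?thesis unfolding cv_def .
qed

lemma grad_saw2: assumes "n > 0" shows "saw2 n (d + 1) - saw2 n d = - saw n (d + 1)"
proof -
  have "saw n e * saw n (d + 1 - e) - saw n e * saw n (d - e) = (1 / real n) * saw n e - saw n e * cind n (d + 1) e" for e
  proof -
    have "cind n (- 1) (d - e) = cind n (d + 1) e"
      unfolding cind_mod by (auto simp: mod_eq_dvd_iff dvd_diff_commute algebra_simps)
    then have "saw n (d + 1 - e) - saw n (d - e) = 1 / real n - cind n (d + 1) e"
      using grad_saw[OF assms, of "d - e"] by (simp add: algebra_simps)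
    then have "saw n e * (saw n (d + 1 - e) - saw n (d - e)) = saw n e * (1 / real n - cind n (d + 1) e)" by simp
    then show ?thesis by (simp only: right_diff_distrib mult.commute[of "saw n e" "1 / real n"])
  qed
  then have "saw2 n (d + 1) - saw2 n d = (1 / real n) * tsum n (saw n) - tsum n (%e. saw n e * cind n (d + 1) e)"
    unfolding saw2_def tsum_diff[symmetric] tsum_cmult[symmetric] by simp
  then show ?thesis unfolding tsum_saw[OF assms] tsum_cind[OF per_saw assms] by simp
qed

lemma grad2_saw2: assumes "n > 0" shows "grad2 n (saw2 n) \<le> real n / 4"
proof -
  have "grad2 n (saw2 n) = tsum n (%d. (saw n (d + 1))^2)" unfolding grad2_def grad_saw2[OF assms] by simp
  also have "... = tsum n (%d. (saw n d)^2)" by (rule tsum_shift[OF per_pow[OF per_saw]])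
  finally show ?thesis using tsum_sq_saw[OF assms] by simp
qed

lemma saw2_abs: assumes "n > 0" shows "\<bar>saw2 n d\<bar> \<le> real n / 4"
proof -
  have "\<bar>saw2 n d\<bar> \<le> tsum n (%e. \<bar>saw n e * saw n (d - e)\<bar>)" unfolding saw2_def by (rule tsum_abs_le)
  also have "... \<le> tsum n (%e. 1 / 4)"
  proof (rule tsum_mono)
    fix e show "\<bar>saw n e * saw n (d - e)\<bar> \<le> 1 / 4"
      unfolding abs_mult using mult_mono[OF saw_abs[OF assms, of e] saw_abs[OF assms, of "d - e"]] by simp
  qed
  finally show ?thesis by (simp add: tsum_const)
qed

lemma tsum_saw2: assumes "n > 0" shows "tsum n (saw2 n) = 0"
proof -
  have "tsum n (saw2 n) = tsum n (%e. saw n e * tsum n (%d. saw n (d - e)))"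
    unfolding saw2_def tsum_cmult[symmetric] by (rule tsum_swap)
  also have "... = 0" by (simp add: tsum_shift'[OF per_saw] tsum_saw[OF assms] tsum_0)
  finally show ?thesis .
qed

section \<open>Response of local fields to an exchange; the Poincare inequality\<close>

lemma tsum_le_const: "(!!i. f i \<le> c) ==> tsum n f \<le> real n * c"
  using tsum_mono[of n f "%_. c"] by (simp add: tsum_const)

text \<open>A dipole changes \<open>cv n U x\<close> by increments of the kernel. The last bound
  puts the sup norm on the kernel and the l1 norm on its increments instead of the reverse; the
  sawtooth requires this, since it has a jump of order one but bounded total variation.\<close>

lemma zeta_exc:
  assumes U: "per n U" and x: "per n x" and n: "n > 0"
    and y: "!!j. y j = x j + c * (cind n b j - cind n (b + 1) j)" and c: "\<bar>c\<bar> \<le> 2"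
    and B: "!!d. \<bar>U (d + 1) - U d\<bar> \<le> B"
  shows "\<bar>cv n U y i - cv n U x i\<bar> \<le> 2 * B"
    "\<bar>cva n U (cv n U y) i - cva n U (cv n U x) i\<bar> \<le> 2 * B * tsum n (%d. \<bar>U d\<bar>)"
    "(!!d. \<bar>U d\<bar> \<le> C) ==> \<bar>cva n U (cv n U y) i - cva n U (cv n U x) i\<bar> \<le> 2 * C * tsum n (%d. \<bar>U (d + 1) - U d\<bar>)"
proof -
  have cvd: "cv n U y l - cv n U x l = c * (U (b - l) - U (b + 1 - l))" for l
    using cv_swap[OF U x n y, of l] by simp
  have B0: "0 \<le> B" using B[of 0] by linarith
  have U1: "\<bar>U (b - l) - U (b + 1 - l)\<bar> \<le> B" for l using B[of "b - l"] by (simp add: algebra_simps abs_minus_commute)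
  have cvb: "\<bar>cv n U y l - cv n U x l\<bar> \<le> 2 * B" for l
    unfolding cvd abs_mult by (rule mult_mono[OF c U1]) auto
  show "\<bar>cv n U y i - cv n U x i\<bar> \<le> 2 * B" by (rule cvb)
  have "cva n U (cv n U y) i - cva n U (cv n U x) i = tsum n (%l. U (i - l) * (cv n U y l - cv n U x l))"
    unfolding cva_def tsum_diff[symmetric] right_diff_distrib ..
  then have 1: "\<bar>cva n U (cv n U y) i - cva n U (cv n U x) i\<bar> \<le> tsum n (%l. \<bar>U (i - l)\<bar> * \<bar>cv n U y l - cv n U x l\<bar>)"
    using tsum_abs_le[of n "%l. U (i - l) * (cv n U y l - cv n U x l)"] by (simp add: abs_mult)
  also have "... \<le> tsum n (%l. \<bar>U (i - l)\<bar> * (2 * B))" by (intro tsum_mono mult_left_mono cvb) auto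
  also have "... = tsum n (%d. \<bar>U d\<bar>) * (2 * B)" unfolding tsum_cmult2 using tsum_reflect[OF per_abs[OF U], of i] by simp
  finally show "\<bar>cva n U (cv n U y) i - cva n U (cv n U x) i\<bar> \<le> 2 * B * tsum n (%d. \<bar>U d\<bar>)" by (simp add: mult.commute)
  assume C: "!!d. \<bar>U d\<bar> \<le> C"
  have C0: "0 \<le> C" using C[of 0] by linarith
  have p: "per n (%d. \<bar>U (d + 1) - U d\<bar>)" by (intro per_intros U)
  have "tsum n (%l. \<bar>U (i - l)\<bar> * \<bar>cv n U y l - cv n U x l\<bar>) \<le> tsum n (%l. C * (2 * \<bar>U (b - l + 1) - U (b - l)\<bar>))"
  proof (rule tsum_mono)
    fix l
    have "\<bar>cv n U y l - cv n U x l\<bar> \<le> 2 * \<bar>U (b - l + 1) - U (b - l)\<bar>"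
      unfolding cvd abs_mult using c by (simp add: algebra_simps abs_minus_commute mult_right_mono)
    then show "\<bar>U (i - l)\<bar> * \<bar>cv n U y l - cv n U x l\<bar> \<le> C * (2 * \<bar>U (b - l + 1) - U (b - l)\<bar>)"
      by (intro mult_mono C C0) auto
  qed
  also have "... = 2 * C * tsum n (%d. \<bar>U (d + 1) - U d\<bar>)"
    unfolding tsum_cmult using tsum_reflect[OF p, of b] by simp
  finally show "\<bar>cva n U (cv n U y) i - cva n U (cv n U x) i\<bar> \<le> 2 * C * tsum n (%d. \<bar>U (d + 1) - U d\<bar>)"
    using 1 by linarith
qed

text \<open>Every deviation from the mean is at most the total variation \<open>D\<close>, and
  \<open>D^2\<close> is bounded by Cauchy--Schwarz. The constant is crude, but \<open>n^2\<close>
  times the gradient energy is precisely what the exchanges dissipate for block averages.\<close>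

lemma poincare:
  assumes n: "n > 0" and y: "per n y"
  shows "tsum n (%i. (y i - mg n y)^2) \<le> (real n)^2 * grad2 n y"
proof -
  define D where "D = tsum n (%i. \<bar>y (i + 1) - y i\<bar>)"
  have pD: "per n (%i. \<bar>y (i + 1) - y i\<bar>)" by (intro per_intros y)
  have step: "\<bar>y (i + int k) - y i\<bar> \<le> D" if "k \<le> n" for i k
  proof -
    have "\<bar>y (i + int k) - y i\<bar> \<le> (\<Sum>j<k. \<bar>y (i + int j + 1) - y (i + int j)\<bar>)"
    proof (induction k)
      case (Suc k)
      then show ?case by (simp add: algebra_simps)
    qed simp
    also have "... \<le> (\<Sum>j<n. \<bar>y (i + int j + 1) - y (i + int j)\<bar>)" by (rule sum_mono2) (use that in auto)
    also have "... = tsum n (%j. \<bar>y (j + i + 1) - y (j + i)\<bar>)" unfolding tsum_nat unfolding tsum_def by (intro sum.cong) (auto simp: algebra_simps)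
    also have "... = D" unfolding D_def using tsum_shift[OF pD, of i] by simp
    finally show ?thesis .
  qed
  have D2: "D^2 \<le> real n * grad2 n y"
    using tsum_CS[of n "%_. 1" "%i. \<bar>y (i + 1) - y i\<bar>"] by (simp add: D_def tsum_const grad2_def)
  have dev: "(y i - mg n y)^2 \<le> D^2" for i
  proof -
    have "y i - mg n y = (1 / real n) * tsum n (%j. y i - y (j + i))"
      unfolding tsum_diff tsum_const tsum_shift[OF y] mg_def using n by (simp add: field_simps)
    also have "\<bar>...\<bar> \<le> (1 / real n) * tsum n (%j. D)"
      unfolding abs_mult
    proof (rule mult_mono)
      show "\<bar>tsum n (%j. y i - y (j + i))\<bar> \<le> tsum n (%j. D)"
      proof (rule order_trans[OF tsum_abs_le], rule tsum_mono)
        fix j assume "0 \<le> j" "j < int n"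
        then show "\<bar>y i - y (j + i)\<bar> \<le> D" using step[of "nat j" i] by (simp add: algebra_simps abs_minus_commute)
      qed
    qed auto
    also have "... = D" unfolding tsum_const using n by simp
    finally have "\<bar>y i - mg n y\<bar> \<le> D" .
    then show ?thesis by (metis abs_ge_zero power2_abs power_mono)
  qed
  have "tsum n (%i. (y i - mg n y)^2) \<le> real n * D^2" by (rule tsum_le_const[OF dev])
  also have "... \<le> real n * (real n * grad2 n y)" by (rule mult_left_mono[OF D2]) simp
  finally show ?thesis by (simp add: power2_eq_square mult.assoc)
qed

lemma shift_diff:
  assumes n: "n > 0" and y: "per n y"
  shows "tsum n (%i. (y (i + int k) - y i)^2) \<le> (real k)^2 * grad2 n y"
proof -
  have g: "tsum n (%i. (y (i + int j + 1) - y (i + int j))^2) = grad2 n y" for j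
  proof -
    have "per n (%i. (y (i + 1) - y i)^2)" by (intro per_intros y)
    from tsum_shift[OF this, of "int j"] show ?thesis unfolding grad2_def by simp
  qed
  have "y (i + int k) - y i = (\<Sum>j<k. y (i + int j + 1) - y (i + int j))" for i
    by (induction k) (auto simp: algebra_simps)
  then have "(y (i + int k) - y i)^2 \<le> real k * (\<Sum>j<k. (y (i + int j + 1) - y (i + int j))^2)" for i
    using Cauchy_Schwarz_ineq_sum[of "%_. 1" "%j. y (i + int j + 1) - y (i + int j)" "{..<k}"] by simp
  then have "tsum n (%i. (y (i + int k) - y i)^2) \<le> tsum n (%i. real k * (\<Sum>j<k. (y (i + int j + 1) - y (i + int j))^2))"
    by (rule tsum_mono)
  also have "... = real k * (\<Sum>j<k. grad2 n y)" unfolding tsum_cmult tsum_sum g ..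
  finally show ?thesis by (simp add: power2_eq_square mult.assoc)
qed

lemma mg_exc: assumes "n \<ge> 2" shows "mg n (fld n (exc n cf c)) = mg n (fld n cf)"
proof -
  have "cv n (%_. 1) (fld n (exc n cf c)) 0 = cv n (%_. 1) (fld n cf) 0"
    using cv_swap[OF per_const per_fld _ fld_exc[OF assms]] assms by simp
  then show ?thesis unfolding cv_const mg_def by simp
qed

lemma fld_exc_rel:
  assumes "n \<ge> 2" "s \<noteq> c" "s \<noteq> c + 1" "\<bar>s - c\<bar> < int n" "\<bar>s - c - 1\<bar> < int n"
  shows "fld n (exc n cf (i + c)) (i + s) = fld n cf (i + s)"
proof -
  have "(s - c) mod int n \<noteq> 0" using assms zdvd_imp_le[of "int n" "\<bar>s - c\<bar>"] by (auto simp: mod_eq_0_iff_dvd)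
  moreover have "(s - c - 1) mod int n \<noteq> 0"
    using assms zdvd_imp_le[of "int n" "\<bar>s - c - 1\<bar>"] by (auto simp: mod_eq_0_iff_dvd)
  ultimately show ?thesis unfolding fld_exc[OF assms(1)] cind_def by (simp add: algebra_simps)
qed

text \<open>The window of \<open>tent\<close> at \<open>s\<close> covers the
  \<open>2 * w - 1\<close> sites from \<open>s\<close> to \<open>s + 2 * w - 2\<close>; the last
  hypothesis keeps bond and window from meeting around the torus.\<close>

lemma tent_exc_rel:
  assumes "n \<ge> 2" "w > 0" "c + 1 < s \<or> s + 2 * int w - 2 < c" "\<bar>s - c\<bar> + 2 * int w < int n"
  shows "tent w (fld n (exc n cf (i + c))) (i + s) = tent w (fld n cf) (i + s)"
proof -
  have "fld n (exc n cf (i + c)) (i + s + int j + int k) = fld n cf (i + s + int j + int k)" if "j < w" "k < w" for j k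
    using fld_exc_rel[of n "s + int j + int k" c cf i] assms that by (simp add: algebra_simps abs_less_iff abs_le_iff) linarith
  then show ?thesis unfolding tent_def by simp
qed

lemma tentl_tent: assumes "w > 0" shows "tentl w x i = tent w x (i - (2 * int w - 2))"
proof -
  have r: "(\<Sum>j<w. f (- int j)) = (\<Sum>j<w. f (int j - (int w - 1)))" for f :: "int => real"
    by (rule sum.reindex_bij_witness[of _ "%j. w - 1 - j" "%j. w - 1 - j"]) (use assms in \<open>auto simp: of_nat_diff\<close>)
  have "(\<Sum>j<w. \<Sum>k<w. x (i - int j - int k)) = (\<Sum>j<w. \<Sum>k<w. x (i - int j + (int k - (int w - 1))))"
    using r[of "%t. x (i - int j + t)" for j] by simp
  also have "... = (\<Sum>j<w. \<Sum>k<w. x (i + (int j - (int w - 1)) + (int k - (int w - 1))))"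
    using r[of "%t. \<Sum>k<w. x (i + t + (int k - (int w - 1)))"] by simp
  also have "... = (\<Sum>j<w. \<Sum>k<w. x (i - (2 * int w - 2) + int j + int k))"
    by (intro sum.cong refl) (simp add: algebra_simps)
  finally show ?thesis unfolding tentl_def tent_def by simp
qed

lemma tent_abs: assumes "!!j. \<bar>x j\<bar> \<le> 1" "w > 0" shows "\<bar>tent w x i\<bar> \<le> 1"
proof -
  have "\<bar>\<Sum>j<w. \<Sum>k<w. x (i + int j + int k)\<bar> \<le> (\<Sum>j<w. \<Sum>k<w. 1)"
    by (rule order_trans[OF sum_abs], rule sum_mono, rule order_trans[OF sum_abs], rule sum_mono) (rule assms)
  then show ?thesis unfolding tent_def abs_mult using assms(2) by (simp add: power2_eq_square field_simps)
qed

lemma tent_fld_abs: assumes "cf \<in> Omega n" "n > 0" "w > 0" shows "\<bar>tent w (fld n cf) i\<bar> \<le> 1"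
  by (rule tent_abs) (use fld_abs[OF assms(1,2)] assms(3) in auto)

lemma tent_exc: assumes "cf \<in> Omega n" "n \<ge> 2" "w > 0" "w \<le> n"
  shows "\<bar>tent w (fld n (exc n cf c)) i - tent w (fld n cf) i\<bar> \<le> 2 / (real w)^2"
proof -
  have n: "n > 0" using assms by simp
  have d: "\<bar>fld n cf (c + 1) - fld n cf c\<bar> \<le> 2"
    using fld_values[OF assms(1) n, of "c+1"] fld_values[OF assms(1) n, of c] by auto
  show ?thesis using zeta_exc(1)[OF per_tentker per_fld n fld_exc[OF assms(2)] d grad_tentker_abs[OF assms(3,4)], of i]
    unfolding cv_tentker[OF n per_fld] by simp
qed

lemma per_tent: "per n x ==> per n (tent w x)"
  unfolding tent_def[abs_def]
  by (intro per_cmult per_sum) (auto intro!: per_shift[where k = "int _ + int _", simplified add.assoc[symmetric]])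

lemma mg_tent: assumes "w > 0" "n > 0" "per n x" shows "mg n (tent w x) = mg n x"
proof -
  have "tsum n (tent w x) = tsum n (cv n (tentker n w) x)" unfolding cv_tentker[OF assms(2,3), abs_def] ..
  then show ?thesis unfolding tsum_cv[OF per_tentker] tsum_tentker[OF assms(1,2)] mg_def by simp
qed

context movable
begin

lemma tent_weights: assumes "w > (0::nat)" shows "(\<Sum>t\<in>{..<w} \<times> {..<w}. 1 / (real w)^2) = 1"
  using assms by (simp add: card_cartesian_product power2_eq_square)

lemma move_tent:
  assumes w: "w > 0" and \<beta>: "\<beta> > 0" and J: "{o'..<o' + 2 * int w} \<subseteq> J"
  shows "\<bar>EE n p (%cf. tsum n (%i. A i cf * (fld n cf (i + o') - tent w (fld n cf) (i + o'))))\<bar>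
     \<le> \<beta> * Dex n p + (2 * real w)^2 / (\<beta> * (real n)^2) * EE n p (%cf. tsum n (%i. G i cf)) + 2 * real w * EE n p (%cf. tsum n (%i. e i cf))"
proof -
  have t: "tent w (fld n cf) (i + o') = (\<Sum>t\<in>{..<w} \<times> {..<w}. 1 / (real w)^2 * fld n cf (i + (o' + (int (fst t) + int (snd t)))))" for cf i
    unfolding tent_def sum.cartesian_product sum_distrib_left by (rule sum.cong) (auto simp: algebra_simps)
  have "\<bar>EE n p (%cf. tsum n (%i. A i cf * (fld n cf (i + o') - (\<Sum>t\<in>{..<w} \<times> {..<w}. 1 / (real w)^2 * fld n cf (i + (o' + (int (fst t) + int (snd t))))))))\<bar>
   \<le> \<beta> * Dex n p + (real (2 * w))^2 / (\<beta> * (real n)^2) * EE n p (%cf. tsum n (%i. G i cf)) + real (2 * w) * EE n p (%cf. tsum n (%i. e i cf))"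
    by (rule move_avg[OF _ _ tent_weights[OF w] _ \<beta>]) (use w J in \<open>auto simp: subset_iff\<close>)
  then show ?thesis unfolding t by simp
qed

text \<open>The offset \<open>s\<close> allows the spin to be replaced by the block ending one site
  further left, so that in \<open>S3_moves\<close> two neighbouring spins are replaced by the same
  block average and a square appears.\<close>

lemma move_tentl:
  assumes w: "w > 0" and \<beta>: "\<beta> > 0" and J: "{o' - 2 * int w..<o'} \<subseteq> J" and s: "s = 0 \<or> s = 1"
  shows "\<bar>EE n p (%cf. tsum n (%i. A i cf * (fld n cf (i + o') - tentl w (fld n cf) (i + o' - s))))\<bar>
     \<le> \<beta> * Dex n p + (2 * real w)^2 / (\<beta> * (real n)^2) * EE n p (%cf. tsum n (%i. G i cf)) + 2 * real w * EE n p (%cf. tsum n (%i. e i cf))"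
proof -
  have t: "tentl w (fld n cf) (i + o' - s) = (\<Sum>t\<in>{..<w} \<times> {..<w}. 1 / (real w)^2 * fld n cf (i + (o' + (- s - int (fst t) - int (snd t)))))" for cf i
    unfolding tentl_def sum.cartesian_product sum_distrib_left by (rule sum.cong) (auto simp: algebra_simps)
  have "\<bar>EE n p (%cf. tsum n (%i. A i cf * (fld n cf (i + o') - (\<Sum>t\<in>{..<w} \<times> {..<w}. 1 / (real w)^2 * fld n cf (i + (o' + (- s - int (fst t) - int (snd t))))))))\<bar>
   \<le> \<beta> * Dex n p + (real (2 * w))^2 / (\<beta> * (real n)^2) * EE n p (%cf. tsum n (%i. G i cf)) + real (2 * w) * EE n p (%cf. tsum n (%i. e i cf))"
    by (rule move_avg[OF _ _ tent_weights[OF w] _ \<beta>]) (use w J s in \<open>auto simp: subset_iff\<close>)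
  then show ?thesis unfolding t by simp
qed

end

lemma abs_mult_le1: fixes a b :: real shows "\<bar>a\<bar> \<le> 1 ==> \<bar>b\<bar> \<le> 1 ==> \<bar>a * b\<bar> \<le> 1"
  unfolding abs_mult using mult_mono[of "\<bar>a\<bar>" 1 "\<bar>b\<bar>" 1] by simp

lemma sq_mult_le1: fixes a b :: real shows "\<bar>b\<bar> \<le> 1 ==> (a * b)^2 \<le> a^2"
  unfolding power_mult_distrib using power_mono[of "\<bar>b\<bar>" 1 2] mult_left_mono[of "b^2" 1 "a^2"] by simp

lemma sq_add_le: fixes a b :: real shows "(a + b)^2 \<le> 2 * a^2 + 2 * b^2"
proof -
  have "0 \<le> (a - b)^2" by simp
  then show ?thesis by (simp add: power2_eq_square algebra_simps)
qed

section \<open>Replacing products of neighbouring spins by block averages\<close>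

locale pmfn =
  fixes n :: nat and p :: "conf => real" 
  assumes n2: "n \<ge> 2" and p0: "!!cf. cf \<in> Omega n ==> 0 \<le> p cf" and p1: "(\<Sum>cf\<in>Omega n. p cf) = 1"
begin

lemma npos: "n > 0" using n2 by simp

abbreviation "x cf \<equiv> fld n cf"

text \<open>The right spin is moved to the right, then the left one to the left. The bonds used
  avoid the sites of the other factor, and \<open>b\<close> is invariant under exchanges, so no
  variation of the prefactor arises.\<close>

lemma W2_moves:
  assumes w: "w > 0" "4 * w + 6 < n" and \<beta>: "\<beta> > 0" and k: "k = 1 \<or> k = 2"
    and b: "!!cf c. cf \<in> Omega n ==> b (exc n cf c) = b cf"
  shows "\<bar>EE n p (%cf. b cf * tsum n (%i. x cf i * x cf (i + k))) - EE n p (%cf. b cf * tsum n (%i. tentl w (x cf) i * tent w (x cf) (i + k)))\<bar>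
    \<le> 2 * (\<beta> * Dex n p + (2 * real w)^2 / (\<beta> * (real n)^2) * EE n p (%cf. real n * (b cf)^2))"
proof -
  let ?R = "\<beta> * Dex n p + (2 * real w)^2 / (\<beta> * (real n)^2) * EE n p (%cf. real n * (b cf)^2)"
  interpret m1: movable n p "%i cf. b cf * x cf i" "%i cf. (b cf)^2" "%i cf. 0" "{k..<k + 2 * int w}"
  proof
    fix i cf c assume e: "cf \<in> Omega n" and c: "c \<in> {k..<k + 2 * int w}"
    have "x (exc n cf (i + c)) (i + 0) = x cf (i + 0)" by (rule fld_exc_rel) (use c w k n2 in auto)
    then have eq: "x (exc n cf (i + c)) i = x cf i" by simp
    show "(b (exc n cf (i + c)) * x (exc n cf (i + c)) i)^2 \<le> (b cf)^2"
      unfolding eq b[OF e] by (rule sq_mult_le1) (simp add: fld_abs[OF e npos])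
    show "\<bar>b (exc n cf (i + c)) * x (exc n cf (i + c)) i - b cf * x cf i\<bar> \<le> 0" unfolding eq b[OF e] by simp
  qed (use n2 p0 in \<open>auto intro!: sq_mult_le1 simp: fld_abs npos\<close>)
  interpret m2: movable n p "%i cf. b cf * tent w (x cf) (i + k)" "%i cf. (b cf)^2" "%i cf. 0" "{0 - 2 * int w..<0}"
  proof
    fix i cf c assume e: "cf \<in> Omega n" and c: "c \<in> {0 - 2 * int w..<0}"
    have eq: "tent w (x (exc n cf (i + c))) (i + k) = tent w (x cf) (i + k)" by (rule tent_exc_rel) (use c w k n2 in auto)
    show "(b (exc n cf (i + c)) * tent w (x (exc n cf (i + c))) (i + k))^2 \<le> (b cf)^2"
      unfolding eq b[OF e] by (rule sq_mult_le1) (rule tent_fld_abs[OF e npos w(1)])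
    show "\<bar>b (exc n cf (i + c)) * tent w (x (exc n cf (i + c))) (i + k) - b cf * tent w (x cf) (i + k)\<bar> \<le> 0" unfolding eq b[OF e] by simp
  qed (use n2 p0 w in \<open>auto intro!: sq_mult_le1 tent_fld_abs npos\<close>)
  have g: "EE n p (%cf. tsum n (%i. (b cf)^2)) = EE n p (%cf. real n * (b cf)^2)" by (simp add: tsum_const)
  have 1: "\<bar>EE n p (%cf. tsum n (%i. b cf * x cf i * (x cf (i + k) - tent w (x cf) (i + k))))\<bar> \<le> ?R"
    using m1.move_tent[OF w(1) \<beta>, of k] unfolding g tsum_0 by (simp add: EE_def)
  have 2: "\<bar>EE n p (%cf. tsum n (%i. b cf * tent w (x cf) (i + k) * (x cf i - tentl w (x cf) i)))\<bar> \<le> ?R"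
    using m2.move_tentl[OF w(1) \<beta>, of 0 0] unfolding g tsum_0 by (simp add: EE_def)
  have "EE n p (%cf. b cf * tsum n (%i. x cf i * x cf (i + k))) - EE n p (%cf. b cf * tsum n (%i. tentl w (x cf) i * tent w (x cf) (i + k)))
    = EE n p (%cf. tsum n (%i. b cf * x cf i * (x cf (i + k) - tent w (x cf) (i + k))))
    + EE n p (%cf. tsum n (%i. b cf * tent w (x cf) (i + k) * (x cf i - tentl w (x cf) i)))"
    unfolding EE_add[symmetric] EE_diff[symmetric] tsum_add[symmetric] tsum_cmult[symmetric] tsum_diff[symmetric]
    by (simp add: algebra_simps)
  moreover have "\<bar>X1 + X2\<bar> \<le> 2 * R" if "\<bar>X1\<bar> \<le> R" "\<bar>X2\<bar> \<le> R" for X1 X2 R :: real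
    using that by linarith
  ultimately show ?thesis using 1 2 by presburger
qed

text \<open>Two scales. Both left spins go to the same left block of size \<open>l\<close>; the
  bonds crossed by the second one lie in that block, which changes under these exchanges, whence the
  term \<open>4 / l\<close>. The prefactor of the last move, at scale \<open>w\<close>, is
  \<open>b\<close> times a squared block average, so its cost retains this square instead of a
  constant.\<close>

lemma S3_moves:
  assumes w: "w > 0" and l: "l > 0" and wl: "4 * w + 4 * l + 8 < n" and \<beta>: "\<beta> > 0"
    and b: "!!cf c. cf \<in> Omega n ==> b (exc n cf c) = b cf"
  shows "\<bar>EE n p (%cf. b cf * tsum n (%i. x cf (i - 1) * x cf i * x cf (i + 1))) - EE n p (%cf. b cf * tsum n (%i. (tentl l (x cf) (i - 1))^2 * tent w (x cf) (i + 1)))\<bar>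
    \<le> 3 * \<beta> * Dex n p + 2 * ((2 * real l)^2 / (\<beta> * (real n)^2)) * EE n p (%cf. real n * (b cf)^2)
      + 4 / real l * EE n p (%cf. real n * \<bar>b cf\<bar>)
      + (2 * real w)^2 / (\<beta> * (real n)^2) * EE n p (%cf. (b cf)^2 * tsum n (%i. (tentl l (x cf) (i - 1))^2))"
proof -
  let ?t = "%cf i. tentl l (x cf) (i - 1)"
  have t: "?t cf i = tent l (x cf) (i + (1 - 2 * int l))" for cf i unfolding tentl_tent[OF l] by (simp add: algebra_simps)
  have tb: "\<bar>?t cf i\<bar> \<le> 1" if "cf \<in> Omega n" for cf i unfolding t by (rule tent_fld_abs[OF that npos l])
  interpret m1: movable n p "%i cf. b cf * (x cf i * x cf (i + 1))" "%i cf. (b cf)^2" "%i cf. 0" "{- 1 - 2 * int l..<- 1}"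
  proof
    fix i cf c assume e: "cf \<in> Omega n" and c: "c \<in> {- 1 - 2 * int l..<- 1}"
    have "x (exc n cf (i + c)) (i + 0) = x cf (i + 0)" by (rule fld_exc_rel) (use c wl n2 in auto)
    then have eq: "x (exc n cf (i + c)) i = x cf i" by simp
    have eq1: "x (exc n cf (i + c)) (i + 1) = x cf (i + 1)" by (rule fld_exc_rel) (use c wl n2 in auto)
    show "(b (exc n cf (i + c)) * (x (exc n cf (i + c)) i * x (exc n cf (i + c)) (i + 1)))^2 \<le> (b cf)^2"
      unfolding eq eq1 b[OF e] by (rule sq_mult_le1) (simp add: abs_mult fld_abs[OF e npos])
    show "\<bar>b (exc n cf (i + c)) * (x (exc n cf (i + c)) i * x (exc n cf (i + c)) (i + 1)) - b cf * (x cf i * x cf (i + 1))\<bar> \<le> 0"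
      unfolding eq eq1 b[OF e] by simp
  qed (use n2 p0 in \<open>auto intro!: sq_mult_le1 simp: abs_mult fld_abs npos\<close>)
  interpret m2: movable n p "%i cf. b cf * (?t cf i * x cf (i + 1))" "%i cf. (b cf)^2" "%i cf. \<bar>b cf\<bar> * (2 / (real l)^2)" "{0 - 2 * int l..<0}"
  proof
    fix i cf c assume e: "cf \<in> Omega n" and c: "c \<in> {0 - 2 * int l..<0}"
    have e': "exc n cf (i + c) \<in> Omega n" by (rule exc_Omega[OF e npos])
    have eq1: "x (exc n cf (i + c)) (i + 1) = x cf (i + 1)" by (rule fld_exc_rel) (use c wl n2 in auto)
    show "(b (exc n cf (i + c)) * (?t (exc n cf (i + c)) i * x (exc n cf (i + c)) (i + 1)))^2 \<le> (b cf)^2"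
      unfolding b[OF e] by (rule sq_mult_le1) (simp add: abs_mult fld_abs[OF e' npos] tb[OF e'])
    have d: "\<bar>?t (exc n cf (i + c)) i - ?t cf i\<bar> \<le> 2 / (real l)^2"
      unfolding t by (rule tent_exc[OF e n2 l]) (use wl in simp)
    have "\<bar>b (exc n cf (i + c)) * (?t (exc n cf (i + c)) i * x (exc n cf (i + c)) (i + 1)) - b cf * (?t cf i * x cf (i + 1))\<bar>
       = \<bar>b cf\<bar> * (\<bar>?t (exc n cf (i + c)) i - ?t cf i\<bar> * \<bar>x cf (i + 1)\<bar>)"
      unfolding eq1 b[OF e] abs_mult[symmetric] by (simp add: algebra_simps)
    also have "... \<le> \<bar>b cf\<bar> * (2 / (real l)^2)" using d by (intro mult_left_mono) (simp_all add: fld_abs[OF e npos])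
    finally show "\<bar>b (exc n cf (i + c)) * (?t (exc n cf (i + c)) i * x (exc n cf (i + c)) (i + 1)) - b cf * (?t cf i * x cf (i + 1))\<bar> \<le> \<bar>b cf\<bar> * (2 / (real l)^2)" .
  qed (use n2 p0 in \<open>auto intro!: sq_mult_le1 simp: abs_mult fld_abs npos tb\<close>)
  interpret m3: movable n p "%i cf. b cf * (?t cf i)^2" "%i cf. (b cf)^2 * (?t cf i)^2" "%i cf. 0" "{1..<1 + 2 * int w}"
  proof
    fix i cf c assume e: "cf \<in> Omega n" and c: "c \<in> {1..<1 + 2 * int w}"
    have eq: "?t (exc n cf (i + c)) i = ?t cf i" unfolding t by (rule tent_exc_rel) (use c wl l n2 in auto)
    show "\<bar>b (exc n cf (i + c)) * (?t (exc n cf (i + c)) i)^2 - b cf * (?t cf i)^2\<bar> \<le> 0"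
      unfolding eq b[OF e] by simp
    have "(b cf * ?t cf i * ?t cf i)^2 \<le> (b cf * ?t cf i)^2" by (rule sq_mult_le1[OF tb[OF e]])
    then show "(b (exc n cf (i + c)) * (?t (exc n cf (i + c)) i)^2)^2 \<le> (b cf)^2 * (?t cf i)^2"
      unfolding eq b[OF e] by (simp add: power2_eq_square mult_ac)
  next
    fix i cf assume e: "cf \<in> Omega n"
    have "(b cf * ?t cf i * ?t cf i)^2 \<le> (b cf * ?t cf i)^2" by (rule sq_mult_le1[OF tb[OF e]])
    then show "(b cf * (?t cf i)^2)^2 \<le> (b cf)^2 * (?t cf i)^2"
      by (simp add: power2_eq_square mult_ac)
  qed (use n2 p0 in auto)
  define X1 where "X1 = EE n p (%cf. tsum n (%i. b cf * (x cf i * x cf (i + 1)) * (x cf (i - 1) - ?t cf i)))"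
  define X2 where "X2 = EE n p (%cf. tsum n (%i. b cf * (?t cf i * x cf (i + 1)) * (x cf i - ?t cf i)))"
  define X3 where "X3 = EE n p (%cf. tsum n (%i. b cf * (?t cf i)^2 * (x cf (i + 1) - tent w (x cf) (i + 1))))"
  define Cl where "Cl = (2 * real l)^2 / (\<beta> * (real n)^2)"
  define E2 where "E2 = EE n p (%cf. real n * (b cf)^2)"
  have g: "EE n p (%cf. tsum n (%i. (b cf)^2)) = E2" by (simp add: tsum_const E2_def)
  have g2: "2 * real l * EE n p (%cf. tsum n (%i. \<bar>b cf\<bar> * (2 / (real l)^2))) = 4 / real l * EE n p (%cf. real n * \<bar>b cf\<bar>)"
  proof -
    have "EE n p (%cf. tsum n (%i. \<bar>b cf\<bar> * (2 / (real l)^2))) = (2 / (real l)^2) * EE n p (%cf. real n * \<bar>b cf\<bar>)"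
      unfolding tsum_const EE_cmult[symmetric] by (simp add: mult_ac)
    then show ?thesis using l by (simp add: power2_eq_square)
  qed
  have g3: "EE n p (%cf. tsum n (%i. (0::real))) = 0" by (simp add: EE_def tsum_0)
  have 1: "\<bar>X1\<bar> \<le> \<beta> * Dex n p + Cl * E2"
    using m1.move_tentl[OF l \<beta>, of "-1" 0] unfolding g g3 X1_def Cl_def by simp
  have 2: "\<bar>X2\<bar> \<le> \<beta> * Dex n p + Cl * E2 + 4 / real l * EE n p (%cf. real n * \<bar>b cf\<bar>)"
    using m2.move_tentl[OF l \<beta>, of 0 1] unfolding g g2 X2_def Cl_def by simp
  have 3: "\<bar>X3\<bar> \<le> \<beta> * Dex n p + (2 * real w)^2 / (\<beta> * (real n)^2) * EE n p (%cf. (b cf)^2 * tsum n (%i. (?t cf i)^2))"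
    using m3.move_tent[OF w \<beta>, of 1] unfolding g3 X3_def tsum_cmult by simp
  have "EE n p (%cf. b cf * tsum n (%i. x cf (i - 1) * x cf i * x cf (i + 1))) - EE n p (%cf. b cf * tsum n (%i. (?t cf i)^2 * tent w (x cf) (i + 1)))
    = X1 + X2 + X3"
    unfolding X1_def X2_def X3_def EE_add[symmetric] EE_diff[symmetric] tsum_add[symmetric] tsum_cmult[symmetric] tsum_diff[symmetric]
    by (simp add: algebra_simps power2_eq_square)
  then have "\<bar>EE n p (%cf. b cf * tsum n (%i. x cf (i - 1) * x cf i * x cf (i + 1))) - EE n p (%cf. b cf * tsum n (%i. (?t cf i)^2 * tent w (x cf) (i + 1)))\<bar>
     \<le> \<bar>X1\<bar> + \<bar>X2\<bar> + \<bar>X3\<bar>" by linarith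
  then show ?thesis using 1 2 3 unfolding Cl_def E2_def by linarith
qed

text \<open>Here the field \<open>Z\<close> itself varies under exchanges, by at most
  \<open>C\<close>, and the last move, that of the middle spin, crosses the right-hand block. All
  three moves use the same scale \<open>w\<close>; for the fields of the quadratic functionals the
  resulting additive errors are of order one (\<open>Z_est\<close>).\<close>

lemma Z_moves:
  assumes w: "w > 0" "4 * w + 6 < n" and \<beta>: "\<beta> > 0" 
    and Z1: "!!cf i. cf \<in> Omega n ==> \<bar>Z cf i\<bar> \<le> B"
    and Z2: "!!cf i c. cf \<in> Omega n ==> \<bar>Z (exc n cf c) i - Z cf i\<bar> \<le> C"
  shows "\<bar>EE n p (%cf. cub n (x cf) (Z cf)) - EE n p (%cf. tsum n (%i. tentl w (x cf) (i - 1) * tent w (x cf) i * tent w (x cf) (i + 1) * Z cf i))\<bar>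
    \<le> 3 * \<beta> * Dex n p + 3 * ((2 * real w)^2 / (\<beta> * (real n)^2)) * EE n p (%cf. 2 * tsum n (%i. (Z cf i)^2) + 2 * real n * C^2)
      + 6 * real w * real n * (C + 4 * B / (real w)^2)"
proof -
  let ?l = "%cf i. tentl w (x cf) (i - 1)" and ?r = "%cf i. tent w (x cf) (i + 1)"
  have t: "?l cf i = tent w (x cf) (i + (1 - 2 * int w))" for cf i unfolding tentl_tent[OF w(1)] by (simp add: algebra_simps)
  have tb: "\<bar>?l cf i\<bar> \<le> 1" if "cf \<in> Omega n" for cf i unfolding t by (rule tent_fld_abs[OF that npos w(1)])
  have rb: "\<bar>?r cf i\<bar> \<le> 1" if "cf \<in> Omega n" for cf i by (rule tent_fld_abs[OF that npos w(1)])
  have xb: "\<bar>x cf i\<bar> \<le> 1" if "cf \<in> Omega n" for cf i using fld_abs[OF that npos] by simp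
  have wn: "w \<le> n" using w by simp
  have td: "\<bar>?l (exc n cf c) i - ?l cf i\<bar> \<le> 2 / (real w)^2" "\<bar>?r (exc n cf c) i - ?r cf i\<bar> \<le> 2 / (real w)^2" if "cf \<in> Omega n" for cf i c
    unfolding t by (rule tent_exc[OF that n2 w(1) wn])+
  let ?e = "C + 4 * B / (real w)^2"
  let ?G = "%i cf. 2 * (Z cf i)^2 + 2 * C^2"
  obtain cf0 where e0: "cf0 \<in> Omega n" using Omega_ne by blast
  have B0: "B \<ge> 0" using Z1[OF e0, of 0] by linarith
  have C0: "C \<ge> 0" using Z2[OF e0, of 0 0] by linarith
  have ZG: "(v * Z cf i)^2 \<le> ?G i cf" if "\<bar>v\<bar> \<le> 1" for v cf i
  proof -
    have "(v * Z cf i)^2 \<le> (Z cf i)^2" using sq_mult_le1[OF that, of "Z cf i"] by (simp add: mult.commute)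
    then show ?thesis using zero_le_power2[of "Z cf i"] zero_le_power2[of C] by linarith
  qed
  have ZG': "(v * Z (exc n cf c) i)^2 \<le> ?G i cf" if "\<bar>v\<bar> \<le> 1" "cf \<in> Omega n" for v cf i c
  proof -
    have "(v * Z (exc n cf c) i)^2 \<le> (Z (exc n cf c) i)^2" using sq_mult_le1[OF that(1), of "Z (exc n cf c) i"] by (simp add: mult.commute)
    also have "... = (Z cf i + (Z (exc n cf c) i - Z cf i))^2" by simp
    also have "... \<le> 2 * (Z cf i)^2 + 2 * (Z (exc n cf c) i - Z cf i)^2"
      by (rule sq_add_le)
    also have "(Z (exc n cf c) i - Z cf i)^2 \<le> C^2" using power_mono[OF Z2[OF that(2), of c i], of 2] by simp
    finally show ?thesis by simp
  qed
  have Zd: "\<bar>v' * Z (exc n cf c) i - v * Z cf i\<bar> \<le> ?e" if "\<bar>v' - v\<bar> \<le> 4 / (real w)^2" "\<bar>v'\<bar> \<le> 1" "cf \<in> Omega n" for v v' cf i c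
  proof -
    have "v' * Z (exc n cf c) i - v * Z cf i = v' * (Z (exc n cf c) i - Z cf i) + (v' - v) * Z cf i" by (simp add: algebra_simps)
    moreover have "\<bar>v' * (Z (exc n cf c) i - Z cf i)\<bar> \<le> 1 * C" unfolding abs_mult by (rule mult_mono[OF that(2) Z2[OF that(3)]]) auto
    moreover have "\<bar>(v' - v) * Z cf i\<bar> \<le> 4 / (real w)^2 * B" unfolding abs_mult by (rule mult_mono[OF that(1) Z1[OF that(3)]]) auto
    ultimately show ?thesis by (simp add: mult.commute)
  qed
  have ed0: "0 \<le> ?e" using B0 C0 by simp
  have pd: "\<bar>u' * v' - u * v\<bar> \<le> \<bar>u' - u\<bar> + \<bar>v' - v\<bar>" if "\<bar>u'\<bar> \<le> 1" "\<bar>v\<bar> \<le> 1" for u u' v v' :: real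
  proof -
    have eq: "u' * v' - u * v = u' * (v' - v) + (u' - u) * v" by (simp add: algebra_simps)
    have 1: "\<bar>u' * (v' - v)\<bar> \<le> 1 * \<bar>v' - v\<bar>" unfolding abs_mult by (rule mult_right_mono[OF that(1)]) simp
    have 2: "\<bar>(u' - u) * v\<bar> \<le> \<bar>u' - u\<bar> * 1" unfolding abs_mult by (rule mult_left_mono[OF that(2)]) simp
    have "\<bar>u' * v' - u * v\<bar> \<le> 1 * \<bar>v' - v\<bar> + \<bar>u' - u\<bar> * 1"
      unfolding eq by (rule order_trans[OF abs_triangle_ineq add_mono[OF 1 2]])
    then show ?thesis by simp
  qed
  have w4: "0 \<le> 2 / (real w)^2" "2 / (real w)^2 + 2 / (real w)^2 = 4 / (real w)^2" by simp_all
  interpret m1: movable n p "%i cf. (x cf (i - 1) * x cf i) * Z cf i" ?G "%i cf. ?e" "{1..<1 + 2 * int w}"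
  proof
    fix i cf c assume e: "cf \<in> Omega n" and c: "c \<in> {1..<1 + 2 * int w}"
    have "x (exc n cf (i + c)) (i + 0) = x cf (i + 0)" by (rule fld_exc_rel) (use c w n2 in auto)
    then have eq: "x (exc n cf (i + c)) i = x cf i" by simp
    have "x (exc n cf (i + c)) (i + (-1)) = x cf (i + (-1))" by (rule fld_exc_rel) (use c w n2 in auto)
    then have eq1: "x (exc n cf (i + c)) (i - 1) = x cf (i - 1)" by simp
    show "(x (exc n cf (i + c)) (i - 1) * x (exc n cf (i + c)) i * Z (exc n cf (i + c)) i)^2 \<le> ?G i cf"
      unfolding eq eq1 by (rule ZG'[OF abs_mult_le1[OF xb[OF e] xb[OF e]] e])
    show "\<bar>x (exc n cf (i + c)) (i - 1) * x (exc n cf (i + c)) i * Z (exc n cf (i + c)) i - x cf (i - 1) * x cf i * Z cf i\<bar> \<le> ?e"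
      unfolding eq eq1 by (rule Zd[OF _ abs_mult_le1[OF xb[OF e] xb[OF e]] e]) simp
  next
    fix i cf assume e: "cf \<in> Omega n"
    show "(x cf (i - 1) * x cf i * Z cf i)^2 \<le> ?G i cf" by (rule ZG[OF abs_mult_le1[OF xb[OF e] xb[OF e]]])
  qed (use n2 p0 ed0 in auto)
  interpret m2: movable n p "%i cf. (?r cf i * x cf i) * Z cf i" ?G "%i cf. ?e" "{- 1 - 2 * int w..<- 1}"
  proof
    fix i cf c assume e: "cf \<in> Omega n" and c: "c \<in> {- 1 - 2 * int w..<- 1}"
    have e': "exc n cf (i + c) \<in> Omega n" by (rule exc_Omega[OF e npos])
    have "x (exc n cf (i + c)) (i + 0) = x cf (i + 0)" by (rule fld_exc_rel) (use c w n2 in auto)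
    then have eq: "x (exc n cf (i + c)) i = x cf i" by simp
    show "(?r (exc n cf (i + c)) i * x (exc n cf (i + c)) i * Z (exc n cf (i + c)) i)^2 \<le> ?G i cf"
      by (rule ZG'[OF abs_mult_le1[OF rb[OF e'] xb[OF e']] e])
    have "\<bar>?r (exc n cf (i + c)) i * x (exc n cf (i + c)) i - ?r cf i * x cf i\<bar> \<le> 4 / (real w)^2"
      using pd[OF rb[OF e', of i] xb[OF e, of i], of "x (exc n cf (i + c)) i" "?r cf i"] td(2)[OF e, of "i + c" i] w4 unfolding eq by linarith
    then show "\<bar>?r (exc n cf (i + c)) i * x (exc n cf (i + c)) i * Z (exc n cf (i + c)) i - ?r cf i * x cf i * Z cf i\<bar> \<le> ?e"
      by (rule Zd[OF _ abs_mult_le1[OF rb[OF e'] xb[OF e']] e])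
  next
    fix i cf assume e: "cf \<in> Omega n"
    show "(?r cf i * x cf i * Z cf i)^2 \<le> ?G i cf" by (rule ZG[OF abs_mult_le1[OF rb[OF e] xb[OF e]]])
  qed (use n2 p0 ed0 in auto)
  interpret m3: movable n p "%i cf. (?r cf i * ?l cf i) * Z cf i" ?G "%i cf. ?e" "{0..<0 + 2 * int w}"
  proof
    fix i cf c assume e: "cf \<in> Omega n" and c: "c \<in> {0..<0 + 2 * int w}"
    have e': "exc n cf (i + c) \<in> Omega n" by (rule exc_Omega[OF e npos])
    show "(?r (exc n cf (i + c)) i * ?l (exc n cf (i + c)) i * Z (exc n cf (i + c)) i)^2 \<le> ?G i cf"
      by (rule ZG'[OF abs_mult_le1[OF rb[OF e'] tb[OF e']] e])
    have "\<bar>?r (exc n cf (i + c)) i * ?l (exc n cf (i + c)) i - ?r cf i * ?l cf i\<bar> \<le> 4 / (real w)^2"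
      using pd[OF rb[OF e', of i] tb[OF e, of i], of "?l (exc n cf (i + c)) i" "?r cf i"] td[OF e, of "i + c" i] w4 by linarith
    then show "\<bar>?r (exc n cf (i + c)) i * ?l (exc n cf (i + c)) i * Z (exc n cf (i + c)) i - ?r cf i * ?l cf i * Z cf i\<bar> \<le> ?e"
      by (rule Zd[OF _ abs_mult_le1[OF rb[OF e'] tb[OF e']] e])
  next
    fix i cf assume e: "cf \<in> Omega n"
    show "(?r cf i * ?l cf i * Z cf i)^2 \<le> ?G i cf" by (rule ZG[OF abs_mult_le1[OF rb[OF e] tb[OF e]]])
  qed (use n2 p0 ed0 in auto)
  define X1 where "X1 = EE n p (%cf. tsum n (%i. (x cf (i - 1) * x cf i) * Z cf i * (x cf (i + 1) - ?r cf i)))"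
  define X2 where "X2 = EE n p (%cf. tsum n (%i. (?r cf i * x cf i) * Z cf i * (x cf (i - 1) - ?l cf i)))"
  define X3 where "X3 = EE n p (%cf. tsum n (%i. (?r cf i * ?l cf i) * Z cf i * (x cf i - tent w (x cf) i)))"
  define R where "R = \<beta> * Dex n p + (2 * real w)^2 / (\<beta> * (real n)^2) * EE n p (%cf. 2 * tsum n (%i. (Z cf i)^2) + 2 * real n * C^2) + 2 * real w * (real n * ?e)"
  have g: "EE n p (%cf. tsum n (%i. ?G i cf)) = EE n p (%cf. 2 * tsum n (%i. (Z cf i)^2) + 2 * real n * C^2)"
    by (simp add: tsum_add tsum_cmult tsum_const mult_ac)
  have g2: "EE n p (%cf. tsum n (%i. ?e)) = real n * ?e" unfolding tsum_const by (rule EE_const[OF p1])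
  have 1: "\<bar>X1\<bar> \<le> R"
    using m1.move_tent[OF w(1) \<beta>, of 1] unfolding g g2 X1_def R_def by simp
  have 2: "\<bar>X2\<bar> \<le> R"
    using m2.move_tentl[OF w(1) \<beta>, of "-1" 0] unfolding g g2 X2_def R_def by simp
  have 3: "\<bar>X3\<bar> \<le> R"
    using m3.move_tent[OF w(1) \<beta>, of 0] unfolding g g2 X3_def R_def by simp
  have "EE n p (%cf. cub n (x cf) (Z cf)) - EE n p (%cf. tsum n (%i. ?l cf i * tent w (x cf) i * ?r cf i * Z cf i)) = X1 + X2 + X3"
    unfolding X1_def X2_def X3_def cub_def EE_add[symmetric] EE_diff[symmetric] tsum_add[symmetric] tsum_diff[symmetric]
    by (simp add: algebra_simps)
  then have "\<bar>EE n p (%cf. cub n (x cf) (Z cf)) - EE n p (%cf. tsum n (%i. ?l cf i * tent w (x cf) i * ?r cf i * Z cf i))\<bar> \<le> 3 * R"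
    using 1 2 3 by linarith
  then show ?thesis unfolding R_def by (simp add: algebra_simps)
qed

end

section \<open>Entropy production\<close>

text \<open>Dirichlet form of the square root of the density with respect to the weight \<open>exp U\<close>, which is not reversible for the rates.\<close>

definition DG :: "real => nat => (conf => real) => (conf => real) => real" where
  "DG g n U p = tsum n (%i. \<Sum>cf\<in>Omega n. crate g (fld n cf) i *
     (sqrt (p (flp n cf i)) * exp ((U cf - U (flp n cf i)) / 2) - sqrt (p cf))^2)"

text \<open>The adjoint of the flip part with respect to the weight \<open>exp U\<close>, applied to
  the constant 1; it vanishes when this weight is invariant for the flips.\<close>

definition Afun :: "real => nat => (conf => real) => conf => real" where
  "Afun g n U cf = tsum n (%i. crate g (fld n (flp n cf i)) i * exp (U (flp n cf i) - U cf) - crate g (fld n cf) i)"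

lemma EE_gen_L: "EE n p (gen_L a vt n f) = (real n)^2 * tsum n (%b. \<Sum>cf\<in>Omega n. p cf * (f (exc n cf b) - f cf))
   + a * tsum n (%i. \<Sum>cf\<in>Omega n. p cf * (crate (gam vt n) (fld n cf) i * (f (flp n cf i) - f cf)))"
  unfolding gen_L_tsum EE_add EE_cmult EE_tsum unfolding EE_def ..

text \<open>\<open>ln z <= z - 1\<close> at \<open>z = Q / sqrt P\<close>; passing through square
  roots retains the square that becomes the Dirichlet form.\<close>

lemma log_ineq: fixes P Q :: real assumes "P > 0" "Q > 0"
  shows "P * (ln (Q^2) - ln P) \<le> Q^2 - P - (Q - sqrt P)^2"
proof -
  define u where "u = sqrt P"
  have u: "u > 0" "P = u^2" using assms by (auto simp: u_def)
  have "ln (Q / u) \<le> Q / u - 1" using assms u by (intro ln_le_minus_one) simp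
  moreover have "ln (Q / u) = ln Q - ln u" using assms u by (simp add: ln_div)
  moreover have "ln (Q^2) - ln P = 2 * (ln Q - ln u)" using assms u by (simp add: ln_realpow)
  ultimately have "ln (Q^2) - ln P = 2 * ln (Q / u)" "ln (Q / u) \<le> Q / u - 1" by auto
  then have "ln (Q^2) - ln P \<le> 2 * (Q / u - 1)" by simp
  then have "P * (ln (Q^2) - ln P) \<le> P * (2 * (Q / u - 1))" using assms by (intro mult_left_mono) auto
  also have "... = 2 * u * Q - 2 * u^2" using u by (simp add: power2_eq_square field_simps)
  also have "... = Q^2 - P - (Q - u)^2" unfolding u(2) by (simp add: power2_eq_square algebra_simps)
  finally show ?thesis unfolding u_def .
qed

text \<open>\<open>log_ineq\<close> is applied with \<open>Q\<close> the square root of the tilted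
  mass of the target configuration. Exchanges preserve counting measure and \<open>U\<close>, so
  they leave only dissipation; for the flips a change of variables turns the remaining first-order
  terms into \<open>Afun\<close>.\<close>

lemma entropy_production:
  assumes n: "n \<ge> 2" and p: "!!cf. cf \<in> Omega n ==> 0 < p cf" and a: "a \<ge> 0" and g: "0 \<le> gam vt n" "gam vt n \<le> 1"
    and U: "!!cf b. cf \<in> Omega n ==> U (exc n cf b) = U cf"
  shows "EE n p (gen_L a vt n (%cf. ln (p cf) - U cf)) \<le> - Dex n p - a * DG (gam vt n) n U p + a * EE n p (Afun (gam vt n) n U)"
proof -
  have n0: "n > 0" using n by simp
  let ?f = "%cf. ln (p cf) - U cf"
  let ?c = "%cf i. crate (gam vt n) (fld n cf) i"
  have ex: "(\<Sum>cf\<in>Omega n. p cf * (?f (exc n cf b) - ?f cf)) \<le> - dex n p b" for b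
  proof -
    have "(\<Sum>cf\<in>Omega n. p cf * (?f (exc n cf b) - ?f cf)) \<le> (\<Sum>cf\<in>Omega n. p (exc n cf b) - p cf - (sqrt (p (exc n cf b)) - sqrt (p cf))^2)"
    proof (rule sum_mono)
      fix cf assume e: "cf \<in> Omega n"
      have "p (exc n cf b) > 0" using p exc_Omega[OF e n0] by blast
      then show "p cf * (?f (exc n cf b) - ?f cf) \<le> p (exc n cf b) - p cf - (sqrt (p (exc n cf b)) - sqrt (p cf))^2"
        using log_ineq[OF p[OF e], of "sqrt (p (exc n cf b))"] U[OF e, of b] by simp
    qed
    then show ?thesis using sum_exc[OF n0, of p b] by (simp add: sum_subtractf dex_def)
  qed
  have fl: "(\<Sum>cf\<in>Omega n. p cf * (?c cf i * (?f (flp n cf i) - ?f cf))) \<le>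
     - (\<Sum>cf\<in>Omega n. ?c cf i * (sqrt (p (flp n cf i)) * exp ((U cf - U (flp n cf i)) / 2) - sqrt (p cf))^2)
     + EE n p (%cf. ?c (flp n cf i) i * exp (U (flp n cf i) - U cf) - ?c cf i)" for i
  proof -
    have "(\<Sum>cf\<in>Omega n. p cf * (?c cf i * (?f (flp n cf i) - ?f cf))) \<le> 
      (\<Sum>cf\<in>Omega n. ?c cf i * (p (flp n cf i) * exp (U cf - U (flp n cf i))) - ?c cf i * p cf 
         - ?c cf i * (sqrt (p (flp n cf i)) * exp ((U cf - U (flp n cf i)) / 2) - sqrt (p cf))^2)"
    proof (rule sum_mono)
      fix cf assume e: "cf \<in> Omega n"
      have pf: "p (flp n cf i) > 0" using p flp_Omega[OF e n0] by blast
      define Q where "Q = sqrt (p (flp n cf i)) * exp ((U cf - U (flp n cf i)) / 2)"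
      have Q: "Q > 0" using pf by (simp add: Q_def)
      have Q2: "Q^2 = p (flp n cf i) * exp (U cf - U (flp n cf i))"
        using pf by (simp add: Q_def power_mult_distrib power2_eq_square[of "exp _"] flip: exp_add)
      have "ln (Q^2) = ln (p (flp n cf i)) + (U cf - U (flp n cf i))" unfolding Q2 using pf by (simp add: ln_mult)
      then have eq: "?f (flp n cf i) - ?f cf = ln (Q^2) - ln (p cf)" by simp
      have "p cf * (?f (flp n cf i) - ?f cf) \<le> Q^2 - p cf - (Q - sqrt (p cf))^2"
        unfolding eq by (rule log_ineq[OF p[OF e] Q])
      then have "?c cf i * (p cf * (?f (flp n cf i) - ?f cf)) \<le> ?c cf i * (Q^2 - p cf - (Q - sqrt (p cf))^2)"
        using crate_bounds[OF e n0 g] by (intro mult_left_mono) auto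
      then show "p cf * (?c cf i * (?f (flp n cf i) - ?f cf)) \<le> ?c cf i * (p (flp n cf i) * exp (U cf - U (flp n cf i))) - ?c cf i * p cf 
         - ?c cf i * (sqrt (p (flp n cf i)) * exp ((U cf - U (flp n cf i)) / 2) - sqrt (p cf))^2"
        unfolding Q2 unfolding Q_def by (simp add: right_diff_distrib mult.left_commute)
    qed
    also have "... = (\<Sum>cf\<in>Omega n. ?c cf i * (p (flp n cf i) * exp (U cf - U (flp n cf i)))) - (\<Sum>cf\<in>Omega n. ?c cf i * p cf)
       - (\<Sum>cf\<in>Omega n. ?c cf i * (sqrt (p (flp n cf i)) * exp ((U cf - U (flp n cf i)) / 2) - sqrt (p cf))^2)"
      by (simp add: sum_subtractf)
    also have "(\<Sum>cf\<in>Omega n. ?c cf i * (p (flp n cf i) * exp (U cf - U (flp n cf i))))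
       = (\<Sum>cf\<in>Omega n. p cf * (?c (flp n cf i) i * exp (U (flp n cf i) - U cf)))"
      unfolding sum_flp[OF n0, of "%cf. ?c cf i * (p (flp n cf i) * exp (U cf - U (flp n cf i)))" i, symmetric]
      by (rule sum.cong) (simp_all add: flp_flp n0)
    finally show ?thesis unfolding EE_def right_diff_distrib sum_subtractf by (simp add: mult.commute)
  qed
  have "EE n p (gen_L a vt n ?f) \<le> (real n)^2 * tsum n (%b. - dex n p b) + a * tsum n (%i. - (\<Sum>cf\<in>Omega n. ?c cf i * (sqrt (p (flp n cf i)) * exp ((U cf - U (flp n cf i)) / 2) - sqrt (p cf))^2)
     + EE n p (%cf. ?c (flp n cf i) i * exp (U (flp n cf i) - U cf) - ?c cf i))"
    unfolding EE_gen_L by (intro add_mono mult_left_mono tsum_mono ex fl a) auto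
  also have "... = - Dex n p - a * DG (gam vt n) n U p + a * EE n p (Afun (gam vt n) n U)"
    unfolding Dex_def DG_def Afun_def[abs_def] EE_tsum tsum_add tsum_uminus by (simp add: algebra_simps)
  finally show ?thesis .
qed

section \<open>The Curie--Weiss weight and the quadratic functionals\<close>

lemma exp2_le: "exp (2::real) \<le> 8"
proof -
  have "exp (2::real) = exp 1 * exp 1" by (simp flip: exp_add)
  also have "... \<le> 2.8 * 2.8" using e_less_272 by (intro mult_mono) auto
  finally show ?thesis by simp
qed

text \<open>The leading terms of \<open>cosh (2 * m) - 1\<close> and of
  \<open>m * sinh (2 * m)\<close> are both \<open>2 * m^2\<close>; the explicit remainders let them
  cancel up to \<open>m^4\<close> in \<open>Afun_le\<close>.\<close>

lemma cosh_sinh_bounds: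
  fixes m :: real assumes m: "\<bar>m\<bar> \<le> 1"
  shows "cosh (2 * m) - 1 \<le> 2 * m^2 + 6 * m^4" "0 \<le> cosh (2 * m) - 1" "cosh (2 * m) - 1 \<le> 8 * m^2"
    "2 * m^2 \<le> m * sinh (2 * m)" "\<bar>sinh (2 * m)\<bar> \<le> 16 * \<bar>m\<bar>"
proof -
  have e8: "exp t \<le> 8" if "\<bar>t\<bar> \<le> \<bar>2 * m\<bar>" for t :: real
    using exp2_le that m by (smt (verit) exp_le_cancel_iff)
  obtain t1 where t1: "\<bar>t1\<bar> \<le> \<bar>2 * m\<bar>" "exp (2 * m) = (\<Sum>k<4. (2 * m) ^ k / fact k) + exp t1 / fact 4 * (2 * m) ^ 4"
    using Maclaurin_exp_le[of "2 * m" 4] by blast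
  obtain t2 where t2: "\<bar>t2\<bar> \<le> \<bar>- 2 * m\<bar>" "exp (- 2 * m) = (\<Sum>k<4. (- 2 * m) ^ k / fact k) + exp t2 / fact 4 * (- 2 * m) ^ 4"
    using Maclaurin_exp_le[of "- 2 * m" 4] by blast
  have "cosh (2 * m) = 1 + 2 * m^2 + (exp t1 + exp t2) / 3 * m ^ 4"
    unfolding cosh_def using t1(2) t2(2) by (simp add: numeral_eq_Suc power2_eq_square field_simps fact_numeral)
  moreover have "(exp t1 + exp t2) / 3 * m ^ 4 \<le> 6 * m ^ 4"
    using e8[of t1] e8[of t2] t1(1) t2(1) by (intro mult_right_mono) auto
  ultimately show 1: "cosh (2 * m) - 1 \<le> 2 * m^2 + 6 * m^4" by simp
  show "0 \<le> cosh (2 * m) - 1" using cosh_real_ge_1[of "2 * m"] by simp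
  have "m ^ 4 \<le> m^2" using power_mono[OF m, of 2] mult_left_mono[of "m^2" 1 "m^2"] by (simp add: power2_eq_square power4_eq_xxxx mult.assoc)
  then show "cosh (2 * m) - 1 \<le> 8 * m^2" using 1 by simp
  have s: "t \<le> sinh t" if "0 \<le> t" for t :: real using real_le_x_sinh[OF that] by (simp add: sinh_def exp_minus)
  show "2 * m^2 \<le> m * sinh (2 * m)"
  proof (cases "m \<ge> 0")
    case True then show ?thesis using s[of "2 * m"] mult_left_mono[of "2 * m" "sinh (2 * m)" m] by (simp add: power2_eq_square)
  next
    case False then show ?thesis using s[of "- 2 * m"] mult_left_mono[of "- 2 * m" "- sinh (2 * m)" "- m"] by (simp add: power2_eq_square)
  qed
  obtain t3 where t3: "\<bar>t3\<bar> \<le> \<bar>2 * m\<bar>" "exp (2 * m) = (\<Sum>k<1. (2 * m) ^ k / fact k) + exp t3 / fact 1 * (2 * m) ^ 1"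
    using Maclaurin_exp_le[of "2 * m" 1] by blast
  obtain t4 where t4: "\<bar>t4\<bar> \<le> \<bar>- 2 * m\<bar>" "exp (- 2 * m) = (\<Sum>k<1. (- 2 * m) ^ k / fact k) + exp t4 / fact 1 * (- 2 * m) ^ 1"
    using Maclaurin_exp_le[of "- 2 * m" 1] by blast
  have "2 * sinh (2 * m) = (exp t3 + exp t4) * (2 * m)" unfolding sinh_def using t3(2) t4(2) by (simp add: algebra_simps)
  then have eq: "sinh (2 * m) = (exp t3 + exp t4) * m" by simp
  show "\<bar>sinh (2 * m)\<bar> \<le> 16 * \<bar>m\<bar>" unfolding eq abs_mult using e8[of t3] e8[of t4] t3(1) t4(1) by (intro mult_right_mono) auto
qed

section \<open>The entropy production error of the Curie--Weiss weight\<close>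

definition UU :: "nat => conf => real" where
  "UU n cf = real n * (mg n (fld n cf))^2 / 2"

lemma mg_flp: assumes "n > 0" "cf \<in> Omega n" shows "mg n (fld n (flp n cf i)) = mg n (fld n cf) - 2 * fld n cf i / real n"
proof -
  have "cv n (%_. 1) (fld n (flp n cf i)) 0 = cv n (%_. 1) (fld n cf) 0 + (- 2 * fld n cf i) * 1"
    using cv_single[OF per_const per_fld assms(1) fld_flp[OF assms]] by simp
  then show ?thesis unfolding cv_const mg_def by (simp add: diff_divide_distrib)
qed

lemma mg_abs: assumes "cf \<in> Omega n" "n > 0" shows "\<bar>mg n (fld n cf)\<bar> \<le> 1"
proof -
  have "\<bar>tsum n (fld n cf)\<bar> \<le> tsum n (%i. 1)"
    by (rule order_trans[OF tsum_abs_le], rule tsum_mono) (simp add: fld_abs[OF assms])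
  then show ?thesis unfolding mg_def using assms(2) by (simp add: tsum_const)
qed

lemma UU_flp: assumes "n > 0" "cf \<in> Omega n"
  shows "UU n (flp n cf i) - UU n cf = - 2 * fld n cf i * mg n (fld n cf) + 2 / real n"
proof -
  have "(fld n cf i)^2 = 1" using fld_sq[OF assms(2,1)] .
  then show ?thesis unfolding UU_def mg_flp[OF assms] using assms(1)
    by (simp add: power2_diff power_divide field_simps power2_eq_square[of "real n"])
qed

lemma UU_exc: "n \<ge> 2 ==> UU n (exc n cf c) = UU n cf"
  unfolding UU_def by (simp add: mg_exc)

lemma fld_flp_nb: assumes "n \<ge> 3" "cf \<in> Omega n"
  shows "fld n (flp n cf i) i = - fld n cf i" "fld n (flp n cf i) (i + 1) = fld n cf (i + 1)"
    "fld n (flp n cf i) (i - 1) = fld n cf (i - 1)"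
proof -
  have n: "n > 0" "n \<ge> 2" using assms by auto
  have "cind n i i = 1" "cind n i (i + 1) = 0" using mod_succ_ne[OF n(2), of i] by (auto simp: cind_mod)
  moreover have "cind n i (i - 1) = 0" using mod_succ_ne[OF n(2), of "i - 1"] by (auto simp: cind_mod)
  ultimately show "fld n (flp n cf i) i = - fld n cf i" "fld n (flp n cf i) (i + 1) = fld n cf (i + 1)"
    "fld n (flp n cf i) (i - 1) = fld n cf (i - 1)" unfolding fld_flp[OF n(1) assms(2)] by auto
qed

abbreviation W2f :: "nat => int => (int => real) => real" where
  "W2f n k x \<equiv> tsum n (%i. x i * x (i + k)) - real n * (mg n x)^2"

abbreviation S3f :: "nat => (int => real) => real" where
  "S3f n x \<equiv> tsum n (%i. x (i - 1) * x i * x (i + 1))"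

text \<open>For spins equal to plus or minus one the flip ratio \<open>exp (- 2 * m * x i)\<close>
  is affine in \<open>x i\<close>, so the sum is a polynomial in neighbouring spins. The terms of
  order \<open>n * m^2\<close> cancel because the weight has the critical coupling;
  \<open>n * m^4\<close> and the two- and three-point sums remain.\<close>

lemma Afun_le:
  assumes n: "n \<ge> 3" and e: "cf \<in> Omega n" and g: "0 \<le> g" "g \<le> 1"
  defines "x \<equiv> fld n cf" defines "m \<equiv> mg n x" 
  shows "Afun g n (UU n) cf \<le> 4 * g * W2f n 1 x + 30 * (real n * m^4) + (cosh (2 * m) - 1) * (2 * g * W2f n 1 x + g^2 * W2f n 2 x)
     - g^2 * (sinh (2 * m) * S3f n x) + 128"
proof -
  have n0: "n > 0" using n by simp
  define ch sh where "ch = cosh (2 * m)" and "sh = sinh (2 * m)"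
  have px: "per n x" unfolding x_def by (rule per_fld)
  have xv: "x i = 1 \<or> x i = - 1" for i unfolding x_def by (rule fld_values[OF e n0])
  have xx: "x i * x i = 1" for i using xv[of i] by auto
  have m1: "\<bar>m\<bar> \<le> 1" unfolding m_def x_def by (rule mg_abs[OF e n0])
  note cs = cosh_sinh_bounds[OF m1, folded ch_def sh_def]
  have cfl: "crate g (fld n (flp n cf i)) i = 1 + g * x i * (x (i - 1) + x (i + 1)) + g^2 * x (i - 1) * x (i + 1)" for i
    unfolding crate_def fld_flp_nb[OF n e] x_def by simp
  have ex: "exp (UU n (flp n cf i) - UU n cf) = (ch - x i * sh) * exp (2 / real n)" for i
  proof -
    have "exp (UU n (flp n cf i) - UU n cf) = exp (- (2 * m) * x i) * exp (2 / real n)"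
      unfolding UU_flp[OF n0 e] x_def[symmetric] m_def[symmetric] exp_add[symmetric] by (simp add: mult_ac)
    moreover have "exp (- (2 * m) * x i) = ch - x i * sh"
      using xv[of i] cosh_plus_sinh[of "2 * m"] cosh_minus_sinh[of "2 * m"] unfolding ch_def sh_def by auto
    ultimately show ?thesis by simp
  qed
  define c' where "c' i = crate g (fld n (flp n cf i)) i" for i
  have c'b: "0 \<le> c' i" "c' i \<le> 4" for i unfolding c'_def using crate_bounds[OF flp_Omega[OF e n0] n0 g] by auto
  have eb: "0 \<le> ch - x i * sh" "ch - x i * sh \<le> 8" for i
  proof -
    have "ch - x i * sh = exp (- (2 * m) * x i)"
      using xv[of i] cosh_plus_sinh[of "2 * m"] cosh_minus_sinh[of "2 * m"] unfolding ch_def sh_def by auto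
    moreover have "- (2 * m) * x i \<le> 2" using xv[of i] m1 by auto
    then have "exp (- (2 * m) * x i) \<le> exp 2" by (simp only: exp_le_cancel_iff)
    then have "exp (- (2 * m) * x i) \<le> 8" using exp2_le by linarith
    ultimately show "0 \<le> ch - x i * sh" "ch - x i * sh \<le> 8" by auto
  qed
  have e2n: "exp (2 / real n) \<le> 1 + 4 / real n"
  proof -
    have "2 / real n \<le> 1" using n by simp
    then have "exp (2 / real n) \<le> 1 + 2 / real n + (2 / real n)^2" by (intro exp_bound) auto
    also have "(2 / real n)^2 \<le> 1 * (2 / real n)" unfolding power2_eq_square using \<open>2 / real n \<le> 1\<close> by (intro mult_right_mono) auto
    finally show ?thesis by simp
  qed
  \<comment> \<open>The factor \<open>exp (2 / n)\<close> is the self-interaction of the flipped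
    spin. With rate at most 4, ratio at most 8 and excess at most \<open>4 / n\<close> it costs 128
    in total.\<close>
  have t: "c' i * exp (UU n (flp n cf i) - UU n cf) - crate g x i \<le> c' i * (ch - x i * sh) - crate g x i + 128 / real n" for i
  proof -
    have "c' i * (ch - x i * sh) \<le> 4 * 8" by (rule mult_mono) (use c'b eb in auto)
    moreover have "0 \<le> c' i * (ch - x i * sh)" using c'b eb by simp
    ultimately have "c' i * (ch - x i * sh) * (4 / real n) \<le> 32 * (4 / real n)" by (intro mult_right_mono) auto
    moreover have "c' i * (ch - x i * sh) * exp (2 / real n) \<le> c' i * (ch - x i * sh) * (1 + 4 / real n)"
      by (rule mult_left_mono[OF e2n]) fact
    ultimately show ?thesis unfolding ex by (simp add: algebra_simps)
  qed
  have "Afun g n (UU n) cf \<le> tsum n (%i. c' i * (ch - x i * sh) - crate g x i + 128 / real n)"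
    unfolding Afun_def c'_def[symmetric] x_def[symmetric] by (rule tsum_mono) (rule t)
  also have "... = tsum n (%i. c' i * (ch - x i * sh) - crate g x i) + 128"
    unfolding tsum_add tsum_const using n0 by simp
  \<comment> \<open>The polynomial is ordered so that its last bracket sums to zero by translation
    invariance.\<close>
  also have "tsum n (%i. c' i * (ch - x i * sh) - crate g x i)
    = tsum n (%i. (ch - 1) * 1 - sh * (1 + 2 * g) * x i + (g * (ch + 1)) * (x (i - 1) * x i) + (g * (ch + 1)) * (x i * x (i + 1)) + (g^2 * (ch - 1)) * (x (i - 1) * x (i + 1)) 
       - (g^2 * sh) * (x (i - 1) * x i * x (i + 1)) - g * sh * (x (i - 1) - x i + (x (i + 1) - x i)))"
  proof (rule tsum_cong)
    fix i
    have c'eq: "c' i = 1 + g * x i * (x (i - 1) + x (i + 1)) + g^2 * x (i - 1) * x (i + 1)" unfolding c'_def by (rule cfl)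
    show "c' i * (ch - x i * sh) - crate g x i = (ch - 1) * 1 - sh * (1 + 2 * g) * x i + (g * (ch + 1)) * (x (i - 1) * x i) + (g * (ch + 1)) * (x i * x (i + 1)) + (g^2 * (ch - 1)) * (x (i - 1) * x (i + 1)) 
       - (g^2 * sh) * (x (i - 1) * x i * x (i + 1)) - g * sh * (x (i - 1) - x i + (x (i + 1) - x i))"
      unfolding c'eq crate_def using xv[of i] by (elim disjE) (simp_all add: algebra_simps)
  qed
  also have "... = (ch - 1) * real n - sh * (1 + 2 * g) * tsum n x + (g * (ch + 1)) * tsum n (%i. x (i - 1) * x i) + (g * (ch + 1)) * tsum n (%i. x i * x (i + 1))
     + (g^2 * (ch - 1)) * tsum n (%i. x (i - 1) * x (i + 1)) - (g^2 * sh) * S3f n x - g * sh * (tsum n (%i. x (i - 1)) - tsum n x + (tsum n (%i. x (i + 1)) - tsum n x))"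
    by (simp only: tsum_add tsum_diff tsum_cmult tsum_const mult_1_right) (simp add: algebra_simps)
  also have "tsum n (%i. x (i - 1)) = tsum n x" by (rule tsum_shift'[OF px])
  also have "tsum n (%i. x (i + 1)) = tsum n x" by (rule tsum_shift[OF px])
  also have "tsum n (%i. x (i - 1) * x i) = tsum n (%i. x i * x (i + 1))"
    using tsum_shift'[of n "%i. x i * x (i + 1)" 1] px by (simp add: per_intros)
  also have "tsum n (%i. x (i - 1) * x (i + 1)) = tsum n (%i. x i * x (i + 2))"
    using tsum_shift'[of n "%i. x i * x (i + 2)" 1] px by (simp add: per_intros add.commute)
  also have "tsum n x = real n * m" using n0 by (simp add: m_def mg_def)
  finally have main: "Afun g n (UU n) cf \<le> (ch - 1) * real n - sh * (1 + 2 * g) * (real n * m) + (g * (ch + 1)) * tsum n (%i. x i * x (i + 1)) + (g * (ch + 1)) * tsum n (%i. x i * x (i + 1))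
     + (g^2 * (ch - 1)) * tsum n (%i. x i * x (i + 2)) - (g^2 * sh) * S3f n x + 128" by simp
  define W1 W2 where "W1 = W2f n 1 x" and "W2 = W2f n 2 x"
  have s1: "tsum n (%i. x i * x (i + 1)) = W1 + real n * m^2" "tsum n (%i. x i * x (i + 2)) = W2 + real n * m^2"
    by (simp_all add: W1_def W2_def m_def)
  \<comment> \<open>Once the two-point sums are centred, these are the coefficients of
    \<open>1\<close>, \<open>2 * g\<close> and \<open>g^2\<close> in the part proportional to
    \<open>n\<close>; each is at most a multiple of \<open>m^4\<close>.\<close>
  define E1 where "E1 = (ch - 1) - m * sh"
  define E2 where "E2 = m^2 * (ch + 1) - m * sh"
  define E3 where "E3 = m^2 * (ch - 1)"
  have m4: "m^2 * m^2 = m ^ 4" by (simp add: power2_eq_square power4_eq_xxxx)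
  have m40: "0 \<le> m ^ 4" by simp
  have E1: "E1 \<le> 6 * m ^ 4" unfolding E1_def using cs by linarith
  have E3: "E3 \<le> 8 * m ^ 4" unfolding E3_def using mult_left_mono[OF cs(3), of "m^2"] unfolding mult.left_commute[of "m^2" 8] m4 by simp
  have E2: "E2 \<le> 8 * m ^ 4" using E3 cs(4) unfolding E2_def E3_def by (simp add: algebra_simps)
  have "g^2 \<le> 1" using g by (simp add: power_le_one)
  have "2 * g * E2 \<le> 2 * g * (8 * m ^ 4)" by (rule mult_left_mono[OF E2]) (use g in auto)
  also have "... \<le> 2 * (8 * m ^ 4)" using g m40 by (intro mult_right_mono) auto
  finally have E2': "2 * g * E2 \<le> 16 * m ^ 4" by simp
  have "g^2 * E3 \<le> g^2 * (8 * m ^ 4)" by (rule mult_left_mono[OF E3]) auto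
  also have "... \<le> 1 * (8 * m ^ 4)" using \<open>g^2 \<le> 1\<close> m40 by (intro mult_right_mono) auto
  finally have E3': "g^2 * E3 \<le> 8 * m ^ 4" by simp
  have "real n * (E1 + 2 * g * E2 + g^2 * E3) \<le> real n * (30 * m ^ 4)"
  proof (rule mult_left_mono)
    show "E1 + 2 * g * E2 + g^2 * E3 \<le> 30 * m ^ 4" using E1 E2' E3' by linarith
  qed simp
  moreover have "(ch - 1) * real n - sh * (1 + 2 * g) * (real n * m) + (g * (ch + 1)) * (W1 + real n * m^2) + (g * (ch + 1)) * (W1 + real n * m^2)
     + (g^2 * (ch - 1)) * (W2 + real n * m^2)
     = real n * (E1 + 2 * g * E2 + g^2 * E3) + 4 * g * W1 + (ch - 1) * (2 * g * W1 + g^2 * W2)"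
    unfolding E1_def E2_def E3_def by (simp add: algebra_simps)
  ultimately show ?thesis using main unfolding s1 m_def[symmetric] ch_def[symmetric] sh_def[symmetric]
    by (simp add: mult.assoc)
qed

section \<open>The quadratic functionals and the generator acting on them\<close>

definition P0 :: "nat => (int => real) => real" where "P0 n x = Qf n (%_. 1 / real n) x"
text \<open>The factor \<open>2 / n^2\<close> makes the exchanges produce
  \<open>- 4 * W2f n 1\<close> in \<open>gen_P1\<close> up to a bounded error; likewise
  \<open>1 / n^4\<close> in \<open>P3\<close> makes them produce \<open>- P1\<close>.\<close>

definition P1 :: "nat => (int => real) => real" where "P1 n x = 2 / (real n)^2 * Qf n (saw n) x"
definition P2 :: "nat => nat => (int => real) => real" where "P2 n w x = Qf n (tentker0 n w) x"
definition P3 :: "nat => (int => real) => real" where "P3 n x = 1 / (real n)^4 * Qf n (saw2 n) x"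

text \<open>Half the gradients of \<open>P1\<close>, \<open>P2\<close> and \<open>P3\<close> in the
  spins; they are multiplied by the three-spin part of the flip rate in the cubic terms
  \<open>cub\<close>.\<close>

definition z1 :: "nat => (int => real) => int => real" where "z1 n x i = 2 / (real n)^2 * cva n (saw n) (cv n (saw n) x) i"
definition z2 :: "nat => nat => (int => real) => int => real" where "z2 n w x i = cva n (tentker0 n w) (cv n (tentker0 n w) x) i"
definition z3 :: "nat => (int => real) => int => real" where "z3 n x i = 1 / (real n)^4 * cva n (saw2 n) (cv n (saw2 n) x) i"

lemma P0_eq: "n > 0 ==> P0 n x = real n * (mg n x)^2"
  unfolding P0_def Qf_def cv_const tsum_const mg_def by (simp add: power2_eq_square)

lemma P_nonneg: "0 \<le> P0 n x" "0 \<le> P1 n x" "0 \<le> P2 n w x" "0 \<le> P3 n x"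
  unfolding P0_def P1_def P2_def P3_def by (simp_all add: Qf_nonneg)

lemma cub_cmult: "cub n x (%i. c * z i) = c * cub n x z"
  unfolding cub_def tsum_cmult[symmetric] by (rule tsum_cong) (simp add: mult_ac)
lemma cub_add: "cub n x (%i. y i + z i) = cub n x y + cub n x z"
  unfolding cub_def tsum_add[symmetric] by (rule tsum_cong) (simp add: algebra_simps)

text \<open>The constant kernel has no gradient, so the exchanges do not act. The term in
  \<open>S3f\<close> is the nonlinear restoring force: on block averages it becomes the sink of
  order \<open>n * m^4\<close>.\<close>

lemma gen_P0:
  assumes "n \<ge> 2" "cf \<in> Omega n" "a \<ge> 0" "0 \<le> gam vt n" "gam vt n \<le> 1"
  shows "gen_L a vt n (%\<xi>. P0 n (fld n \<xi>)) cf \<le> - 4 * a * (1 - 2 * gam vt n) * P0 n (fld n cf)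
    - 4 * a * (gam vt n)^2 * (mg n (fld n cf) * S3f n (fld n cf)) + 16 * a"
proof -
  have n: "n > 0" using assms by simp
  have z: "cva n (%_. 1 / real n) (cv n (%_. 1 / real n) x) i = mg n x * 1" for x i
    unfolding cva_const cv_const tsum_const mg_def using n by simp
  have c: "cub n x (cva n (%_. 1 / real n) (cv n (%_. 1 / real n) x)) = mg n x * S3f n x" for x
    unfolding z[abs_def] cub_cmult unfolding cub_def by simp
  have "grad2 n (cv n (%_. 1 / real n) x) = 0" "grad2 n (%_. 1 / real n) = 0" for x
    unfolding grad2_def cv_const by (simp_all add: tsum_0)
  then show ?thesis using gen_L_Qf_le[OF assms(1) per_const assms(2-5), of "1 / real n"] n
    unfolding P0_def c by (simp add: tsum_const power2_eq_square)
qed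

lemma grad2_cv_saw: assumes "n > 0" "per n x" shows "grad2 n (cv n (saw n) x) = tsum n (%i. (x i)^2) - real n * (mg n x)^2"
proof -
  have "grad2 n (cv n (saw n) x) = tsum n (%i. (x i)^2 - (2 * mg n x) * x i + (mg n x)^2)"
    unfolding grad2_def grad_cv_saw[OF assms] by (rule tsum_cong) (simp add: power2_diff)
  also have "... = tsum n (%i. (x i)^2) - (2 * mg n x) * tsum n x + real n * (mg n x)^2"
    by (simp only: tsum_add tsum_diff tsum_cmult tsum_const)
  also have "tsum n x = real n * mg n x" using assms by (simp add: mg_def)
  finally show ?thesis by (simp add: power2_eq_square)
qed

text \<open>\<open>cv n (saw n) x\<close> is a primitive of \<open>x\<close> minus its mean, so its
  gradient energy is \<open>n - n * m^2\<close>; the other exchange term contributes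
  \<open>2 * n\<close> minus twice the two-point sum, up to the factor \<open>1 - 1 / n\<close>. The
  parts of order \<open>n\<close> cancel and the centred two-point sum remains.\<close>

lemma gen_P1:
  assumes "n \<ge> 2" "cf \<in> Omega n" "a \<ge> 0" "0 \<le> gam vt n" "gam vt n \<le> 1"
  shows "gen_L a vt n (%\<xi>. P1 n (fld n \<xi>)) cf \<le> - 4 * W2f n 1 (fld n cf) - 4 * a * (1 - 2 * gam vt n) * P1 n (fld n cf)
    - 4 * a * (gam vt n)^2 * cub n (fld n cf) (z1 n (fld n cf)) + 8 * a"
proof -
  have n: "n > 0" using assms by simp
  define x where "x = fld n cf"
  define S where "S = tsum n (%i. x i * x (i + 1))"
  have px: "per n x" unfolding x_def by (rule per_fld)
  have sq: "(x i)^2 = 1" for i unfolding x_def by (rule fld_sq[OF assms(2) n])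
  have g1: "grad2 n (cv n (saw n) x) = real n - real n * (mg n x)^2"
    unfolding grad2_cv_saw[OF n px] sq tsum_const by simp
  have g2: "grad2 n x = 2 * real n - 2 * S"
  proof -
    have "grad2 n x = tsum n (%i. 2 - 2 * (x i * x (i + 1)))"
      unfolding grad2_def by (rule tsum_cong) (simp add: power2_diff sq)
    then show ?thesis by (simp only: tsum_diff tsum_cmult tsum_const S_def mult.commute)
  qed
  have Sn: "S \<le> real n"
  proof -
    have "S \<le> real n * 1" unfolding S_def
    proof (rule tsum_le_const)
      fix i show "x i * x (i + 1) \<le> 1" using fld_values[OF assms(2) n, of i] fld_values[OF assms(2) n, of "i+1"] unfolding x_def by auto
    qed
    then show ?thesis by simp
  qed
  define N where "N = real n"
  have N: "N \<ge> 2" using assms(1) by (simp add: N_def)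
  have T: "tsum n (%d. (saw n d)^2) \<le> N / 4" unfolding N_def by (rule tsum_sq_saw[OF n])
  have main: "gen_L a vt n (%\<xi>. Qf n (saw n) (fld n \<xi>)) cf \<le> N^2 * (- 2 * (N - N * (mg n x)^2) + (1 - 1 / N) * (2 * N - 2 * S))
    - 4 * a * (1 - 2 * gam vt n) * Qf n (saw n) x - 4 * a * (gam vt n)^2 * cub n x (cva n (saw n) (cv n (saw n) x)) + 16 * a * N * tsum n (%d. (saw n d)^2)"
    using gen_L_Qf_le[OF assms(1) per_saw assms(2-5)] unfolding x_def[symmetric] g1 g2 grad2_saw[OF n] N_def .
  have c0: "2 / N^2 \<ge> 0" by simp
  have "gen_L a vt n (%\<xi>. P1 n (fld n \<xi>)) cf = 2 / N^2 * gen_L a vt n (%\<xi>. Qf n (saw n) (fld n \<xi>)) cf"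
    unfolding P1_def gen_L_cmult N_def ..
  also have "... \<le> 2 / N^2 * (N^2 * (- 2 * (N - N * (mg n x)^2) + (1 - 1 / N) * (2 * N - 2 * S))
    - 4 * a * (1 - 2 * gam vt n) * Qf n (saw n) x - 4 * a * (gam vt n)^2 * cub n x (cva n (saw n) (cv n (saw n) x)) + 16 * a * N * tsum n (%d. (saw n d)^2))"
    by (rule mult_left_mono[OF main c0])
  also have "... = 2 * (- 2 * (N - N * (mg n x)^2) + (1 - 1 / N) * (2 * N - 2 * S))
    - 4 * a * (1 - 2 * gam vt n) * (2 / N^2 * Qf n (saw n) x) - 4 * a * (gam vt n)^2 * (2 / N^2 * cub n x (cva n (saw n) (cv n (saw n) x))) + 2 / N^2 * (16 * a * N * tsum n (%d. (saw n d)^2))"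
    using N by (simp add: field_simps)
  also have "2 / N^2 * cub n x (cva n (saw n) (cv n (saw n) x)) = cub n x (z1 n x)"
    unfolding z1_def[abs_def] cub_cmult N_def ..
  also have "2 / N^2 * Qf n (saw n) x = P1 n x" unfolding P1_def N_def ..
  also have "2 / N^2 * (16 * a * N * tsum n (%d. (saw n d)^2)) \<le> 2 / N^2 * (16 * a * N * (N / 4))"
    using T N assms(3) by (intro mult_left_mono) auto
  also have "2 / N^2 * (16 * a * N * (N / 4)) = 8 * a" using N by (simp add: power2_eq_square)
  also have "2 * (- 2 * (N - N * (mg n x)^2) + (1 - 1 / N) * (2 * N - 2 * S)) \<le> - 4 * (S - N * (mg n x)^2)"
  proof -
    have "S / N \<le> 1" using Sn N by (simp add: N_def)
    have eq: "(1 - 1 / N) * (2 * N - 2 * S) = 2 * N - 2 * S - 2 + 2 * (S / N)" using N by (simp add: field_simps)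
    have "2 * (- 2 * (A - t) + (2 * A - 2 * B - 2 + 2 * r)) \<le> - 4 * (B - t)" if "r \<le> 1" for r t A B :: real
      using that by (simp add: algebra_simps)
    then show ?thesis unfolding eq using \<open>S / N \<le> 1\<close> by blast
  qed
  finally show ?thesis unfolding x_def[symmetric] S_def[symmetric] N_def by simp
qed

text \<open>\<open>saw2\<close> is the sawtooth convolved with itself, so the gradient of
  \<open>cv n (saw2 n) x\<close> is \<open>cv n (saw n) x\<close>, whose mean vanishes; the exchange
  dissipation of \<open>P3\<close> is thus \<open>P1\<close> itself.\<close>

lemma gen_P3:
  assumes "n \<ge> 2" "cf \<in> Omega n" "a \<ge> 0" "0 \<le> gam vt n" "gam vt n \<le> 1"
  shows "gen_L a vt n (%\<xi>. P3 n (fld n \<xi>)) cf \<le> - P1 n (fld n cf) - 4 * a * (1 - 2 * gam vt n) * P3 n (fld n cf)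
    - 4 * a * (gam vt n)^2 * cub n (fld n cf) (z3 n (fld n cf)) + 1 + a"
proof -
  have n: "n > 0" using assms by simp
  define x where "x = fld n cf"
  define N where "N = real n"
  have N: "N \<ge> 2" using assms(1) by (simp add: N_def)
  have px: "per n x" unfolding x_def by (rule per_fld)
  have mz: "mg n (cv n (saw n) x) = 0" unfolding mg_def tsum_cv[OF per_saw] tsum_saw[OF n] by simp
  have g1: "grad2 n (cv n (saw2 n) x) = Qf n (saw n) x"
    unfolding cv_saw2[OF n px, abs_def] grad2_cv_saw[OF n per_cv[OF per_saw]] mz Qf_def by simp
  have g2: "grad2 n (saw2 n) * grad2 n x \<le> (N / 4) * (4 * N)"
    using mult_mono[OF grad2_saw2[OF n] grad2_fld_le[OF assms(2) n]] grad2_nonneg unfolding x_def N_def by simp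
  have T: "tsum n (%d. (saw2 n d)^2) \<le> N * (N^2 / 16)"
    unfolding N_def
  proof (rule tsum_le_const)
    fix d show "(saw2 n d)^2 \<le> (real n)^2 / 16" using power_mono[OF saw2_abs[OF n, of d], of 2] by (simp add: power_divide)
  qed
  have main: "gen_L a vt n (%\<xi>. Qf n (saw2 n) (fld n \<xi>)) cf \<le> N^2 * (- 2 * Qf n (saw n) x + N * N)
    - 4 * a * (1 - 2 * gam vt n) * Qf n (saw2 n) x - 4 * a * (gam vt n)^2 * cub n x (cva n (saw2 n) (cv n (saw2 n) x)) + 16 * a * N * (N * (N^2 / 16))"
  proof -
    have "N^2 * (- 2 * Qf n (saw n) x + grad2 n (saw2 n) * grad2 n x) \<le> N^2 * (- 2 * Qf n (saw n) x + N * N)"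
      using g2 by (intro mult_left_mono) auto
    moreover have "16 * a * N * tsum n (%d. (saw2 n d)^2) \<le> 16 * a * N * (N * (N^2 / 16))"
      using T N assms(3) by (intro mult_left_mono) auto
    ultimately show ?thesis using gen_L_Qf_le[OF assms(1) per_saw2 assms(2-5)] unfolding x_def[symmetric] g1 N_def[symmetric] by linarith
  qed
  have c0: "1 / N^4 \<ge> 0" using N by simp
  have "gen_L a vt n (%\<xi>. P3 n (fld n \<xi>)) cf = 1 / N^4 * gen_L a vt n (%\<xi>. Qf n (saw2 n) (fld n \<xi>)) cf"
    unfolding P3_def gen_L_cmult N_def ..
  also have "... \<le> 1 / N^4 * (N^2 * (- 2 * Qf n (saw n) x + N * N)
    - 4 * a * (1 - 2 * gam vt n) * Qf n (saw2 n) x - 4 * a * (gam vt n)^2 * cub n x (cva n (saw2 n) (cv n (saw2 n) x)) + 16 * a * N * (N * (N^2 / 16)))"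
    by (rule mult_left_mono[OF main c0])
  also have "... = - (2 / N^2 * Qf n (saw n) x) + 1
    - 4 * a * (1 - 2 * gam vt n) * (1 / N^4 * Qf n (saw2 n) x) - 4 * a * (gam vt n)^2 * (1 / N^4 * cub n x (cva n (saw2 n) (cv n (saw2 n) x))) + a"
    using N by (simp add: field_simps power_eq_if)
  also have "1 / N^4 * cub n x (cva n (saw2 n) (cv n (saw2 n) x)) = cub n x (z3 n x)"
    unfolding z3_def[abs_def] cub_cmult N_def ..
  finally show ?thesis unfolding P1_def P3_def N_def x_def by simp
qed

text \<open>Subtracting the mean does not affect gradients, so the exchanges dissipate the gradient
  energy of the block averages. The price \<open>(n / w)^3\<close> stays bounded when
  \<open>w\<close> is a fixed fraction of \<open>n\<close>.\<close>

lemma gen_P2: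
  assumes "n \<ge> 2" "cf \<in> Omega n" "a \<ge> 0" "0 \<le> gam vt n" "gam vt n \<le> 1" and w: "w > 0" "w \<le> n"
  shows "gen_L a vt n (%\<xi>. P2 n w (fld n \<xi>)) cf \<le> - 2 * ((real n)^2 * grad2 n (tent w (fld n cf))) - 4 * a * (1 - 2 * gam vt n) * P2 n w (fld n cf)
    - 4 * a * (gam vt n)^2 * cub n (fld n cf) (z2 n w (fld n cf)) + 8 * (real n / real w)^3 + 16 * a * (real n / real w)"
proof -
  have n: "n > 0" using assms by simp
  define x where "x = fld n cf"
  define N where "N = real n"
  have N: "N \<ge> 2" using assms(1) by (simp add: N_def)
  have px: "per n x" unfolding x_def by (rule per_fld)
  have g1: "grad2 n (cv n (tentker0 n w) x) = grad2 n (tent w x)"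
    unfolding grad2_def cv_tentker0[OF n px] by simp
  have g2: "grad2 n (tentker0 n w) * grad2 n x \<le> (2 / real w^3) * (4 * N)"
    unfolding N_def x_def by (rule mult_mono[OF grad2_tentker0[OF w] grad2_fld_le[OF assms(2) n]]) (use grad2_nonneg in auto)
  have "N^2 * (- 2 * grad2 n (tent w x) + grad2 n (tentker0 n w) * grad2 n x) \<le> N^2 * (- 2 * grad2 n (tent w x) + (2 / real w^3) * (4 * N))"
    using g2 by (intro mult_left_mono) auto
  also have "... = - 2 * (N^2 * grad2 n (tent w x)) + 8 * (N / real w)^3"
    using w by (simp add: field_simps power_eq_if)
  finally have 1: "N^2 * (- 2 * grad2 n (tent w x) + grad2 n (tentker0 n w) * grad2 n x) \<le> - 2 * (N^2 * grad2 n (tent w x)) + 8 * (N / real w)^3" .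
  have 2: "16 * a * N * tsum n (%d. (tentker0 n w d)^2) \<le> 16 * a * N * (1 / real w)"
    using tsum_sq_tentker0[OF w] N assms(3) by (intro mult_left_mono) auto
  show ?thesis using gen_L_Qf_le[OF assms(1) per_tentker0[of n w] assms(2-5)] 1 2
    unfolding x_def[symmetric] g1 N_def[symmetric] P2_def z2_def[abs_def] by simp
qed

definition Zt :: "nat => nat => real => real => (int => real) => int => real" where
  "Zt n w c K x i = (c * z1 n x i + z3 n x i) + K * z2 n w x i"

definition Phi :: "nat => nat => real => real => real => (int => real) => real" where
  "Phi n w \<kappa> c K x = \<kappa> * P0 n x + c * P1 n x + P3 n x + K * P2 n w x"

definition Dsp :: "nat => nat => (int => real) => real" where
  "Dsp n w x = (real n)^2 * grad2 n (tent w x)"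

lemma Dsp_nonneg: "0 \<le> Dsp n w x" unfolding Dsp_def by (simp add: grad2_nonneg)

text \<open>The coefficient \<open>a * gam vt n\<close> of \<open>P1\<close> is dictated by
  \<open>Afun_le\<close>: the leading term there, \<open>4 * g * W2f n 1\<close> multiplied by
  \<open>a\<close>, has no definite sign and is the exact opposite of the one produced here.\<close>

lemma gen_Phi:
  assumes "n \<ge> 2" "cf \<in> Omega n" "a \<ge> 0" "0 \<le> gam vt n" "gam vt n \<le> 1" and w: "w > 0" "w \<le> n" and k: "\<kappa> \<ge> 0" "K \<ge> 0"
  defines "g \<equiv> gam vt n" and "x \<equiv> fld n cf"
  shows "gen_L a vt n (%\<xi>. Phi n w \<kappa> (a * gam vt n) K (fld n \<xi>)) cf \<le> - 4 * a * (1 - 2 * g) * Phi n w \<kappa> (a * g) K x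
    - 4 * a * g^2 * (\<kappa> * (mg n x * S3f n x) + cub n x (Zt n w (a * g) K x)) - 4 * a * g * W2f n 1 x - P1 n x - 2 * K * Dsp n w x
    + (16 * a * \<kappa> + 8 * a^2 + 1 + a + K * (8 * (real n / real w)^3 + 16 * a * (real n / real w)))"
proof -
  have c: "cub n x (Zt n w (a * g) K x) = a * g * cub n x (z1 n x) + cub n x (z3 n x) + K * cub n x (z2 n w x)"
    unfolding Zt_def[abs_def] cub_add cub_cmult by simp
  have L: "gen_L a vt n (%\<xi>. Phi n w \<kappa> (a * gam vt n) K (fld n \<xi>)) cf
     = \<kappa> * gen_L a vt n (%\<xi>. P0 n (fld n \<xi>)) cf + a * g * gen_L a vt n (%\<xi>. P1 n (fld n \<xi>)) cf
      + gen_L a vt n (%\<xi>. P3 n (fld n \<xi>)) cf + K * gen_L a vt n (%\<xi>. P2 n w (fld n \<xi>)) cf"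
    unfolding Phi_def gen_L_add gen_L_cmult g_def ..
  have g01: "0 \<le> g" "g \<le> 1" using assms(4,5) g_def by auto
  note b0 = mult_left_mono[OF gen_P0[OF assms(1-5)] k(1)]
  have ag: "0 \<le> a * g" using g01 assms(3) by simp
  note b1 = mult_left_mono[OF gen_P1[OF assms(1-5)] ag]
  note b3 = gen_P3[OF assms(1-5)]
  note b2 = mult_left_mono[OF gen_P2[OF assms(1-5) w] k(2)]
  have "a * g * (8 * a) \<le> a * 1 * (8 * a)" using g01 assms(3) by (intro mult_right_mono mult_left_mono) auto
  then have "a * g * (8 * a) \<le> 8 * a^2" by (simp add: power2_eq_square)
  then show ?thesis using b0 b1 b2 b3 unfolding L c unfolding Phi_def Dsp_def x_def[symmetric] g_def[symmetric] 
    by (simp add: algebra_simps)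
qed

section \<open>Size of the local fields and their response to an exchange\<close>

lemma cv_abs: assumes "per n U" "!!i. \<bar>x i\<bar> \<le> c" shows "\<bar>cv n U x i\<bar> \<le> tsum n (%d. \<bar>U d\<bar>) * c"
proof -
  have "\<bar>cv n U x i\<bar> \<le> tsum n (%j. \<bar>U (j - i)\<bar> * c)"
    unfolding cv_def by (rule order_trans[OF tsum_abs_le], rule tsum_mono) (simp add: abs_mult mult_left_mono assms)
  then show ?thesis unfolding tsum_cmult2 using tsum_shift'[OF per_abs[OF assms(1)], of i] by simp
qed

lemma cva_abs: assumes "per n U" "!!i. \<bar>x i\<bar> \<le> c" shows "\<bar>cva n U x i\<bar> \<le> tsum n (%d. \<bar>U d\<bar>) * c"
proof -
  have "\<bar>cva n U x i\<bar> \<le> tsum n (%j. \<bar>U (i - j)\<bar> * c)"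
    unfolding cva_def by (rule order_trans[OF tsum_abs_le], rule tsum_mono) (simp add: abs_mult mult_left_mono assms)
  then show ?thesis unfolding tsum_cmult2 using tsum_reflect[OF per_abs[OF assms(1)], of i] by simp
qed

lemma tsum_abs_saw2: assumes "n > 0" shows "tsum n (%d. \<bar>saw2 n d\<bar>) \<le> (real n)^2 / 4"
proof -
  have "tsum n (%d. \<bar>saw2 n d\<bar>) \<le> real n * (real n / 4)" by (rule tsum_le_const) (rule saw2_abs[OF assms])
  then show ?thesis by (simp add: power2_eq_square)
qed

text \<open>The fields of both \<open>P1\<close> and \<open>P3\<close> are measured by
  \<open>P1\<close>, because \<open>P1\<close> is what the generator dissipates through
  \<open>P3\<close>.\<close>

lemma z1_sq: assumes "n > 0" "per n x" shows "tsum n (%i. (z1 n x i)^2) \<le> P1 n x"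
proof -
  define N where "N = real n"
  have N: "N > 0" using assms by (simp add: N_def)
  have "tsum n (%i. (cva n (saw n) (cv n (saw n) x) i)^2) \<le> (tsum n (%d. \<bar>saw n d\<bar>))^2 * Qf n (saw n) x"
    unfolding Qf_def by (rule Young[OF per_saw per_cv[OF per_saw] assms(1)])
  also have "... \<le> (N / 2)^2 * Qf n (saw n) x"
    unfolding N_def by (intro mult_right_mono power_mono tsum_abs_saw assms Qf_nonneg tsum_nonneg) auto
  finally have 1: "tsum n (%i. (cva n (saw n) (cv n (saw n) x) i)^2) \<le> (N / 2)^2 * Qf n (saw n) x" .
  have "tsum n (%i. (z1 n x i)^2) = (2 / N^2)^2 * tsum n (%i. (cva n (saw n) (cv n (saw n) x) i)^2)"
    unfolding z1_def power_mult_distrib tsum_cmult N_def ..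
  also have "... \<le> (2 / N^2)^2 * ((N / 2)^2 * Qf n (saw n) x)" by (rule mult_left_mono[OF 1]) simp
  also have "... = 1 / N^2 * Qf n (saw n) x" using N by (simp add: field_simps power2_eq_square)
  also have "... \<le> P1 n x" unfolding P1_def N_def by (intro mult_right_mono Qf_nonneg divide_right_mono) auto
  finally show ?thesis .
qed

lemma z3_sq: assumes "n > 0" "per n x" shows "tsum n (%i. (z3 n x i)^2) \<le> P1 n x"
proof -
  define N where "N = real n"
  have N: "N > 0" using assms by (simp add: N_def)
  have Q: "Qf n (saw2 n) x \<le> (N / 2)^2 * Qf n (saw n) x"
  proof -
    have "Qf n (saw2 n) x \<le> (tsum n (%d. \<bar>saw n d\<bar>))^2 * Qf n (saw n) x"
      unfolding Qf_def cv_saw2[OF assms] by (rule Young'[OF per_saw per_cv[OF per_saw] assms(1)])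
    also have "... \<le> (N / 2)^2 * Qf n (saw n) x"
      unfolding N_def by (intro mult_right_mono power_mono tsum_abs_saw assms Qf_nonneg tsum_nonneg) auto
    finally show ?thesis .
  qed
  have "tsum n (%i. (cva n (saw2 n) (cv n (saw2 n) x) i)^2) \<le> (tsum n (%d. \<bar>saw2 n d\<bar>))^2 * Qf n (saw2 n) x"
    unfolding Qf_def by (rule Young[OF per_saw2 per_cv[OF per_saw2] assms(1)])
  also have "... \<le> (N^2 / 4)^2 * Qf n (saw2 n) x"
    unfolding N_def by (intro mult_right_mono power_mono tsum_abs_saw2 assms Qf_nonneg tsum_nonneg) auto
  also have "... \<le> (N^2 / 4)^2 * ((N / 2)^2 * Qf n (saw n) x)" by (rule mult_left_mono[OF Q]) simp
  finally have 1: "tsum n (%i. (cva n (saw2 n) (cv n (saw2 n) x) i)^2) \<le> (N^2 / 4)^2 * ((N / 2)^2 * Qf n (saw n) x)" .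
  have "tsum n (%i. (z3 n x i)^2) = (1 / N^4)^2 * tsum n (%i. (cva n (saw2 n) (cv n (saw2 n) x) i)^2)"
    unfolding z3_def power_mult_distrib tsum_cmult N_def ..
  also have "... \<le> (1 / N^4)^2 * ((N^2 / 4)^2 * ((N / 2)^2 * Qf n (saw n) x))" by (rule mult_left_mono[OF 1]) simp
  also have "... = 1 / 64 * (1 / N^2 * Qf n (saw n) x)" using N by (simp add: field_simps power_eq_if)
  also have "... \<le> P1 n x"
  proof -
    have "0 \<le> 1 / N^2 * Qf n (saw n) x" by (simp add: Qf_nonneg)
    then show ?thesis unfolding P1_def N_def by simp
  qed
  finally show ?thesis .
qed

text \<open>On fields of mean zero the kernels \<open>tentker0\<close> and \<open>tentker\<close>
  act alike. The second form shows \<open>z2\<close> as a twice averaged field minus its mean, hence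
  close to \<open>tent w x i - mg n x\<close>; the sign argument in \<open>Y3_bound\<close> rests on
  this.\<close>

lemma z2_eq: assumes "n > 0" "w > 0" "per n x"
  shows "z2 n w x i = cva n (tentker n w) (%i. tent w x i - mg n x) i" "z2 n w x i = tentl w (tent w x) i - mg n x"
proof -
  have p: "per n (%i. tent w x i - mg n x)" by (intro per_cdiff per_tent assms)
  have "mg n (%i. tent w x i - mg n x) = 0"
  proof -
    have "tsum n (tent w x) = real n * mg n x" using mg_tent[OF assms(2,1,3)] assms(1) by (simp add: mg_def field_simps)
    then show ?thesis by (simp add: mg_def[of n "%i. tent w x i - mg n x"] tsum_diff tsum_const)
  qed
  then show 1: "z2 n w x i = cva n (tentker n w) (%i. tent w x i - mg n x) i"
    unfolding z2_def cv_tentker0[OF assms(1,3), abs_def] cva_tentker0[OF assms(1) p] cva_tentker[OF assms(1) p] by simp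
  show "z2 n w x i = tentl w (tent w x) i - mg n x"
    unfolding 1 cva_diff cva_tentker[OF assms(1) per_tent[OF assms(3)]] cva_tentker[OF assms(1) per_const]
    using assms(2) by (simp add: tentl_def power2_eq_square)
qed

lemma z2_sq: assumes "n > 0" "w > 0" "per n x" shows "tsum n (%i. (z2 n w x i)^2) \<le> tsum n (%i. (tent w x i - mg n x)^2)"
proof -
  have p: "per n (%i. tent w x i - mg n x)" by (intro per_cdiff per_tent assms)
  have "tsum n (%d. \<bar>tentker n w d\<bar>) = 1" using tsum_tentker[OF assms(2,1)] tentker_nonneg[of n w] by simp
  then show ?thesis unfolding z2_eq(1)[OF assms] using Young[OF per_tentker p assms(1), of w] by simp
qed

lemma tsum_z: assumes "n > 0" "w > 0" shows "tsum n (Zt n w c K x) = 0"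
proof -
  have "tsum n (z1 n x) = 0" unfolding z1_def[abs_def] tsum_cmult tsum_cva[OF per_saw] tsum_saw[OF assms(1)] by simp
  moreover have "tsum n (z3 n x) = 0" unfolding z3_def[abs_def] tsum_cmult tsum_cva[OF per_saw2] tsum_saw2[OF assms(1)] by simp
  moreover have "tsum n (z2 n w x) = 0" unfolding z2_def[abs_def] tsum_cva[OF per_tentker0] tsum_tentker0[OF assms(2,1)] by simp
  ultimately show ?thesis unfolding Zt_def[abs_def] by (simp add: tsum_add tsum_cmult)
qed

lemma z_abs: assumes n: "n > 0" and w: "w > 0" and x: "!!i. \<bar>x i\<bar> \<le> 1" "per n x" and c: "0 \<le> c" "0 \<le> K"
  shows "\<bar>Zt n w c K x i\<bar> \<le> c + 1 + 4 * K"
proof -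
  define N where "N = real n"
  have N: "N > 0" using n by (simp add: N_def)
  have "\<bar>cv n (saw n) x j\<bar> \<le> N / 2" for j using cv_abs[where x = x and i = j and c = 1, OF per_saw[of n] x(1)] tsum_abs_saw[OF n] unfolding N_def by simp
  then have "\<bar>cva n (saw n) (cv n (saw n) x) i\<bar> \<le> tsum n (%d. \<bar>saw n d\<bar>) * (N / 2)" by (rule cva_abs[OF per_saw])
  also have "... \<le> (N / 2) * (N / 2)" using tsum_abs_saw[OF n] N unfolding N_def by (intro mult_right_mono) auto
  finally have "2 / N^2 * \<bar>cva n (saw n) (cv n (saw n) x) i\<bar> \<le> 2 / N^2 * ((N / 2) * (N / 2))" by (intro mult_left_mono) auto
  also have "... \<le> 1" using N by (simp add: power2_eq_square)
  finally have 1: "\<bar>z1 n x i\<bar> \<le> 1" unfolding z1_def abs_mult N_def by simp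
  have "\<bar>cv n (saw2 n) x j\<bar> \<le> N^2 / 4" for j using cv_abs[where x = x and i = j and c = 1, OF per_saw2[of n] x(1)] tsum_abs_saw2[OF n] unfolding N_def by simp
  then have "\<bar>cva n (saw2 n) (cv n (saw2 n) x) i\<bar> \<le> tsum n (%d. \<bar>saw2 n d\<bar>) * (N^2 / 4)" by (rule cva_abs[OF per_saw2])
  also have "... \<le> (N^2 / 4) * (N^2 / 4)" using tsum_abs_saw2[OF n] N unfolding N_def by (intro mult_right_mono) auto
  finally have "1 / N^4 * \<bar>cva n (saw2 n) (cv n (saw2 n) x) i\<bar> \<le> 1 / N^4 * ((N^2 / 4) * (N^2 / 4))" by (intro mult_left_mono) auto
  also have "... \<le> 1" using N by (simp add: field_simps power_eq_if)
  finally have 3: "\<bar>z3 n x i\<bar> \<le> 1" unfolding z3_def abs_mult N_def by simp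
  have t2: "tsum n (%d. \<bar>tentker0 n w d\<bar>) \<le> 2" by (rule tsum_abs_tentker0[OF w n])
  have "\<bar>cv n (tentker0 n w) x j\<bar> \<le> 2" for j using cv_abs[where x = x and i = j and c = 1, OF per_tentker0[of n w] x(1)] t2 by simp
  then have "\<bar>z2 n w x i\<bar> \<le> tsum n (%d. \<bar>tentker0 n w d\<bar>) * 2" unfolding z2_def by (rule cva_abs[OF per_tentker0])
  then have 2: "\<bar>z2 n w x i\<bar> \<le> 4" using t2 by simp
  have "\<bar>c * z1 n x i\<bar> \<le> c * 1" "\<bar>K * z2 n w x i\<bar> \<le> K * 4"
    using mult_left_mono[OF 1 c(1)] mult_left_mono[OF 2 c(2)] c by (simp_all only: abs_mult abs_of_nonneg)
  then show ?thesis unfolding Zt_def using 3 by linarith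
qed

text \<open>The sawtooth field uses the variation bound of \<open>zeta_exc\<close>, the other two
  the gradient bound; with \<open>w\<close> a fixed fraction of \<open>n\<close> all changes are of
  order \<open>1 / n^2\<close>.\<close>

lemma z_exc: assumes e: "cf \<in> Omega n" and n2: "n \<ge> 2" and w: "w > 0" "w \<le> n" and c: "0 \<le> c" "0 \<le> K"
  shows "\<bar>Zt n w c K (fld n (exc n cf b)) i - Zt n w c K (fld n cf) i\<bar> \<le> (4 * c + 1) / (real n)^2 + 4 * K / (real w)^2"
proof -
  define N where "N = real n"
  have n: "n > 0" using n2 by simp
  have N: "N \<ge> 1" using n by (simp add: N_def)
  have d: "\<bar>fld n cf (b + 1) - fld n cf b\<bar> \<le> 2"
    using fld_values[OF e n, of "b+1"] fld_values[OF e n, of b] by auto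
  note ze = zeta_exc[OF _ per_fld n fld_exc[OF n2] d]
  have gs: "\<bar>saw n (d + 1) - saw n d\<bar> \<le> 1 / N + cind n (- 1) d" for d
    unfolding grad_saw[OF n] N_def using cind_nonneg[of n "-1" d] by (smt (verit) divide_nonneg_nonneg of_nat_0_le_iff)
  have gs1: "\<bar>saw n (d + 1) - saw n d\<bar> \<le> 2" for d using gs[of d] N by (simp add: cind_def divide_le_eq) (smt (verit) divide_le_eq_1)
  have tg: "tsum n (%d. \<bar>saw n (d + 1) - saw n d\<bar>) \<le> 2"
  proof -
    have "tsum n (%d. \<bar>saw n (d + 1) - saw n d\<bar>) \<le> tsum n (%d. 1 / N + cind n (- 1) d)" by (rule tsum_mono) (rule gs)
    then show ?thesis unfolding tsum_add tsum_const tsum_cind1[OF n] N_def using n by simp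
  qed
  have 1: "\<bar>z1 n (fld n (exc n cf b)) i - z1 n (fld n cf) i\<bar> \<le> 4 / N^2"
  proof -
    have "\<bar>cva n (saw n) (cv n (saw n) (fld n (exc n cf b))) i - cva n (saw n) (cv n (saw n) (fld n cf)) i\<bar> \<le> 2 * (1/2) * tsum n (%d. \<bar>saw n (d + 1) - saw n d\<bar>)"
      by (rule ze(3)[OF per_saw gs1 saw_abs[OF n]])
    then have "\<bar>cva n (saw n) (cv n (saw n) (fld n (exc n cf b))) i - cva n (saw n) (cv n (saw n) (fld n cf)) i\<bar> \<le> 2" using tg by simp
    then have "2 / N^2 * \<bar>cva n (saw n) (cv n (saw n) (fld n (exc n cf b))) i - cva n (saw n) (cv n (saw n) (fld n cf)) i\<bar> \<le> 2 / N^2 * 2"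
      by (intro mult_left_mono) auto
    then show ?thesis unfolding z1_def right_diff_distrib[symmetric] abs_mult N_def by simp
  qed
  have 3: "\<bar>z3 n (fld n (exc n cf b)) i - z3 n (fld n cf) i\<bar> \<le> 1 / N^2"
  proof -
    have s2: "\<bar>saw2 n (d + 1) - saw2 n d\<bar> \<le> 1 / 2" for d unfolding grad_saw2[OF n] using saw_abs[OF n, of "d+1"] by simp
    have "\<bar>cva n (saw2 n) (cv n (saw2 n) (fld n (exc n cf b))) i - cva n (saw2 n) (cv n (saw2 n) (fld n cf)) i\<bar> \<le> 2 * (1/2) * tsum n (%d. \<bar>saw2 n d\<bar>)"
      by (rule ze(2)[OF per_saw2 s2])
    then have "\<bar>cva n (saw2 n) (cv n (saw2 n) (fld n (exc n cf b))) i - cva n (saw2 n) (cv n (saw2 n) (fld n cf)) i\<bar> \<le> N^2"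
    proof -
      have "tsum n (%d. \<bar>saw2 n d\<bar>) \<le> N^2" using tsum_abs_saw2[OF n] zero_le_power2[of N] unfolding N_def by linarith
      then show ?thesis using \<open>\<bar>cva n (saw2 n) (cv n (saw2 n) (fld n (exc n cf b))) i - cva n (saw2 n) (cv n (saw2 n) (fld n cf)) i\<bar> \<le> 2 * (1/2) * tsum n (%d. \<bar>saw2 n d\<bar>)\<close> by simp
    qed
    then have "1 / N^4 * \<bar>cva n (saw2 n) (cv n (saw2 n) (fld n (exc n cf b))) i - cva n (saw2 n) (cv n (saw2 n) (fld n cf)) i\<bar> \<le> 1 / N^4 * N^2"
      by (intro mult_left_mono) auto
    also have "1 / N^4 * N^2 = 1 / N^2" using N by (simp add: field_simps power_eq_if)
    finally show ?thesis unfolding z3_def right_diff_distrib[symmetric] abs_mult N_def by simp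
  qed
  have 2: "\<bar>z2 n w (fld n (exc n cf b)) i - z2 n w (fld n cf) i\<bar> \<le> 4 / (real w)^2"
  proof -
    have s2: "\<bar>tentker0 n w (d + 1) - tentker0 n w d\<bar> \<le> 1 / (real w)^2" for d unfolding tentker0_def using grad_tentker_abs[OF w, of d] by simp
    have "\<bar>z2 n w (fld n (exc n cf b)) i - z2 n w (fld n cf) i\<bar> \<le> 2 * (1 / (real w)^2) * tsum n (%d. \<bar>tentker0 n w d\<bar>)"
      unfolding z2_def by (rule ze(2)[OF per_tentker0 s2])
    also have "... \<le> 2 * (1 / (real w)^2) * 2" using tsum_abs_tentker0[OF w(1) n] by (intro mult_left_mono) auto
    finally show ?thesis by simp
  qed
  have "\<bar>c * (z1 n (fld n (exc n cf b)) i - z1 n (fld n cf) i)\<bar> \<le> c * (4 / N^2)" using mult_left_mono[OF 1 c(1)] c(1) by (simp only: abs_mult abs_of_nonneg)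
  moreover have "\<bar>K * (z2 n w (fld n (exc n cf b)) i - z2 n w (fld n cf) i)\<bar> \<le> K * (4 / (real w)^2)" using mult_left_mono[OF 2 c(2)] c(2) by (simp only: abs_mult abs_of_nonneg)
  moreover have "Zt n w c K (fld n (exc n cf b)) i - Zt n w c K (fld n cf) i = c * (z1 n (fld n (exc n cf b)) i - z1 n (fld n cf) i)
     + (z3 n (fld n (exc n cf b)) i - z3 n (fld n cf) i) + K * (z2 n w (fld n (exc n cf b)) i - z2 n w (fld n cf) i)"
    unfolding Zt_def by (simp add: algebra_simps)
  moreover have "(4 * c + 1) / N^2 + 4 * K / (real w)^2 = c * (4 / N^2) + 1 / N^2 + K * (4 / (real w)^2)" by (simp add: add_divide_distrib mult.commute)
  ultimately show ?thesis using 3 unfolding N_def[symmetric] by (smt (verit))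
qed

section \<open>The cubic term on block averages\<close>

lemma cube_diff: fixes y m :: real assumes "\<bar>y\<bar> \<le> 1" "\<bar>m\<bar> \<le> 1"
  shows "\<bar>y^3 - m^3\<bar> \<le> 3 * \<bar>y - m\<bar>" "0 \<le> (y^3 - m^3) * (y - m)"
proof -
  have f: "y^3 - m^3 = (y^2 + y * m + m^2) * (y - m)" by (simp add: power2_eq_square power3_eq_cube algebra_simps)
  have "y^2 \<le> 1" "m^2 \<le> 1" using assms abs_square_le_1 by auto
  moreover have "\<bar>y * m\<bar> \<le> 1" by (rule abs_mult_le1[OF assms])
  ultimately have "y^2 + y * m + m^2 \<le> 3" by linarith
  moreover have nn: "0 \<le> y^2 + y * m + m^2"
  proof -
    have "y^2 + y * m + m^2 = (y + m / 2)^2 + 3 / 4 * m^2" by (simp add: power2_eq_square algebra_simps)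
    then show ?thesis by simp
  qed
  ultimately show "\<bar>y^3 - m^3\<bar> \<le> 3 * \<bar>y - m\<bar>" unfolding f abs_mult by (intro mult_right_mono) auto
  have "(y^3 - m^3) * (y - m) = (y^2 + y * m + m^2) * (y - m)^2" unfolding f by (simp add: power2_eq_square)
  then show "0 \<le> (y^3 - m^3) * (y - m)" using nn by simp
qed

lemma amgm: fixes a b t :: real assumes "t > 0" shows "\<bar>a * b\<bar> \<le> t / 2 * a^2 + b^2 / (2 * t)"
proof -
  have "0 \<le> (t * \<bar>a\<bar> - \<bar>b\<bar>)^2" by simp
  then have "2 * t * (\<bar>a\<bar> * \<bar>b\<bar>) \<le> t^2 * a^2 + b^2" by (simp add: power2_diff power_mult_distrib algebra_simps)
  then have "\<bar>a\<bar> * \<bar>b\<bar> \<le> (t^2 * a^2 + b^2) / (2 * t)" using assms by (simp add: field_simps)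
  also have "... = t / 2 * a^2 + b^2 / (2 * t)" using assms by (simp add: field_simps power2_eq_square)
  finally show ?thesis by (simp add: abs_mult)
qed

lemma tentl_diff: assumes n: "n > 0" and y: "per n y" and w: "w > 0"
  shows "tsum n (%i. (tentl w y i - y i)^2) \<le> (2 * real w)^2 * grad2 n y"
proof -
  let ?I = "{..<w} \<times> {..<w}"
  have W: "(\<Sum>t\<in>?I. 1 / (real w)^2) = 1" using w by (simp add: card_cartesian_product power2_eq_square)
  have eq: "tentl w y i - y i = (\<Sum>t\<in>?I. (1 / real w) * ((1 / real w) * (y (i - int (fst t + snd t)) - y i)))" for i
  proof -
    have "y i = (\<Sum>t\<in>?I. 1 / (real w)^2 * y i)" unfolding sum_distrib_right[symmetric] W by simp
    moreover have "tentl w y i = (\<Sum>t\<in>?I. 1 / (real w)^2 * y (i - int (fst t + snd t)))"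
      unfolding tentl_def sum.cartesian_product sum_distrib_left by (rule sum.cong) (auto simp: algebra_simps)
    ultimately have "tentl w y i - y i = (\<Sum>t\<in>?I. 1 / (real w)^2 * y (i - int (fst t + snd t)) - 1 / (real w)^2 * y i)"
      unfolding sum_subtractf by linarith
    also have "... = (\<Sum>t\<in>?I. (1 / real w) * ((1 / real w) * (y (i - int (fst t + snd t)) - y i)))"
      by (rule sum.cong) (auto simp: power2_eq_square algebra_simps)
    finally show ?thesis .
  qed
  have pt: "(tentl w y i - y i)^2 \<le> (\<Sum>t\<in>?I. 1 / (real w)^2 * (y (i - int (fst t + snd t)) - y i)^2)" for i
  proof -
    have "(tentl w y i - y i)^2 \<le> (\<Sum>t\<in>?I. (1 / real w)^2) * (\<Sum>t\<in>?I. ((1 / real w) * (y (i - int (fst t + snd t)) - y i))^2)"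
      unfolding eq by (rule Cauchy_Schwarz_ineq_sum)
    then show ?thesis using W by (simp add: power_mult_distrib power_divide)
  qed
  have sh: "tsum n (%i. (y (i - int k) - y i)^2) \<le> (2 * real w)^2 * grad2 n y" if "k \<le> 2 * w" for k
  proof -
    have "per n (%i. (y (i - int k) - y i)^2)" by (intro per_intros y)
    from tsum_shift[OF this, of "int k"] have "tsum n (%i. (y (i - int k) - y i)^2) = tsum n (%i. (y (i + int k) - y i)^2)"
      by (simp add: power2_commute)
    also have "... \<le> (real k)^2 * grad2 n y" by (rule shift_diff[OF n y])
    also have "... \<le> (2 * real w)^2 * grad2 n y" using that by (intro mult_right_mono power_mono grad2_nonneg) auto
    finally show ?thesis .
  qed
  have "tsum n (%i. (tentl w y i - y i)^2) \<le> (\<Sum>t\<in>?I. 1 / (real w)^2 * tsum n (%i. (y (i - int (fst t + snd t)) - y i)^2))"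
    unfolding tsum_cmult[symmetric] tsum_sum[symmetric] by (rule tsum_mono) (rule pt)
  also have "... \<le> (\<Sum>t\<in>?I. 1 / (real w)^2 * ((2 * real w)^2 * grad2 n y))"
    by (intro sum_mono mult_left_mono sh) auto
  also have "... = (2 * real w)^2 * grad2 n y" unfolding sum_distrib_right[symmetric] W by simp
  finally show ?thesis .
qed

text \<open>At the cost of gradients the three block averages are replaced by \<open>y i\<close>.
  Since \<open>Z\<close> sums to zero, \<open>y i ^ 3\<close> may be lowered by
  \<open>m ^ 3\<close>. The part \<open>K * (y i - m)\<close> of \<open>Z\<close> then has the
  favourable sign by monotonicity of the cube, so that outside \<open>Z\<close> the constant
  \<open>K\<close> appears only multiplied by \<open>e\<close>. The fields free of \<open>K\<close>
  are split off with the parameter \<open>s\<close>.\<close>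

lemma Y3_bound:
  assumes n: "n > 0" and w: "w > 0" and x: "per n x" "!!i. \<bar>x i\<bar> \<le> 1" and c: "0 \<le> c" "0 \<le> K" and s: "s > 0"
  defines "e \<equiv> real w / real n" and "y \<equiv> tent w x" and "Z \<equiv> Zt n w c K x" and "Z' \<equiv> (%i. c * z1 n x i + z3 n x i)"
  shows "- tsum n (%i. tentl w x (i - 1) * y i * y (i + 1) * Z i)
    \<le> e * tsum n (%i. (Z i)^2) + (5/2 * e + 6 * K * e + 3/2 * s) * Dsp n w x + 3 / (2 * s) * tsum n (%i. (Z' i)^2)"
proof -
  define m where "m = mg n x"
  have e: "e > 0" using n w by (simp add: e_def)
  have py: "per n y" unfolding y_def by (rule per_tent[OF x(1)])
  have y1: "\<bar>y i\<bar> \<le> 1" for i unfolding y_def by (rule tent_abs[OF x(2) w])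
  have my: "mg n y = m" unfolding y_def m_def by (rule mg_tent[OF w n x(1)])
  have m1: "\<bar>m\<bar> \<le> 1"
  proof -
    have "\<bar>tsum n x\<bar> \<le> tsum n (%i. 1)" by (rule order_trans[OF tsum_abs_le], rule tsum_mono) (rule x)
    then show ?thesis unfolding m_def mg_def using n by (simp add: tsum_const)
  qed
  define ysq where "ysq = tsum n (%i. (y i - m)^2)"
  have ysq: "ysq \<le> Dsp n w x" using poincare[OF n py] unfolding my ysq_def Dsp_def y_def[symmetric] .
  have tl: "tentl w x (i - 1) = y (i + 1 - 2 * int w)" for i unfolding tentl_tent[OF w] y_def by (simp add: algebra_simps)
  have wg: "(real w)^2 * grad2 n y = e^2 * Dsp n w x" using n by (simp add: Dsp_def e_def y_def power_divide)
  let ?d1 = "%i. y (i + 1 - 2 * int w) - y i" and ?d2 = "%i. y (i + 1) - y i"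
  have pt: "- (tentl w x (i - 1) * y i * y (i + 1) * Z i) \<le> - ((y i)^3 * Z i) + (e * (Z i)^2 + ((?d1 i)^2 + (?d2 i)^2) / (2 * e))" for i
  proof -
    define u where "u = y (i + 1 - 2 * int w)"
    have "u * y i * y (i + 1) - (y i)^3 = (u - y i) * (y i * y (i + 1)) + (y (i + 1) - y i) * (y i * y i)" by (simp add: power3_eq_cube algebra_simps)
    then have eq: "u * y i * y (i + 1) * Z i = (y i)^3 * Z i + (Z i * ((u - y i) * (y i * y (i + 1))) + Z i * ((y (i + 1) - y i) * (y i * y i)))"
      by (simp add: algebra_simps)
    have a1: "\<bar>Z i * ((u - y i) * (y i * y (i + 1)))\<bar> \<le> e / 2 * (Z i)^2 + (u - y i)^2 / (2 * e)"
    proof -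
      have "((u - y i) * (y i * y (i + 1)))^2 \<le> (u - y i)^2" by (rule sq_mult_le1[OF abs_mult_le1[OF y1 y1]])
      then have "((u - y i) * (y i * y (i + 1)))^2 / (2 * e) \<le> (u - y i)^2 / (2 * e)" using e by (intro divide_right_mono) auto
      then show ?thesis using amgm[OF e, of "Z i" "(u - y i) * (y i * y (i + 1))"] by linarith
    qed
    have a2: "\<bar>Z i * ((y (i + 1) - y i) * (y i * y i))\<bar> \<le> e / 2 * (Z i)^2 + (y (i + 1) - y i)^2 / (2 * e)"
    proof -
      have "((y (i + 1) - y i) * (y i * y i))^2 \<le> (y (i + 1) - y i)^2" by (rule sq_mult_le1[OF abs_mult_le1[OF y1 y1]])
      then have "((y (i + 1) - y i) * (y i * y i))^2 / (2 * e) \<le> (y (i + 1) - y i)^2 / (2 * e)" using e by (intro divide_right_mono) auto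
      then show ?thesis using amgm[OF e, of "Z i" "(y (i + 1) - y i) * (y i * y i)"] by linarith
    qed
    have "- (A + (X + Y)) \<le> - A + (e * z + (p + q) / (2 * e))" if "\<bar>X\<bar> \<le> e / 2 * z + p / (2 * e)" "\<bar>Y\<bar> \<le> e / 2 * z + q / (2 * e)" for A X Y z p q
      using that by (simp add: add_divide_distrib)
    from this[OF a1 a2] show ?thesis unfolding tl u_def[symmetric] eq .
  qed
  have d1: "tsum n (%i. (?d1 i)^2) \<le> 4 * (e^2 * Dsp n w x)"
  proof -
    have "per n (%i. (?d1 i)^2)"
    proof -
      have "per n (%i. y (i + (1 - 2 * int w)))" by (intro per_shift py)
      then have "per n (%i. y (i + 1 - 2 * int w))" by (simp add: algebra_simps)
      then show ?thesis by (intro per_pow per_diff py)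
    qed
    from tsum_shift[OF this, of "int (2 * w - 1)"] have "tsum n (%i. (?d1 i)^2) = tsum n (%i. (y (i + int (2 * w - 1)) - y i)^2)"
      using w by (simp add: power2_commute algebra_simps of_nat_diff)
    also have "... \<le> (real (2 * w - 1))^2 * grad2 n y" by (rule shift_diff[OF n py])
    also have "... \<le> (2 * real w)^2 * grad2 n y" using w by (intro mult_right_mono power_mono grad2_nonneg) auto
    also have "... = 4 * (e^2 * Dsp n w x)" unfolding wg[symmetric] by (simp add: power_mult_distrib)
    finally show ?thesis .
  qed
  have d2: "tsum n (%i. (?d2 i)^2) \<le> e^2 * Dsp n w x"
  proof -
    have "1 * grad2 n y \<le> (real w)^2 * grad2 n y" using w by (intro mult_right_mono grad2_nonneg) auto
    then show ?thesis unfolding wg unfolding grad2_def by simp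
  qed
  have A: "- tsum n (%i. tentl w x (i - 1) * y i * y (i + 1) * Z i) \<le> - tsum n (%i. (y i)^3 * Z i) + e * tsum n (%i. (Z i)^2) + 5/2 * e * Dsp n w x"
  proof -
    have "- tsum n (%i. tentl w x (i - 1) * y i * y (i + 1) * Z i) \<le> tsum n (%i. - ((y i)^3 * Z i) + (e * (Z i)^2 + ((?d1 i)^2 + (?d2 i)^2) / (2 * e)))"
      unfolding tsum_uminus[symmetric] by (rule tsum_mono) (rule pt)
    also have "... = - tsum n (%i. (y i)^3 * Z i) + (e * tsum n (%i. (Z i)^2) + (tsum n (%i. (?d1 i)^2) + tsum n (%i. (?d2 i)^2)) / (2 * e))"
      by (simp only: tsum_add tsum_uminus tsum_cmult tsum_cdiv)
    also have "(tsum n (%i. (?d1 i)^2) + tsum n (%i. (?d2 i)^2)) / (2 * e) \<le> (5 * (e^2 * Dsp n w x)) / (2 * e)"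
      using d1 d2 e by (intro divide_right_mono) auto
    also have "... = 5/2 * e * Dsp n w x" using e by (simp add: power2_eq_square)
    finally show ?thesis by simp
  qed
  have Zz: "tsum n Z = 0" unfolding Z_def by (rule tsum_z[OF n w])
  have "tsum n (%i. (y i)^3 * Z i) = tsum n (%i. ((y i)^3 - m^3) * Z i + m^3 * Z i)" by (rule tsum_cong) (simp add: algebra_simps)
  then have B0: "tsum n (%i. (y i)^3 * Z i) = tsum n (%i. ((y i)^3 - m^3) * Z i)"
    using Zz by (simp add: tsum_add tsum_cmult)
  have ptB: "- (((y i)^3 - m^3) * Z i) \<le> K * (3 * e * (y i - m)^2 + 3 / (4 * e) * (tentl w y i - y i)^2) + (3/2 * s * (y i - m)^2 + 3 / (2 * s) * (Z' i)^2)" for i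
  proof -
    define q where "q = (y i)^3 - m^3"
    define v where "v = y i - m"
    note q = cube_diff[OF y1[of i] m1, folded q_def v_def]
    \<comment> \<open>The first summand has a sign; the second is a difference on the block scale,
      controlled by \<open>e\<close>; the third is free of \<open>K\<close>.\<close>
    have Zi: "Z i = K * v + K * (tentl w y i - y i) + Z' i"
      unfolding Z_def Zt_def Z'_def z2_eq(2)[OF n w x(1)] v_def m_def[symmetric] y_def by (simp add: algebra_simps)
    have t1: "\<bar>q * (tentl w y i - y i)\<bar> \<le> 3 * e * v^2 + 3 / (4 * e) * (tentl w y i - y i)^2"
    proof -
      have "\<bar>q * (tentl w y i - y i)\<bar> \<le> 3 * \<bar>v * (tentl w y i - y i)\<bar>" unfolding abs_mult using q(1) by (simp add: mult_right_mono mult.assoc[symmetric])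
      also have "... \<le> 3 * ((2 * e) / 2 * v^2 + (tentl w y i - y i)^2 / (2 * (2 * e)))" using amgm[of "2 * e" v "tentl w y i - y i"] e by simp
      finally show ?thesis using e by (simp add: field_simps)
    qed
    have t2: "\<bar>q * Z' i\<bar> \<le> 3/2 * s * v^2 + 3 / (2 * s) * (Z' i)^2"
    proof -
      have "\<bar>q * Z' i\<bar> \<le> 3 * \<bar>v * Z' i\<bar>" unfolding abs_mult using q(1) by (simp add: mult_right_mono mult.assoc[symmetric])
      also have "... \<le> 3 * (s / 2 * v^2 + (Z' i)^2 / (2 * s))" using amgm[OF s, of v "Z' i"] by simp
      finally show ?thesis using s by (simp add: field_simps)
    qed
    have "- (q * Z i) = - (K * (q * v)) - K * (q * (tentl w y i - y i)) - q * Z' i" unfolding Zi by (simp add: algebra_simps)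
    moreover have "0 \<le> K * (q * v)" using q(2) c by simp
    moreover have "- (K * (q * (tentl w y i - y i))) \<le> K * (3 * e * v^2 + 3 / (4 * e) * (tentl w y i - y i)^2)"
    proof -
      have "K * (- (q * (tentl w y i - y i))) \<le> K * (3 * e * v^2 + 3 / (4 * e) * (tentl w y i - y i)^2)" using t1 c(2) by (intro mult_left_mono) linarith+
      then show ?thesis by simp
    qed
    moreover have "- (q * Z' i) \<le> 3/2 * s * v^2 + 3 / (2 * s) * (Z' i)^2" using t2 by linarith
    ultimately show ?thesis unfolding q_def[symmetric] v_def[symmetric] by linarith
  qed
  have "- tsum n (%i. (y i)^3 * Z i) \<le> tsum n (%i. K * (3 * e * (y i - m)^2 + 3 / (4 * e) * (tentl w y i - y i)^2) + (3/2 * s * (y i - m)^2 + 3 / (2 * s) * (Z' i)^2))"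
    unfolding B0 tsum_uminus[symmetric] by (rule tsum_mono) (rule ptB)
  also have "... = K * (3 * e * ysq + 3 / (4 * e) * tsum n (%i. (tentl w y i - y i)^2)) + (3/2 * s * ysq + 3 / (2 * s) * tsum n (%i. (Z' i)^2))"
    unfolding ysq_def by (simp only: tsum_add tsum_cmult)
  also have "... \<le> K * (6 * e * Dsp n w x) + (3/2 * s * Dsp n w x + 3 / (2 * s) * tsum n (%i. (Z' i)^2))"
  proof -
    have "tsum n (%i. (tentl w y i - y i)^2) \<le> 4 * (e^2 * Dsp n w x)"
      using tentl_diff[OF n py w] unfolding wg[symmetric] by (simp add: power_mult_distrib)
    then have "3 / (4 * e) * tsum n (%i. (tentl w y i - y i)^2) \<le> 3 / (4 * e) * (4 * (e^2 * Dsp n w x))" using e by (intro mult_left_mono) auto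
    also have "... = 3 * e * Dsp n w x" using e by (simp add: power2_eq_square)
    finally have td: "3 / (4 * e) * tsum n (%i. (tentl w y i - y i)^2) \<le> 3 * e * Dsp n w x" .
    have "3 * e * ysq + 3 / (4 * e) * tsum n (%i. (tentl w y i - y i)^2) \<le> 6 * e * Dsp n w x"
    proof -
      have "3 * e * ysq \<le> 3 * e * Dsp n w x" by (rule mult_left_mono[OF ysq]) (use e in simp)
      then show ?thesis using td by linarith
    qed
    then have "K * (3 * e * ysq + 3 / (4 * e) * tsum n (%i. (tentl w y i - y i)^2)) \<le> K * (6 * e * Dsp n w x)" by (rule mult_left_mono[OF _ c(2)])
    moreover have "3/2 * s * ysq \<le> 3/2 * s * Dsp n w x" using ysq s by (intro mult_left_mono) auto
    ultimately show ?thesis by linarith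
  qed
  finally show ?thesis using A by (simp add: algebra_simps)
qed

section \<open>The static estimate\<close>

context pmfn
begin

lemma EE_le: "(!!cf. cf \<in> Omega n ==> F cf \<le> G cf) ==> EE n p F \<le> EE n p G"
  by (rule EE_mono[OF p0])

lemma EE_c: "EE n p (%cf. c) = c" by (rule EE_const[OF p1])

lemma Dsp_ge: assumes "w > 0" shows "tsum n (%i. (tent w (x cf) i - mg n (x cf))^2) \<le> Dsp n w (x cf)"
  using poincare[OF npos per_tent[OF per_fld], of w cf] unfolding mg_tent[OF assms npos per_fld] Dsp_def .

text \<open>After the replacement the centred two-point sum is a correlation of deviations of two
  block averages from the mean, hence at most their variance, which \<open>poincare\<close> bounds
  by \<open>Dsp\<close>. The prefactor is at most 8, and it is of order \<open>m^2\<close>, so the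
  cost of the moves is quartic.\<close>

lemma W_est:
  assumes w: "w > 0" "4 * w + 6 < n" and \<beta>: "\<beta> > 0" and k: "k = 1 \<or> k = 2"
  defines "q \<equiv> (2 * real w)^2 / (\<beta> * (real n)^2)"
  shows "EE n p (%cf. (cosh (2 * mg n (x cf)) - 1) * W2f n k (x cf))
    \<le> 2 * (\<beta> * Dex n p) + 128 * q * EE n p (%cf. real n * (mg n (x cf))^4) + 8 * EE n p (%cf. Dsp n w (x cf))"
proof -
  define b where "b cf = cosh (2 * mg n (x cf)) - 1" for cf
  have bexc: "b (exc n cf c) = b cf" for cf c unfolding b_def mg_exc[OF n2] ..
  have q0: "q \<ge> 0" unfolding q_def using \<beta> by simp
  have bb: "0 \<le> b cf" "b cf \<le> 8 * (mg n (x cf))^2" "b cf \<le> 8" if "cf \<in> Omega n" for cf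
  proof -
    have m1: "\<bar>mg n (x cf)\<bar> \<le> 1" by (rule mg_abs[OF that npos])
    show "0 \<le> b cf" "b cf \<le> 8 * (mg n (x cf))^2" using cosh_sinh_bounds[OF m1] unfolding b_def by auto
    moreover have "(mg n (x cf))^2 \<le> 1" using m1 abs_square_le_1 by auto
    ultimately show "b cf \<le> 8" by linarith
  qed
  have sqb: "EE n p (%cf. real n * (b cf)^2) \<le> 64 * EE n p (%cf. real n * (mg n (x cf))^4)"
    unfolding EE_cmult[symmetric]
  proof (rule EE_le)
    fix cf assume e: "cf \<in> Omega n"
    have "(b cf)^2 \<le> (8 * (mg n (x cf))^2)^2" using bb[OF e] by (intro power_mono) auto
    also have "... = 64 * (mg n (x cf))^4" by (simp add: power_mult_distrib flip: power_mult)
    finally have "real n * (b cf)^2 \<le> real n * (64 * (mg n (x cf))^4)" by (intro mult_left_mono) auto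
    then show "real n * (b cf)^2 \<le> 64 * (real n * (mg n (x cf))^4)" by simp
  qed
  have pt: "b cf * tsum n (%i. tentl w (x cf) i * tent w (x cf) (i + k)) - b cf * (real n * (mg n (x cf))^2) \<le> 8 * Dsp n w (x cf)" if e: "cf \<in> Omega n" for cf
  proof -
    define m where "m = mg n (x cf)"
    define y where "y = tent w (x cf)"
    have py: "per n y" unfolding y_def by (rule per_tent[OF per_fld])
    have my: "tsum n y = real n * m" using mg_tent[OF w(1) npos per_fld, of cf] npos unfolding y_def m_def by (simp add: mg_def field_simps)
    define o' where "o' = 2 * int w - 2"
    have s1: "tsum n (%i. y (i - o')) = real n * m" using tsum_shift'[OF py] my by simp
    have s2: "tsum n (%i. y (i + k)) = real n * m" using tsum_shift[OF py] my by simp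
    have pv: "per n (%i. (y i - m)^2)" by (intro per_intros py)
    define V where "V = tsum n (%i. (y i - m)^2)"
    have VD: "V \<le> Dsp n w (x cf)" using Dsp_ge[OF w(1)] unfolding V_def y_def m_def .
    have V0: "V \<ge> 0" unfolding V_def by (rule tsum_nonneg) simp
    have "tsum n (%i. y (i - o') * y (i + k)) = tsum n (%i. (y (i - o') - m) * (y (i + k) - m) + m * y (i - o') + m * y (i + k) - m * m)"
      by (rule tsum_cong) (simp add: algebra_simps)
    also have "... = tsum n (%i. (y (i - o') - m) * (y (i + k) - m)) + m * (real n * m) + m * (real n * m) - real n * (m * m)"
      unfolding tsum_add tsum_diff tsum_cmult s1 s2 tsum_const by simp
    finally have eq: "tsum n (%i. y (i - o') * y (i + k)) - real n * m^2 = tsum n (%i. (y (i - o') - m) * (y (i + k) - m))"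
      by (simp add: power2_eq_square)
    have "tsum n (%i. (y (i - o') - m) * (y (i + k) - m)) \<le> tsum n (%i. (1/2) * (y (i - o') - m)^2 + (1/2) * (y (i + k) - m)^2)"
    proof (rule tsum_mono)
      fix i show "(y (i - o') - m) * (y (i + k) - m) \<le> (1/2) * (y (i - o') - m)^2 + (1/2) * (y (i + k) - m)^2"
        using abs_ge_self[of "(y (i - o') - m) * (y (i + k) - m)"] amgm[of 1 "y (i - o') - m" "y (i + k) - m"] by linarith
    qed
    also have "... = (1/2) * V + (1/2) * V" unfolding tsum_add tsum_cmult V_def using tsum_shift[OF pv, of k] tsum_shift'[OF pv, of o'] by simp
    finally have X: "tsum n (%i. y (i - o') * y (i + k)) - real n * m^2 \<le> V" unfolding eq by simp
    have "b cf * (tsum n (%i. y (i - o') * y (i + k)) - real n * m^2) \<le> b cf * V" by (rule mult_left_mono[OF X bb(1)[OF e]])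
    also have "... \<le> 8 * V" by (rule mult_right_mono[OF bb(3)[OF e] V0])
    also have "... \<le> 8 * Dsp n w (x cf)" using VD by simp
    finally show ?thesis unfolding tentl_tent[OF w(1)] o'_def y_def m_def by (simp add: right_diff_distrib)
  qed
  have "EE n p (%cf. b cf * W2f n k (x cf)) = (EE n p (%cf. b cf * tsum n (%i. x cf i * x cf (i + k))) - EE n p (%cf. b cf * tsum n (%i. tentl w (x cf) i * tent w (x cf) (i + k))))
     + EE n p (%cf. b cf * tsum n (%i. tentl w (x cf) i * tent w (x cf) (i + k)) - b cf * (real n * (mg n (x cf))^2))"
    unfolding right_diff_distrib EE_diff by simp
  moreover have "EE n p (%cf. b cf * tsum n (%i. tentl w (x cf) i * tent w (x cf) (i + k)) - b cf * (real n * (mg n (x cf))^2)) \<le> 8 * EE n p (%cf. Dsp n w (x cf))"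
    unfolding EE_cmult[symmetric] by (rule EE_le[OF pt])
  moreover have "EE n p (%cf. b cf * tsum n (%i. x cf i * x cf (i + k))) - EE n p (%cf. b cf * tsum n (%i. tentl w (x cf) i * tent w (x cf) (i + k)))
     \<le> 2 * (\<beta> * Dex n p + q * EE n p (%cf. real n * (b cf)^2))"
    using W2_moves[OF w \<beta> k, of b] bexc unfolding q_def by (auto simp: abs_le_iff)
  moreover have "q * EE n p (%cf. real n * (b cf)^2) \<le> q * (64 * EE n p (%cf. real n * (mg n (x cf))^4))" by (rule mult_left_mono[OF sqb q0])
  ultimately show ?thesis unfolding b_def[symmetric] by argo
qed

text \<open>The moves of the two left spins cost a multiple of \<open>n * b^2\<close>, which is of
  order \<open>P0\<close> and is not dissipated; it must carry a factor \<open>1 / sqrt n\<close> to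
  survive the time scale. This limits \<open>l\<close> from above, while the variation term
  \<open>n * b / l\<close> limits it from below: \<open>l\<close> is of order
  \<open>n powr (3/4)\<close>. The last spin may be moved over the macroscopic distance
  \<open>w\<close>, since the square in its prefactor makes the cost comparable with the
  sink.\<close>

lemma S3_est:
  assumes w: "w > 0" and l: "l > 0" and wl: "4 * w + 4 * l + 8 < n" and \<beta>: "\<beta> > 0" and \<kappa>: "\<kappa> \<ge> 1"
    and l2: "(real l)^2 \<le> real n * sqrt (real n)" and l1: "(real n / real l)^2 \<le> 4 * sqrt (real n)"
  defines "q \<equiv> (2 * real w)^2 / (\<beta> * (real n)^2)"
  assumes q: "400 * q * \<kappa> \<le> 1"
  shows "- EE n p (%cf. (sinh (2 * mg n (x cf)) + 4 * \<kappa> * mg n (x cf)) * S3f n (x cf))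
    \<le> 3 * \<beta> * Dex n p - 2 * \<kappa> * EE n p (%cf. real n * (mg n (x cf))^4) + 100 * \<kappa> * EE n p (%cf. Dsp n w (x cf))
      + (3200 * \<kappa>^2 / \<beta> + 80 * \<kappa>) / sqrt (real n) * EE n p (%cf. P0 n (x cf)) + 80 * \<kappa>"
proof -
  define m where "m cf = mg n (x cf)" for cf
  define b where "b cf = sinh (2 * m cf) + 4 * \<kappa> * m cf" for cf
  have bexc: "b (exc n cf c) = b cf" for cf c unfolding b_def m_def mg_exc[OF n2] ..
  define N where "N = real n"
  have N: "N > 0" using npos by (simp add: N_def)
  have q0: "q \<ge> 0" unfolding q_def using \<beta> by simp
  define t where "t cf i = tentl l (x cf) (i - 1)" for cf i
  define \<Lambda> where "\<Lambda> cf = tsum n (%i. (t cf i)^2)" for cf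
  have m1: "\<bar>m cf\<bar> \<le> 1" if "cf \<in> Omega n" for cf unfolding m_def by (rule mg_abs[OF that npos])
  have bm: "4 * \<kappa> * (m cf)^2 \<le> b cf * m cf" "\<bar>b cf\<bar> \<le> 20 * \<kappa> * \<bar>m cf\<bar>" "(b cf)^2 \<le> 400 * \<kappa>^2 * (m cf)^2" if "cf \<in> Omega n" for cf
  proof -
    note cs = cosh_sinh_bounds[OF m1[OF that]]
    have "0 \<le> m cf * sinh (2 * m cf)" using cs(4) by (smt (verit) zero_le_power2)
    then show "4 * \<kappa> * (m cf)^2 \<le> b cf * m cf" unfolding b_def by (simp add: power2_eq_square algebra_simps)
    have "\<bar>b cf\<bar> \<le> \<bar>sinh (2 * m cf)\<bar> + 4 * \<kappa> * \<bar>m cf\<bar>" unfolding b_def using \<kappa> by (simp add: abs_mult order_trans[OF abs_triangle_ineq])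
    also have "... \<le> 16 * (1 * \<bar>m cf\<bar>) + 4 * \<kappa> * \<bar>m cf\<bar>" using cs(5) by simp
    also have "... \<le> 16 * (\<kappa> * \<bar>m cf\<bar>) + 4 * \<kappa> * \<bar>m cf\<bar>" using \<kappa> by (intro add_mono mult_left_mono mult_right_mono) auto
    finally show B: "\<bar>b cf\<bar> \<le> 20 * \<kappa> * \<bar>m cf\<bar>" by simp
    have "(b cf)^2 \<le> (20 * \<kappa> * \<bar>m cf\<bar>)^2" using power_mono[OF B, of 2] by simp
    then show "(b cf)^2 \<le> 400 * \<kappa>^2 * (m cf)^2" by (simp add: power_mult_distrib)
  qed
  have tt: "t cf i = tent l (x cf) (i + (1 - 2 * int l))" for cf i unfolding t_def tentl_tent[OF l] by (simp add: algebra_simps)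
  have t1: "(t cf i)^2 \<le> 1" if "cf \<in> Omega n" for cf i
    using tent_fld_abs[OF that npos l] abs_square_le_1 unfolding tt by auto
  \<comment> \<open>Cauchy--Schwarz; this later converts the sink \<open>m^2 * \<Lambda>\<close>
    into \<open>n * m^4\<close>.\<close>
  have \<Lambda>m: "N * (m cf)^2 \<le> \<Lambda> cf" for cf
  proof -
    have "tsum n (t cf) = tsum n (tent l (x cf))" unfolding tt[abs_def] by (rule tsum_shift[OF per_tent[OF per_fld]])
    also have "... = N * m cf" using mg_tent[OF l npos per_fld, of cf] npos unfolding m_def N_def by (simp add: mg_def field_simps)
    finally have s: "tsum n (t cf) = N * m cf" .
    have "(tsum n (%i. 1 * t cf i))^2 \<le> tsum n (%i. 1^2) * \<Lambda> cf" unfolding \<Lambda>_def by (rule tsum_CS)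
    then have "N * (N * (m cf)^2) \<le> N * \<Lambda> cf" unfolding tsum_const using s by (simp add: N_def power_mult_distrib power2_eq_square mult_ac)
    then show ?thesis using N by simp
  qed
  have pt: "- (b cf * tsum n (%i. (t cf i)^2 * tent w (x cf) (i + 1))) \<le> - (3 * \<kappa> * (m cf)^2 * \<Lambda> cf) + 100 * \<kappa> * Dsp n w (x cf)" if e: "cf \<in> Omega n" for cf
  proof -
    define d where "d i = tent w (x cf) i - m cf" for i
    have pd: "per n (%i. (d i)^2)" unfolding d_def by (intro per_intros per_tent per_fld)
    have "- (b cf * ((t cf i)^2 * tent w (x cf) (i + 1))) \<le> - (3 * \<kappa> * (m cf)^2) * (t cf i)^2 + 100 * \<kappa> * (d (i + 1))^2" for i
    proof -
      have "- (b cf * (m cf + d (i + 1))) \<le> - (3 * \<kappa> * (m cf)^2) + 100 * \<kappa> * (d (i + 1))^2"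
      proof -
        have "\<bar>b cf * d (i + 1)\<bar> \<le> 20 * \<kappa> * \<bar>m cf\<bar> * \<bar>d (i + 1)\<bar>" unfolding abs_mult by (rule mult_right_mono[OF bm(2)[OF e]]) simp
        also have "... = 20 * \<kappa> * \<bar>m cf * d (i + 1)\<bar>" by (simp add: abs_mult)
        \<comment> \<open>The weight \<open>1/10\<close> spends one of the four units
          \<open>\<kappa> * m^2\<close> available.\<close>
        also have "... \<le> 20 * \<kappa> * ((1/10) / 2 * (m cf)^2 + (d (i + 1))^2 / (2 * (1/10)))" using \<kappa> by (intro mult_left_mono amgm) auto
        also have "... = \<kappa> * (m cf)^2 + 100 * \<kappa> * (d (i + 1))^2" by (simp add: algebra_simps)
        finally have "- (b cf * d (i + 1)) \<le> \<kappa> * (m cf)^2 + 100 * \<kappa> * (d (i + 1))^2" by linarith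
        then show ?thesis using bm(1)[OF e] by (simp add: distrib_left)
      qed
      then have "(t cf i)^2 * (- (b cf * (m cf + d (i + 1)))) \<le> (t cf i)^2 * (- (3 * \<kappa> * (m cf)^2) + 100 * \<kappa> * (d (i + 1))^2)" by (rule mult_left_mono) simp
      also have "... = - (3 * \<kappa> * (m cf)^2) * (t cf i)^2 + (t cf i)^2 * (100 * \<kappa> * (d (i + 1))^2)" by (simp add: algebra_simps)
      also have "(t cf i)^2 * (100 * \<kappa> * (d (i + 1))^2) \<le> 1 * (100 * \<kappa> * (d (i + 1))^2)" using t1[OF e, of i] \<kappa> by (intro mult_right_mono) auto
      finally show ?thesis by (simp add: d_def mult_ac)
    qed
    then have "tsum n (%i. - (b cf * ((t cf i)^2 * tent w (x cf) (i + 1)))) \<le> tsum n (%i. - (3 * \<kappa> * (m cf)^2) * (t cf i)^2 + 100 * \<kappa> * (d (i + 1))^2)"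
      by (intro tsum_mono)
    also have "... = - (3 * \<kappa> * (m cf)^2) * \<Lambda> cf + 100 * \<kappa> * tsum n (%i. (d i)^2)"
      unfolding \<Lambda>_def tsum_add tsum_cmult using tsum_shift[OF pd, of 1] by simp
    also have "tsum n (%i. (d i)^2) \<le> Dsp n w (x cf)" unfolding d_def m_def by (rule Dsp_ge[OF w])
    finally show ?thesis using \<kappa> by (simp add: tsum_uminus tsum_cmult)
  qed
  define S where "S = EE n p (%cf. b cf * S3f n (x cf))"
  define S' where "S' = EE n p (%cf. b cf * tsum n (%i. (t cf i)^2 * tent w (x cf) (i + 1)))"
  define M2 where "M2 = EE n p (%cf. (m cf)^2 * \<Lambda> cf)"
  define E4 where "E4 = EE n p (%cf. real n * (m cf)^4)"
  define EP where "EP = EE n p (%cf. P0 n (x cf))"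
  define ED where "ED = EE n p (%cf. Dsp n w (x cf))"
  have mv: "\<bar>S - S'\<bar> \<le> 3 * \<beta> * Dex n p + 2 * ((2 * real l)^2 / (\<beta> * (real n)^2)) * EE n p (%cf. real n * (b cf)^2)
      + 4 / real l * EE n p (%cf. real n * \<bar>b cf\<bar>) + q * EE n p (%cf. (b cf)^2 * \<Lambda> cf)"
    unfolding S_def S'_def q_def \<Lambda>_def t_def by (rule S3_moves[OF w l wl \<beta> bexc])
  have S': "- S' \<le> - (3 * \<kappa> * M2) + 100 * \<kappa> * ED"
  proof -
    have "- S' \<le> EE n p (%cf. - (3 * \<kappa>) * ((m cf)^2 * \<Lambda> cf) + 100 * \<kappa> * Dsp n w (x cf))"
      unfolding S'_def EE_uminus[symmetric] by (rule EE_le) (use pt in \<open>simp add: mult.assoc\<close>)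
    then show ?thesis unfolding EE_add EE_cmult M2_def ED_def by simp
  qed
  have M2: "E4 \<le> M2" unfolding E4_def M2_def
  proof (rule EE_le)
    fix cf show "real n * (m cf)^4 \<le> (m cf)^2 * \<Lambda> cf"
      using mult_left_mono[OF \<Lambda>m[of cf], of "(m cf)^2"] by (simp add: N_def power2_eq_square power4_eq_xxxx mult_ac)
  qed
  have P0m: "P0 n (x cf) = N * (m cf)^2" for cf unfolding N_def m_def by (rule P0_eq[OF npos])
  have b2: "EE n p (%cf. real n * (b cf)^2) \<le> 400 * \<kappa>^2 * EP" unfolding EP_def EE_cmult[symmetric]
  proof (rule EE_le)
    fix cf assume "cf \<in> Omega n"
    from mult_left_mono[OF bm(3)[OF this], of "real n"] show "real n * (b cf)^2 \<le> 400 * \<kappa>^2 * P0 n (x cf)"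
      unfolding P0m N_def by (simp add: mult_ac)
  qed
  have EP0: "0 \<le> EP" unfolding EP_def by (rule EE_nonneg[OF p0 P_nonneg(1)])
  have c1: "2 * ((2 * real l)^2 / (\<beta> * (real n)^2)) * EE n p (%cf. real n * (b cf)^2) \<le> 3200 * \<kappa>^2 / \<beta> / sqrt N * EP"
  proof -
    have "(2 * real l)^2 / (\<beta> * (real n)^2) = 4 * (real l)^2 / (\<beta> * N^2)" by (simp add: N_def power_mult_distrib)
    also have "... \<le> 4 * (N * sqrt N) / (\<beta> * N^2)" using l2 \<beta> N unfolding N_def by (intro divide_right_mono mult_left_mono) auto
    also have "... = 4 / (\<beta> * sqrt N)" using N \<beta> by (simp add: field_simps power2_eq_square)
    finally have "2 * ((2 * real l)^2 / (\<beta> * (real n)^2)) * EE n p (%cf. real n * (b cf)^2) \<le> 2 * (4 / (\<beta> * sqrt N)) * (400 * \<kappa>^2 * EP)"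
      using b2 \<beta> N by (intro mult_mono mult_left_mono EE_nonneg[OF p0]) auto
    then show ?thesis by (simp add: mult_ac)
  qed
  have c2: "4 / real l * EE n p (%cf. real n * \<bar>b cf\<bar>) \<le> 80 * \<kappa> / sqrt N * EP + 80 * \<kappa>"
  proof -
    have "4 / real l * (real n * \<bar>b cf\<bar>) \<le> 80 * \<kappa> / sqrt N * P0 n (x cf) + 80 * \<kappa>" if e: "cf \<in> Omega n" for cf
    proof -
      define r where "r = N / real l"
      have r: "r \<ge> 0" "r^2 \<le> 4 * sqrt N" using l1 N l unfolding r_def N_def by auto
      have "4 / real l * (real n * \<bar>b cf\<bar>) = 4 * r * \<bar>b cf\<bar>" by (simp add: r_def N_def)
      also have "... \<le> 4 * r * (20 * \<kappa> * \<bar>m cf\<bar>)" using r by (intro mult_left_mono bm(2)[OF e]) auto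
      also have "... = 80 * \<kappa> * \<bar>r * m cf\<bar>" using r by (simp add: abs_mult)
      also have "... \<le> 80 * \<kappa> * (sqrt N * (m cf)^2 + 1)"
      proof (rule mult_left_mono)
        have "\<bar>r * m cf\<bar> \<le> (1/2) / 2 * (r * m cf)^2 + 1^2 / (2 * (1/2))" using amgm[of "1/2" "r * m cf" 1] by simp
        also have "(r * m cf)^2 \<le> 4 * sqrt N * (m cf)^2" unfolding power_mult_distrib by (rule mult_right_mono[OF r(2)]) simp
        finally show "\<bar>r * m cf\<bar> \<le> sqrt N * (m cf)^2 + 1" by simp
      qed (use \<kappa> in simp)
      also have "sqrt N * (m cf)^2 = P0 n (x cf) / sqrt N" unfolding P0m using N by (simp add: field_simps)
      finally show ?thesis by (simp add: algebra_simps)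
    qed
    then have "EE n p (%cf. 4 / real l * (real n * \<bar>b cf\<bar>)) \<le> EE n p (%cf. 80 * \<kappa> / sqrt N * P0 n (x cf) + 80 * \<kappa>)" by (rule EE_le)
    then show ?thesis unfolding EE_add EE_cmult EE_c EP_def .
  qed
  \<comment> \<open>Smallness of \<open>q\<close> lets one further unit of the sink pay for the last
    move, so two of the remaining three are left.\<close>
  have c3: "q * EE n p (%cf. (b cf)^2 * \<Lambda> cf) \<le> \<kappa> * M2"
  proof -
    have \<Lambda>0: "0 \<le> \<Lambda> cf" for cf unfolding \<Lambda>_def by (rule tsum_nonneg) simp
    have "EE n p (%cf. (b cf)^2 * \<Lambda> cf) \<le> 400 * \<kappa>^2 * M2" unfolding M2_def EE_cmult[symmetric]
    proof (rule EE_le)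
      fix cf assume "cf \<in> Omega n"
      from mult_right_mono[OF bm(3)[OF this] \<Lambda>0[of cf]] show "(b cf)^2 * \<Lambda> cf \<le> 400 * \<kappa>^2 * ((m cf)^2 * \<Lambda> cf)" by (simp add: mult.assoc)
    qed
    then have "q * EE n p (%cf. (b cf)^2 * \<Lambda> cf) \<le> q * (400 * \<kappa>^2 * M2)" by (rule mult_left_mono[OF _ q0])
    also have "... = (400 * q * \<kappa>) * (\<kappa> * M2)" by (simp add: power2_eq_square)
    also have "... \<le> 1 * (\<kappa> * M2)"
    proof (rule mult_right_mono[OF q])
      have "0 \<le> M2" unfolding M2_def by (rule EE_nonneg[OF p0]) (use \<Lambda>0 in auto)
      then show "0 \<le> \<kappa> * M2" using \<kappa> by simp
    qed
    finally show ?thesis by simp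
  qed
  have "2 * \<kappa> * E4 \<le> 2 * \<kappa> * M2" using M2 \<kappa> by (intro mult_left_mono) auto
  moreover have "(3200 * \<kappa>^2 / \<beta> + 80 * \<kappa>) / sqrt N * EP = 3200 * \<kappa>^2 / \<beta> / sqrt N * EP + 80 * \<kappa> / sqrt N * EP"
    by (simp add: add_divide_distrib distrib_right)
  ultimately have "- S \<le> 3 * \<beta> * Dex n p - 2 * \<kappa> * E4 + 100 * \<kappa> * ED + (3200 * \<kappa>^2 / \<beta> + 80 * \<kappa>) / sqrt N * EP + 80 * \<kappa>"
    using mv S' c1 c2 c3 unfolding abs_le_iff by linarith
  then show ?thesis unfolding S_def b_def m_def E4_def ED_def EP_def N_def .
qed

text \<open>Every term that is not constant is charged to \<open>Dex\<close>, \<open>P1\<close> or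
  \<open>Dsp\<close>. In the coefficients of \<open>P1\<close> and \<open>Dsp\<close> the constant
  \<open>K\<close> is always accompanied by \<open>q\<close> or \<open>e\<close>, so a large
  \<open>K\<close> is compatible with a small block fraction.\<close>

lemma Z_est:
  assumes w: "w > 0" "4 * w + 6 < n" and \<beta>: "\<beta> > 0" and c: "0 \<le> c" "c \<le> a" "0 \<le> K" and s: "s > 0" and r: "real n / real w \<le> r"
  defines "q \<equiv> (2 * real w)^2 / (\<beta> * (real n)^2)" and "e \<equiv> real w / real n" and "Cz \<equiv> 2 * (a^2 + 1)" and "Cc \<equiv> 4 * a + 1 + 4 * K * r^2"
  assumes q: "q \<le> 1"
  shows "- EE n p (%cf. cub n (x cf) (Zt n w c K (x cf)))
    \<le> 3 * \<beta> * Dex n p + (12 * q * K^2 + 2 * e * K^2 + 5/2 * e + 6 * K * e + 3/2 * s) * EE n p (%cf. Dsp n w (x cf))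
      + ((12 * q + 2 * e) * Cz + 3 / (2 * s) * Cz) * EE n p (%cf. P1 n (x cf)) + (6 * Cc^2 + 6 * Cc + 24 * r * (a + 1 + 4 * K))"
proof -
  define N where "N = real n"
  have N: "N \<ge> 1" using npos by (simp add: N_def)
  have w0: "real w > 0" using w by simp
  have wn: "w \<le> n" using w by simp
  have e0: "e > 0" unfolding e_def using w npos by simp
  have q0: "q \<ge> 0" unfolding q_def using \<beta> by simp
  have r0: "r \<ge> 0" using r by (smt (verit) divide_nonneg_nonneg of_nat_0_le_iff)
  define C where "C = (4 * c + 1) / (real n)^2 + 4 * K / (real w)^2"
  define B where "B = c + 1 + 4 * K"
  have x1: "\<bar>x cf i\<bar> \<le> 1" if "cf \<in> Omega n" for cf i using fld_abs[OF that npos] by simp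
  have ZB: "\<bar>Zt n w c K (x cf) i\<bar> \<le> B" if "cf \<in> Omega n" for cf i
    unfolding B_def by (rule z_abs[OF npos w(1) x1[OF that] per_fld c(1,3)])
  have ZC: "\<bar>Zt n w c K (x (exc n cf b)) i - Zt n w c K (x cf) i\<bar> \<le> C" if "cf \<in> Omega n" for cf i b
    unfolding C_def by (rule z_exc[OF that n2 w(1) wn c(1,3)])
  define Y where "Y cf = tsum n (%i. tentl w (x cf) (i - 1) * tent w (x cf) i * tent w (x cf) (i + 1) * Zt n w c K (x cf) i)" for cf
  define Zs where "Zs cf = tsum n (%i. (Zt n w c K (x cf) i)^2)" for cf
  define ED where "ED = EE n p (%cf. Dsp n w (x cf))"
  define E1 where "E1 = EE n p (%cf. P1 n (x cf))"
  have mv: "\<bar>EE n p (%cf. cub n (x cf) (Zt n w c K (x cf))) - EE n p Y\<bar> \<le> 3 * \<beta> * Dex n p + 3 * q * EE n p (%cf. 2 * Zs cf + 2 * real n * C^2)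
      + 6 * real w * real n * (C + 4 * B / (real w)^2)"
    unfolding q_def Y_def Zs_def by (rule Z_moves[OF w \<beta> ZB ZC])
  define Z' where "Z' cf i = c * z1 n (x cf) i + z3 n (x cf) i" for cf i
  have Z's: "tsum n (%i. (Z' cf i)^2) \<le> Cz * P1 n (x cf)" for cf
  proof -
    have "tsum n (%i. (Z' cf i)^2) \<le> tsum n (%i. 2 * c^2 * (z1 n (x cf) i)^2 + 2 * (z3 n (x cf) i)^2)"
      unfolding Z'_def
    proof (rule tsum_mono)
      fix i show "(c * z1 n (x cf) i + z3 n (x cf) i)^2 \<le> 2 * c^2 * (z1 n (x cf) i)^2 + 2 * (z3 n (x cf) i)^2"
        using sq_add_le[of "c * z1 n (x cf) i" "z3 n (x cf) i"] by (simp add: power_mult_distrib mult.assoc)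
    qed
    also have "... \<le> 2 * c^2 * P1 n (x cf) + 2 * P1 n (x cf)"
      unfolding tsum_add tsum_cmult by (intro add_mono mult_left_mono z1_sq z3_sq npos per_fld) auto
    also have "... \<le> 2 * a^2 * P1 n (x cf) + 2 * P1 n (x cf)"
      using c by (intro add_mono mult_right_mono mult_left_mono power_mono P_nonneg) auto
    finally show ?thesis unfolding Cz_def by (simp add: algebra_simps)
  qed
  have ZsB: "Zs cf \<le> 2 * Cz * P1 n (x cf) + 2 * K^2 * Dsp n w (x cf)" for cf
  proof -
    have "Zs cf \<le> tsum n (%i. 2 * (Z' cf i)^2 + 2 * K^2 * (z2 n w (x cf) i)^2)"
      unfolding Zs_def Zt_def Z'_def[symmetric]
    proof (rule tsum_mono)
      fix i show "(Z' cf i + K * z2 n w (x cf) i)^2 \<le> 2 * (Z' cf i)^2 + 2 * K^2 * (z2 n w (x cf) i)^2"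
        using sq_add_le[of "Z' cf i" "K * z2 n w (x cf) i"] by (simp add: power_mult_distrib mult.assoc)
    qed
    also have "... = 2 * tsum n (%i. (Z' cf i)^2) + 2 * K^2 * tsum n (%i. (z2 n w (x cf) i)^2)" by (simp only: tsum_add tsum_cmult)
    also have "... \<le> 2 * (Cz * P1 n (x cf)) + 2 * K^2 * Dsp n w (x cf)"
      by (intro add_mono mult_left_mono Z's order_trans[OF z2_sq[OF npos w(1) per_fld] Dsp_ge[OF w(1)]]) auto
    finally show ?thesis by simp
  qed
  have ZsE: "EE n p Zs \<le> 2 * Cz * E1 + 2 * K^2 * ED"
  proof -
    have "EE n p Zs \<le> EE n p (%cf. 2 * Cz * P1 n (x cf) + 2 * K^2 * Dsp n w (x cf))" by (rule EE_le[OF ZsB])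
    then show ?thesis unfolding EE_add EE_cmult E1_def ED_def .
  qed
  have YE: "- EE n p Y \<le> e * EE n p Zs + (5/2 * e + 6 * K * e + 3/2 * s) * ED + 3 / (2 * s) * (Cz * E1)"
  proof -
    have "- Y cf \<le> e * Zs cf + (5/2 * e + 6 * K * e + 3/2 * s) * Dsp n w (x cf) + 3 / (2 * s) * (Cz * P1 n (x cf))" if "cf \<in> Omega n" for cf
    proof -
      have "3 / (2 * s) * tsum n (%i. (Z' cf i)^2) \<le> 3 / (2 * s) * (Cz * P1 n (x cf))" using Z's s by (intro mult_left_mono) auto
      then show ?thesis using Y3_bound[OF npos w(1) per_fld x1[OF that] c(1,3) s] unfolding Y_def Zs_def Z'_def e_def by linarith
    qed
    then have "EE n p (%cf. - Y cf) \<le> EE n p (%cf. e * Zs cf + (5/2 * e + 6 * K * e + 3/2 * s) * Dsp n w (x cf) + 3 / (2 * s) * (Cz * P1 n (x cf)))"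
      by (rule EE_le)
    then show ?thesis unfolding EE_uminus EE_add EE_cmult E1_def ED_def .
  qed
  have Cn: "N^2 * C \<le> Cc"
  proof -
    have "N^2 * C = 4 * c + 1 + 4 * K * (N / real w)^2" using N w0 unfolding C_def N_def by (simp add: field_simps)
    also have "... \<le> 4 * a + 1 + 4 * K * r^2" using c r w0 N unfolding N_def by (intro add_mono mult_left_mono power_mono) auto
    finally show ?thesis unfolding Cc_def .
  qed
  have C0: "C \<ge> 0" unfolding C_def using c by simp
  have c1: "6 * real w * N * (C + 4 * B / (real w)^2) \<le> 6 * Cc + 24 * r * (a + 1 + 4 * K)"
  proof -
    have "6 * real w * N * (C + 4 * B / (real w)^2) = 6 * (real w * N * C) + 24 * ((N / real w) * B)" using w0 by (simp add: field_simps power2_eq_square)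
    moreover have "real w * N * C \<le> N * N * C" using wn C0 N unfolding N_def by (intro mult_right_mono) auto
    moreover have "(N / real w) * B \<le> r * (a + 1 + 4 * K)" using r r0 c unfolding N_def B_def by (intro mult_mono) auto
    ultimately show ?thesis using Cn by (simp add: power2_eq_square)
  qed
  have Cc0: "Cc \<ge> 0" using Cn C0 N by (meson order_trans mult_nonneg_nonneg zero_le_power2)
  have c2: "3 * q * (2 * N * C^2) \<le> 6 * Cc^2"
  proof -
    have "N * C^2 \<le> (N^2 * C)^2"
    proof -
      have "N * C^2 \<le> N^4 * C^2" using N by (intro mult_right_mono self_le_power) auto
      then show ?thesis by (simp add: power_mult_distrib flip: power_mult)
    qed
    also have "... \<le> Cc^2" using Cn C0 by (intro power_mono) auto
    finally have "q * (N * C^2) \<le> 1 * Cc^2" using q q0 N by (intro mult_mono) auto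
    then show ?thesis by simp
  qed
  have E2: "EE n p (%cf. 2 * Zs cf + 2 * real n * C^2) = 2 * EE n p Zs + 2 * N * C^2" unfolding EE_add EE_cmult EE_c N_def ..
  have "- EE n p (%cf. cub n (x cf) (Zt n w c K (x cf))) \<le> 3 * \<beta> * Dex n p + 3 * q * (2 * EE n p Zs + 2 * N * C^2) + 6 * real w * N * (C + 4 * B / (real w)^2) - EE n p Y"
    using mv unfolding abs_le_iff E2 N_def by linarith
  also have "... \<le> 3 * \<beta> * Dex n p + (6 * q + e) * EE n p Zs + (5/2 * e + 6 * K * e + 3/2 * s) * ED + 3 / (2 * s) * (Cz * E1) + (6 * Cc^2 + 6 * Cc + 24 * r * (a + 1 + 4 * K))"
    using YE c1 c2 by (simp add: algebra_simps)
  also have "(6 * q + e) * EE n p Zs \<le> (6 * q + e) * (2 * Cz * E1 + 2 * K^2 * ED)" using q0 e0 by (intro mult_left_mono[OF ZsE]) auto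
  finally show ?thesis unfolding E1_def[symmetric] ED_def[symmetric] by (simp add: algebra_simps)
qed

text \<open>The constants are matched to the errors. \<open>\<kappa> = 248\<close>: as
  \<open>gam^2 >= 1/16\<close>, the sink is at least \<open>31 * n * m^4\<close>, against 30 from
  \<open>Afun_le\<close> and 1 from the moves in \<open>W_est\<close>. \<open>\<beta>\<close>: the
  replacements use \<open>Dex\<close> with total weight \<open>(6 + 3 + 12) * a * \<beta>\<close>,
  at most one half. \<open>s\<close>: a quarter of \<open>P1\<close> pays for the fields free of
  \<open>K\<close>, another quarter for the small terms. \<open>K\<close>: it collects the
  coefficients of \<open>Dsp\<close> without \<open>q\<close> or \<open>e\<close>, and 1 for those
  with them.\<close>

lemma static_estimate:
  fixes a vt :: real
  assumes pp: "!!cf. cf \<in> Omega n ==> 0 < p cf" and n3: "n \<ge> 3" and a: "a > 0" and g: "1/4 \<le> gam vt n" "gam vt n \<le> 1"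
    and w: "w > 0" and l: "l > 0" and wl: "4 * w + 4 * l + 8 < n"
    and l2: "(real l)^2 \<le> real n * sqrt (real n)" and l1: "(real n / real l)^2 \<le> 4 * sqrt (real n)"
    and r: "real n / real w \<le> r"
  defines "\<beta> \<equiv> 1 / (42 * (a + 1))" and "\<kappa> \<equiv> (248 :: real)" and "Cz \<equiv> 2 * (a^2 + 1)" 
  defines "s \<equiv> 24 * a * Cz" defines "K \<equiv> 24 * a + 100 * \<kappa> * a + 6 * a * s + 1"
  defines "q \<equiv> (2 * real w)^2 / (\<beta> * (real n)^2)" and "e \<equiv> real w / real n" and "Cc \<equiv> 4 * a + 1 + 4 * K * r^2"
  assumes q: "400 * q * \<kappa> \<le> 1" and qe1: "4 * a * ((12 * q + 2 * e) * Cz) \<le> 1/4" and qe2: "4 * a * (12 * q * K^2 + 2 * e * K^2 + 5/2 * e + 6 * K * e) \<le> 1"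
  shows "EE n p (gen_L a vt n (%cf. ln (p cf) - UU n cf + Phi n w \<kappa> (a * gam vt n) K (x cf)))
    \<le> - (1/2) * Dex n p - a * DG (gam vt n) n (UU n) p - (1/2) * EE n p (%cf. P1 n (x cf))
     + (a * (3200 * \<kappa>^2 / \<beta> + 80 * \<kappa>) + 4 * a * \<bar>vt\<bar>) / sqrt (real n) * EE n p (%cf. Phi n w \<kappa> (a * gam vt n) K (x cf))
     + (80 * \<kappa> * a + 4 * a * (6 * Cc^2 + 6 * Cc + 24 * r * (a + 1 + 4 * K)) + 128 * a + (16 * a * \<kappa> + 8 * a^2 + 1 + a + K * (8 * r^3 + 16 * a * r)))"
proof -
  let ?g = "gam vt n"
  define m where "m cf = mg n (x cf)" for cf
  have g0: "0 \<le> ?g" using g by simp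
  have g2: "1/16 \<le> ?g^2" "?g^2 \<le> 1" using power_mono[OF g(1), of 2] g0 g(2) by (auto simp: power_divide power_le_one)
  have wn: "w \<le> n" "4 * w + 6 < n" using wl by auto
  have \<beta>: "\<beta> > 0" unfolding \<beta>_def using a by simp
  have Cz: "Cz > 0" unfolding Cz_def by (simp add: add_nonneg_pos)
  have s: "s > 0" unfolding s_def using a Cz by simp
  have K: "K \<ge> 1" unfolding K_def \<kappa>_def using a s by simp
  have q0: "q \<ge> 0" unfolding q_def using \<beta> by simp
  have q1: "q \<le> 1" using q unfolding \<kappa>_def by simp
  define c where "c = a * ?g"
  have c: "0 \<le> c" "c \<le> a" "0 \<le> K" unfolding c_def using a g g0 K by (auto simp: mult_left_le)
  define D where "D = Dex n p"
  define E4 where "E4 = EE n p (%cf. real n * (m cf)^4)"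
  define ED where "ED = EE n p (%cf. Dsp n w (x cf))"
  define E1 where "E1 = EE n p (%cf. P1 n (x cf))"
  define EP where "EP = EE n p (%cf. P0 n (x cf))"
  define EPhi where "EPhi = EE n p (%cf. Phi n w \<kappa> c K (x cf))"
  have D0: "D \<ge> 0" unfolding D_def by (rule Dex_nonneg)
  have pos: "0 \<le> E4" "0 \<le> ED" "0 \<le> E1" "0 \<le> EP"
    unfolding E4_def ED_def E1_def EP_def by (auto intro!: EE_nonneg p0 Dsp_nonneg P_nonneg)
  have EPP: "EP \<le> EPhi" unfolding EP_def EPhi_def
  proof (rule EE_le)
    fix cf
    have "P0 n (x cf) \<le> \<kappa> * P0 n (x cf)" using P_nonneg(1)[of n "x cf"] unfolding \<kappa>_def by simp
    moreover have "0 \<le> c * P1 n (x cf)" "0 \<le> P3 n (x cf)" "0 \<le> K * P2 n w (x cf)" using c P_nonneg by auto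
    ultimately show "P0 n (x cf) \<le> Phi n w \<kappa> c K (x cf)" unfolding Phi_def by linarith
  qed
  define W1 where "W1 = EE n p (%cf. (cosh (2 * m cf) - 1) * W2f n 1 (x cf))"
  define W2 where "W2 = EE n p (%cf. (cosh (2 * m cf) - 1) * W2f n 2 (x cf))"
  define W0 where "W0 = EE n p (%cf. W2f n 1 (x cf))"
  define Sh where "Sh = EE n p (%cf. sinh (2 * m cf) * S3f n (x cf))"
  define Sm where "Sm = EE n p (%cf. m cf * S3f n (x cf))"
  define SB where "SB = EE n p (%cf. (sinh (2 * m cf) + 4 * \<kappa> * m cf) * S3f n (x cf))"
  define Cu where "Cu = EE n p (%cf. cub n (x cf) (Zt n w c K (x cf)))"
  have SB: "SB = Sh + 4 * \<kappa> * Sm"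
    unfolding SB_def Sh_def Sm_def EE_cmult[symmetric] EE_add[symmetric] by (simp add: distrib_right mult.assoc)
  define C1 where "C1 = 16 * a * \<kappa> + 8 * a^2 + 1 + a + K * (8 * r^3 + 16 * a * r)"
  have A: "EE n p (Afun ?g n (UU n)) \<le> 4 * ?g * W0 + 30 * E4 + 2 * ?g * W1 + ?g^2 * W2 - ?g^2 * Sh + 128"
  proof -
    have "EE n p (Afun ?g n (UU n)) \<le> EE n p (%cf. 4 * ?g * W2f n 1 (x cf) + 30 * (real n * (m cf)^4) + 2 * ?g * ((cosh (2 * m cf) - 1) * W2f n 1 (x cf)) + ?g^2 * ((cosh (2 * m cf) - 1) * W2f n 2 (x cf))
       - ?g^2 * (sinh (2 * m cf) * S3f n (x cf)) + 128)"
    proof (rule EE_le)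
      fix cf assume "cf \<in> Omega n"
      from Afun_le[OF n3 this g0 g(2)] show "Afun ?g n (UU n) cf \<le> 4 * ?g * W2f n 1 (x cf) + 30 * (real n * (m cf)^4) + 2 * ?g * ((cosh (2 * m cf) - 1) * W2f n 1 (x cf)) + ?g^2 * ((cosh (2 * m cf) - 1) * W2f n 2 (x cf))
       - ?g^2 * (sinh (2 * m cf) * S3f n (x cf)) + 128"
        unfolding m_def[symmetric] distrib_left[of "cosh (2 * m cf) - 1"] mult.left_commute[of "cosh (2 * m cf) - 1"] by linarith
    qed
    then show ?thesis unfolding EE_add EE_diff EE_cmult EE_c W0_def W1_def W2_def E4_def Sh_def EE_diff[symmetric] by (simp add: EE_diff)
  qed
  have G: "EE n p (gen_L a vt n (%\<xi>. Phi n w \<kappa> c K (x \<xi>))) \<le> - 4 * a * (1 - 2 * ?g) * EPhi - 4 * a * ?g^2 * (\<kappa> * Sm + Cu) - 4 * c * W0 - E1 - 2 * K * ED + C1"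
  proof -
    have "EE n p (gen_L a vt n (%\<xi>. Phi n w \<kappa> c K (x \<xi>))) \<le> EE n p (%cf. - 4 * a * (1 - 2 * ?g) * Phi n w \<kappa> c K (x cf)
      - 4 * a * ?g^2 * (\<kappa> * (m cf * S3f n (x cf)) + cub n (x cf) (Zt n w c K (x cf))) - 4 * c * W2f n 1 (x cf) - P1 n (x cf) - 2 * K * Dsp n w (x cf) + C1)"
    proof (rule EE_le)
      fix cf assume e: "cf \<in> Omega n"
      have rr: "0 \<le> real n / real w" by simp
      have "K * (8 * (real n / real w)^3 + 16 * a * (real n / real w)) \<le> K * (8 * r^3 + 16 * a * r)"
        using r rr a K by (intro mult_left_mono add_mono power_mono) auto
      then have "16 * a * \<kappa> + 8 * a^2 + 1 + a + K * (8 * (real n / real w)^3 + 16 * a * (real n / real w)) \<le> C1" unfolding C1_def by linarith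
      moreover have "gen_L a vt n (%\<xi>. Phi n w \<kappa> c K (x \<xi>)) cf \<le> - 4 * a * (1 - 2 * ?g) * Phi n w \<kappa> c K (x cf)
          - 4 * a * ?g^2 * (\<kappa> * (m cf * S3f n (x cf)) + cub n (x cf) (Zt n w c K (x cf))) - 4 * a * ?g * W2f n 1 (x cf) - P1 n (x cf) - 2 * K * Dsp n w (x cf)
          + (16 * a * \<kappa> + 8 * a^2 + 1 + a + K * (8 * (real n / real w)^3 + 16 * a * (real n / real w)))"
        using gen_Phi[OF n2 e _ g0 g(2) w wn(1), of a \<kappa> K] a K unfolding c_def m_def \<kappa>_def by simp
      ultimately show "gen_L a vt n (%\<xi>. Phi n w \<kappa> c K (x \<xi>)) cf \<le> - 4 * a * (1 - 2 * ?g) * Phi n w \<kappa> c K (x cf)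
      - 4 * a * ?g^2 * (\<kappa> * (m cf * S3f n (x cf)) + cub n (x cf) (Zt n w c K (x cf))) - 4 * c * W2f n 1 (x cf) - P1 n (x cf) - 2 * K * Dsp n w (x cf) + C1"
        unfolding c_def by (simp add: mult.assoc)
    qed
    also have "... = - 4 * a * (1 - 2 * ?g) * EPhi - 4 * a * ?g^2 * (\<kappa> * Sm + Cu) - 4 * c * W0 - E1 - 2 * K * ED + C1"
      unfolding EPhi_def Sm_def Cu_def W0_def E1_def ED_def EE_cmult[symmetric] EE_add[symmetric] EE_diff[symmetric]
      using EE_c[of C1] by (simp only: EE_add EE_diff)
    finally show ?thesis .
  qed
  have Ent: "EE n p (gen_L a vt n (%cf. ln (p cf) - UU n cf)) \<le> - D - a * DG ?g n (UU n) p + a * EE n p (Afun ?g n (UU n))"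
    unfolding D_def by (rule entropy_production[OF n2 pp _ g0 g(2)]) (use a UU_exc[OF n2] in auto)
  define R where "R = 12 * q * K^2 + 2 * e * K^2 + 5/2 * e + 6 * K * e"
  define R1 where "R1 = (12 * q + 2 * e) * Cz"
  define C2 where "C2 = 6 * Cc^2 + 6 * Cc + 24 * r * (a + 1 + 4 * K)"
  define t where "t = (3200 * \<kappa>^2 / \<beta> + 80 * \<kappa>) / sqrt (real n)"
  have w1: "W1 \<le> 2 * (\<beta> * D) + 128 * q * E4 + 8 * ED" "W2 \<le> 2 * (\<beta> * D) + 128 * q * E4 + 8 * ED"
    unfolding W1_def W2_def D_def E4_def ED_def q_def m_def by (rule W_est[OF w wn(2) \<beta>], simp)+
  have s3: "- SB \<le> 3 * \<beta> * D - 2 * \<kappa> * E4 + 100 * \<kappa> * ED + t * EP + 80 * \<kappa>"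
    unfolding SB_def D_def E4_def ED_def EP_def m_def t_def
    by (rule S3_est[OF w l wl \<beta> _ l2 l1]) (use q in \<open>simp_all add: \<kappa>_def q_def\<close>)
  have cu: "- Cu \<le> 3 * \<beta> * D + (R + 3/2 * s) * ED + (R1 + 3 / (2 * s) * Cz) * E1 + C2"
    using Z_est[OF w wn(2) \<beta> c s r] q1 unfolding Cu_def D_def ED_def E1_def R_def R1_def C2_def q_def e_def Cz_def Cc_def by simp
  have e0: "e \<ge> 0" unfolding e_def by simp
  have r0: "r \<ge> 0" using r by (smt (verit) divide_nonneg_nonneg of_nat_0_le_iff)
  have Cc0: "Cc \<ge> 0" unfolding Cc_def using a K by simp
  have C20: "C2 \<ge> 0" unfolding C2_def using Cc0 r0 a K by simp
  have R0: "R \<ge> 0" "R1 \<ge> 0" unfolding R_def R1_def using q0 e0 K Cz by auto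
  have t0: "t \<ge> 0" unfolding t_def \<kappa>_def using \<beta> by simp
  have x1: "2 * ?g * W1 + ?g^2 * W2 \<le> 3 * (2 * (\<beta> * D) + 128 * q * E4 + 8 * ED)"
  proof -
    define Y where "Y = 2 * (\<beta> * D) + 128 * q * E4 + 8 * ED"
    have Y0: "Y \<ge> 0" unfolding Y_def using \<beta> D0 q0 pos by simp
    have "2 * ?g * W1 \<le> 2 * ?g * Y" "?g^2 * W2 \<le> ?g^2 * Y" using w1 g0 unfolding Y_def by (auto intro!: mult_left_mono)
    moreover have "?g * Y \<le> 1 * Y" by (rule mult_right_mono[OF g(2) Y0])
    moreover have "?g^2 * Y \<le> 1 * Y" by (rule mult_right_mono[OF g2(2) Y0])
    ultimately show ?thesis unfolding Y_def by linarith
  qed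
  have x2: "- (?g^2 * SB) \<le> 3 * \<beta> * D - 31 * E4 + 100 * \<kappa> * ED + t * EP + 80 * \<kappa>"
  proof -
    define Y where "Y = 3 * \<beta> * D + 100 * \<kappa> * ED + t * EP + 80 * \<kappa>"
    have Y0: "Y \<ge> 0" unfolding Y_def \<kappa>_def using \<beta> D0 t0 pos by simp
    have "?g^2 * (- SB) \<le> ?g^2 * (Y - 2 * \<kappa> * E4)" using s3 unfolding Y_def by (intro mult_left_mono) auto
    moreover have "?g^2 * Y \<le> 1 * Y" using g2 Y0 by (intro mult_right_mono) auto
    moreover have "1/16 * (2 * \<kappa> * E4) \<le> ?g^2 * (2 * \<kappa> * E4)" using g2 pos unfolding \<kappa>_def by (intro mult_right_mono) auto
    moreover have "1/16 * (2 * \<kappa> * E4) = 31 * E4" unfolding \<kappa>_def by simp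
    moreover have "?g^2 * (Y - 2 * \<kappa> * E4) = ?g^2 * Y - ?g^2 * (2 * \<kappa> * E4)" "?g^2 * (- SB) = - (?g^2 * SB)"
      by (simp_all add: right_diff_distrib)
    ultimately have "- (?g^2 * SB) \<le> Y - 31 * E4" by linarith
    then show ?thesis unfolding Y_def by linarith
  qed
  have x3: "- (?g^2 * Cu) \<le> 3 * \<beta> * D + (R + 3/2 * s) * ED + (R1 + 3 / (2 * s) * Cz) * E1 + C2"
  proof -
    define Y where "Y = 3 * \<beta> * D + (R + 3/2 * s) * ED + (R1 + 3 / (2 * s) * Cz) * E1 + C2"
    have Y0: "Y \<ge> 0" unfolding Y_def using \<beta> D0 pos s Cz R0 C20 by (auto intro!: add_nonneg_nonneg mult_nonneg_nonneg)
    have "?g^2 * (- Cu) \<le> ?g^2 * Y" using cu unfolding Y_def by (intro mult_left_mono) auto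
    moreover have "?g^2 * Y \<le> 1 * Y" using g2 Y0 by (intro mult_right_mono) auto
    ultimately have "?g^2 * (- Cu) \<le> Y" by linarith
    then show ?thesis unfolding Y_def[symmetric] by simp
  qed
  have L: "EE n p (gen_L a vt n (%cf. ln (p cf) - UU n cf + Phi n w \<kappa> c K (x cf)))
     = EE n p (gen_L a vt n (%cf. ln (p cf) - UU n cf)) + EE n p (gen_L a vt n (%\<xi>. Phi n w \<kappa> c K (x \<xi>)))"
    unfolding gen_L_add[abs_def] EE_add ..
  have y1: "a * EE n p (Afun ?g n (UU n)) \<le> a * (4 * ?g * W0 + 30 * E4 + 2 * ?g * W1 + ?g^2 * W2 - ?g^2 * Sh + 128)"
    using A a by (intro mult_left_mono) auto
  have th: "- 4 * a * (1 - 2 * ?g) * EPhi \<le> 4 * a * \<bar>vt\<bar> / sqrt (real n) * EPhi"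
  proof -
    have "1 - 2 * ?g = vt / sqrt (real n)" unfolding gam_def by (simp add: field_simps)
    then have "- 4 * a * (1 - 2 * ?g) = 4 * a * (- vt) / sqrt (real n)" by simp
    also have "... \<le> 4 * a * \<bar>vt\<bar> / sqrt (real n)" using a by (intro divide_right_mono mult_left_mono) auto
    finally show ?thesis using EPP pos by (intro mult_right_mono) auto
  qed
  have tE: "a * (t * EP) \<le> a * (t * EPhi)" using EPP t0 a by (intro mult_left_mono) auto
  \<comment> \<open>The two-point terms \<open>4 * c * W0\<close>, from \<open>A\<close> and from
    \<open>G\<close>, cancel here; the three-point terms combine into \<open>SB\<close>.\<close>
  have bound: "EE n p (gen_L a vt n (%cf. ln (p cf) - UU n cf + Phi n w \<kappa> c K (x cf)))
     \<le> - D - a * DG ?g n (UU n) p + 30 * a * E4 + a * (2 * ?g * W1 + ?g^2 * W2) + a * (- (?g^2 * SB)) + 128 * a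
      + 4 * a * \<bar>vt\<bar> / sqrt (real n) * EPhi + 4 * a * (- (?g^2 * Cu)) - E1 - 2 * K * ED + C1"
  proof -
    have 1: "a * (4 * ?g * W0 + 30 * E4 + 2 * ?g * W1 + ?g^2 * W2 - ?g^2 * Sh + 128)
       = 4 * c * W0 + 30 * a * E4 + a * (2 * ?g * W1 + ?g^2 * W2) - a * (?g^2 * Sh) + 128 * a"
      unfolding c_def by (simp add: algebra_simps)
    have 2: "4 * a * ?g^2 * (\<kappa> * Sm + Cu) = a * (?g^2 * (4 * \<kappa> * Sm)) - 4 * a * (- (?g^2 * Cu))" by (simp add: algebra_simps)
    have 3: "a * (- (?g^2 * SB)) = - (a * (?g^2 * Sh)) - a * (?g^2 * (4 * \<kappa> * Sm))" unfolding SB by (simp add: algebra_simps)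
    have G': "EE n p (gen_L a vt n (%\<xi>. Phi n w \<kappa> c K (x \<xi>))) \<le> - 4 * a * (1 - 2 * ?g) * EPhi - (4 * a * ?g^2 * (\<kappa> * Sm + Cu)) - 4 * c * W0 - E1 - 2 * K * ED + C1"
      using G by simp
    show ?thesis using Ent G' y1 th unfolding L 1 2 3 by argo
  qed
  have z1: "a * (2 * ?g * W1 + ?g^2 * W2) \<le> a * (3 * (2 * (\<beta> * D) + 128 * q * E4 + 8 * ED))" using x1 a by (intro mult_left_mono) auto
  have z2: "a * (- (?g^2 * SB)) \<le> a * (3 * \<beta> * D - 31 * E4 + 100 * \<kappa> * ED + t * EP + 80 * \<kappa>)" using x2 a by (intro mult_left_mono) auto
  have z3: "4 * a * (- (?g^2 * Cu)) \<le> 4 * a * (3 * \<beta> * D + (R + 3/2 * s) * ED + (R1 + 3 / (2 * s) * Cz) * E1 + C2)" using x3 a by (intro mult_left_mono) auto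
  have f1: "21 * (a * \<beta>) * D \<le> 1/2 * D"
  proof (rule mult_right_mono[OF _ D0])
    have u: "a * \<beta> = (a / (a + 1)) / 42" unfolding \<beta>_def by simp
    have le: "a / (a + 1) \<le> 1" using a by simp
    have gen: "21 * (v / 42) = v / 2" for v :: real by simp
    have "21 * (a * \<beta>) = (a / (a + 1)) / 2" unfolding u by (rule gen)
    also have "... \<le> 1 / 2" using divide_right_mono[OF le, of 2] by simp
    finally show "21 * (a * \<beta>) \<le> 1/2" .
  qed
  have f2: "(384 * q) * (a * E4) \<le> 1 * (a * E4)" using q pos a unfolding \<kappa>_def by (intro mult_right_mono) auto
  have f3: "(4 * a * R) * ED \<le> 1 * ED" using qe2 pos unfolding R_def by (intro mult_right_mono) auto
  have f4: "(4 * a * R1) * E1 \<le> 1/4 * E1" using qe1 pos unfolding R1_def by (intro mult_right_mono) auto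
  have f5: "4 * a * (3 / (2 * s) * Cz) = 1/4" unfolding s_def using a Cz by (simp add: field_simps)
  have f6: "2 * K * ED = K * ED + (24 * a + 100 * \<kappa> * a + 6 * a * s + 1) * ED" unfolding K_def by (simp add: algebra_simps)
  have f7: "0 \<le> K * ED" using K pos by simp
  have "4 * a * ((R1 + 3 / (2 * s) * Cz) * E1) \<le> 1/2 * E1"
  proof -
    have "4 * a * ((R1 + 3 / (2 * s) * Cz) * E1) = (4 * a * R1) * E1 + (4 * a * (3 / (2 * s) * Cz)) * E1" by (simp add: algebra_simps)
    then show ?thesis using f4 unfolding f5 by linarith
  qed
  note f8 = this
  have fin: "EE n p (gen_L a vt n (%cf. ln (p cf) - UU n cf + Phi n w \<kappa> c K (x cf)))
    \<le> - (1/2) * D - a * DG ?g n (UU n) p - (1/2) * E1 + a * (t * EPhi) + 4 * a * \<bar>vt\<bar> / sqrt (real n) * EPhi + (80 * \<kappa> * a + 4 * a * C2 + 128 * a + C1)"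
  proof -
    have "a * (3 * (2 * (\<beta> * D) + 128 * q * E4 + 8 * ED)) = 6 * (a * \<beta>) * D + (384 * q) * (a * E4) + 24 * a * ED" by (simp add: algebra_simps)
    moreover have "a * (3 * \<beta> * D - 31 * E4 + 100 * \<kappa> * ED + t * EP + 80 * \<kappa>) = 3 * (a * \<beta>) * D - 31 * (a * E4) + 100 * \<kappa> * a * ED + a * (t * EP) + 80 * \<kappa> * a" by (simp add: algebra_simps)
    moreover have "4 * a * (3 * \<beta> * D + (R + 3/2 * s) * ED + (R1 + 3 / (2 * s) * Cz) * E1 + C2) = 12 * (a * \<beta>) * D + (4 * a * R) * ED + 6 * a * s * ED + 4 * a * ((R1 + 3 / (2 * s) * Cz) * E1) + 4 * a * C2" by (simp add: algebra_simps)
    moreover have "(24 * a + 100 * \<kappa> * a + 6 * a * s + 1) * ED = 24 * a * ED + 100 * \<kappa> * a * ED + 6 * a * s * ED + ED" by (simp add: algebra_simps)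
    moreover have "30 * a * E4 = 30 * (a * E4)" by simp
    moreover have "6 * (a * \<beta>) * D + 3 * (a * \<beta>) * D + 12 * (a * \<beta>) * D = 21 * (a * \<beta>) * D" by simp
    ultimately show ?thesis using bound z1 z2 z3 f1 f2 f3 f6 f7 f8 tE by argo
  qed
  have "a * (t * EPhi) + 4 * a * \<bar>vt\<bar> / sqrt (real n) * EPhi = (a * (3200 * \<kappa>^2 / \<beta> + 80 * \<kappa>) + 4 * a * \<bar>vt\<bar>) / sqrt (real n) * EPhi"
    unfolding t_def by (simp add: add_divide_distrib distrib_right distrib_left)
  then show ?thesis using fin unfolding C1_def C2_def D_def E1_def EPhi_def c_def by linarith
qed

end

section \<open>The kernel of the reference measure\<close>

text \<open>The Fourier multiplier of the inverse of \<open>a\<close> minus half the Laplacian on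
  the circle, at frequency \<open>Suc l\<close>; the zero mode is treated apart.\<close>

definition hk :: "real => nat => real" where
  "hk a l = 1 / (a + 2 * pi^2 * (real (Suc l))^2)"

text \<open>The factor \<open>r ^ Suc l\<close> is there so that the series may be differentiated
  termwise for \<open>r < 1\<close>; the case \<open>r = 1\<close>, whose graph has a cusp at 0, is
  reached as a limit.\<close>

definition hr :: "real => real => real => real" where
  "hr a r x = (\<Sum>l. r ^ Suc l * (hk a l * (2 * cos (2 * pi * real (Suc l) * x))))"

lemma hk_bounds: assumes "a > 0" shows "0 < hk a l" "hk a l \<le> 1 / 18 * (1 / (real l + 1)^2)" "hk a l * (real (Suc l))^2 \<le> 1 / 18"
  "2 * pi^2 * (real (Suc l))^2 * hk a l = 1 - a * hk a l"
proof -
  define L where "L = (real (Suc l))^2"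
  have L: "L > 0" by (simp add: L_def)
  have "3^2 \<le> pi^2" using pi_gt3 by (intro power_mono) auto
  then have p: "9 \<le> pi^2" by simp
  have "18 * L \<le> 2 * pi^2 * L" using p L by (intro mult_right_mono) auto
  then have d: "18 * L \<le> a + 2 * pi^2 * L" using assms by linarith
  have d0: "a + 2 * pi^2 * L > 0" using assms L by (simp add: add_pos_pos)
  show "0 < hk a l" unfolding hk_def L_def[symmetric] using d0 by simp
  have "hk a l \<le> 1 / (18 * L)" unfolding hk_def L_def[symmetric] using d L by (intro divide_left_mono) auto
  then show "hk a l \<le> 1 / 18 * (1 / (real l + 1)^2)" by (simp add: L_def add.commute)
  have "hk a l * L \<le> 1 / (18 * L) * L" using \<open>hk a l \<le> 1 / (18 * L)\<close> L by (intro mult_right_mono) auto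
  then show "hk a l * (real (Suc l))^2 \<le> 1 / 18" using L unfolding L_def by simp
  show "2 * pi^2 * (real (Suc l))^2 * hk a l = 1 - a * hk a l"
    unfolding hk_def L_def[symmetric] using d0 by (simp add: field_simps)
qed

lemma isq_sums: "(%l. 1 / (real l + 1)^2) sums (pi^2 / 6)"
  using inverse_squares_sums by (simp add: add.commute)

lemma summable_hk: assumes "a > 0" shows "summable (hk a)"
proof (rule summable_comparison_test'[OF summable_mult[OF sums_summable[OF isq_sums], of "1/18"], of 0])
  fix l show "norm (hk a l) \<le> 1 / 18 * (1 / (real l + 1)^2)"
    using hk_bounds(1,2)[OF assms, of l] by simp
qed

lemma suminf_hk: assumes "a > 0" shows "(\<Sum>l. hk a l) \<le> 1 / 2"
proof -
  have "(\<Sum>l. hk a l) \<le> (\<Sum>l. 1 / 18 * (1 / (real l + 1)^2))"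
    by (rule suminf_le[OF hk_bounds(2)[OF assms] summable_hk[OF assms] summable_mult[OF sums_summable[OF isq_sums]]])
  also have "... = 1 / 18 * (pi^2 / 6)"
    using sums_unique[OF sums_mult[OF isq_sums, of "1/18"]] by simp
  also have "... \<le> 1 / 18 * (4^2 / 6)" using pi_less_4 by (intro mult_left_mono divide_right_mono power_mono) auto
  finally show ?thesis by simp
qed

lemma hr_term: assumes "a > 0" "0 \<le> r" "r \<le> 1" shows "\<bar>r ^ Suc l * (hk a l * (2 * cos y))\<bar> \<le> 2 * hk a l"
proof -
  have "\<bar>r ^ Suc l * (hk a l * (2 * cos y))\<bar> = \<bar>r ^ Suc l\<bar> * (hk a l * (2 * \<bar>cos y\<bar>))"
    using hk_bounds(1)[OF assms(1), of l] by (simp add: abs_mult)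
  also have "... \<le> 1 * (hk a l * (2 * 1))"
    using hk_bounds(1)[OF assms(1), of l] assms by (intro mult_mono mult_left_mono) (auto simp: power_le_one abs_mult simp del: power_Suc)
  finally show ?thesis by simp
qed

lemma hr_summable: assumes "a > 0" "0 \<le> r" "r \<le> 1"
  shows "summable (%l. r ^ Suc l * (hk a l * (2 * cos (2 * pi * real (Suc l) * x))))"
  by (rule summable_comparison_test'[OF summable_mult[OF summable_hk[OF assms(1)], of 2], of 0])
     (simp only: real_norm_def hr_term[OF assms])

lemma hr_abs: assumes "a > 0" "0 \<le> r" "r \<le> 1" shows "\<bar>hr a r x\<bar> \<le> 1"
proof -
  have "norm (hr a r x) \<le> (\<Sum>l. 2 * hk a l)" unfolding hr_def
    by (rule norm_suminf_le[OF _ summable_mult[OF summable_hk[OF assms(1)]]]) (simp only: real_norm_def hr_term[OF assms])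
  also have "... = 2 * (\<Sum>l. hk a l)" by (rule suminf_mult[OF summable_hk[OF assms(1)]])
  finally show ?thesis using suminf_hk[OF assms(1)] by simp
qed

text \<open>The sum is the real part of \<open>z / (1 - z)\<close> at \<open>z = r * cis t\<close>,
  and this map sends the unit disc into the half plane of real part above
  \<open>- 1/2\<close>.\<close>

lemma poisson_nonneg:
  fixes r t :: real assumes "0 \<le> r" "r < 1"
  shows "summable (%l. r ^ Suc l * cos (real (Suc l) * t))" "- 1 / 2 \<le> (\<Sum>l. r ^ Suc l * cos (real (Suc l) * t))"
proof -
  define z where "z = of_real r * cis t"
  have nz: "norm z < 1" using assms by (simp add: z_def norm_mult)
  have g: "(%l. z * z ^ l) sums (z * (1 / (1 - z)))" by (rule sums_mult[OF geometric_sums[OF nz]])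
  have Rez: "Re (z * z ^ l) = r ^ Suc l * cos (real (Suc l) * t)" for l
  proof -
    have "z * z ^ l = z ^ Suc l" by simp
    also have "... = of_real (r ^ Suc l) * cis (real (Suc l) * t)"
      unfolding z_def power_mult_distrib Complex.DeMoivre by (simp only: of_real_power)
    finally have "z * z ^ l = of_real (r ^ Suc l) * cis (real (Suc l) * t)" .
    then show ?thesis by simp
  qed
  have s: "(%l. r ^ Suc l * cos (real (Suc l) * t)) sums Re (z * (1 / (1 - z)))"
    using sums_Re[OF g] unfolding Rez .
  then show "summable (%l. r ^ Suc l * cos (real (Suc l) * t))" by (rule sums_summable)
  have eq: "(\<Sum>l. r ^ Suc l * cos (real (Suc l) * t)) = Re (z / (1 - z))" using sums_unique[OF s] by simp
  have z1: "1 - z \<noteq> 0" using nz by auto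
  define u v where "u = Re z" and "v = Im z"
  have n: "u^2 + v^2 < 1" using nz unfolding u_def v_def by (simp add: cmod_def)
  have q: "(1 - u)^2 + v^2 > 0"
  proof -
    have "u^2 < 1" using n by (smt (verit) zero_le_power2)
    then have "u \<noteq> 1" by auto
    then show ?thesis by (simp add: add_pos_nonneg)
  qed
  have "Re (z / (1 - z)) = (u * (1 - u) - v^2) / ((1 - u)^2 + v^2)"
    by (simp add: Re_divide u_def v_def power2_eq_square)
  moreover have "- 1 / 2 \<le> (u * (1 - u) - v^2) / ((1 - u)^2 + v^2)"
    unfolding pos_le_divide_eq[OF q] using n by (simp add: power2_eq_square algebra_simps)
  ultimately show "- 1 / 2 \<le> (\<Sum>l. r ^ Suc l * cos (real (Suc l) * t))" using eq by simp
qed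

text \<open>The identity \<open>2 * pi^2 * l^2 * hk = 1 - a * hk\<close> turns the twice
  differentiated series into \<open>2 * a * hr\<close> minus four times the Poisson sum. Because of
  the cusp only an upper bound on the second derivative is uniform in \<open>r\<close>.\<close>

lemma hr_derivs:
  assumes a: "a > 0" and r: "0 \<le> r" "r < 1"
  shows "\<exists>H1 H2. \<forall>x. (hr a r has_field_derivative H1 x) (at x) \<and> (H1 has_field_derivative H2 x) (at x) \<and> H2 x \<le> 2 + 2 * a * hr a r x"
proof -
  define h1 where "h1 l x = r ^ Suc l * (hk a l * (2 * (- sin (2 * pi * real (Suc l) * x) * (2 * pi * real (Suc l)))))" for l x
  define h2 where "h2 l x = - (r ^ Suc l * (hk a l * (2 * (cos (2 * pi * real (Suc l) * x) * (2 * pi * real (Suc l))^2))))" for l x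
  have gs: "summable (%l. c * r ^ Suc l)" for c
    using summable_mult[OF summable_geometric[of r], of "c * r"] r by (simp add: mult.assoc)
  have hkL: "hk a l * real (Suc l) \<le> 1" for l
  proof -
    have "hk a l * real (Suc l) \<le> hk a l * (real (Suc l))^2"
      using hk_bounds(1)[OF a, of l] by (intro mult_left_mono self_le_power) auto
    then show ?thesis using hk_bounds(3)[OF a, of l] by linarith
  qed
  have b1: "norm (h1 l x) \<le> 4 * pi * r ^ Suc l" for l x
  proof -
    have "\<bar>h1 l x\<bar> = r ^ Suc l * (4 * pi * \<bar>sin (2 * pi * real (Suc l) * x)\<bar> * (hk a l * real (Suc l)))"
      using r hk_bounds(1)[OF a, of l] unfolding h1_def abs_mult by (simp add: abs_mult)
    also have "... \<le> r ^ Suc l * (4 * pi * 1 * 1)"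
      using r hkL[of l] hk_bounds(1)[OF a, of l] by (intro mult_left_mono mult_mono) auto
    finally show ?thesis by (simp add: mult_ac)
  qed
  have h2eq: "h2 l x = 2 * a * (r ^ Suc l * (hk a l * (2 * cos (2 * pi * real (Suc l) * x)))) - 4 * (r ^ Suc l * cos (real (Suc l) * (2 * pi * x)))" for l x
  proof -
    have "h2 l x = - (r ^ Suc l * (4 * cos (2 * pi * real (Suc l) * x) * (2 * pi^2 * (real (Suc l))^2 * hk a l)))"
    proof -
      have "(2 * pi * real (Suc l))^2 = 2 * (2 * pi^2 * (real (Suc l))^2)" by (simp only: power_mult_distrib) simp
      moreover have "- (R * (H * (2 * (C * (2 * P))))) = - (R * (4 * C * (P * H)))" for R H C P :: real by simp
      ultimately show ?thesis unfolding h2_def by (simp only:)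
    qed
    also have "... = - (r ^ Suc l * (4 * cos (2 * pi * real (Suc l) * x) * (1 - a * hk a l)))" unfolding hk_bounds(4)[OF a] ..
    also have "cos (2 * pi * real (Suc l) * x) = cos (real (Suc l) * (2 * pi * x))" by (simp add: mult_ac)
    finally show ?thesis by (simp add: algebra_simps)
  qed
  have b2: "norm (h2 l x) \<le> (4 * a + 4) * r ^ Suc l" for l x
  proof -
    have "hk a l * 1 \<le> hk a l * real (Suc l)" using hk_bounds(1)[OF a, of l] by (intro mult_left_mono) auto
    then have hk1: "hk a l \<le> 1" using hkL[of l] by linarith
    have "\<bar>h2 l x\<bar> \<le> \<bar>2 * a * (r ^ Suc l * (hk a l * (2 * cos (2 * pi * real (Suc l) * x))))\<bar> + \<bar>4 * (r ^ Suc l * cos (real (Suc l) * (2 * pi * x)))\<bar>"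
      unfolding h2eq by (rule abs_triangle_ineq4)
    also have "... = r ^ Suc l * (4 * a * hk a l * \<bar>cos (2 * pi * real (Suc l) * x)\<bar>) + r ^ Suc l * (4 * \<bar>cos (real (Suc l) * (2 * pi * x))\<bar>)"
      using a r hk_bounds(1)[OF a, of l] by (simp add: abs_mult)
    also have "... \<le> r ^ Suc l * (4 * a * 1 * 1) + r ^ Suc l * (4 * 1)"
      using a r hk1 hk_bounds(1)[OF a, of l] by (intro add_mono mult_left_mono mult_mono) auto
    finally show ?thesis by (simp add: algebra_simps)
  qed
  have uc1: "uniformly_convergent_on UNIV (%k x. \<Sum>i<k. h1 i x)"
    by (rule Weierstrass_m_test'[OF b1 gs])
  have uc2: "uniformly_convergent_on UNIV (%k x. \<Sum>i<k. h2 i x)"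
    by (rule Weierstrass_m_test'[OF b2 gs])
  have D1: "(hr a r has_field_derivative (\<Sum>l. h1 l x)) (at x)" for x
    unfolding hr_def[abs_def]
    by (rule has_field_derivative_series'(2)[OF convex_UNIV _ uc1, of _ 0])
       (use hr_summable[OF a r(1), of 0] r in \<open>auto simp: h1_def intro!: derivative_eq_intros\<close>)
  have s1: "summable (%l. h1 l x)" for x
    by (rule summable_comparison_test'[OF gs[of "4 * pi"], of 0]) (use b1 in auto)
  have D2: "((%x. \<Sum>l. h1 l x) has_field_derivative (\<Sum>l. h2 l x)) (at x)" for x
    by (rule has_field_derivative_series'(2)[OF convex_UNIV _ uc2, of _ 0])
       (use s1 in \<open>auto simp: h1_def h2_def power2_eq_square intro!: derivative_eq_intros\<close>)
  have h2le: "(\<Sum>l. h2 l x) \<le> 2 + 2 * a * hr a r x" for x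
  proof -
    have "(\<Sum>l. h2 l x) = 2 * a * hr a r x - 4 * (\<Sum>l. r ^ Suc l * cos (real (Suc l) * (2 * pi * x)))"
    proof -
      have "(%l. h2 l x) sums (2 * a * hr a r x - 4 * (\<Sum>l. r ^ Suc l * cos (real (Suc l) * (2 * pi * x))))"
        unfolding h2eq hr_def
        by (rule sums_diff[OF sums_mult[OF summable_sums[OF hr_summable[OF a r(1)]]] sums_mult[OF summable_sums[OF poisson_nonneg(1)[OF r]]]])
           (use r in simp)
      from sums_unique[OF this] show ?thesis by simp
    qed
    then show ?thesis using poisson_nonneg(2)[OF r, of "2 * pi * x"] by argo
  qed
  show ?thesis by (rule exI[of _ "%x. \<Sum>l. h1 l x"], rule exI[of _ "%x. \<Sum>l. h2 l x"]) (use D1 D2 h2le in blast)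
qed

text \<open>An upper bound on the second derivative means that
  \<open>(1 + a) * x^2 - hr a r x\<close> is convex; midpoint convexity gives a bound on second
  differences that survives the limit \<open>r = 1\<close>.\<close>

lemma hr_second_diff:
  assumes a: "a > 0" and r: "0 \<le> r" "r < 1"
  shows "hr a r (x + d) + hr a r (x - d) - 2 * hr a r x \<le> (2 + 2 * a) * d^2"
proof -
  obtain H1 H2 where D1: "!!x. (hr a r has_field_derivative H1 x) (at x)" and D2: "!!x. (H1 has_field_derivative H2 x) (at x)"
    and H2: "!!x. H2 x \<le> 2 + 2 * a * hr a r x" using hr_derivs[OF assms] by blast
  have h2le: "H2 x \<le> 2 + 2 * a" for x
  proof -
    have "2 * a * hr a r x \<le> 2 * a * 1" using hr_abs[OF a r(1), of x] r a by (intro mult_left_mono) auto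
    then show ?thesis using H2[of x] by linarith
  qed
  define \<phi> where "\<phi> x = (1 + a) * x^2 - hr a r x" for x
  have cvx: "convex_on UNIV \<phi>"
  proof (rule f''_ge0_imp_convex)
    show "DERIV \<phi> x :> (2 * (1 + a) * x - H1 x)" for x
      unfolding \<phi>_def by (auto intro!: derivative_eq_intros D1)
    show "DERIV (%x. 2 * (1 + a) * x - H1 x) x :> (2 * (1 + a) - H2 x)" for x
      by (auto intro!: derivative_eq_intros D2)
    show "2 * (1 + a) - H2 x \<ge> 0" for x using h2le[of x] by (simp add: algebra_simps)
  qed auto
  have "\<phi> ((1 - 1/2) *\<^sub>R (x + d) + (1/2) *\<^sub>R (x - d)) \<le> (1 - 1/2) * \<phi> (x + d) + (1/2) * \<phi> (x - d)"
    by (rule convex_onD[OF cvx]) auto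
  moreover have "(1 - 1/2) *\<^sub>R (x + d) + (1/2) *\<^sub>R (x - d) = x" by (simp add: field_simps)
  ultimately have "2 * \<phi> x \<le> \<phi> (x + d) + \<phi> (x - d)" by simp
  then show ?thesis unfolding \<phi>_def by (simp add: power2_eq_square algebra_simps)
qed

lemma hr_even: "hr a r (- x) = hr a r x" unfolding hr_def by simp

lemma hr_per: "hr a r (x + real_of_int k) = hr a r x"
proof -
  have "cos (2 * pi * real (Suc l) * (x + real_of_int k)) = cos (2 * pi * real (Suc l) * x)" for l
  proof -
    have "2 * pi * real (Suc l) * (x + real_of_int k) = 2 * pi * real (Suc l) * x + 2 * pi * real_of_int (int (Suc l) * k)" by (simp add: algebra_simps)
    then show ?thesis by (simp add: cos_add cos_int_2pin sin_int_2pin del: of_nat_Suc of_int_mult)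
  qed
  then show ?thesis unfolding hr_def by simp
qed

text \<open>Maximum principle: \<open>hr a r\<close> is the mean-zero part of the Green function of \<open>a\<close> minus half the Laplacian, smoothed by a Poisson kernel.\<close>

lemma hr_ge: assumes a: "a > 0" and r: "0 \<le> r" "r < 1" shows "- 1 / a \<le> hr a r x"
proof -
  obtain H1 H2 where D1: "!!x. (hr a r has_field_derivative H1 x) (at x)" and D2: "!!x. (H1 has_field_derivative H2 x) (at x)"
    and H2: "!!x. H2 x \<le> 2 + 2 * a * hr a r x" using hr_derivs[OF assms] by blast
  have "continuous_on {0..1} (hr a r)" using D1 by (meson DERIV_isCont continuous_at_imp_continuous_on)
  from continuous_attains_inf[OF compact_Icc _ this]
  obtain x0 where x0: "!!y. y \<in> {0..1} ==> hr a r x0 \<le> hr a r y" by force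
  have min: "hr a r x0 \<le> hr a r y" for y
    using x0[of "frac y"] hr_per[of a r "frac y" "floor y"] frac_lt_1[of y] by (simp add: frac_def)
  have z: "H1 x0 = 0" by (rule DERIV_local_min[OF D1 zero_less_one]) (simp add: min)
  \<comment> \<open>The second derivative test at the minimum: a negative \<open>H2 x0\<close> would
    make the first derivative negative just to the right of \<open>x0\<close>, and the function
    would fall below its minimum.\<close>
  have "H2 x0 \<ge> 0"
  proof (rule ccontr)
    assume "\<not> H2 x0 \<ge> 0"
    then obtain d where d: "d > 0" "!!h. 0 < h ==> h < d ==> H1 (x0 + h) < H1 x0"
      using DERIV_neg_dec_right[OF D2[of x0]] by auto
    obtain y where y: "x0 < y" "y < x0 + d / 2" "hr a r (x0 + d / 2) - hr a r x0 = (x0 + d / 2 - x0) * H1 y"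
      using MVT2[of x0 "x0 + d / 2" "hr a r" H1] D1 d(1) by auto
    have "H1 y < 0" using d(2)[of "y - x0"] y z d(1) by auto
    then have "(x0 + d / 2 - x0) * H1 y < 0" using d(1) by (intro mult_pos_neg) auto
    then show False using y(3) min[of "x0 + d / 2"] by linarith
  qed
  then have "- 1 / a \<le> hr a r x0" using H2[of x0] a by (simp add: field_simps)
  then show ?thesis using min[of x] by linarith
qed

lemma hr_limit: assumes a: "a > 0" shows "(%k. hr a (1 - 1 / real (Suc k)) x) \<longlonglongrightarrow> hr a 1 x"
proof -
  have r: "0 \<le> 1 - 1 / real (Suc k)" "1 - 1 / real (Suc k) \<le> 1" for k by auto
  have l: "(%k. 1 - 1 / real (Suc k)) \<longlonglongrightarrow> 1"
    using tendsto_diff[OF tendsto_const LIMSEQ_Suc[OF lim_1_over_n]] by simp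
  have "(%k. \<Sum>l. (1 - 1 / real (Suc k)) ^ Suc l * (hk a l * (2 * cos (2 * pi * real (Suc l) * x)))) \<longlonglongrightarrow> (\<Sum>l. 1 ^ Suc l * (hk a l * (2 * cos (2 * pi * real (Suc l) * x))))"
  proof (rule conjunct2[OF conjunct2[OF tannerys_theorem]])
    show "((%k. (1 - 1 / real (Suc k)) ^ Suc l * (hk a l * (2 * cos (2 * pi * real (Suc l) * x)))) \<longlongrightarrow> 1 ^ Suc l * (hk a l * (2 * cos (2 * pi * real (Suc l) * x)))) sequentially" for l
      by (intro tendsto_intros l)
    show "\<forall>\<^sub>F (l, k) in sequentially \<times>\<^sub>F sequentially. norm ((1 - 1 / real (Suc k)) ^ Suc l * (hk a l * (2 * cos (2 * pi * real (Suc l) * x)))) \<le> 2 * hk a l"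
      by (rule always_eventually) (auto simp only: real_norm_def split: prod.split intro!: hr_term[OF a r])
    show "summable (%l. 2 * hk a l)" by (rule summable_mult[OF summable_hk[OF a]])
  qed simp
  then show ?thesis unfolding hr_def .
qed

lemma h1_second_diff: assumes a: "a > 0"
  shows "hr a 1 (x + d) + hr a 1 (x - d) - 2 * hr a 1 x \<le> (2 + 2 * a) * d^2"
proof (rule tendsto_upperbound)
  show "(%k. hr a (1 - 1 / real (Suc k)) (x + d) + hr a (1 - 1 / real (Suc k)) (x - d) - 2 * hr a (1 - 1 / real (Suc k)) x) \<longlonglongrightarrow> hr a 1 (x + d) + hr a 1 (x - d) - 2 * hr a 1 x"
    by (intro tendsto_intros hr_limit[OF a])
  show "\<forall>\<^sub>F k in sequentially. hr a (1 - 1 / real (Suc k)) (x + d) + hr a (1 - 1 / real (Suc k)) (x - d) - 2 * hr a (1 - 1 / real (Suc k)) x \<le> (2 + 2 * a) * d^2"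
    by (rule always_eventually) (auto intro!: hr_second_diff[OF a])
qed simp

lemma h1_ge: assumes a: "a > 0" shows "- 1 / a \<le> hr a 1 x"
  by (rule LIMSEQ_le_const[OF hr_limit[OF a]]) (use hr_ge[OF a] in auto)

text \<open>Near \<open>gam = 1/2\<close> the absolute value in \<open>lam\<close> opens with a plus
  sign, because \<open>4 * pi^2 * l^2 >= 36\<close> for \<open>l >= 1\<close>; the frequency cancels
  from the numerator and a multiple of the Green function multiplier remains.\<close>

lemma lam_eq: assumes "a > 0" "2 * a * \<bar>1 - 2 * gam vt n\<bar> \<le> 36"
  shows "lam a vt n (Suc l) = 8 * a * gam vt n * hk a l"
proof -
  define L where "L = pi^2 * (real (Suc l))^2"
  have "3^2 \<le> pi^2" using pi_gt3 by (intro power_mono) auto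
  moreover have "1 \<le> (real (Suc l))^2" by simp
  ultimately have "9 * 1 \<le> L" unfolding L_def by (intro mult_mono) auto
  moreover have "\<bar>2 * a * (1 - 2 * gam vt n)\<bar> \<le> 36" using assms by (simp add: abs_mult)
  ultimately have "\<bar>4 * L + 2 * a * (1 - 2 * gam vt n)\<bar> = 4 * L + 2 * a * (1 - 2 * gam vt n)" by linarith
  then show ?thesis unfolding lam_def hk_def mult.assoc[of _ "pi^2"] L_def[symmetric] by (simp add: algebra_simps)
qed

lemma gfun_eq: assumes "a > 0" "2 * a * \<bar>1 - 2 * gam vt n\<bar> \<le> 36"
  shows "gfun a vt n x = min 4 (8 * gam vt n) + 8 * a * gam vt n * hr a 1 x"
proof -
  have "(\<Sum>l. lam a vt n (Suc l) * (2 * cos (2 * pi * real (Suc l) * x))) = (\<Sum>l. 8 * a * gam vt n * (1 ^ Suc l * (hk a l * (2 * cos (2 * pi * real (Suc l) * x)))))"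
    unfolding lam_eq[OF assms] by (simp add: mult_ac)
  also have "... = 8 * a * gam vt n * hr a 1 x" unfolding hr_def
    by (rule suminf_mult) (rule hr_summable, use assms in auto)
  finally show ?thesis unfolding gfun_def by simp
qed


section \<open>Sums over the grid and discrete kernels with one-sided second differences\<close>

lemma sum_cis: assumes n: "n > 0" shows "(\<Sum>j<n. cis (2 * pi * real_of_int k * real j / real n + c)) = (if int n dvd k then of_nat n * cis c else 0)"
proof -
  define z where "z = cis (2 * pi * real_of_int k / real n)"
  have t: "cis (2 * pi * real_of_int k * real j / real n + c) = cis c * z ^ j" for j
  proof -
    have "2 * pi * real_of_int k * real j / real n + c = c + real j * (2 * pi * real_of_int k / real n)" by simp
    then show ?thesis unfolding z_def Complex.DeMoivre cis_mult by (simp only:)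
  qed
  have zn: "z ^ n = 1"
  proof -
    have "z ^ n = cis (2 * pi * real_of_int k)" unfolding z_def Complex.DeMoivre using n by simp
    also have "... = 1" by (rule cis_multiple_2pi[OF Ints_of_int])
    finally show ?thesis .
  qed
  show ?thesis
  proof (cases "int n dvd k")
    case True
    then obtain m where m: "k = int n * m" by auto
    have "2 * pi * real_of_int k / real n = 2 * pi * real_of_int m" unfolding m using n by simp
    then have "z = 1" unfolding z_def by (simp only: cis_multiple_2pi[OF Ints_of_int])
    then show ?thesis unfolding t using True by simp
  next
    case False
    have "z \<noteq> 1"
    proof
      assume "z = 1"
      then have "cos (2 * pi * real_of_int k / real n) = 1" unfolding z_def by (simp add: complex_eq_iff)
      then obtain m :: int where "2 * pi * real_of_int k / real n = real_of_int m * 2 * pi" using cos_one_2pi_int by blast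
      then have "real_of_int k = real_of_int m * real n" using n by (simp add: field_simps)
      then have "k = m * int n" by (metis of_int_eq_iff of_int_mult of_int_of_nat_eq)
      then show False using False by simp
    qed
    then have "(\<Sum>j<n. z ^ j) = 0" using zn by (simp add: sum_gp_strict)
    then show ?thesis unfolding t sum_distrib_left[symmetric] using False by simp
  qed
qed

lemma sum_cos: assumes "n > 0" shows "(\<Sum>j<n. cos (2 * pi * real_of_int k * real j / real n + c)) = (if int n dvd k then real n * cos c else 0)"
  using arg_cong[OF sum_cis[OF assms, of k c], of Re] by (auto simp: Re_sum)

text \<open>Second differences sum to zero over the torus, so a one-sided bound controls their l1
  norm; first differences also sum to zero and are therefore bounded by that norm.\<close>

lemma second_diff_bounds:
  fixes V :: "int => real"
  assumes V: "per n V" and n: "n > 0" and \<delta>: "!!d. V (d + 1) + V (d - 1) - 2 * V d \<le> \<delta>" "\<delta> \<ge> 0"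
  shows "tsum n (%d. \<bar>V (d + 1) + V (d - 1) - 2 * V d\<bar>) \<le> 2 * (real n * \<delta>)"
    "\<bar>V (d + 1) - V d\<bar> \<le> 2 * (real n * \<delta>)"
proof -
  let ?L = "%d. V (d + 1) + V (d - 1) - 2 * V d"
  have "tsum n ?L = tsum n (%d. V (d + 1)) + tsum n (%d. V (d - 1)) - 2 * tsum n V"
    by (simp add: tsum_def sum.distrib sum_subtractf sum_distrib_left)
  also have "... = tsum n V + tsum n V - 2 * tsum n V" by (simp only: tsum_shift[OF V] tsum_shift'[OF V])
  also have "... = 0" by simp
  finally have z: "tsum n ?L = 0" .
  have "\<bar>?L d\<bar> \<le> 2 * \<delta> - ?L d" for d using \<delta>(1)[of d] \<delta>(2) by linarith
  then have "tsum n (%d. \<bar>?L d\<bar>) \<le> tsum n (%d. 2 * \<delta> - ?L d)" by (rule tsum_mono)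
  also have "... = tsum n (%d. 2 * \<delta>) - tsum n ?L" by (rule tsum_diff)
  also have "... = 2 * (real n * \<delta>)" unfolding z tsum_const by simp
  finally show b: "tsum n (%d. \<bar>?L d\<bar>) \<le> 2 * (real n * \<delta>)" .
  define D where "D d = V (d + 1) - V d" for d
  have pD: "per n D" unfolding D_def by (intro per_intros V)
  have Dz: "tsum n D = 0" unfolding D_def by (rule tsum_telescope[OF V])
  have DL: "D (d + 1) - D d = ?L (d + 1)" for d unfolding D_def by simp
  have pL: "per n (%d. \<bar>?L d\<bar>)" by (intro per_intros V)
  have step: "\<bar>D (d + int k) - D d\<bar> \<le> 2 * (real n * \<delta>)" if "k \<le> n" for k d
  proof -
    have "\<bar>D (d + int k) - D d\<bar> \<le> (\<Sum>j<k. \<bar>?L (d + int j + 1)\<bar>)"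
    proof (induction k)
      case (Suc k)
      have "D (d + int (Suc k)) - D d = (D (d + int k) - D d) + ?L (d + int k + 1)" using DL[of "d + int k"] by (simp add: algebra_simps)
      then show ?case using Suc by simp
    qed simp
    also have "... \<le> (\<Sum>j<n. \<bar>?L (d + int j + 1)\<bar>)" by (rule sum_mono2) (use that in auto)
    also have "... = tsum n (%j. \<bar>?L (j + (d + 1))\<bar>)" unfolding tsum_nat unfolding tsum_def by (intro sum.cong) (auto simp: algebra_simps)
    also have "... = tsum n (%d. \<bar>?L d\<bar>)" by (rule tsum_shift[OF pL])
    finally show ?thesis using b by simp
  qed
  have "D d = (1 / real n) * tsum n (%j. D d - D (j + d))"
    unfolding tsum_diff tsum_const tsum_shift[OF pD] Dz using n by simp
  also have "\<bar>...\<bar> \<le> (1 / real n) * tsum n (%j. 2 * (real n * \<delta>))"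
    unfolding abs_mult
  proof (rule mult_mono)
    show "\<bar>tsum n (%j. D d - D (j + d))\<bar> \<le> tsum n (%j. 2 * (real n * \<delta>))"
    proof (rule order_trans[OF tsum_abs_le], rule tsum_mono)
      fix j assume "0 \<le> j" "j < int n"
      then show "\<bar>D d - D (j + d)\<bar> \<le> 2 * (real n * \<delta>)" using step[of "nat j" d] by (simp add: add.commute abs_minus_commute)
    qed
  qed auto
  also have "... = 2 * (real n * \<delta>)" unfolding tsum_const using n by simp
  finally show "\<bar>V (d + 1) - V d\<bar> \<le> 2 * (real n * \<delta>)" unfolding D_def .
qed

text \<open>Summation by parts against the primitive \<open>cv n (saw n) x\<close>: it puts one more
  difference on the kernel and allows the field to be measured by \<open>P1\<close>.\<close>

lemma cv_via_saw:
  assumes V: "per n V" and n: "n > 0" and x: "per n x"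
  shows "cv n V x i = tsum n V * mg n x + cv n (%d. V (d - 1) - V d) (cv n (saw n) x) i"
    "cv n V x (i + 1) - cv n V x i = cv n (%d. V (d - 2) + V d - 2 * V (d - 1)) (cv n (saw n) x) i"
proof -
  define X where "X = cv n (saw n) x"
  have pX: "per n X" unfolding X_def by (rule per_cv[OF per_saw])
  have XD: "X (j + 1) - X j = x j - mg n x" for j unfolding X_def by (rule grad_cv_saw[OF n x])
  have A: "cv n V x i = tsum n V * mg n x + cv n (%d. V (d - 1) - V d) X i" for i
  proof -
    have pV: "per n (%j. V (j - i))" by (intro per_intros V)
    have "cv n V x i = tsum n (%j. (X (j + 1) - X j) * V (j - i) + V (j - i) * mg n x)"
      unfolding cv_def XD by (rule tsum_cong) (simp add: algebra_simps)
    also have "... = tsum n (%j. X j * (V (j - 1 - i) - V (j - i))) + tsum n V * mg n x"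
      unfolding tsum_add tsum_cmult2 tsum_parts[OF pX pV] tsum_shift'[OF V] ..
    finally show ?thesis unfolding cv_def by (simp add: algebra_simps)
  qed
  show "cv n V x i = tsum n V * mg n x + cv n (%d. V (d - 1) - V d) (cv n (saw n) x) i" using A unfolding X_def .
  have "cv n V x (i + 1) - cv n V x i = cv n (%d. V (d - 1) - V d) X (i + 1) - cv n (%d. V (d - 1) - V d) X i" using A by simp
  also have "... = cv n (%d. V (d - 2) + V d - 2 * V (d - 1)) X i"
    unfolding cv_def tsum_diff[symmetric] by (rule tsum_cong) (simp add: algebra_simps)
  finally show "cv n V x (i + 1) - cv n V x i = cv n (%d. V (d - 2) + V d - 2 * V (d - 1)) (cv n (saw n) x) i" unfolding X_def .
qed

section \<open>The energy of the Gibbs measure and its increments\<close>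

definition bil :: "nat => (int => real) => (int => real) => real" where
  "bil n V x = tsum n (%i. x i * cv n V x i)"

lemma bil_swap:
  assumes V: "per n V" "!!d. V (- d) = V d" and x: "per n x" and n: "n > 0"
    and y: "!!j. y j = x j + c * (cind n b j - cind n (b + 1) j)"
  shows "bil n V y - bil n V x = 2 * c * (cv n V x b - cv n V x (b + 1)) + 2 * c^2 * (V 0 - V 1)"
proof -
  have cvy: "cv n V y i = cv n V x i + c * (V (i - b) - V (i - (b + 1)))" for i
    unfolding cv_swap[OF V(1) x n y] using V(2)[of "i - b"] V(2)[of "i - (b + 1)"] by simp
  have e: "tsum n (%i. x i * V (i - b)) = cv n V x b" for b unfolding cv_def by (simp add: mult.commute)
  define w where "w i = cv n V x i + c * (V (i - b) - V (i - (b + 1)))" for i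
  have pw: "per n w" unfolding w_def by (intro per_intros per_cv V)
  have "bil n V y = tsum n (%i. x i * cv n V x i + c * (x i * V (i - b) - x i * V (i - (b + 1))) + c * (w i * cind n b i - w i * cind n (b + 1) i))"
    unfolding bil_def cvy by (rule tsum_cong) (simp add: y w_def algebra_simps)
  also have "... = bil n V x + c * (cv n V x b - cv n V x (b + 1)) + c * (w b - w (b + 1))"
    by (simp only: tsum_add tsum_cmult tsum_diff e tsum_cind[OF pw n] bil_def)
  finally show ?thesis unfolding w_def using V(2)[of 1] by (simp add: power2_eq_square algebra_simps)
qed

lemma bil_single:
  assumes V: "per n V" "!!d. V (- d) = V d" and x: "per n x" and n: "n > 0"
    and y: "!!j. y j = x j + c * cind n b j"
  shows "bil n V y - bil n V x = 2 * c * cv n V x b + c^2 * V 0"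
proof -
  have cvy: "cv n V y i = cv n V x i + c * V (i - b)" for i
    unfolding cv_single[OF V(1) x n y] using V(2)[of "i - b"] by simp
  have e: "tsum n (%i. x i * V (i - b)) = cv n V x b" for b unfolding cv_def by (simp add: mult.commute)
  define w where "w i = cv n V x i + c * V (i - b)" for i
  have pw: "per n w" unfolding w_def by (intro per_intros per_cv V)
  have "bil n V y = tsum n (%i. x i * cv n V x i + c * (x i * V (i - b)) + c * (w i * cind n b i))"
    unfolding bil_def cvy by (rule tsum_cong) (simp add: y w_def algebra_simps)
  also have "... = bil n V x + c * cv n V x b + c * w b"
    by (simp only: tsum_add tsum_cmult tsum_diff e tsum_cind[OF pw n] bil_def)
  finally show ?thesis unfolding w_def by (simp add: power2_eq_square algebra_simps)
qed

definition Gk :: "real => real => nat => int => real" where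
  "Gk a vt n d = gfun a vt n (real_of_int d / real n) / real n"

text \<open>The factor \<open>1/8\<close> combines \<open>1 / (2 * n)\<close>, the factor
  \<open>n\<close> divided out in \<open>Gk\<close>, and the two halves from passing from
  \<open>centred\<close> to spins. The subtracted constant is the diagonal, absent from the Gibbs
  weight.\<close>

definition Eg :: "real => real => nat => conf => real" where
  "Eg a vt n cf = (1/8) * (bil n (Gk a vt n) (fld n cf) - real n * Gk a vt n 0)"

lemma gibbs_Eg: assumes "n > 0" "cf \<in> Omega n" and even: "!!d. Gk a vt n (- d) = Gk a vt n d"
  shows "gibbs_weight a vt n cf = exp (Eg a vt n cf)"
proof -
  define x where "x = fld n cf"
  have cx: "centred cf i = x (int i) / 2" if "i < n" for i
    unfolding x_def fld_nat[OF that] centred_def spin_def by simp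
  have sq: "x i * x i = 1" for i unfolding x_def using fld_sq[OF assms(2,1), of i] by (simp add: power2_eq_square)
  have "(\<Sum>i<n. \<Sum>j\<in>{..<n} - {i}. centred cf i * centred cf j * gfun a vt n ((real i - real j) / real n))
     = (\<Sum>i<n. (\<Sum>j<n. real n / 4 * (x (int i) * (Gk a vt n (int j - int i) * x (int j)))) - real n / 4 * Gk a vt n 0)"
  proof (rule sum.cong[OF refl])
    fix i assume "i \<in> {..<n}"
    then have i: "i < n" by simp
    have t: "centred cf i * centred cf j * gfun a vt n ((real i - real j) / real n) = real n / 4 * (x (int i) * (Gk a vt n (int j - int i) * x (int j)))" if "j < n" for j
    proof -
      have "gfun a vt n ((real i - real j) / real n) = real n * Gk a vt n (int j - int i)"
        using even[of "int j - int i"] assms(1) unfolding Gk_def by simp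
      then show ?thesis unfolding cx[OF i] cx[OF that] by simp
    qed
    have "(\<Sum>j\<in>{..<n} - {i}. centred cf i * centred cf j * gfun a vt n ((real i - real j) / real n))
      = (\<Sum>j\<in>{..<n} - {i}. real n / 4 * (x (int i) * (Gk a vt n (int j - int i) * x (int j))))"
      by (rule sum.cong) (use t in auto)
    also have "... = (\<Sum>j<n. real n / 4 * (x (int i) * (Gk a vt n (int j - int i) * x (int j)))) - real n / 4 * (x (int i) * (Gk a vt n 0 * x (int i)))"
      using i by (simp add: sum_diff1)
    also have "x (int i) * (Gk a vt n 0 * x (int i)) = Gk a vt n 0" using sq[of "int i"] by (simp add: mult.left_commute)
    finally show "(\<Sum>j\<in>{..<n} - {i}. centred cf i * centred cf j * gfun a vt n ((real i - real j) / real n))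
      = (\<Sum>j<n. real n / 4 * (x (int i) * (Gk a vt n (int j - int i) * x (int j)))) - real n / 4 * Gk a vt n 0" .
  qed
  also have "... = tsum n (%i. tsum n (%j. real n / 4 * (x i * (Gk a vt n (j - i) * x j))) - real n / 4 * Gk a vt n 0)"
    unfolding tsum_nat unfolding tsum_def by (intro sum.cong refl) auto
  also have "... = real n / 4 * (bil n (Gk a vt n) x - real n * Gk a vt n 0)"
  proof -
    have "tsum n (%j. real n / 4 * (x i * (Gk a vt n (j - i) * x j))) = real n / 4 * (x i * cv n (Gk a vt n) x i)" for i
      unfolding cv_def by (simp only: tsum_cmult)
    then have "tsum n (%i. tsum n (%j. real n / 4 * (x i * (Gk a vt n (j - i) * x j))) - real n / 4 * Gk a vt n 0) = tsum n (%i. real n / 4 * (x i * cv n (Gk a vt n) x i)) - real n * (real n / 4 * Gk a vt n 0)"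
      by (simp only: tsum_diff tsum_const)
    also have "tsum n (%i. real n / 4 * (x i * cv n (Gk a vt n) x i)) = real n / 4 * bil n (Gk a vt n) x"
      unfolding bil_def by (rule tsum_cmult)
    finally show ?thesis by (simp add: right_diff_distrib)
  qed
  finally have e: "(\<Sum>i<n. \<Sum>j\<in>{..<n} - {i}. centred cf i * centred cf j * gfun a vt n ((real i - real j) / real n)) = real n / 4 * (bil n (Gk a vt n) x - real n * Gk a vt n 0)" .
  show ?thesis unfolding gibbs_weight_def e Eg_def x_def[symmetric] using assms(1) by simp
qed

text \<open>A tail of the series of inverse squares: half a power of the frequency is spent on the
  decay \<open>1 / sqrt N\<close>, the rate at which errors in the total mass of the interaction are
  tolerated.\<close>

lemma suminf_powr32: 
  defines "S \<equiv> (\<Sum>l. real (Suc l) powr (- 3/2))"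
  assumes "a > 0" shows "summable (%l. real (Suc l) powr (- 3/2))"
    "N > 0 ==> summable (%l. if N \<le> Suc l then hk a l else 0) \<and> (\<Sum>l. if N \<le> Suc l then hk a l else 0) \<le> S / sqrt (real N)"
proof -
  have "summable (%l. real l powr (- 3/2))" by (subst summable_real_powr_iff) simp
  then show s: "summable (%l. real (Suc l) powr (- 3/2))" by (subst summable_Suc_iff)
  assume N: "N > 0"
  have b: "(if N \<le> Suc l then hk a l else 0) \<le> 1 / sqrt (real N) * real (Suc l) powr (- 3/2)" for l
  proof (cases "N \<le> Suc l")
    case True
    define L where "L = real (Suc l)"
    have L: "L > 0" "real N \<le> L" using True by (simp_all add: L_def)
    have "hk a l \<le> 1 / 18 * (1 / L^2)" using hk_bounds(2)[OF assms(2), of l] unfolding L_def by (simp add: add.commute)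
    also have "... \<le> 1 * (1 / L^2)" by (rule mult_right_mono) auto
    also have "1 * (1 / L^2) = 1 / L^2" by simp
    also have "1 / L^2 = L powr (- 1/2) * L powr (- 3/2)" using L by (simp add: powr_add[symmetric] powr_minus_divide)
    also have "... \<le> 1 / sqrt (real N) * L powr (- 3/2)"
    proof (rule mult_right_mono)
      have "L powr (- 1/2) = 1 / sqrt L" using L by (simp add: powr_minus_divide powr_half_sqrt)
      also have "... \<le> 1 / sqrt (real N)" using L N by (intro divide_left_mono) auto
      finally show "L powr (- 1/2) \<le> 1 / sqrt (real N)" .
    qed simp
    finally show ?thesis using True unfolding L_def by simp
  qed simp
  have s2: "summable (%l. 1 / sqrt (real N) * real (Suc l) powr (- 3/2))" by (rule summable_mult[OF s])
  have s1: "summable (%l. if N \<le> Suc l then hk a l else 0)"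
    by (rule summable_comparison_test'[OF s2, of 0]) (use b hk_bounds(1)[OF assms(2)] in \<open>auto simp: less_imp_le\<close>)
  have "(\<Sum>l. if N \<le> Suc l then hk a l else 0) \<le> (\<Sum>l. 1 / sqrt (real N) * real (Suc l) powr (- 3/2))" by (rule suminf_le[OF b s1 s2])
  also have "... = S / sqrt (real N)" unfolding suminf_mult[OF s] S_def by simp
  finally show "summable (%l. if N \<le> Suc l then hk a l else 0) \<and> (\<Sum>l. if N \<le> Suc l then hk a l else 0) \<le> S / sqrt (real N)" using s1 by simp
qed

text \<open>\<open>g36\<close> is the condition that opens the absolute value in \<open>lam\<close>
  (\<open>lam_eq\<close>).\<close>

locale bign =
  fixes a vt :: real and n :: nat
  assumes a: "a > 0" and n3: "n \<ge> 3" and g36: "2 * a * \<bar>1 - 2 * gam vt n\<bar> \<le> 36" and g0: "0 \<le> gam vt n" and g1: "gam vt n \<le> 1"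
begin

lemma n0: "n > 0" and n2: "n \<ge> 2" using n3 by auto

abbreviation "V \<equiv> Gk a vt n"
abbreviation "l0 \<equiv> min 4 (8 * gam vt n)"

lemma V_eq: "V d = (l0 + 8 * a * gam vt n * hr a 1 (real_of_int d / real n)) / real n"
  unfolding Gk_def gfun_eq[OF a g36] ..

lemma V_even: "V (- d) = V d" unfolding V_eq by (simp add: hr_even)

lemma V_per: "per n V"
proof (rule perI)
  fix i
  have "real_of_int (i + int n) / real n = real_of_int i / real n + real_of_int 1" using n0 by (simp add: field_simps)
  then show "V (i + int n) = V i" unfolding V_eq by (simp only: hr_per)
qed

definition "cV = 8 * a * (2 + 2 * a)"

lemma cV0: "cV \<ge> 0" unfolding cV_def using a by simp

lemma V_second: "V (d + 1) + V (d - 1) - 2 * V d \<le> cV / real n ^ 3"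
proof -
  define t where "t = real_of_int d / real n"
  have e: "real_of_int (d + 1) / real n = t + 1 / real n" "real_of_int (d - 1) / real n = t - 1 / real n"
    unfolding t_def by (simp_all add: add_divide_distrib diff_divide_distrib)
  have "V (d + 1) + V (d - 1) - 2 * V d = 8 * a * gam vt n * (hr a 1 (t + 1 / real n) + hr a 1 (t - 1 / real n) - 2 * hr a 1 t) / real n"
    unfolding V_eq e t_def[symmetric] using n0 by (simp add: field_simps)
  also have "... \<le> 8 * a * gam vt n * ((2 + 2 * a) * (1 / real n)^2) / real n"
    using h1_second_diff[OF a, of t "1 / real n"] a g0 by (intro divide_right_mono mult_left_mono) auto
  also have "... \<le> 8 * a * 1 * ((2 + 2 * a) * (1 / real n)^2) / real n"
    using a g0 g1 by (intro divide_right_mono mult_right_mono mult_left_mono) auto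
  also have "... = cV / real n ^ 3" unfolding cV_def using n0 by (simp add: field_simps power_eq_if)
  finally show ?thesis .
qed

lemma V_sum2: "tsum n (%d. \<bar>V (d + 1) + V (d - 1) - 2 * V d\<bar>) \<le> 2 * cV / (real n)^2"
  and V_grad: "\<bar>V (d + 1) - V d\<bar> \<le> 2 * cV / (real n)^2"
proof -
  have c: "0 \<le> cV / real n ^ 3" using cV0 by simp
  have e: "2 * (real n * (cV / real n ^ 3)) = 2 * cV / (real n)^2" using n0 by (simp add: field_simps power_eq_if)
  show "tsum n (%d. \<bar>V (d + 1) + V (d - 1) - 2 * V d\<bar>) \<le> 2 * cV / (real n)^2"
    using second_diff_bounds(1)[OF V_per n0 V_second c] unfolding e .
  show "\<bar>V (d + 1) - V d\<bar> \<le> 2 * cV / (real n)^2"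
    using second_diff_bounds(2)[OF V_per n0 V_second c] unfolding e .
qed

lemma V_abs: "\<bar>V d\<bar> \<le> (4 + 8 * a) / real n"
proof -
  have "\<bar>8 * a * gam vt n * hr a 1 (real_of_int d / real n)\<bar> \<le> 8 * a * 1 * 1"
    unfolding abs_mult using hr_abs[OF a, of 1] a g0 g1 by (intro mult_mono) auto
  moreover have "\<bar>l0\<bar> \<le> 4" using g0 by simp
  ultimately have "\<bar>l0 + 8 * a * gam vt n * hr a 1 (real_of_int d / real n)\<bar> \<le> 4 + 8 * a" by linarith
  then show ?thesis unfolding V_eq abs_divide using n0 by (simp add: divide_right_mono)
qed

definition "S32 = (\<Sum>l. real (Suc l) powr (- 3/2))"

text \<open>Aliasing: summing over the \<open>n\<close> grid points kills every frequency not
  divisible by \<open>n\<close>, and the surviving ones are contained in a tail.\<close>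

lemma hr_sum: "\<bar>(\<Sum>j<n. hr a 1 (real j / real n))\<bar> \<le> 2 * real n * (S32 / sqrt (real n))"
proof -
  have sm: "summable (%l. 1 ^ Suc l * (hk a l * (2 * cos (2 * pi * real (Suc l) * x))))" for x by (rule hr_summable[OF a]) auto
  have "(\<Sum>j<n. hr a 1 (real j / real n)) = (\<Sum>l. \<Sum>j<n. 1 ^ Suc l * (hk a l * (2 * cos (2 * pi * real (Suc l) * (real j / real n)))))"
    unfolding hr_def by (rule suminf_sum[OF sm, symmetric])
  also have "... = (\<Sum>l. 2 * hk a l * (if n dvd Suc l then real n else 0))"
  proof (rule arg_cong[of _ _ suminf], rule ext)
    fix l
    have "(\<Sum>j<n. cos (2 * pi * real (Suc l) * (real j / real n))) = (if n dvd Suc l then real n else 0)"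
      using sum_cos[OF n0, of "int (Suc l)" 0] by (simp only: int_dvd_int_iff of_int_of_nat_eq) (simp add: mult.assoc)
    moreover have "(\<Sum>j<n. 1 ^ Suc l * (hk a l * (2 * cos (2 * pi * real (Suc l) * (real j / real n))))) = 2 * hk a l * (\<Sum>j<n. cos (2 * pi * real (Suc l) * (real j / real n)))"
      unfolding sum_distrib_left by (rule sum.cong) simp_all
    ultimately show "(\<Sum>j<n. 1 ^ Suc l * (hk a l * (2 * cos (2 * pi * real (Suc l) * (real j / real n))))) = 2 * hk a l * (if n dvd Suc l then real n else 0)"
      by (simp only:)
  qed
  finally have eq: "(\<Sum>j<n. hr a 1 (real j / real n)) = (\<Sum>l. 2 * hk a l * (if n dvd Suc l then real n else 0))" .
  note t = suminf_powr32(2)[OF a n0]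
  have sm2: "summable (%l. 2 * real n * (if n \<le> Suc l then hk a l else 0))" by (rule summable_mult) (use t in simp)
  have "norm (\<Sum>l. 2 * hk a l * (if n dvd Suc l then real n else 0)) \<le> (\<Sum>l. 2 * real n * (if n \<le> Suc l then hk a l else 0))"
  proof (rule norm_suminf_le[OF _ sm2])
    fix l
    have "n dvd Suc l ==> n \<le> Suc l" by (rule dvd_imp_le) auto
    then show "norm (2 * hk a l * (if n dvd Suc l then real n else 0)) \<le> 2 * real n * (if n \<le> Suc l then hk a l else 0)"
      using hk_bounds(1)[OF a, of l] by auto
  qed
  also have "... = 2 * real n * (\<Sum>l. if n \<le> Suc l then hk a l else 0)" by (rule suminf_mult) (use t in simp)
  also have "... \<le> 2 * real n * (S32 / sqrt (real n))" using t unfolding S32_def by (intro mult_left_mono) auto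
  finally show ?thesis unfolding eq by simp
qed

text \<open>The mass 4 is the one that matches the Curie--Weiss exponent: a constant field
  \<open>4 * m\<close> changes the energy by \<open>- 2 * x * m\<close> under a flip, as
  \<open>UU_flp\<close> does.\<close>

lemma V_sum: "\<bar>tsum n V - 4\<bar> \<le> (4 * \<bar>vt\<bar> + 16 * a * S32) / sqrt (real n)"
proof -
  have "tsum n V = (\<Sum>j<n. (l0 + 8 * a * gam vt n * hr a 1 (real j / real n)) / real n)"
    unfolding tsum_nat unfolding tsum_def V_eq by (intro sum.cong) auto
  also have "... = l0 + 8 * a * gam vt n * (\<Sum>j<n. hr a 1 (real j / real n)) / real n"
    unfolding sum_divide_distrib[symmetric] sum.distrib sum_distrib_left[symmetric] using n0 by (simp add: add_divide_distrib)
  finally have e: "tsum n V - 4 = (l0 - 4) + 8 * a * gam vt n * (\<Sum>j<n. hr a 1 (real j / real n)) / real n" by simp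
  have "\<bar>8 * a * gam vt n * (\<Sum>j<n. hr a 1 (real j / real n)) / real n\<bar> = 8 * a * gam vt n * \<bar>\<Sum>j<n. hr a 1 (real j / real n)\<bar> / real n"
    using a g0 by (simp add: abs_mult)
  also have "... \<le> 8 * a * 1 * (2 * real n * (S32 / sqrt (real n))) / real n"
    using hr_sum a g0 g1 by (intro divide_right_mono mult_mono) auto
  also have "... = 16 * a * S32 / sqrt (real n)" using n0 by simp
  finally have 1: "\<bar>8 * a * gam vt n * (\<Sum>j<n. hr a 1 (real j / real n)) / real n\<bar> \<le> 16 * a * S32 / sqrt (real n)" .
  have g4: "8 * gam vt n - 4 = - (4 * (vt / sqrt (real n)))" unfolding gam_def by (simp add: field_simps)
  have "\<bar>l0 - 4\<bar> \<le> \<bar>8 * gam vt n - 4\<bar>" by (simp add: min_def)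
  also have "... = 4 * \<bar>vt\<bar> / sqrt (real n)" unfolding g4 by (simp add: abs_mult)
  finally have 2: "\<bar>l0 - 4\<bar> \<le> 4 * \<bar>vt\<bar> / sqrt (real n)" .
  show ?thesis unfolding e add_divide_distrib using order_trans[OF abs_triangle_ineq add_mono[OF 2 1]] .
qed

lemma Qf_P1: "Qf n (saw n) x = (real n)^2 / 2 * P1 n x" unfolding P1_def using n0 by simp

text \<open>The gradient of the interaction field is a convolution of the primitive with second
  differences of \<open>V\<close>, whose l1 norm is of order \<open>1 / n^2\<close> by
  \<open>V_sum2\<close>.\<close>

lemma theta_grad: assumes "per n x"
  shows "(real n)^2 * grad2 n (cv n V x) \<le> 2 * cV^2 * P1 n x"
proof -
  let ?W = "%d. V (d - 2) + V d - 2 * V (d - 1)"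
  have pW: "per n ?W" using V_per by (intro per_diff per_add per_cmult per_shift')
  have sW: "tsum n (%d. \<bar>?W d\<bar>) \<le> 2 * cV / (real n)^2"
  proof -
    have "per n (%d. \<bar>V (d + 1) + V (d - 1) - 2 * V d\<bar>)" using V_per by (intro per_intros)
    from tsum_shift'[OF this, of 1] show ?thesis using V_sum2 by (simp add: add.commute)
  qed
  have "grad2 n (cv n V x) = tsum n (%i. (cv n ?W (cv n (saw n) x) i)^2)"
    unfolding grad2_def cv_via_saw(2)[OF V_per n0 assms] ..
  also have "... \<le> (tsum n (%d. \<bar>?W d\<bar>))^2 * Qf n (saw n) x"
    unfolding Qf_def by (rule Young'[OF pW per_cv[OF per_saw] n0])
  also have "... \<le> (2 * cV / (real n)^2)^2 * Qf n (saw n) x"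
    by (intro mult_right_mono power_mono sW Qf_nonneg tsum_nonneg) auto
  also have "... = 2 * cV^2 * P1 n x / (real n)^2" unfolding Qf_P1 using n0 by (simp add: field_simps power2_eq_square)
  finally have "(real n)^2 * grad2 n (cv n V x) \<le> (real n)^2 * (2 * cV^2 * P1 n x / (real n)^2)" by (intro mult_left_mono) auto
  then show ?thesis using n0 by simp
qed

text \<open>The deviation of the interaction field from its mean part measures how far the Gibbs
  weight is from Curie--Weiss; first differences of \<open>V\<close> suffice here.\<close>

lemma theta_dev: assumes "per n x"
  shows "tsum n (%i. (cv n V x i - tsum n V * mg n x)^2) \<le> 2 * cV^2 * P1 n x"
proof -
  let ?W = "%d. V (d - 1) - V d"
  have pW: "per n ?W" using V_per by (intro per_diff per_shift')
  have sW: "tsum n (%d. \<bar>?W d\<bar>) \<le> 2 * cV / real n"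
  proof -
    have "tsum n (%d. \<bar>?W d\<bar>) \<le> real n * (2 * cV / (real n)^2)"
      by (rule tsum_le_const) (use V_grad[of "_ - 1"] in \<open>simp add: abs_minus_commute\<close>)
    then show ?thesis using n0 by (simp add: power2_eq_square)
  qed
  have "tsum n (%i. (cv n V x i - tsum n V * mg n x)^2) = tsum n (%i. (cv n ?W (cv n (saw n) x) i)^2)"
    unfolding cv_via_saw(1)[OF V_per n0 assms] by simp
  also have "... \<le> (tsum n (%d. \<bar>?W d\<bar>))^2 * Qf n (saw n) x"
    unfolding Qf_def by (rule Young'[OF pW per_cv[OF per_saw] n0])
  also have "... \<le> (2 * cV / real n)^2 * Qf n (saw n) x"
    by (intro mult_right_mono power_mono sW Qf_nonneg tsum_nonneg) auto
  also have "... = 2 * cV^2 * P1 n x" unfolding Qf_P1 using n0 by (simp add: field_simps power2_eq_square)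
  finally show ?thesis .
qed

lemma gibbs: "cf \<in> Omega n ==> gibbs_weight a vt n cf = exp (Eg a vt n cf)"
  by (rule gibbs_Eg[OF n0 _ V_even])

lemma Eg_exc: assumes "cf \<in> Omega n"
  shows "\<bar>Eg a vt n (exc n cf b) - Eg a vt n cf\<bar> \<le> (1/2) * \<bar>cv n V (fld n cf) (b + 1) - cv n V (fld n cf) b\<bar> + 2 * cV / (real n)^2"
    "\<bar>Eg a vt n (exc n cf b) - Eg a vt n cf\<bar> \<le> 3 * cV"
proof -
  let ?x = "fld n cf"
  define c where "c = ?x (b + 1) - ?x b"
  have c: "\<bar>c\<bar> \<le> 2" unfolding c_def using fld_values[OF assms n0, of "b+1"] fld_values[OF assms n0, of b] by auto
  have "bil n V (fld n (exc n cf b)) - bil n V ?x = 2 * c * (cv n V ?x b - cv n V ?x (b + 1)) + 2 * c^2 * (V 0 - V 1)"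
    unfolding c_def by (rule bil_swap[OF V_per V_even per_fld n0 fld_exc[OF n2]])
  then have e: "Eg a vt n (exc n cf b) - Eg a vt n cf = c / 4 * (cv n V ?x b - cv n V ?x (b + 1)) + c^2 / 4 * (V 0 - V 1)"
    unfolding Eg_def by (simp add: algebra_simps)
  have "c^2 \<le> 4" using power_mono[OF c, of 2] by simp
  then have "\<bar>c^2 / 4 * (V 0 - V 1)\<bar> \<le> 1 * (2 * cV / (real n)^2)"
    unfolding abs_mult using V_grad[of 0] by (intro mult_mono) (auto simp: abs_minus_commute)
  moreover have "\<bar>c / 4 * (cv n V ?x b - cv n V ?x (b + 1))\<bar> \<le> (1/2) * \<bar>cv n V ?x (b + 1) - cv n V ?x b\<bar>"
    unfolding abs_mult using c by (intro mult_mono) (auto simp: abs_minus_commute)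
  ultimately show 1: "\<bar>Eg a vt n (exc n cf b) - Eg a vt n cf\<bar> \<le> (1/2) * \<bar>cv n V ?x (b + 1) - cv n V ?x b\<bar> + 2 * cV / (real n)^2"
    unfolding e by linarith
  have "\<bar>cv n V ?x (b + 1) - cv n V ?x b\<bar> \<le> tsum n (%j. 2 * cV / (real n)^2)"
    unfolding cv_def tsum_diff[symmetric]
  proof (rule order_trans[OF tsum_abs_le], rule tsum_mono)
    fix j
    have "V (j - (b + 1)) * ?x j - V (j - b) * ?x j = (V (j - (b + 1)) - V (j - (b + 1) + 1)) * ?x j" by (simp add: algebra_simps)
    then show "\<bar>V (j - (b + 1)) * ?x j - V (j - b) * ?x j\<bar> \<le> 2 * cV / (real n)^2"
      using V_grad[of "j - (b + 1)"] by (simp add: abs_mult fld_abs[OF assms n0] abs_minus_commute)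
  qed
  also have "... = 2 * cV / real n" unfolding tsum_const using n0 by (simp add: power2_eq_square)
  also have "... \<le> 2 * cV / 1" using n0 cV0 by (intro divide_left_mono) auto
  finally have 2: "\<bar>cv n V ?x (b + 1) - cv n V ?x b\<bar> \<le> 2 * cV" by simp
  have "2 * cV / (real n)^2 \<le> 2 * cV / 1" using n0 cV0 by (intro divide_left_mono) auto
  then show "\<bar>Eg a vt n (exc n cf b) - Eg a vt n cf\<bar> \<le> 3 * cV" using 1 2 by argo
qed

definition "cN = (4 * \<bar>vt\<bar> + 16 * a * S32) + (4 + 8 * a) + 2"

lemma S320: "S32 \<ge> 0" unfolding S32_def by (rule suminf_nonneg[OF suminf_powr32(1)[OF a]]) simp
lemma cN0: "cN \<ge> 0" unfolding cN_def using a S320 by simp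

text \<open>The mean parts of the Gibbs and Curie--Weiss fields cancel up to
  \<open>(tsum n V - 4) * m\<close>, which \<open>V_sum\<close> bounds. The diagonal terms are of
  order \<open>1 / n\<close>.\<close>

lemma N_flp: assumes "cf \<in> Omega n"
  defines "N \<equiv> %cf. Eg a vt n cf - UU n cf"
  shows "\<bar>N (flp n cf b) - N cf\<bar> \<le> \<bar>cv n V (fld n cf) b - tsum n V * mg n (fld n cf)\<bar> + cN / sqrt (real n)"
    "\<bar>N (flp n cf b) - N cf\<bar> \<le> 8 + 16 * a + cN"
    "\<bar>UU n (flp n cf b) - UU n cf\<bar> \<le> 4"
proof -
  let ?x = "fld n cf"
  define m where "m = mg n ?x"
  have x1: "\<bar>?x i\<bar> = 1" for i by (rule fld_abs[OF assms(1) n0])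
  have sq: "(?x b)^2 = 1" by (rule fld_sq[OF assms(1) n0])
  have m1: "\<bar>m\<bar> \<le> 1" unfolding m_def by (rule mg_abs[OF assms(1) n0])
  have "bil n V (fld n (flp n cf b)) - bil n V ?x = 2 * (- 2 * ?x b) * cv n V ?x b + (- 2 * ?x b)^2 * V 0"
    by (rule bil_single[OF V_per V_even per_fld n0 fld_flp[OF n0 assms(1)]])
  then have "Eg a vt n (flp n cf b) - Eg a vt n cf = - (?x b / 2) * cv n V ?x b + V 0 / 2"
    unfolding Eg_def by (simp add: power_mult_distrib sq algebra_simps)
  then have e: "N (flp n cf b) - N cf = - (?x b / 2) * ((cv n V ?x b - tsum n V * m) + (tsum n V - 4) * m) + V 0 / 2 - 2 / real n"
    using UU_flp[OF n0 assms(1), of b] unfolding N_def m_def[symmetric] by (simp add: algebra_simps)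
  have sn: "1 / real n \<le> 1 / sqrt (real n)" using n0 by (intro divide_left_mono) (auto simp: real_le_lsqrt power2_eq_square)
  have "\<bar>- (?x b / 2) * ((cv n V ?x b - tsum n V * m) + (tsum n V - 4) * m)\<bar> \<le> \<bar>cv n V ?x b - tsum n V * m\<bar> + \<bar>tsum n V - 4\<bar>"
  proof -
    have "\<bar>- (?x b / 2) * ((cv n V ?x b - tsum n V * m) + (tsum n V - 4) * m)\<bar> = (1/2) * \<bar>(cv n V ?x b - tsum n V * m) + (tsum n V - 4) * m\<bar>"
      using x1[of b] by (simp add: abs_mult)
    also have "... \<le> 1 * (\<bar>cv n V ?x b - tsum n V * m\<bar> + \<bar>(tsum n V - 4) * m\<bar>)" by (rule mult_mono) auto
    also have "\<bar>(tsum n V - 4) * m\<bar> \<le> \<bar>tsum n V - 4\<bar> * 1" unfolding abs_mult by (rule mult_left_mono[OF m1]) simp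
    finally show ?thesis by simp
  qed
  moreover have "\<bar>V 0 / 2\<bar> \<le> (4 + 8 * a) * (1 / sqrt (real n))"
  proof -
    have "\<bar>V 0 / 2\<bar> \<le> \<bar>V 0\<bar>" by simp
    also have "... \<le> (4 + 8 * a) * (1 / real n)" using V_abs[of 0] by simp
    also have "... \<le> (4 + 8 * a) * (1 / sqrt (real n))" using sn a by (intro mult_left_mono) auto
    finally show ?thesis .
  qed
  moreover have "2 / real n \<le> 2 * (1 / sqrt (real n))" using sn by simp
  moreover have "0 \<le> 2 / real n" by simp
  ultimately have "\<bar>N (flp n cf b) - N cf\<bar> \<le> \<bar>cv n V ?x b - tsum n V * m\<bar> + ((4 * \<bar>vt\<bar> + 16 * a * S32) / sqrt (real n) + (4 + 8 * a) * (1 / sqrt (real n)) + 2 * (1 / sqrt (real n)))"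
    using V_sum unfolding e by (smt (verit))
  also have "(4 * \<bar>vt\<bar> + 16 * a * S32) / sqrt (real n) + (4 + 8 * a) * (1 / sqrt (real n)) + 2 * (1 / sqrt (real n)) = cN / sqrt (real n)"
    unfolding cN_def by (simp add: add_divide_distrib)
  finally show 1: "\<bar>N (flp n cf b) - N cf\<bar> \<le> \<bar>cv n V (fld n cf) b - tsum n V * mg n (fld n cf)\<bar> + cN / sqrt (real n)" unfolding m_def .
  have tV: "tsum n (%d. \<bar>V d\<bar>) \<le> 4 + 8 * a"
    using tsum_le_const[of "%d. \<bar>V d\<bar>", OF V_abs, of n] n0 by simp
  have "\<bar>cv n V ?x b\<bar> \<le> 4 + 8 * a" using cv_abs[of n V ?x 1 b, OF V_per] x1 tV by simp
  moreover have "\<bar>tsum n V * mg n ?x\<bar> \<le> (4 + 8 * a) * 1"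
    unfolding abs_mult using tV tsum_abs_le[of n V] m1 a unfolding m_def by (intro mult_mono) auto
  moreover have "cN / sqrt (real n) \<le> cN / 1" using n0 cN0 by (intro divide_left_mono) auto
  ultimately have "\<bar>N (flp n cf b) - N cf\<bar> \<le> (4 + 8 * a) + (4 + 8 * a) + cN" using 1 abs_triangle_ineq4[of "cv n V ?x b" "tsum n V * mg n ?x"] by argo
  then show "\<bar>N (flp n cf b) - N cf\<bar> \<le> 8 + 16 * a + cN" by simp
  have "\<bar>- 2 * ?x b * m\<bar> \<le> 2 * 1" unfolding abs_mult using x1[of b] m1 by simp
  moreover have "2 / real n \<le> 2" "0 \<le> 2 / real n" using n0 by (auto simp: divide_le_eq)
  ultimately show "\<bar>UU n (flp n cf b) - UU n cf\<bar> \<le> 4" unfolding UU_flp[OF n0 assms(1)] m_def[symmetric] by linarith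
qed

end

section \<open>The carre du champ\<close>

lemma exp_minus_one_sq: fixes t T :: real assumes "\<bar>t\<bar> \<le> T" shows "(exp t - 1)^2 \<le> exp (2 * T) * t^2"
proof -
  have "\<bar>exp t - 1\<bar> \<le> exp T * \<bar>t\<bar>"
  proof (cases "t \<ge> 0")
    case True
    have "exp t - 1 = exp t * (1 - exp (- t))" by (simp add: right_diff_distrib exp_minus)
    also have "... \<le> exp T * t" using True assms exp_ge_add_one_self[of "- t"] by (intro mult_mono) auto
    finally show ?thesis using True by simp
  next
    case False
    have "1 - exp t \<le> 1 * \<bar>t\<bar>" using exp_ge_add_one_self[of t] False by linarith
    also have "... \<le> exp T * \<bar>t\<bar>" using assms by (intro mult_right_mono) auto
    finally show ?thesis using False by simp
  qed
  then have "\<bar>exp t - 1\<bar>^2 \<le> (exp T * \<bar>t\<bar>)^2" by (intro power_mono) auto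
  then show ?thesis by (simp add: power_mult_distrib exp_double)
qed

lemma tilt_sq: fixes u e v :: real shows "(u * e - v)^2 \<le> 2 * (u - v)^2 + 2 * (u^2 * (e - 1)^2)"
proof -
  have e: "u * e - v = (u - v) + u * (e - 1)" by (simp add: algebra_simps)
  show ?thesis unfolding e using sq_add_le[of "u - v" "u * (e - 1)"] by (simp only: power_mult_distrib)
qed

lemma sq_sum_half: fixes t x y :: real assumes "\<bar>t\<bar> \<le> \<bar>x\<bar> + y" "y \<ge> 0" shows "t^2 \<le> 2 * x^2 + 2 * y^2"
proof -
  have "\<bar>t\<bar>^2 \<le> (\<bar>x\<bar> + y)^2" using assms by (intro power_mono) auto
  then show ?thesis using sq_add_le[of "\<bar>x\<bar>" y] by simp
qed

text \<open>The exchange counterpart of \<open>DG\<close>; it reduces to \<open>Dex\<close> when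
  \<open>U\<close> is invariant under exchanges.\<close>

definition Xex :: "nat => (conf => real) => (conf => real) => real" where
  "Xex n U p = (real n)^2 * tsum n (%b. \<Sum>cf\<in>Omega n. (sqrt (p (exc n cf b)) * exp ((U cf - U (exc n cf b)) / 2) - sqrt (p cf))^2)"

context bign
begin

text \<open>\<open>tilt_sq\<close> separates the untilted Dirichlet form from the tilt. The tilt is
  bounded by the gradient of the interaction field and so, through \<open>theta_grad\<close>, by
  \<open>P1\<close>.\<close>

lemma Xex_le:
  assumes p: "pmfn n p"
  shows "Xex n (Eg a vt n) p \<le> 2 * Dex n p + exp (3 * cV) * (cV^2 * EE n p (%cf. P1 n (fld n cf)) + 4 * cV^2)"
proof -
  interpret pmfn n p by fact
  let ?E = "Eg a vt n"
  define N where "N = real n"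
  have N: "N \<ge> 1" using n0 unfolding N_def by simp
  define s where "s b cf = (?E (exc n cf b) - ?E cf) / 2" for b cf
  define w where "w b cf = cv n V (x cf) (b + 1) - cv n V (x cf) b" for b cf
  have 1: "(\<Sum>cf\<in>Omega n. (sqrt (p (exc n cf b)) * exp ((?E cf - ?E (exc n cf b)) / 2) - sqrt (p cf))^2)
     \<le> 2 * dex n p b + 2 * EE n p (%cf. (exp (s b cf) - 1)^2)" for b
  proof -
    have "(\<Sum>cf\<in>Omega n. (sqrt (p (exc n cf b)) * exp ((?E cf - ?E (exc n cf b)) / 2) - sqrt (p cf))^2)
       \<le> (\<Sum>cf\<in>Omega n. 2 * (sqrt (p (exc n cf b)) - sqrt (p cf))^2 + 2 * (p (exc n cf b) * (exp (s b (exc n cf b)) - 1)^2))"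
    proof (rule sum_mono)
      fix cf assume "cf \<in> Omega n"
      then have "(sqrt (p (exc n cf b)))^2 = p (exc n cf b)" using p0 exc_Omega[OF _ npos] by simp
      then show "(sqrt (p (exc n cf b)) * exp ((?E cf - ?E (exc n cf b)) / 2) - sqrt (p cf))^2
          \<le> 2 * (sqrt (p (exc n cf b)) - sqrt (p cf))^2 + 2 * (p (exc n cf b) * (exp (s b (exc n cf b)) - 1)^2)"
        using tilt_sq[of "sqrt (p (exc n cf b))" "exp ((?E cf - ?E (exc n cf b)) / 2)" "sqrt (p cf)"] unfolding s_def exc_exc by simp
    qed
    also have "... = 2 * dex n p b + 2 * (\<Sum>cf\<in>Omega n. p (exc n cf b) * (exp (s b (exc n cf b)) - 1)^2)"
      unfolding dex_def sum.distrib sum_distrib_left ..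
    also have "(\<Sum>cf\<in>Omega n. p (exc n cf b) * (exp (s b (exc n cf b)) - 1)^2) = EE n p (%cf. (exp (s b cf) - 1)^2)"
      unfolding EE_def by (rule sum_exc[OF npos])
    finally show ?thesis .
  qed
  have 2: "EE n p (%cf. (exp (s b cf) - 1)^2) \<le> exp (3 * cV) * (1/8 * EE n p (%cf. (w b cf)^2) + 2 * cV^2 / N^4)" for b
  proof -
    have "EE n p (%cf. (exp (s b cf) - 1)^2) \<le> EE n p (%cf. exp (3 * cV) * (1/8 * (w b cf)^2 + 2 * cV^2 / N^4))"
    proof (rule EE_mono[OF p0])
      fix cf assume e: "cf \<in> Omega n"
      have "\<bar>s b cf\<bar> \<le> 3 * cV / 2" using Eg_exc(2)[OF e, of b] unfolding s_def by (simp add: abs_divide)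
      then have "(exp (s b cf) - 1)^2 \<le> exp (2 * (3 * cV / 2)) * (s b cf)^2" by (rule exp_minus_one_sq)
      then have A: "(exp (s b cf) - 1)^2 \<le> exp (3 * cV) * (s b cf)^2" by simp
      have "(s b cf)^2 \<le> 1/8 * (w b cf)^2 + 2 * cV^2 / N^4"
      proof -
        have "\<bar>s b cf\<bar> \<le> \<bar>w b cf / 4\<bar> + cV / N^2" using Eg_exc(1)[OF e, of b] unfolding s_def w_def N_def by (simp add: abs_divide)
        then have "(s b cf)^2 \<le> 2 * (w b cf / 4)^2 + 2 * (cV / N^2)^2" by (rule sq_sum_half) (simp add: cV0)
        then show ?thesis by (simp add: power_divide)
      qed
      then have "exp (3 * cV) * (s b cf)^2 \<le> exp (3 * cV) * (1/8 * (w b cf)^2 + 2 * cV^2 / N^4)" by (intro mult_left_mono) auto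
      with A show "(exp (s b cf) - 1)^2 \<le> exp (3 * cV) * (1/8 * (w b cf)^2 + 2 * cV^2 / N^4)" by (rule order_trans)
    qed
    also have "... = exp (3 * cV) * (1/8 * EE n p (%cf. (w b cf)^2) + 2 * cV^2 / N^4)"
      by (simp only: EE_cmult EE_add EE_const[OF p1])
    finally show ?thesis .
  qed
  have "Xex n ?E p \<le> N^2 * tsum n (%b. 2 * dex n p b + 2 * (exp (3 * cV) * (1/8 * EE n p (%cf. (w b cf)^2) + 2 * cV^2 / N^4)))"
    unfolding Xex_def N_def[symmetric] using order_trans[OF 1 add_left_mono[OF mult_left_mono[OF 2, of 2]]]
    by (intro mult_left_mono tsum_mono) auto
  also have "... = 2 * Dex n p + exp (3 * cV) * (1/4 * (N^2 * tsum n (%b. EE n p (%cf. (w b cf)^2))) + N * (4 * cV^2 / N^2))"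
  proof -
    have "tsum n (%b. 2 * dex n p b + 2 * (exp (3 * cV) * (1/8 * EE n p (%cf. (w b cf)^2) + 2 * cV^2 / N^4)))
      = 2 * tsum n (dex n p) + 2 * (exp (3 * cV) * (1/8 * tsum n (%b. EE n p (%cf. (w b cf)^2)) + N * (2 * cV^2 / N^4)))"
      by (simp only: tsum_add tsum_cmult tsum_const N_def)
    moreover have "N^2 * (2 * D + 2 * (e * (1/8 * W + N * (2 * c / N^4)))) = 2 * (N^2 * D) + e * (1/4 * (N^2 * W) + N * (4 * c / N^2))" for D e W c
      using N by (simp add: field_simps power2_eq_square power4_eq_xxxx)
    ultimately show ?thesis unfolding Dex_def N_def[symmetric] by simp
  qed
  also have "tsum n (%b. EE n p (%cf. (w b cf)^2)) = EE n p (%cf. grad2 n (cv n V (x cf)))"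
    unfolding grad2_def w_def EE_tsum ..
  also have "N^2 * EE n p (%cf. grad2 n (cv n V (x cf))) = EE n p (%cf. N^2 * grad2 n (cv n V (x cf)))" by (rule EE_cmult[symmetric])
  also have "2 * Dex n p + exp (3 * cV) * (1/4 * EE n p (%cf. N^2 * grad2 n (cv n V (x cf))) + N * (4 * cV^2 / N^2))
     \<le> 2 * Dex n p + exp (3 * cV) * (1/4 * (2 * cV^2 * EE n p (%cf. P1 n (x cf))) + 4 * cV^2)"
  proof (intro add_left_mono mult_left_mono add_mono)
    show "EE n p (%cf. N^2 * grad2 n (cv n V (x cf))) \<le> 2 * cV^2 * EE n p (%cf. P1 n (x cf))"
      unfolding EE_cmult[symmetric] N_def by (rule EE_mono[OF p0 theta_grad[OF per_fld]])
    have "N * (4 * cV^2 / N^2) = 4 * cV^2 / N" using N by (simp add: power2_eq_square)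
    also have "... \<le> 4 * cV^2 / 1" using N by (intro divide_left_mono) auto
    finally show "N * (4 * cV^2 / N^2) \<le> 4 * cV^2" by simp
  qed auto
  also have "... \<le> 2 * Dex n p + exp (3 * cV) * (cV^2 * EE n p (%cf. P1 n (x cf)) + 4 * cV^2)"
    using EE_nonneg[OF p0 P_nonneg(2)[of n "x _"]] by (intro add_left_mono mult_left_mono) auto
  finally show ?thesis .
qed

definition "cB = 8 + 16 * a + cN"

text \<open>The dissipation available is \<open>DG\<close> for the Curie--Weiss weight. The
  additional tilt towards the Gibbs weight is the difference of \<open>N_flp\<close>, whose squares
  sum to at most multiples of \<open>P1\<close> and of 1 (\<open>theta_dev\<close>).\<close>

lemma DG_le:
  assumes p: "pmfn n p"
  shows "DG (gam vt n) n (Eg a vt n) p \<le> 2 * DG (gam vt n) n (UU n) p + 8 * exp (4 + cB) * (cV^2 * EE n p (%cf. P1 n (fld n cf)) + cN^2)"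
proof -
  interpret pmfn n p by fact
  let ?E = "Eg a vt n" and ?N = "%cf. Eg a vt n cf - UU n cf"
  let ?c = "%cf i. crate (gam vt n) (fld n cf) i"
  define s where "s i cf = (?N (flp n cf i) - ?N cf) / 2" for i cf
  define w where "w i cf = cv n V (x cf) i - tsum n V * mg n (x cf)" for i cf
  define D where "D i = (\<Sum>cf\<in>Omega n. ?c cf i * (sqrt (p (flp n cf i)) * exp ((UU n cf - UU n (flp n cf i)) / 2) - sqrt (p cf))^2)" for i
  have c: "0 \<le> ?c cf i" "?c cf i \<le> 4" if "cf \<in> Omega n" for cf i using crate_bounds[OF that n0 g0 g1] by auto
  have 1: "(\<Sum>cf\<in>Omega n. ?c cf i * (sqrt (p (flp n cf i)) * exp ((?E cf - ?E (flp n cf i)) / 2) - sqrt (p cf))^2)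
     \<le> 2 * D i + 8 * exp 4 * EE n p (%cf. (exp (s i cf) - 1)^2)" for i
  proof -
    have "(\<Sum>cf\<in>Omega n. ?c cf i * (sqrt (p (flp n cf i)) * exp ((?E cf - ?E (flp n cf i)) / 2) - sqrt (p cf))^2)
       \<le> (\<Sum>cf\<in>Omega n. 2 * (?c cf i * (sqrt (p (flp n cf i)) * exp ((UU n cf - UU n (flp n cf i)) / 2) - sqrt (p cf))^2) + 8 * exp 4 * (p (flp n cf i) * (exp (s i (flp n cf i)) - 1)^2))"
    proof (rule sum_mono)
      fix cf assume e: "cf \<in> Omega n"
      define u where "u = exp ((UU n cf - UU n (flp n cf i)) / 2)"
      define P where "P = sqrt (p (flp n cf i))"
      define q where "q = exp (s i (flp n cf i))"
      have P2: "P^2 = p (flp n cf i)" unfolding P_def using p0 flp_Omega[OF e npos] by simp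
      have u2: "u^2 \<le> exp 4" unfolding u_def using N_flp(3)[OF e, of i] by (simp add: exp_double[symmetric])
      have ex: "exp ((?E cf - ?E (flp n cf i)) / 2) = u * q"
        unfolding u_def q_def s_def flp_flp[OF e npos] exp_add[symmetric] by (simp add: field_simps)
      have "(P * (u * q) - sqrt (p cf))^2 \<le> 2 * (P * u - sqrt (p cf))^2 + 2 * ((P * u)^2 * (q - 1)^2)"
        using tilt_sq[of "P * u" q "sqrt (p cf)"] by (simp add: mult.assoc)
      also have "(P * u)^2 * (q - 1)^2 \<le> exp 4 * (P^2 * (q - 1)^2)"
        using mult_right_mono[OF u2, of "P^2 * (q - 1)^2"] by (simp add: power_mult_distrib mult_ac)
      finally have "?c cf i * (P * (u * q) - sqrt (p cf))^2 \<le> ?c cf i * (2 * (P * u - sqrt (p cf))^2 + 2 * (exp 4 * (P^2 * (q - 1)^2)))"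
        using c[OF e, of i] by (intro mult_left_mono) auto
      also have "... = 2 * (?c cf i * (P * u - sqrt (p cf))^2) + ?c cf i * (2 * (exp 4 * (P^2 * (q - 1)^2)))" by (simp add: algebra_simps)
      also have "?c cf i * (2 * (exp 4 * (P^2 * (q - 1)^2))) \<le> 4 * (2 * (exp 4 * (P^2 * (q - 1)^2)))"
        using c[OF e, of i] by (intro mult_right_mono) auto
      finally show "?c cf i * (sqrt (p (flp n cf i)) * exp ((?E cf - ?E (flp n cf i)) / 2) - sqrt (p cf))^2
        \<le> 2 * (?c cf i * (sqrt (p (flp n cf i)) * exp ((UU n cf - UU n (flp n cf i)) / 2) - sqrt (p cf))^2) + 8 * exp 4 * (p (flp n cf i) * (exp (s i (flp n cf i)) - 1)^2)"
        unfolding ex P2 unfolding P_def u_def q_def by simp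
    qed
    also have "... = 2 * D i + 8 * exp 4 * (\<Sum>cf\<in>Omega n. p (flp n cf i) * (exp (s i (flp n cf i)) - 1)^2)"
      unfolding D_def sum.distrib sum_distrib_left ..
    also have "(\<Sum>cf\<in>Omega n. p (flp n cf i) * (exp (s i (flp n cf i)) - 1)^2) = EE n p (%cf. (exp (s i cf) - 1)^2)"
      unfolding EE_def by (rule sum_flp[OF npos])
    finally show ?thesis .
  qed
  have 2: "EE n p (%cf. (exp (s i cf) - 1)^2) \<le> exp cB * (1/2 * EE n p (%cf. (w i cf)^2) + cN^2 / real n)" for i
  proof -
    have "EE n p (%cf. (exp (s i cf) - 1)^2) \<le> EE n p (%cf. exp cB * (1/2 * (w i cf)^2 + cN^2 / real n))"
    proof (rule EE_mono[OF p0])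
      fix cf assume e: "cf \<in> Omega n"
      have "\<bar>s i cf\<bar> \<le> cB / 2" using N_flp(2)[OF e, of i] unfolding s_def cB_def by (simp add: abs_divide)
      then have "(exp (s i cf) - 1)^2 \<le> exp (2 * (cB / 2)) * (s i cf)^2" by (rule exp_minus_one_sq)
      then have A: "(exp (s i cf) - 1)^2 \<le> exp cB * (s i cf)^2" by simp
      have "\<bar>s i cf\<bar> \<le> \<bar>w i cf / 2\<bar> + cN / sqrt (real n) / 2" using N_flp(1)[OF e, of i] unfolding s_def w_def by (simp add: abs_divide)
      then have "(s i cf)^2 \<le> 2 * (w i cf / 2)^2 + 2 * (cN / sqrt (real n) / 2)^2" by (rule sq_sum_half) (simp add: cN0)
      then have "(s i cf)^2 \<le> 1/2 * (w i cf)^2 + cN^2 / real n / 2" by (simp add: power_divide)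
      moreover have "0 \<le> cN^2 / real n" by simp
      ultimately have "(s i cf)^2 \<le> 1/2 * (w i cf)^2 + cN^2 / real n" by argo
      then have "exp cB * (s i cf)^2 \<le> exp cB * (1/2 * (w i cf)^2 + cN^2 / real n)" by (intro mult_left_mono) auto
      with A show "(exp (s i cf) - 1)^2 \<le> exp cB * (1/2 * (w i cf)^2 + cN^2 / real n)" by (rule order_trans)
    qed
    also have "... = exp cB * (1/2 * EE n p (%cf. (w i cf)^2) + cN^2 / real n)"
      by (simp only: EE_cmult EE_add EE_const[OF p1])
    finally show ?thesis .
  qed
  have "DG (gam vt n) n ?E p \<le> tsum n (%i. 2 * D i + 8 * exp 4 * (exp cB * (1/2 * EE n p (%cf. (w i cf)^2) + cN^2 / real n)))"
    unfolding DG_def by (intro tsum_mono order_trans[OF 1 add_left_mono[OF mult_left_mono[OF 2, of "8 * exp 4"]]]) simp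
  also have "... = 2 * DG (gam vt n) n (UU n) p + 8 * exp 4 * (exp cB * (1/2 * tsum n (%i. EE n p (%cf. (w i cf)^2)) + real n * (cN^2 / real n)))"
    unfolding DG_def D_def by (simp only: tsum_add tsum_cmult tsum_const)
  also have "real n * (cN^2 / real n) = cN^2" using n0 by simp
  also have "tsum n (%i. EE n p (%cf. (w i cf)^2)) = EE n p (%cf. tsum n (%i. (w i cf)^2))" unfolding EE_tsum ..
  also have "2 * DG (gam vt n) n (UU n) p + 8 * exp 4 * (exp cB * (1/2 * EE n p (%cf. tsum n (%i. (w i cf)^2)) + cN^2))
     \<le> 2 * DG (gam vt n) n (UU n) p + 8 * exp 4 * (exp cB * (1/2 * (2 * cV^2 * EE n p (%cf. P1 n (x cf))) + cN^2))"
  proof (intro add_left_mono mult_left_mono add_right_mono)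
    show "EE n p (%cf. tsum n (%i. (w i cf)^2)) \<le> 2 * cV^2 * EE n p (%cf. P1 n (x cf))"
      unfolding EE_cmult[symmetric] w_def by (rule EE_mono[OF p0 theta_dev[OF per_fld]])
  qed auto
  finally show ?thesis by (simp add: exp_add mult.assoc)
qed

end

section \<open>Energies of Ising measures with a contractive coupling\<close>

lemma card_Omega: "card (Omega n) = 2 ^ n"
  unfolding Omega_def by (simp add: card_PiE numeral_2_eq_2)

text \<open>Entropy relative to the uniform measure, which gives each configuration the mass
  \<open>2 powr (- n)\<close>.\<close>

definition Hh :: "nat => (conf => real) => real" where
  "Hh n p = EE n p (%cf. ln (p cf)) + real n * ln 2"

text \<open>Nonnegativity of the entropy of \<open>p\<close> relative to the normalised weight
  \<open>q\<close>, from \<open>ln z <= z - 1\<close>. It serves as the variational bound of an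
  energy by entropy plus logarithm of the partition function.\<close>

lemma gibbs_inequality:
  assumes "pmfn n p" and q: "!!cf. cf \<in> Omega n ==> 0 < q cf"
  shows "EE n p (%cf. ln (q cf)) \<le> EE n p (%cf. ln (p cf)) + ln (\<Sum>cf\<in>Omega n. q cf)"
proof -
  interpret pmfn n p by fact
  define Q where "Q = (\<Sum>cf\<in>Omega n. q cf)"
  have Q: "Q > 0" unfolding Q_def by (rule sum_pos[OF finite_Omega Omega_ne q])
  have t: "p cf * (ln (q cf) - ln (p cf) - ln Q) \<le> q cf / Q - p cf" if e: "cf \<in> Omega n" for cf
  proof (cases "p cf = 0")
    case True then show ?thesis using q[OF e] Q by simp
  next
    case False
    then have pp: "p cf > 0" using p0[OF e] by simp
    have "ln (q cf) - ln (p cf) - ln Q = ln (q cf / (p cf * Q))" using q[OF e] pp Q by (simp add: ln_div ln_mult)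
    also have "... \<le> q cf / (p cf * Q) - 1" using q[OF e] pp Q by (intro ln_le_minus_one) simp
    finally have "p cf * (ln (q cf) - ln (p cf) - ln Q) \<le> p cf * (q cf / (p cf * Q) - 1)" using pp by (intro mult_left_mono) auto
    also have "... = q cf / Q - p cf" using pp by (simp add: field_simps)
    finally show ?thesis .
  qed
  have "EE n p (%cf. ln (q cf) - ln (p cf) - ln Q) \<le> (\<Sum>cf\<in>Omega n. q cf / Q - p cf)" unfolding EE_def by (rule sum_mono[OF t])
  also have "... = 0" using Q by (simp add: sum_subtractf p1 sum_divide_distrib[symmetric] Q_def)
  finally show ?thesis unfolding EE_diff EE_const[OF p1] Q_def by simp
qed

lemma Hh_nonneg: assumes "pmfn n p" shows "0 \<le> Hh n p"
  using gibbs_inequality[OF assms, of "%_. 1"] unfolding Hh_def by (simp add: EE_def card_Omega ln_realpow)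

text \<open>This is \<open>u * tanh u <= u^2\<close> cleared of denominators, the form in which the
  two values of a flipped spin appear.\<close>

lemma tanh_le_self:
  fixes u :: real shows "(1 - exp (- 2 * u)) * u \<le> (1 + exp (- 2 * u)) * u^2"
proof -
  have pos: "exp (2 * t) - 1 \<le> t * (exp (2 * t) + 1)" if "t \<ge> 0" for t :: real
  proof -
    have "0 * (exp (2 * 0) + 1) - (exp (2 * 0) - 1) \<le> t * (exp (2 * t) + 1) - (exp (2 * t) - 1)"
    proof (rule DERIV_nonneg_imp_nondecreasing[OF that])
      fix z :: real
      have "((%t. t * (exp (2 * t) + 1) - (exp (2 * t) - 1)) has_real_derivative (exp (2 * z) + 1) + z * (2 * exp (2 * z)) - 2 * exp (2 * z)) (at z)"
        by (auto intro!: derivative_eq_intros)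
      moreover have "(exp (2 * z) + 1) + z * (2 * exp (2 * z)) - 2 * exp (2 * z) \<ge> 0"
      proof -
        have "exp (2 * z) * (1 - 2 * z) \<le> exp (2 * z) * exp (- (2 * z))" using exp_ge_add_one_self[of "- (2 * z)"] by (intro mult_left_mono) auto
        also have "... = 1" by (simp add: exp_minus)
        finally show ?thesis by (simp add: algebra_simps)
      qed
      ultimately show "\<exists>y. ((%t. t * (exp (2 * t) + 1) - (exp (2 * t) - 1)) has_real_derivative y) (at z) \<and> 0 \<le> y" by blast
    qed
    then show ?thesis by simp
  qed
  show ?thesis
  proof (cases "u \<ge> 0")
    case True
    have "exp (- 2 * u) * u * (exp (2 * u) - 1) \<le> exp (- 2 * u) * u * (u * (exp (2 * u) + 1))"
      using pos[OF True] True by (intro mult_left_mono) auto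
    moreover have "exp (- 2 * u) * exp (2 * u) = 1" by (simp add: exp_add[symmetric])
    ultimately show ?thesis by (simp add: algebra_simps power2_eq_square)
  next
    case False
    have "(- u) * (exp (2 * (- u)) - 1) \<le> (- u) * ((- u) * (exp (2 * (- u)) + 1))"
      using pos[of "- u"] False by (intro mult_left_mono) auto
    then show ?thesis by (simp add: algebra_simps power2_eq_square)
  qed
qed

text \<open>\<open>B\<close> is the quadratic form of an operator, \<open>v\<close> its field and
  \<open>T\<close> its diagonal entry; \<open>contr\<close> says that the square of the operator is
  at most the operator, that is, norm at most one. The abstract form covers both square norms of
  convolutions and the Gibbs interaction.\<close>

locale ising =
  fixes n :: nat and B :: "conf => real" and v :: "int => conf => real" and T s :: real
  assumes n2: "n \<ge> 2" and T0: "T \<ge> 0" and s: "0 < s" "s < 1"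
    and flipB: "!!cf i. cf \<in> Omega n ==> B (flp n cf i) - B cf = - 4 * fld n cf i * v i cf + 4 * T"
    and flipv: "!!cf i. cf \<in> Omega n ==> v i (flp n cf i) = v i cf - 2 * T * fld n cf i"
    and B_eq: "!!cf. cf \<in> Omega n ==> B cf = tsum n (%i. fld n cf i * v i cf)"
    and contr: "!!cf. cf \<in> Omega n ==> tsum n (%i. (v i cf)^2) \<le> B cf"
begin

lemma n0: "n > 0" using n2 by simp

lemma B0: "cf \<in> Omega n ==> 0 \<le> B cf" by (rule order_trans[OF tsum_nonneg contr]) auto

definition "W cf = exp (s / 2 * B cf)"

text \<open>Summing over the spin at \<open>i\<close> first replaces it by the hyperbolic tangent of the local field, which is
  at most the field itself; the contraction hypothesis then closes the bound on the mean energy.\<close>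

lemma mean_energy: "(\<Sum>cf\<in>Omega n. W cf * B cf) \<le> real n * (T + T^2) / (1 - s) * (\<Sum>cf\<in>Omega n. W cf)"
proof -
  \<comment> \<open>The field at \<open>i\<close> without self-interaction. It does not see the flip
    at \<open>i\<close>, so pairing each configuration with its flip isolates this spin.\<close>
  define r where "r i cf = v i cf - T * fld n cf i" for i cf
  have fl: "fld n (flp n cf i) i = - fld n cf i" if "cf \<in> Omega n" for cf i
    unfolding fld_flp[OF n0 that] by (simp add: cind_def)
  have rf: "r i (flp n cf i) = r i cf" if "cf \<in> Omega n" for cf i
    unfolding r_def fl[OF that] flipv[OF that] by simp
  have sq: "fld n cf i * fld n cf i = 1" if "cf \<in> Omega n" for cf i
    using fld_sq[OF that n0, of i] by (simp add: power2_eq_square)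
  have key: "(\<Sum>cf\<in>Omega n. W cf * (fld n cf i * r i cf)) \<le> s * (\<Sum>cf\<in>Omega n. W cf * (r i cf)^2)" for i
  proof -
    define f where "f cf = fld n cf i * r i cf" for cf
    have ff: "f (flp n cf i) = - f cf" if "cf \<in> Omega n" for cf unfolding f_def using fl[OF that] rf[OF that] by simp
    have f2: "(f cf)^2 = (r i cf)^2" if "cf \<in> Omega n" for cf unfolding f_def using fld_sq[OF that n0, of i] by (simp add: power_mult_distrib)
    have t: "W cf * f cf + W (flp n cf i) * f (flp n cf i) \<le> s * (W cf * (f cf)^2 + W (flp n cf i) * (f (flp n cf i))^2)" if e: "cf \<in> Omega n" for cf
    proof -
      have "fld n cf i * v i cf = f cf + T" unfolding f_def r_def using sq[OF e, of i] by (simp add: algebra_simps)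
      then have Bf: "B (flp n cf i) = B cf - 4 * f cf" using flipB[OF e, of i] by (simp add: mult.assoc)
      have Wf: "W (flp n cf i) = W cf * exp (- 2 * (s * f cf))" unfolding W_def Bf by (simp add: exp_add[symmetric] algebra_simps)
      have "(1 - exp (- 2 * (s * f cf))) * (s * f cf) \<le> (1 + exp (- 2 * (s * f cf))) * (s * f cf)^2" by (rule tanh_le_self)
      then have "s * ((1 - exp (- 2 * (s * f cf))) * f cf) \<le> s * ((1 + exp (- 2 * (s * f cf))) * (s * (f cf)^2))"
        by (simp add: power2_eq_square mult_ac)
      then have "(1 - exp (- 2 * (s * f cf))) * f cf \<le> (1 + exp (- 2 * (s * f cf))) * (s * (f cf)^2)"
        by (rule mult_left_le_imp_le[OF _ s(1)])
      then have "W cf * ((1 - exp (- 2 * (s * f cf))) * f cf) \<le> W cf * ((1 + exp (- 2 * (s * f cf))) * (s * (f cf)^2))"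
        by (intro mult_left_mono) (simp_all add: W_def)
      then show ?thesis unfolding Wf ff[OF e] by (simp add: algebra_simps)
    qed
    have "2 * (\<Sum>cf\<in>Omega n. W cf * f cf) = (\<Sum>cf\<in>Omega n. W cf * f cf + W (flp n cf i) * f (flp n cf i))"
      unfolding sum.distrib sum_flp[OF n0, of "%cf. W cf * f cf"] by simp
    also have "... \<le> (\<Sum>cf\<in>Omega n. s * (W cf * (f cf)^2 + W (flp n cf i) * (f (flp n cf i))^2))" by (rule sum_mono[OF t])
    also have "... = s * (\<Sum>cf\<in>Omega n. W cf * (f cf)^2 + W (flp n cf i) * (f (flp n cf i))^2)" by (simp only: sum_distrib_left)
    also have "... = 2 * (s * (\<Sum>cf\<in>Omega n. W cf * (f cf)^2))"
      unfolding sum.distrib sum_flp[OF n0, of "%cf. W cf * (f cf)^2"] by simp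
    finally have "(\<Sum>cf\<in>Omega n. W cf * f cf) \<le> s * (\<Sum>cf\<in>Omega n. W cf * (f cf)^2)" by simp
    also have "(\<Sum>cf\<in>Omega n. W cf * (f cf)^2) = (\<Sum>cf\<in>Omega n. W cf * (r i cf)^2)" by (rule sum.cong) (simp_all add: f2)
    finally show ?thesis unfolding f_def .
  qed
  have Bx: "B cf = real n * T + tsum n (%i. fld n cf i * r i cf)" if e: "cf \<in> Omega n" for cf
  proof -
    have "fld n cf i * v i cf = T + fld n cf i * r i cf" for i unfolding r_def using sq[OF e, of i] by (simp add: algebra_simps)
    then show ?thesis unfolding B_eq[OF e] by (simp only: tsum_add tsum_const)
  qed
  have r2: "tsum n (%i. (r i cf)^2) \<le> B cf + real n * T^2" if e: "cf \<in> Omega n" for cf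
  proof -
    have "(r i cf)^2 = (v i cf)^2 + (- 2 * T) * (fld n cf i * v i cf) + T^2" for i
      unfolding r_def using fld_sq[OF e n0, of i] by (simp add: power2_diff power_mult_distrib)
    then have "tsum n (%i. (r i cf)^2) = tsum n (%i. (v i cf)^2) + (- 2 * T) * B cf + real n * T^2"
      unfolding B_eq[OF e] by (simp only: tsum_add tsum_cmult tsum_const)
    moreover have "T * B cf \<ge> 0" using T0 B0[OF e] by simp
    ultimately show ?thesis using contr[OF e] by linarith
  qed
  define Z where "Z = (\<Sum>cf\<in>Omega n. W cf)"
  define Y where "Y = (\<Sum>cf\<in>Omega n. W cf * B cf)"
  have "Y = (\<Sum>cf\<in>Omega n. real n * T * W cf + tsum n (%i. W cf * (fld n cf i * r i cf)))"
    unfolding Y_def tsum_cmult by (rule sum.cong) (simp_all add: Bx algebra_simps)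
  also have "... = real n * T * Z + tsum n (%i. \<Sum>cf\<in>Omega n. W cf * (fld n cf i * r i cf))"
    unfolding sum.distrib tsum_sum sum_distrib_left Z_def ..
  also have "... \<le> real n * T * Z + tsum n (%i. s * (\<Sum>cf\<in>Omega n. W cf * (r i cf)^2))"
    by (intro add_left_mono tsum_mono key)
  also have "tsum n (%i. s * (\<Sum>cf\<in>Omega n. W cf * (r i cf)^2)) = s * (\<Sum>cf\<in>Omega n. W cf * tsum n (%i. (r i cf)^2))"
    by (simp only: tsum_cmult tsum_sum)
  also have "... \<le> s * (\<Sum>cf\<in>Omega n. W cf * (B cf + real n * T^2))"
    using s(1) r2 by (intro mult_left_mono sum_mono) (auto simp: W_def)
  also have "(\<Sum>cf\<in>Omega n. W cf * (B cf + real n * T^2)) = Y + real n * T^2 * Z"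
    unfolding Y_def Z_def distrib_left sum.distrib sum_distrib_left by (simp add: mult.commute)
  finally have "Y \<le> real n * T * Z + s * (Y + real n * T^2 * Z)" by simp
  moreover have Z0: "Z \<ge> 0" unfolding Z_def W_def by (intro sum_nonneg) auto
  then have "s * (real n * T^2 * Z) \<le> 1 * (real n * T^2 * Z)" using s by (intro mult_right_mono) auto
  \<comment> \<open>The mean energy reappears on the right with the factor \<open>s\<close>, and
    \<open>s < 1\<close> allows it to be moved to the left.\<close>
  ultimately have "(1 - s) * Y \<le> real n * (T + T^2) * Z" by (simp add: algebra_simps)
  then show ?thesis unfolding Y_def[symmetric] Z_def[symmetric] using s by (simp add: field_simps)
qed

definition "CI = s / 2 * (real n * (T + T^2) / (1 - s))"

text \<open>The uniform-relative entropy of the Gibbs measure itself is nonnegative; written out,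
  this bounds \<open>ln Z\<close> by \<open>n * ln 2\<close> plus \<open>s / 2\<close> times the
  mean energy.\<close>

lemma log_partition: "ln (\<Sum>cf\<in>Omega n. W cf) \<le> real n * ln 2 + CI"
proof -
  define Z where "Z = (\<Sum>cf\<in>Omega n. W cf)"
  have Z: "Z > 0" unfolding Z_def W_def by (rule sum_pos[OF finite_Omega Omega_ne]) auto
  define q where "q cf = W cf / Z" for cf
  have q: "pmfn n q" by unfold_locales (use Z n2 in \<open>auto simp: q_def W_def Z_def sum_divide_distrib[symmetric]\<close>)
  from Hh_nonneg[OF q] have "0 \<le> EE n q (%cf. s / 2 * B cf - ln Z) + real n * ln 2"
    unfolding Hh_def q_def W_def using Z by (simp add: ln_div)
  also have "EE n q (%cf. s / 2 * B cf - ln Z) = s / 2 * EE n q B - ln Z"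
    unfolding EE_diff EE_cmult EE_const[OF pmfn.p1[OF q]] ..
  also have "EE n q B \<le> real n * (T + T^2) / (1 - s)"
  proof -
    have "EE n q B = (\<Sum>cf\<in>Omega n. W cf * B cf) / Z" unfolding EE_def q_def by (simp add: sum_divide_distrib)
    also have "... \<le> real n * (T + T^2) / (1 - s) * Z / Z" using mean_energy Z unfolding Z_def by (intro divide_right_mono) auto
    finally show ?thesis using Z by simp
  qed
  finally show ?thesis unfolding Z_def CI_def using s by simp
qed

lemma energy_entropy: assumes "pmfn n p" shows "s / 2 * EE n p B \<le> Hh n p + CI"
proof -
  have "EE n p (%cf. ln (W cf)) = s / 2 * EE n p B" by (simp only: W_def ln_exp EE_cmult)
  then show ?thesis using gibbs_inequality[OF assms, of W] log_partition unfolding Hh_def by (simp add: W_def)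
qed

end

text \<open>Divided by \<open>M^2\<close> the form is a contraction by \<open>Young\<close>. The
  inverse temperature \<open>1/2\<close> stays away from the critical value 1, so no constant beyond
  \<open>M\<close> and \<open>S\<close> depends on \<open>n\<close>.\<close>

lemma Qf_entropy:
  assumes p: "pmfn n p" and U: "per n U" and M: "tsum n (%d. \<bar>U d\<bar>) \<le> M" "M > 0"
  defines "S \<equiv> real n * tsum n (%d. (U d)^2)"
  shows "EE n p (%cf. Qf n U (fld n cf)) \<le> 4 * M^2 * Hh n p + 4 * S"
proof -
  interpret P: pmfn n p by fact
  define t where "t = tsum n (%d. (U d)^2)"
  have t0: "t \<ge> 0" unfolding t_def by (rule tsum_nonneg) simp
  have tM: "t \<le> M^2"
  proof -
    have "t = tsum n (%d. \<bar>U d\<bar> * \<bar>U d\<bar>)" unfolding t_def by (simp add: power2_eq_square)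
    also have "... \<le> tsum n (%d. \<bar>U d\<bar> * M)"
      using order_trans[OF tsum_ge_term[of n "%d. \<bar>U d\<bar>", OF per_abs[OF U] _ P.npos] M(1)] by (intro tsum_mono mult_left_mono) auto
    also have "... \<le> M * M" unfolding tsum_cmult2 using M by (intro mult_right_mono) auto
    finally show ?thesis by (simp add: power2_eq_square)
  qed
  interpret I: ising n "%cf. Qf n U (fld n cf) / M^2" "%i cf. cva n U (cv n U (fld n cf)) i / M^2" "t / M^2" "1/2"
  proof
    show "2 \<le> n" by (rule P.n2)
    show "0 \<le> t / M^2" using t0 by simp
    fix cf :: conf and i :: int assume e: "cf \<in> Omega n"
    have "Qf n U (fld n (flp n cf i)) - Qf n U (fld n cf) = - 4 * fld n cf i * cva n U (cv n U (fld n cf)) i + 4 * t"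
      using Qf_flip[OF U per_fld P.npos fld_flp[OF P.npos e], of i] fld_sq[OF e P.npos, of i] unfolding t_def by simp
    then have "(Qf n U (fld n (flp n cf i)) - Qf n U (fld n cf)) / M^2 = (- 4 * fld n cf i * cva n U (cv n U (fld n cf)) i + 4 * t) / M^2" by simp
    then show "Qf n U (fld n (flp n cf i)) / M^2 - Qf n U (fld n cf) / M^2 = - 4 * fld n cf i * (cva n U (cv n U (fld n cf)) i / M^2) + 4 * (t / M^2)"
      by (simp add: diff_divide_distrib add_divide_distrib)
    have "cva n U (cv n U (fld n (flp n cf i))) i = tsum n (%l. U (i - l) * cv n U (fld n cf) l + (- 2 * fld n cf i) * (U (i - l))^2)"
      unfolding cva_def cv_single[OF U per_fld P.npos fld_flp[OF P.npos e]] by (rule tsum_cong) (simp add: power2_eq_square algebra_simps)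
    also have "... = cva n U (cv n U (fld n cf)) i + (- 2 * fld n cf i) * tsum n (%l. (U (i - l))^2)"
      unfolding cva_def by (simp only: tsum_add tsum_cmult)
    also have "tsum n (%l. (U (i - l))^2) = t" unfolding t_def by (rule tsum_reflect[OF per_pow[OF U]])
    finally show "cva n U (cv n U (fld n (flp n cf i))) i / M^2 = cva n U (cv n U (fld n cf)) i / M^2 - 2 * (t / M^2) * fld n cf i"
      by (simp add: diff_divide_distrib)
  next
    fix cf assume "cf \<in> Omega n"
    have "tsum n (%i. fld n cf i * cva n U (cv n U (fld n cf)) i) = Qf n U (fld n cf)"
      unfolding cv_adj Qf_def by (simp add: power2_eq_square)
    then show "Qf n U (fld n cf) / M^2 = tsum n (%i. fld n cf i * (cva n U (cv n U (fld n cf)) i / M^2))"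
      unfolding times_divide_eq_right tsum_cdiv by simp
    have "tsum n (%i. (cva n U (cv n U (fld n cf)) i)^2) \<le> (tsum n (%d. \<bar>U d\<bar>))^2 * Qf n U (fld n cf)"
      unfolding Qf_def by (rule Young[OF U per_cv[OF U] P.npos])
    also have "... \<le> M^2 * Qf n U (fld n cf)" using M by (intro mult_right_mono power_mono Qf_nonneg tsum_nonneg) auto
    finally have "tsum n (%i. (cva n U (cv n U (fld n cf)) i)^2) / (M^2)^2 \<le> M^2 * Qf n U (fld n cf) / (M^2)^2" by (rule divide_right_mono) simp
    then show "tsum n (%i. (cva n U (cv n U (fld n cf)) i / M^2)^2) \<le> Qf n U (fld n cf) / M^2"
      using M(2) unfolding power_divide tsum_cdiv by (simp add: power2_eq_square)
  qed auto
  have "EE n p (%cf. Qf n U (fld n cf)) = M^2 * EE n p (%cf. Qf n U (fld n cf) / M^2)"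
    unfolding EE_cmult[symmetric] using M(2) by simp
  also have "... \<le> M^2 * (4 * (Hh n p + I.CI))" using I.energy_entropy[OF p] by (intro mult_left_mono) auto
  also have "I.CI = real n * (t / M^2 + (t / M^2)^2) / 2" unfolding I.CI_def by simp
  also have "M^2 * (4 * (Hh n p + real n * (t / M^2 + (t / M^2)^2) / 2)) = 4 * M^2 * Hh n p + 2 * (real n * (t + t * (t / M^2)))"
    using M(2) by (simp add: field_simps power2_eq_square)
  also have "... \<le> 4 * M^2 * Hh n p + 2 * (real n * (t + t * 1))"
    using tM M(2) t0 by (intro add_left_mono mult_left_mono) auto
  finally show ?thesis unfolding S_def t_def by simp
qed

section \<open>Comparison of the free energies\<close>

text \<open>The squared modulus of a Fourier coefficient, so each mode is a nonnegative
  form.\<close>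

lemma bil_cos: "bil n (%d. cos (c * real_of_int d)) x = (tsum n (%i. x i * cos (c * real_of_int i)))^2 + (tsum n (%i. x i * sin (c * real_of_int i)))^2"
proof -
  have sq: "(tsum n f)^2 = tsum n (%i. tsum n (%j. f i * f j))" for f
    by (simp only: tsum_cmult tsum_cmult2 power2_eq_square)
  have "bil n (%d. cos (c * real_of_int d)) x = tsum n (%i. tsum n (%j. x i * (cos (c * real_of_int (j - i)) * x j)))"
    unfolding bil_def cv_def by (simp only: tsum_cmult)
  also have "... = tsum n (%i. tsum n (%j. (x i * cos (c * real_of_int i)) * (x j * cos (c * real_of_int j)) + (x i * sin (c * real_of_int i)) * (x j * sin (c * real_of_int j))))"
    by (intro tsum_cong) (simp add: right_diff_distrib cos_diff distrib_left distrib_right mult_ac)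
  finally show ?thesis unfolding sq by (simp only: tsum_add)
qed

definition RR :: "real => nat => (int => real) => real" where
  "RR a n x = bil n (%d. hr a 1 (real_of_int d / real n)) x"

lemma RR_sums: assumes a: "a > 0"
  shows "(%l. hk a l * (2 * bil n (%d. cos (2 * pi * real (Suc l) / real n * real_of_int d)) x)) sums RR a n x"
proof -
  have "(%l. hk a l * (2 * cos (2 * pi * real (Suc l) / real n * real_of_int d))) sums hr a 1 (real_of_int d / real n)" for d
    using summable_sums[OF hr_summable[OF a, of 1 "real_of_int d / real n"]] unfolding hr_def by simp
  then have "(%l. \<Sum>i\<in>{0..<int n}. x i * (\<Sum>j\<in>{0..<int n}. hk a l * (2 * cos (2 * pi * real (Suc l) / real n * real_of_int (j - i))) * x j)) sums RR a n x"
    unfolding RR_def bil_def cv_def tsum_def by (intro sums_sum sums_mult sums_mult2)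
  moreover have "(\<Sum>i\<in>{0..<int n}. x i * (\<Sum>j\<in>{0..<int n}. hk a l * (2 * cos (2 * pi * real (Suc l) / real n * real_of_int (j - i))) * x j))
     = hk a l * (2 * bil n (%d. cos (2 * pi * real (Suc l) / real n * real_of_int d)) x)" for l
    unfolding bil_def cv_def tsum_def by (simp only: sum_distrib_left) (intro sum.cong refl, simp)
  ultimately show ?thesis by simp
qed

lemma RR_nonneg: "a > 0 ==> 0 \<le> RR a n x"
  by (rule sums_le[OF _ sums_zero RR_sums], unfold bil_cos, intro mult_nonneg_nonneg)
     (use hk_bounds(1) in \<open>auto simp: less_imp_le\<close>)

text \<open>Doubling \<open>a\<close> raises every nonzero mode by a fixed factor while leaving the critical zero mode unchanged.\<close>

lemma RR_double: assumes a: "a > 0" shows "(1 + 1 / (1 + a)) * RR a n x \<le> 2 * RR (2 * a) n x"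
proof (rule sums_le[OF _ sums_mult[OF RR_sums[OF a]] sums_mult[OF RR_sums]])
  fix l
  define b where "b = 2 * bil n (%d. cos (2 * pi * real (Suc l) / real n * real_of_int d)) x"
  define L where "L = 2 * pi^2 * (real (Suc l))^2"
  have "3^2 \<le> pi^2" using pi_gt3 by (intro power_mono) auto
  then have "2 * 9 * 1 \<le> L" unfolding L_def by (intro mult_mono) auto
  then have L: "L \<ge> 2" by simp
  have b: "0 \<le> b" unfolding b_def bil_cos by simp
  have "(2 + a) * (2 * a + L) \<le> 2 * (1 + a) * (a + L)" using mult_left_mono[OF L, of a] a by (simp add: algebra_simps)
  then have "2 + a \<le> 2 * (1 + a) * (a + L) / (2 * a + L)" using a L by (subst pos_le_divide_eq) auto
  then have "(2 + a) / ((1 + a) * (a + L)) \<le> 2 * (1 + a) * (a + L) / (2 * a + L) / ((1 + a) * (a + L))" using a L by (intro divide_right_mono) auto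
  also have "... = 2 / (2 * a + L)"
  proof -
    have g: "2 * A * B / E / (A * B) = 2 / E" if "A \<noteq> 0" "B \<noteq> 0" for A B E :: real using that by simp
    show ?thesis by (rule g) (use a L in auto)
  qed
  also have "(2 + a) / ((1 + a) * (a + L)) = (1 + 1 / (1 + a)) * (1 / (a + L))"
  proof -
    have "1 + 1 / (1 + a) = (2 + a) / (1 + a)" using a by (simp add: field_simps)
    then show ?thesis by simp
  qed
  finally have "(1 + 1 / (1 + a)) * hk a l \<le> 2 * hk (2 * a) l" unfolding hk_def L_def[symmetric] by simp
  then show "(1 + 1 / (1 + a)) * (hk a l * b) \<le> 2 * (hk (2 * a) l * b)" using mult_right_mono[OF _ b] by (metis mult.assoc)
qed (use a in simp)

section \<open>Contraction and partition function of the Gibbs measure\<close>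

context bign
begin

text \<open>The zero mode of the interaction is a multiple of \<open>P0\<close> and the other modes
  form the nonnegative \<open>RR\<close>; the two are treated differently in
  \<open>entropy_le_FF\<close>.\<close>

lemma bil_V: "bil n V x = l0 * P0 n x + 8 * a * gam vt n / real n * RR a n x"
proof -
  have "bil n V x = tsum n (%i. l0 / real n * (tsum n x * x i) + 8 * a * gam vt n / real n * (x i * cv n (%d. hr a 1 (real_of_int d / real n)) x i))"
    unfolding bil_def
  proof (rule tsum_cong)
    fix i
    have "cv n V x i = tsum n (%j. l0 / real n * x j + 8 * a * gam vt n / real n * (hr a 1 (real_of_int (j - i) / real n) * x j))"
      unfolding cv_def V_eq by (rule tsum_cong) (simp add: add_divide_distrib algebra_simps)
    then show "x i * cv n V x i = l0 / real n * (tsum n x * x i) + 8 * a * gam vt n / real n * (x i * cv n (%d. hr a 1 (real_of_int d / real n)) x i)"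
      unfolding cv_def tsum_add tsum_cmult by (simp add: algebra_simps)
  qed
  also have "... = l0 / real n * (tsum n x * tsum n x) + 8 * a * gam vt n / real n * RR a n x"
    by (simp only: tsum_add tsum_cmult RR_def bil_def)
  also have "l0 / real n * (tsum n x * tsum n x) = l0 * P0 n x"
    unfolding P0_eq[OF n0] mg_def using n0 by (simp add: field_simps power2_eq_square)
  finally show ?thesis .
qed

lemma bil_V_nonneg: "0 \<le> bil n V x"
  unfolding bil_V using a g0 RR_nonneg[OF a] P_nonneg(1)[of n x] by (intro add_nonneg_nonneg mult_nonneg_nonneg divide_nonneg_nonneg) auto

definition "cM = 12 * \<bar>vt\<bar> + 16 * a * S32"
definition "M = 4 + cM / sqrt (real n)"

lemma cM0: "cM \<ge> 0" unfolding cM_def using a S320 by simp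
lemma M4: "M \<ge> 4" unfolding M_def using cM0 by simp

text \<open>By \<open>h1_ge\<close> the kernel is at least \<open>(l0 - 8 * gam) / n\<close>, which
  is zero for \<open>gam <= 1/2\<close> and of order \<open>- 1 / (n * sqrt n)\<close> otherwise. An
  almost nonnegative kernel has an l1 norm close to its total mass.\<close>

lemma V_abs_sum: "tsum n (%d. \<bar>V d\<bar>) \<le> M"
proof -
  define e where "e = 4 * \<bar>vt\<bar> / sqrt (real n)"
  have e0: "e \<ge> 0" unfolding e_def by simp
  have "8 * gam vt n - 4 = - (4 * (vt / sqrt (real n)))" unfolding gam_def by (simp add: field_simps)
  then have "\<bar>8 * gam vt n - 4\<bar> = e" unfolding e_def by (simp add: abs_mult)
  then have ge: "l0 - 8 * gam vt n \<ge> - e" by (auto simp: min_def)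
  have Vd: "\<bar>V d\<bar> \<le> V d + 2 * e / real n" for d
  proof -
    have "8 * a * gam vt n * (- 1 / a) \<le> 8 * a * gam vt n * hr a 1 (real_of_int d / real n)"
      using h1_ge[OF a] a g0 by (intro mult_left_mono) auto
    then have "- e \<le> l0 + 8 * a * gam vt n * hr a 1 (real_of_int d / real n)" using ge a by simp
    then have 1: "- e / real n \<le> V d" unfolding V_eq by (intro divide_right_mono) auto
    define f where "f = e / real n"
    have "- e / real n = - f" "2 * e / real n = 2 * f" "f \<ge> 0" using e0 unfolding f_def by simp_all
    then show ?thesis using 1 by linarith
  qed
  have "tsum n (%d. \<bar>V d\<bar>) \<le> tsum n (%d. V d + 2 * e / real n)" by (rule tsum_mono[OF Vd])
  also have "... = tsum n V + 2 * e" unfolding tsum_add tsum_const using n0 by simp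
  also have "... \<le> 4 + (4 * \<bar>vt\<bar> + 16 * a * S32) / sqrt (real n) + 2 * e" using V_sum by linarith
  also have "... = M" unfolding M_def cM_def e_def by (simp add: add_divide_distrib)
  finally show ?thesis .
qed

text \<open>For a nonnegative form of norm at most \<open>M\<close> the square is at most
  \<open>M\<close> times the form. Nonnegativity is tested on \<open>x\<close> minus its field
  divided by \<open>M\<close>, which avoids square roots of the operator.\<close>

lemma V_contr: assumes x: "per n x" shows "tsum n (%i. (cv n V x i)^2) \<le> M * bil n V x"
proof -
  define y where "y = cv n V x"
  define Y where "Y = tsum n (%i. (y i)^2)"
  have py: "per n y" unfolding y_def by (rule per_cv[OF V_per])
  have Y0: "Y \<ge> 0" unfolding Y_def by (rule tsum_nonneg) simp
  have sym: "tsum n (%i. x i * cv n V y i) = Y"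
  proof -
    have "cv n V y i = cva n V y i" for i
      unfolding cv_def cva_def by (rule tsum_cong) (metis V_even minus_diff_eq)
    then show ?thesis unfolding Y_def using cv_adj[of n x V y] by (simp add: y_def power2_eq_square)
  qed
  have "bil n V y \<le> M * Y"
  proof -
    have "(bil n V y)^2 \<le> Y * tsum n (%i. (cv n V y i)^2)" unfolding bil_def Y_def by (rule tsum_CS)
    also have "... \<le> Y * (M^2 * Y)"
    proof (rule mult_left_mono[OF _ Y0])
      have "tsum n (%i. (cv n V y i)^2) \<le> (tsum n (%d. \<bar>V d\<bar>))^2 * Y" unfolding Y_def by (rule Young'[OF V_per py n0])
      also have "... \<le> M^2 * Y" using V_abs_sum Y0 by (intro mult_right_mono power_mono tsum_nonneg) auto
      finally show "tsum n (%i. (cv n V y i)^2) \<le> M^2 * Y" .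
    qed
    also have "... = (M * Y)^2" by (simp add: power2_eq_square)
    finally show ?thesis by (rule power2_le_imp_le) (use M4 Y0 in simp)
  qed
  define t where "t = 1 / M"
  have "0 \<le> bil n V (%i. x i - t * y i)" by (rule bil_V_nonneg)
  also have "... = tsum n (%i. x i * y i - t * (x i * cv n V y i) - t * (y i)^2 + t^2 * (y i * cv n V y i))"
    unfolding bil_def cv_diff cv_cmult y_def[symmetric] by (rule tsum_cong) (simp add: power2_eq_square algebra_simps)
  also have "... = bil n V x - t * Y - t * Y + t^2 * bil n V y"
    unfolding tsum_add tsum_diff tsum_cmult sym Y_def[symmetric] unfolding bil_def y_def ..
  also have "t^2 * bil n V y \<le> t^2 * (M * Y)" using \<open>bil n V y \<le> M * Y\<close> by (intro mult_left_mono) auto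
  also have "t^2 * (M * Y) = t * Y" unfolding t_def using M4 by (simp add: power2_eq_square)
  finally have "t * Y \<le> bil n V x" by linarith
  then show ?thesis unfolding t_def Y_def y_def using M4 by (simp add: field_simps)
qed

lemma V0_nonneg: "0 \<le> V 0"
proof -
  have "0 \<le> hr a 1 0" unfolding hr_def using hk_bounds(1)[OF a] hr_summable[OF a, of 1 0]
    by (intro suminf_nonneg) (auto simp: less_imp_le)
  then show ?thesis unfolding V_eq using a g0 by simp
qed

text \<open>The inverse temperature is lowered by \<open>1 / sqrt n\<close>. This balances two
  errors: the factor \<open>1 / (1 - s)\<close> in the mean energy, multiplied by a bounded quantity
  since the diagonal is of order \<open>1 / n\<close>, and the energy given away, at most of order
  \<open>n / sqrt n\<close>. Both are of order \<open>sqrt n\<close>.\<close>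

definition "sM = 1 - 1 / sqrt (real n)"
definition "QQ cf = bil n V (fld n cf) / 8"
definition "cQ = (1 + 2 * a)^2 + (cM + 4) / 8"

lemma sM: "0 < sM" "sM < 1" unfolding sM_def using n2 by auto

lemma ising: "ising n (%cf. bil n V (fld n cf) / M) (%i cf. cv n V (fld n cf) i / M) (V 0 / M) sM"
proof
  have M0: "M > 0" using M4 by simp
  show "2 \<le> n" by (rule n2)
  show "0 \<le> V 0 / M" using V0_nonneg M0 by simp
  show "0 < sM" "sM < 1" by (rule sM)+
  fix cf :: conf and i :: int assume e: "cf \<in> Omega n"
  have "bil n V (fld n (flp n cf i)) - bil n V (fld n cf) = 2 * (- 2 * fld n cf i) * cv n V (fld n cf) i + (- 2 * fld n cf i)^2 * V 0"
    by (rule bil_single[OF V_per V_even per_fld n0 fld_flp[OF n0 e]])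
  then have "bil n V (fld n (flp n cf i)) - bil n V (fld n cf) = - 4 * fld n cf i * cv n V (fld n cf) i + 4 * V 0"
    using fld_sq[OF e n0, of i] by (simp add: power_mult_distrib)
  then have "(bil n V (fld n (flp n cf i)) - bil n V (fld n cf)) / M = (- 4 * fld n cf i * cv n V (fld n cf) i + 4 * V 0) / M" by simp
  then show "bil n V (fld n (flp n cf i)) / M - bil n V (fld n cf) / M = - 4 * fld n cf i * (cv n V (fld n cf) i / M) + 4 * (V 0 / M)"
    by (simp add: diff_divide_distrib add_divide_distrib)
  show "cv n V (fld n (flp n cf i)) i / M = cv n V (fld n cf) i / M - 2 * (V 0 / M) * fld n cf i"
    unfolding cv_single[OF V_per per_fld n0 fld_flp[OF n0 e]] by (simp add: diff_divide_distrib mult_ac)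
next
  fix cf assume "cf \<in> Omega n"
  show "bil n V (fld n cf) / M = tsum n (%i. fld n cf i * (cv n V (fld n cf) i / M))"
    unfolding bil_def times_divide_eq_right tsum_cdiv ..
  have "tsum n (%i. (cv n V (fld n cf) i)^2) / M^2 \<le> M * bil n V (fld n cf) / M^2" by (rule divide_right_mono[OF V_contr[OF per_fld]]) simp
  then show "tsum n (%i. (cv n V (fld n cf) i / M)^2) \<le> bil n V (fld n cf) / M"
    using M4 unfolding power_divide tsum_cdiv by (simp add: power2_eq_square)
qed

interpretation I: ising n "%cf. bil n V (fld n cf) / M" "%i cf. cv n V (fld n cf) i / M" "V 0 / M" sM by (rule ising)

lemma sqrt_n: "sqrt (real n) * sqrt (real n) = real n" "sqrt (real n) \<ge> 1" "real n / sqrt (real n) = sqrt (real n)"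
  using n0 by (simp_all add: real_div_sqrt)

lemma CI_le: "I.CI \<le> (1 + 2 * a)^2 * sqrt (real n)"
proof -
  define T where "T = V 0 / M"
  have T0: "T \<ge> 0" unfolding T_def using V0_nonneg M4 by simp
  have "T \<le> V 0 / 4" unfolding T_def using V0_nonneg M4 by (intro divide_left_mono) auto
  also have "... \<le> (4 + 8 * a) / real n / 4" using V_abs[of 0] by (intro divide_right_mono) auto
  finally have T: "real n * T \<le> 1 + 2 * a" using n0 by (simp add: field_simps)
  have "1 * T \<le> real n * T" using n0 T0 by (intro mult_right_mono) auto
  then have T1: "T \<le> 1 + 2 * a" using T by simp
  have "real n * (T + T^2) = (real n * T) * (1 + T)" by (simp add: power2_eq_square algebra_simps)
  also have "... \<le> (1 + 2 * a) * (1 + (1 + 2 * a))" using T T1 T0 a by (intro mult_mono) auto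
  also have "... \<le> (1 + 2 * a) * (2 * (1 + 2 * a))" using a by (intro mult_left_mono) auto
  also have "... = 2 * (1 + 2 * a)^2" by (simp add: power2_eq_square algebra_simps)
  finally have N: "real n * (T + T^2) \<le> 2 * (1 + 2 * a)^2" .
  have "I.CI = sM / 2 * (real n * (T + T^2) / (1 - sM))" unfolding T_def by (rule I.CI_def)
  also have "1 - sM = 1 / sqrt (real n)" by (simp add: sM_def)
  also have "sM / 2 * (real n * (T + T^2) / (1 / sqrt (real n))) = sM / 2 * (real n * (T + T^2) * sqrt (real n))" by simp
  also have "... \<le> 1 / 2 * (2 * (1 + 2 * a)^2 * sqrt (real n))"
    by (rule mult_mono[OF _ mult_right_mono[OF N]]) (use sM T0 in auto)
  finally show ?thesis by simp
qed

lemma QQ_le: assumes e: "cf \<in> Omega n"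
  shows "QQ cf \<le> sM / 2 * (bil n V (fld n cf) / M) + (cM + 4) / 8 * sqrt (real n)"
proof -
  have cv: "\<bar>cv n V (fld n cf) i\<bar> \<le> M" for i
    using cv_abs[of n V "fld n cf" 1 i, OF V_per] fld_abs[OF e n0] V_abs_sum by simp
  have "bil n V (fld n cf) \<le> tsum n (%i. M)" unfolding bil_def
  proof (rule tsum_mono)
    fix i show "fld n cf i * cv n V (fld n cf) i \<le> M"
      using cv[of i] fld_values[OF e n0, of i] by auto
  qed
  then have b: "bil n V (fld n cf) \<le> real n * M" by (simp add: tsum_const)
  have "(1 - 4 * sM / M) * bil n V (fld n cf) \<le> (1 - 4 * sM / M) * (real n * M)"
    using b M4 sM by (intro mult_left_mono) (auto simp: field_simps)
  also have "... = real n * (M - 4 * sM)" using M4 by (simp add: field_simps)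
  also have "M - 4 * sM = (cM + 4) / sqrt (real n)" unfolding M_def sM_def by (simp add: add_divide_distrib)
  also have "real n * ((cM + 4) / sqrt (real n)) = (cM + 4) * sqrt (real n)" using sqrt_n(3) by (metis mult.commute times_divide_eq_right)
  finally show ?thesis unfolding QQ_def using M4 by (simp add: field_simps)
qed

lemma QQ_entropy: assumes p: "pmfn n p" shows "EE n p QQ \<le> Hh n p + cQ * sqrt (real n)"
proof -
  interpret P: pmfn n p by fact
  have "EE n p QQ \<le> EE n p (%cf. sM / 2 * (bil n V (fld n cf) / M) + (cM + 4) / 8 * sqrt (real n))"
    by (rule EE_mono[OF P.p0 QQ_le])
  also have "... = sM / 2 * EE n p (%cf. bil n V (fld n cf) / M) + (cM + 4) / 8 * sqrt (real n)"
    unfolding EE_add EE_cmult EE_const[OF P.p1] ..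
  also have "... \<le> Hh n p + (1 + 2 * a)^2 * sqrt (real n) + (cM + 4) / 8 * sqrt (real n)"
    using I.energy_entropy[OF p] CI_le by linarith
  finally show ?thesis unfolding cQ_def by (simp add: algebra_simps)
qed

lemma Eg_QQ: "Eg a vt n cf = QQ cf - real n * V 0 / 8" unfolding Eg_def QQ_def by (simp add: algebra_simps)

lemma V0_le: "0 \<le> real n * V 0 / 8" "real n * V 0 / 8 \<le> 1 + a"
proof -
  have "real n * V 0 \<le> real n * ((4 + 8 * a) / real n)" using V_abs[of 0] by (intro mult_left_mono) auto
  then show "real n * V 0 / 8 \<le> 1 + a" using n0 a by simp
qed (use V0_nonneg in simp)

lemma Eg_ge: "- (1 + a) \<le> Eg a vt n cf"
  using V0_le(2) bil_V_nonneg[of "fld n cf"] unfolding Eg_QQ QQ_def by linarith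

definition "lnZ = ln ((\<Sum>cf\<in>Omega n. exp (Eg a vt n cf)) / 2 ^ n)"

lemma lnZ: "lnZ \<le> cQ * sqrt (real n)" "- (1 + a) \<le> lnZ"
proof -
  define S where "S = (\<Sum>cf\<in>Omega n. exp (Eg a vt n cf))"
  have S: "S > 0" unfolding S_def by (rule sum_pos[OF finite_Omega Omega_ne]) auto
  have l: "lnZ = ln S - real n * ln 2" unfolding lnZ_def S_def[symmetric] using S by (simp add: ln_div ln_realpow)
  have "S \<le> exp ((cM + 4) / 8 * sqrt (real n)) * (\<Sum>cf\<in>Omega n. I.W cf)"
    unfolding S_def sum_distrib_left
  proof (rule sum_mono)
    fix cf assume e: "cf \<in> Omega n"
    show "exp (Eg a vt n cf) \<le> exp ((cM + 4) / 8 * sqrt (real n)) * I.W cf"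
      unfolding I.W_def exp_add[symmetric] using QQ_le[OF e] V0_le(1) unfolding Eg_QQ by simp
  qed
  moreover have W: "(\<Sum>cf\<in>Omega n. I.W cf) > 0" unfolding I.W_def by (rule sum_pos[OF finite_Omega Omega_ne]) auto
  ultimately have "ln S \<le> ln (exp ((cM + 4) / 8 * sqrt (real n)) * (\<Sum>cf\<in>Omega n. I.W cf))" using S by (intro ln_mono) auto
  also have "... = (cM + 4) / 8 * sqrt (real n) + ln (\<Sum>cf\<in>Omega n. I.W cf)" using W by (simp add: ln_mult)
  finally have "lnZ \<le> (cM + 4) / 8 * sqrt (real n) + (1 + 2 * a)^2 * sqrt (real n)"
    using I.log_partition CI_le unfolding l by linarith
  then show "lnZ \<le> cQ * sqrt (real n)" unfolding cQ_def by (simp add: algebra_simps)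
  have "(\<Sum>cf\<in>Omega n. exp (- (1 + a))) \<le> S" unfolding S_def
    by (rule sum_mono) (simp only: exp_le_cancel_iff Eg_ge)
  then have "2 ^ n * exp (- (1 + a)) \<le> S" by (simp add: card_Omega)
  then have "ln (2 ^ n * exp (- (1 + a))) \<le> ln S" using S by (intro ln_mono) auto
  then show "- (1 + a) \<le> lnZ" unfolding l by (simp add: ln_mult ln_realpow)
qed

text \<open>The free energy for \<open>\<kappa> = 1\<close> (\<open>FE_FF\<close>); the term
  \<open>1/4 * P0\<close> is the magnetisation term (\<open>magnet_P0\<close>).\<close>

definition "FF p = Hh n p - EE n p (Eg a vt n) + lnZ + 1/4 * EE n p (%cf. P0 n (fld n cf))"

lemma EE_QQ: "EE n p QQ = l0 / 8 * EE n p (%cf. P0 n (fld n cf)) + a * gam vt n / real n * EE n p (%cf. RR a n (fld n cf))"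
proof -
  have "QQ = (%cf. l0 / 8 * P0 n (fld n cf) + a * gam vt n / real n * RR a n (fld n cf))"
    by (rule ext) (simp add: QQ_def bil_V add_divide_distrib)
  then show ?thesis by (simp only: EE_add EE_cmult)
qed

lemma FF_le: assumes p: "pmfn n p"
  shows "FF p \<le> Hh n p + 1/4 * EE n p (%cf. P0 n (fld n cf)) + (1 + a + cQ) * sqrt (real n)"
proof -
  interpret P: pmfn n p by fact
  have "EE n p (%cf. - (1 + a)) \<le> EE n p (Eg a vt n)"
    by (rule EE_mono[OF P.p0]) (simp_all only: Eg_ge)
  then have "- (1 + a) \<le> EE n p (Eg a vt n)" unfolding EE_const[OF P.p1] .
  moreover have "1 + a \<le> (1 + a) * sqrt (real n)" using mult_left_mono[OF sqrt_n(2), of "1 + a"] a by simp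
  ultimately have "FF p \<le> Hh n p + 1/4 * EE n p (%cf. P0 n (fld n cf)) + (1 + a) * sqrt (real n) + cQ * sqrt (real n)"
    using lnZ(1) unfolding FF_def by linarith
  then show ?thesis by (simp add: algebra_simps)
qed

end

text \<open>\<open>g36'\<close> is \<open>g36\<close> for the doubled parameter
  \<open>2 * a\<close>, and \<open>g4\<close> keeps the zero mode of the interaction at 2 or
  more.\<close>

locale bign2 = bign + assumes g36': "4 * a * \<bar>1 - 2 * gam vt n\<bar> \<le> 36" and g4: "gam vt n \<ge> 1/4"
begin

interpretation B2: bign "2 * a" vt n
  by unfold_locales (use a n3 g36' g0 g1 in auto)

definition "cQ2 = B2.cQ"

text \<open>At \<open>a\<close> alone the energy bound can use up the whole entropy. For
  \<open>2 * a\<close> the same entropy controls \<open>1 + \<epsilon>\<close> times the nonzero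
  modes, with \<open>\<epsilon> = 1 / (1 + a)\<close> from \<open>RR_double\<close>. Multiplying
  \<open>FF\<close> by \<open>1 + \<epsilon>\<close> then leaves \<open>\<epsilon>\<close> times the
  entropy, and the magnetisation term pays for the excess zero mode.\<close>

lemma entropy_le_FF: assumes p: "pmfn n p"
  shows "Hh n p \<le> (a + 2) * FF p + (1 + a) * (cQ2 + 4 * (1 + a)) * sqrt (real n)"
proof -
  interpret P: pmfn n p by fact
  define H where "H = Hh n p"
  define P0E where "P0E = EE n p (%cf. P0 n (fld n cf))"
  define X where "X = a * gam vt n / real n * EE n p (%cf. RR a n (fld n cf))"
  define \<epsilon> where "\<epsilon> = 1 / (1 + a)"
  have \<epsilon>: "0 < \<epsilon>" "\<epsilon> \<le> 1" "\<epsilon> * (1 + a) = 1" unfolding \<epsilon>_def using a by auto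
  have P0: "0 \<le> P0E" unfolding P0E_def by (rule EE_nonneg[OF P.p0 P_nonneg(1)])
  have "(1 + \<epsilon>) * X = a * gam vt n / real n * EE n p (%cf. (1 + \<epsilon>) * RR a n (fld n cf))" unfolding X_def EE_cmult by simp
  also have "... \<le> a * gam vt n / real n * EE n p (%cf. 2 * RR (2 * a) n (fld n cf))"
    using a g0 unfolding \<epsilon>_def by (intro mult_left_mono EE_mono[OF P.p0] RR_double) auto
  also have "... = 2 * a * gam vt n / real n * EE n p (%cf. RR (2 * a) n (fld n cf))" unfolding EE_cmult by simp
  finally have 1: "l0 / 8 * P0E + (1 + \<epsilon>) * X \<le> H + cQ2 * sqrt (real n)"
    using B2.QQ_entropy[OF p] unfolding B2.EE_QQ P0E_def[symmetric] H_def cQ2_def by linarith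
  have "EE n p (Eg a vt n) = EE n p QQ - real n * V 0 / 8"
    unfolding Eg_QQ EE_diff EE_const[OF P.p1] ..
  then have F: "FF p \<ge> H - l0 / 8 * P0E - X - (1 + a) + 1/4 * P0E"
    unfolding FF_def EE_QQ H_def P0E_def[symmetric] X_def[symmetric] using lnZ(2) V0_le(1) by linarith
  have lP: "l0 / 8 * P0E \<le> 1/2 * P0E" using P0 by (intro mult_right_mono) auto
  have "(1 + \<epsilon>) * FF p \<ge> (1 + \<epsilon>) * (H - l0 / 8 * P0E - X - (1 + a) + 1/4 * P0E)" using F \<epsilon> by (intro mult_left_mono) auto
  moreover have "(1 + \<epsilon>) * (H - l0 / 8 * P0E - X - (1 + a) + 1/4 * P0E)
     = \<epsilon> * H + (H - (l0 / 8 * P0E + (1 + \<epsilon>) * X)) - \<epsilon> * (l0 / 8 * P0E) - (1 + \<epsilon>) * (1 + a) + (1 + \<epsilon>) * (1/4 * P0E)" by (simp add: algebra_simps)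
  moreover have "\<epsilon> * (l0 / 8 * P0E) \<le> \<epsilon> * (1/2 * P0E)" using lP \<epsilon> by (intro mult_left_mono) auto
  moreover have "\<epsilon> * P0E \<le> 1 * P0E" using \<epsilon> P0 by (intro mult_right_mono) auto
  then have "\<epsilon> * (1/2 * P0E) \<le> (1 + \<epsilon>) * (1/4 * P0E)" by (simp add: algebra_simps)
  moreover have "(1 + \<epsilon>) * (1 + a) \<le> 2 * (1 + a)" using \<epsilon> a by (intro mult_right_mono) auto
  ultimately have "\<epsilon> * H \<le> (1 + \<epsilon>) * FF p + cQ2 * sqrt (real n) + 2 * (1 + a)" using 1 by linarith
  moreover have "2 * (1 + a) \<le> 4 * (1 + a) * sqrt (real n)" using mult_mono[OF _ sqrt_n(2), of "2 * (1 + a)" "4 * (1 + a)"] a by simp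
  ultimately have "\<epsilon> * H \<le> (1 + \<epsilon>) * FF p + (cQ2 + 4 * (1 + a)) * sqrt (real n)" by (simp only: distrib_right)
  then have "(1 + a) * (\<epsilon> * H) \<le> (1 + a) * ((1 + \<epsilon>) * FF p + (cQ2 + 4 * (1 + a)) * sqrt (real n))" using a by (intro mult_left_mono) auto
  moreover have "(1 + a) * (\<epsilon> * H) = H" using \<epsilon>(3) by (metis mult.assoc mult.commute mult_1)
  moreover have "(1 + a) * (1 + \<epsilon>) = a + 2" using \<epsilon>(3) by (simp add: algebra_simps)
  then have "(1 + a) * ((1 + \<epsilon>) * FF p) = (a + 2) * FF p" by (metis mult.assoc)
  ultimately show ?thesis unfolding H_def by (simp only: distrib_left[of "1 + a" "(1 + \<epsilon>) * FF p"] mult.assoc)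
qed

text \<open>The zero mode is one part of the energy in \<open>QQ_entropy\<close>, and the other part
  is nonnegative.\<close>

lemma P0_entropy: assumes p: "pmfn n p"
  shows "EE n p (%cf. P0 n (fld n cf)) \<le> 4 * Hh n p + 4 * cQ2 * sqrt (real n)"
proof -
  interpret P: pmfn n p by fact
  define P0E where "P0E = EE n p (%cf. P0 n (fld n cf))"
  have "0 \<le> P0E" unfolding P0E_def by (rule EE_nonneg[OF P.p0 P_nonneg(1)])
  then have "1/4 * P0E \<le> l0 / 8 * P0E" using g4 by (intro mult_right_mono) auto
  moreover have "0 \<le> 2 * a * gam vt n / real n * EE n p (%cf. RR (2 * a) n (fld n cf))"
    using a g0 by (intro mult_nonneg_nonneg divide_nonneg_nonneg EE_nonneg[OF P.p0 RR_nonneg]) auto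
  ultimately show ?thesis using B2.QQ_entropy[OF p] unfolding B2.EE_QQ P0E_def[symmetric] cQ2_def by linarith
qed

end

text \<open>\<open>Qf_entropy\<close> with the l1 bounds \<open>n / 2\<close>,
  \<open>n^2 / 4\<close> and 2 for the three kernels; the normalisations of \<open>P1\<close> and
  \<open>P3\<close> make the constants independent of \<open>n\<close>.\<close>

lemma P_entropy: assumes p: "pmfn n p" and w: "w > 0" "w \<le> n"
  shows "EE n p (%cf. P1 n (fld n cf)) \<le> 2 * Hh n p + 2"
    "EE n p (%cf. P3 n (fld n cf)) \<le> Hh n p + 1"
    "EE n p (%cf. P2 n w (fld n cf)) \<le> 16 * Hh n p + 4 * (real n / real w)"
proof -
  interpret P: pmfn n p by fact
  define N where "N = real n"
  have N: "N > 0" unfolding N_def using P.npos by simp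
  note H = Hh_nonneg[OF p]
  have "EE n p (%cf. P1 n (fld n cf)) = 2 / N^2 * EE n p (%cf. Qf n (saw n) (fld n cf))" unfolding P1_def EE_cmult N_def ..
  also have "... \<le> 2 / N^2 * (4 * (N / 2)^2 * Hh n p + 4 * (N * (N / 4)))"
  proof (rule mult_left_mono)
    have "EE n p (%cf. Qf n (saw n) (fld n cf)) \<le> 4 * (N / 2)^2 * Hh n p + 4 * (real n * tsum n (%d. (saw n d)^2))"
      by (rule Qf_entropy[OF p per_saw]) (use tsum_abs_saw[OF P.npos] N in \<open>auto simp: N_def\<close>)
    also have "4 * (real n * tsum n (%d. (saw n d)^2)) \<le> 4 * (N * (N / 4))"
      unfolding N_def by (intro mult_left_mono tsum_sq_saw P.npos) auto
    finally show "EE n p (%cf. Qf n (saw n) (fld n cf)) \<le> 4 * (N / 2)^2 * Hh n p + 4 * (N * (N / 4))" by simp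
  qed simp
  also have "... = 2 * Hh n p + 2" using N by (simp add: field_simps power2_eq_square)
  finally show "EE n p (%cf. P1 n (fld n cf)) \<le> 2 * Hh n p + 2" .
  have "EE n p (%cf. P3 n (fld n cf)) = 1 / N^4 * EE n p (%cf. Qf n (saw2 n) (fld n cf))" unfolding P3_def EE_cmult N_def ..
  also have "... \<le> 1 / N^4 * (4 * (N^2 / 4)^2 * Hh n p + 4 * (N * (N * (N / 4)^2)))"
  proof (rule mult_left_mono)
    have "EE n p (%cf. Qf n (saw2 n) (fld n cf)) \<le> 4 * (N^2 / 4)^2 * Hh n p + 4 * (real n * tsum n (%d. (saw2 n d)^2))"
      by (rule Qf_entropy[OF p per_saw2]) (use tsum_abs_saw2[OF P.npos] N in \<open>auto simp: N_def\<close>)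
    also have "4 * (real n * tsum n (%d. (saw2 n d)^2)) \<le> 4 * (N * (N * (N / 4)^2))"
    proof -
      have "(saw2 n d)^2 \<le> (N / 4)^2" for d using power_mono[OF saw2_abs[OF P.npos, of d], of 2] by (simp add: N_def)
      then have "tsum n (%d. (saw2 n d)^2) \<le> N * (N / 4)^2" unfolding N_def by (rule tsum_le_const)
      then show ?thesis using N unfolding N_def by (intro mult_left_mono) auto
    qed
    finally show "EE n p (%cf. Qf n (saw2 n) (fld n cf)) \<le> 4 * (N^2 / 4)^2 * Hh n p + 4 * (N * (N * (N / 4)^2))" by simp
  qed simp
  also have "... = Hh n p / 4 + 1 / 4" using N by (simp add: field_simps power2_eq_square power4_eq_xxxx)
  also have "... \<le> Hh n p + 1" using H by simp
  finally show "EE n p (%cf. P3 n (fld n cf)) \<le> Hh n p + 1" .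
  have "EE n p (%cf. P2 n w (fld n cf)) \<le> 4 * 2^2 * Hh n p + 4 * (real n * tsum n (%d. (tentker0 n w d)^2))"
    unfolding P2_def by (rule Qf_entropy[OF p per_tentker0]) (use tsum_abs_tentker0[OF w(1) P.npos] in auto)
  also have "4 * (real n * tsum n (%d. (tentker0 n w d)^2)) \<le> 4 * (real n * (1 / real w))"
    by (intro mult_left_mono tsum_sq_tentker0 w) auto
  finally show "EE n p (%cf. P2 n w (fld n cf)) \<le> 16 * Hh n p + 4 * (real n / real w)" by simp
qed

section \<open>The semigroup\<close>

text \<open>Pascal's rule, in the form of the induction step that expands the powers of the
  generator plus \<open>\<Lambda>\<close>.\<close>

lemma binomial_step:
  fixes A :: "nat => real"
  shows "(\<Sum>i\<le>k. real (k choose i) * \<Lambda> ^ (k - i) * A (Suc i)) + \<Lambda> * (\<Sum>i\<le>k. real (k choose i) * \<Lambda> ^ (k - i) * A i)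
    = (\<Sum>i\<le>Suc k. real (Suc k choose i) * \<Lambda> ^ (Suc k - i) * A i)"
proof -
  have "\<Lambda> * (\<Sum>i\<le>k. real (k choose i) * \<Lambda> ^ (k - i) * A i) = (\<Sum>i\<le>Suc k. real (k choose i) * \<Lambda> ^ (Suc k - i) * A i)"
    unfolding sum_distrib_left sum.atMost_Suc by (simp add: binomial_eq_0) (rule sum.cong, auto simp: Suc_diff_le)
  also have "... = \<Lambda> ^ Suc k * A 0 + (\<Sum>i\<le>k. real (k choose Suc i) * \<Lambda> ^ (k - i) * A (Suc i))"
    by (subst sum.atMost_Suc_shift) simp
  finally show ?thesis by (subst sum.atMost_Suc_shift) (simp add: sum.distrib algebra_simps)
qed

lemma sum_indicator:
  fixes f :: "conf => real" assumes "cf \<in> Omega n"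
  shows "(\<Sum>\<xi>\<in>Omega n. f \<xi> * indicator {cf} \<xi>) = f cf" "(\<Sum>\<xi>\<in>Omega n. f \<xi> * indicator {\<xi>} cf) = f cf"
proof -
  have "(\<Sum>\<xi>\<in>Omega n. f \<xi> * indicator {cf} \<xi>) = (\<Sum>\<xi>\<in>Omega n. if \<xi> = cf then f \<xi> else 0)" by (rule sum.cong) auto
  then show "(\<Sum>\<xi>\<in>Omega n. f \<xi> * indicator {cf} \<xi>) = f cf" using assms by (simp add: finite_Omega)
  have "(\<Sum>\<xi>\<in>Omega n. f \<xi> * indicator {\<xi>} cf) = (\<Sum>\<xi>\<in>Omega n. if \<xi> = cf then f \<xi> else 0)" by (rule sum.cong) auto
  then show "(\<Sum>\<xi>\<in>Omega n. f \<xi> * indicator {\<xi>} cf) = f cf" using assms by (simp add: finite_Omega)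
qed

lemma gen_cong: assumes "!!cf. cf \<in> Omega n ==> f cf = g cf" "cf \<in> Omega n" shows "gen a vt n f cf = gen a vt n g cf"
proof (cases "n = 0")
  case False
  then show ?thesis unfolding gen_def gen_L_tsum using assms exc_Omega[OF assms(2)] flp_Omega[OF assms(2)] by simp
qed (simp add: gen_def)

lemma gen_add: "gen a vt n (%cf. f cf + g cf) cf = gen a vt n f cf + gen a vt n g cf"
  unfolding gen_def gen_L_add by (simp add: distrib_left)
lemma gen_cmult: "gen a vt n (%cf. c * f cf) cf = c * gen a vt n f cf"
  unfolding gen_def gen_L_cmult by simp
lemma gen_const: "gen a vt n (%cf. c) cf = 0"
  unfolding gen_def gen_L_def by simp
lemma gen_sum: "finite I ==> gen a vt n (%cf. \<Sum>i\<in>I. c i * f i cf) cf = (\<Sum>i\<in>I. c i * gen a vt n (f i) cf)"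
  by (induction I rule: finite_induct) (simp_all add: gen_const gen_add gen_cmult)

lemma gen_pow_indicator: assumes "\<xi> \<in> Omega n"
  shows "(gen a vt n ^^ k) f \<xi> = (\<Sum>cf\<in>Omega n. f cf * (gen a vt n ^^ k) (indicator {cf}) \<xi>)"
  using assms
proof (induction k arbitrary: \<xi>)
  case 0
  then show ?case by (simp add: sum_indicator)
next
  case (Suc k)
  then show ?case using gen_cong[OF Suc.IH Suc.prems] by (simp add: gen_sum[OF finite_Omega])
qed

lemma semigroup_expand: assumes "\<xi> \<in> Omega n"
  shows "semigroup_S a vt n t f \<xi> = (\<Sum>cf\<in>Omega n. f cf * semigroup_S a vt n t (indicator {cf}) \<xi>)"
proof -
  have s: "summable (%k. t ^ k / fact k * (gen a vt n ^^ k) g \<xi>)" for g by (rule summable_semigroup[OF assms])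
  have "semigroup_S a vt n t f \<xi> = (\<Sum>k. \<Sum>cf\<in>Omega n. f cf * (t ^ k / fact k * (gen a vt n ^^ k) (indicator {cf}) \<xi>))"
    unfolding semigroup_S_def gen_pow_indicator[OF assms, where f = f] sum_distrib_left by (simp add: mult_ac)
  also have "... = (\<Sum>cf\<in>Omega n. \<Sum>k. f cf * (t ^ k / fact k * (gen a vt n ^^ k) (indicator {cf}) \<xi>))"
    by (rule suminf_sum) (rule summable_mult[OF s])
  finally show ?thesis unfolding semigroup_S_def using suminf_mult[OF s] by simp
qed

lemma semigroup_const: "semigroup_S a vt n t (%_. c) \<xi> = c"
proof -
  have "(gen a vt n ^^ Suc k) (%_. c) = (%_. 0)" for k
    by (induction k) (auto simp: gen_const)
  then have z: "(gen a vt n ^^ k) (%_. c) \<xi> = (if k = 0 then c else 0)" for k by (cases k) auto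
  have "(%k. t ^ k / fact k * (gen a vt n ^^ k) (%_. c) \<xi>) sums (\<Sum>k\<in>{0}. t ^ k / fact k * (gen a vt n ^^ k) (%_. c) \<xi>)"
    by (rule sums_finite) (auto simp: z)
  then show ?thesis unfolding semigroup_S_def by (simp add: sums_iff)
qed

lemma semigroup_0: "semigroup_S a vt n 0 f \<xi> = f \<xi>"
  unfolding semigroup_S_def using powser_zero[of "%k. (gen a vt n ^^ k) f \<xi> / fact k"] by (simp add: field_simps)

lemma semigroup_deriv: assumes "\<xi> \<in> Omega n"
  shows "((%t. semigroup_S a vt n t f \<xi>) has_real_derivative semigroup_S a vt n t (gen a vt n f) \<xi>) (at t)"
proof -
  define c where "c k = (gen a vt n ^^ k) f \<xi> / fact k" for k
  have s: "summable (%k. c k * t ^ k)" for t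
    using summable_semigroup[OF assms, of t a vt f] unfolding c_def by (simp add: mult.commute)
  have d: "diffs c k = (gen a vt n ^^ k) (gen a vt n f) \<xi> / fact k" for k
    unfolding diffs_def c_def funpow_Suc_right comp_def by (simp add: field_simps del: of_nat_Suc)
  have "((%t. \<Sum>k. c k * t ^ k) has_real_derivative (\<Sum>k. diffs c k * t ^ k)) (at t)"
    by (rule termdiffs_strong_converges_everywhere[OF s])
  then show ?thesis unfolding semigroup_S_def d unfolding c_def by (simp add: mult.commute)
qed

text \<open>Uniformisation: \<open>\<Lambda>\<close> bounds the total jump rate, so the generator
  plus \<open>\<Lambda>\<close> preserves nonnegativity. Its exponential is
  \<open>exp (\<Lambda> * t)\<close> times the semigroup, by a Cauchy product, and the zeroth term
  of a series of nonnegative terms is a lower bound.\<close>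

lemma semigroup_lower:
  assumes a: "a \<ge> 0" and n: "n > 0" and g: "0 \<le> gam vt n" "gam vt n \<le> 1" and e: "\<xi> \<in> Omega n" and t: "t \<ge> 0"
    and f: "!!cf. cf \<in> Omega n ==> 0 \<le> f cf"
  defines "\<Lambda> \<equiv> sqrt (real n) * ((real n)^2 * real n + a * (real n * 4))"
  shows "exp (- \<Lambda> * t) * f \<xi> \<le> semigroup_S a vt n t f \<xi>"
proof -
  define P where "P h cf = gen a vt n h cf + \<Lambda> * h cf" for h cf
  have Ppos: "0 \<le> P h cf" if h: "!!cf. cf \<in> Omega n ==> 0 \<le> h cf" and "cf \<in> Omega n" for h cf
  proof -
    let ?c = "%i. crate (gam vt n) (fld n cf) i"
    have "P h cf = sqrt (real n) * ((real n)^2 * (tsum n (%b. h (exc n cf b) - h cf) + real n * h cf)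
      + a * (tsum n (%i. ?c i * (h (flp n cf i) - h cf)) + real n * (4 * h cf)))"
      unfolding P_def gen_def gen_L_tsum \<Lambda>_def by (simp add: algebra_simps)
    also have "tsum n (%b. h (exc n cf b) - h cf) + real n * h cf = tsum n (%b. h (exc n cf b))"
      unfolding tsum_diff tsum_const by simp
    also have "tsum n (%i. ?c i * (h (flp n cf i) - h cf)) + real n * (4 * h cf) = tsum n (%i. ?c i * h (flp n cf i) + (4 - ?c i) * h cf)"
      unfolding tsum_const[symmetric] tsum_add[symmetric] by (rule tsum_cong) (simp add: algebra_simps)
    finally show ?thesis using crate_bounds[OF that(2) n g] h[OF that(2)] h[OF exc_Omega[OF that(2) n]] h[OF flp_Omega[OF that(2) n]] a
      by (auto intro!: mult_nonneg_nonneg add_nonneg_nonneg tsum_nonneg)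
  qed
  have Pk: "0 \<le> (P ^^ k) f cf" if "cf \<in> Omega n" for k cf
    using that by (induction k arbitrary: cf) (auto simp: f intro: Ppos)
  define A where "A i = (gen a vt n ^^ i) f" for i
  have Pb: "(P ^^ k) f = (%cf. \<Sum>i\<le>k. real (k choose i) * \<Lambda> ^ (k - i) * A i cf)" for k
  proof (induction k)
    case (Suc k)
    have "(P ^^ Suc k) f cf = (\<Sum>i\<le>Suc k. real (Suc k choose i) * \<Lambda> ^ (Suc k - i) * A i cf)" for cf
      unfolding binomial_step[symmetric] by (simp add: Suc P_def gen_sum A_def)
    then show ?case by blast
  qed (simp add: A_def)
  have summ: "summable (%k. norm (t ^ k / fact k * A k \<xi>))"
  proof -
    have "summable (%k. (A k \<xi> / fact k) * (\<bar>t\<bar> + 1) ^ k)"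
      using summable_semigroup[OF e, of "\<bar>t\<bar> + 1" a vt f] unfolding A_def by (simp add: mult.commute)
    then have "summable (%k. norm ((A k \<xi> / fact k) * t ^ k))" by (rule powser_insidea) simp
    then show ?thesis by (simp add: mult.commute)
  qed
  have "(%k. \<Sum>i\<le>k. (t ^ i / fact i * A i \<xi>) * (inverse (fact (k - i)) * (\<Lambda> * t) ^ (k - i))) sums
      ((\<Sum>k. t ^ k / fact k * A k \<xi>) * (\<Sum>k. inverse (fact k) * (\<Lambda> * t) ^ k))"
    by (rule Cauchy_product_sums[OF summ]) (use summable_norm_exp[of "\<Lambda> * t"] in simp)
  moreover have "(\<Sum>i\<le>k. (t ^ i / fact i * A i \<xi>) * (inverse (fact (k - i)) * (\<Lambda> * t) ^ (k - i))) = t ^ k / fact k * (P ^^ k) f \<xi>" for k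
    unfolding Pb sum_distrib_left
  proof (rule sum.cong[OF refl])
    fix i assume "i \<in> {..k}"
    then have i: "i \<le> k" by simp
    have c: "real (k choose i) = fact k / (fact i * fact (k - i))" using binomial_fact[OF i] by simp
    have tk: "t ^ k = t ^ i * t ^ (k - i)" using i by (simp add: power_add[symmetric])
    show "t ^ i / fact i * A i \<xi> * (inverse (fact (k - i)) * (\<Lambda> * t) ^ (k - i)) = t ^ k / fact k * (real (k choose i) * \<Lambda> ^ (k - i) * A i \<xi>)"
      unfolding c tk power_mult_distrib by (simp add: field_simps)
  qed
  moreover have "(\<Sum>k. inverse (fact k) * (\<Lambda> * t) ^ k) = exp (\<Lambda> * t)" by (simp add: exp_def)
  ultimately have S: "(%k. t ^ k / fact k * (P ^^ k) f \<xi>) sums (semigroup_S a vt n t f \<xi> * exp (\<Lambda> * t))"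
    unfolding semigroup_S_def A_def by simp
  have "(\<Sum>k\<in>{0}. t ^ k / fact k * (P ^^ k) f \<xi>) \<le> semigroup_S a vt n t f \<xi> * exp (\<Lambda> * t)"
    unfolding sums_unique[OF S] by (rule sum_le_suminf[OF sums_summable[OF S]]) (use Pk[OF e] t in auto)
  then have "exp (- (\<Lambda> * t)) * f \<xi> \<le> exp (- (\<Lambda> * t)) * (semigroup_S a vt n t f \<xi> * exp (\<Lambda> * t))" by (intro mult_left_mono) auto
  moreover have "exp (- (\<Lambda> * t)) * (semigroup_S a vt n t f \<xi> * exp (\<Lambda> * t)) = semigroup_S a vt n t f \<xi>" by (simp add: exp_minus)
  ultimately show ?thesis by simp
qed

section \<open>The law at time t and its density\<close>

definition pt :: "real => real => nat => (conf => real) => real => conf => real" where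
  "pt a vt n m t cf = (\<Sum>\<xi>\<in>Omega n. m \<xi> * semigroup_S a vt n t (indicator {cf}) \<xi>)"

lemma EE_pt: "EE n (pt a vt n m t) f = (\<Sum>\<xi>\<in>Omega n. m \<xi> * semigroup_S a vt n t f \<xi>)"
proof -
  have "EE n (pt a vt n m t) f = (\<Sum>\<xi>\<in>Omega n. \<Sum>cf\<in>Omega n. m \<xi> * (f cf * semigroup_S a vt n t (indicator {cf}) \<xi>))"
    unfolding EE_def pt_def sum_distrib_right by (subst sum.swap) (simp add: mult_ac)
  also have "... = (\<Sum>\<xi>\<in>Omega n. m \<xi> * semigroup_S a vt n t f \<xi>)"
    unfolding sum_distrib_left[symmetric] by (intro sum.cong refl arg_cong2[of _ _ _ _ "(*)"] semigroup_expand[symmetric])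
  finally show ?thesis .
qed

lemma EE_pt_deriv: "((%t. EE n (pt a vt n m t) f) has_real_derivative EE n (pt a vt n m t) (gen a vt n f)) (at t)"
  unfolding EE_pt by (intro DERIV_sum DERIV_cmult semigroup_deriv)

lemma pt_EE: assumes "cf \<in> Omega n" shows "pt a vt n m t cf = EE n (pt a vt n m t) (indicator {cf})"
  unfolding EE_pt pt_def ..

lemma pt_deriv: assumes "cf \<in> Omega n"
  shows "((%t. pt a vt n m t cf) has_real_derivative EE n (pt a vt n m t) (gen a vt n (indicator {cf}))) (at t)"
  unfolding pt_EE[OF assms] by (rule EE_pt_deriv)

lemma pt_0: "cf \<in> Omega n ==> pt a vt n m 0 cf = m cf"
  unfolding pt_def semigroup_0
  by (rule sum_indicator)

lemma pt_pmfn: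
  assumes "a \<ge> 0" "n \<ge> 2" "0 \<le> gam vt n" "gam vt n \<le> 1" "t \<ge> 0" and m: "pmfn n m"
  shows "pmfn n (pt a vt n m t)" "(!!cf. cf \<in> Omega n ==> 0 < m cf) ==> cf \<in> Omega n ==> 0 < pt a vt n m t cf"
proof -
  interpret M: pmfn n m by fact
  define \<Lambda> where "\<Lambda> = sqrt (real n) * ((real n)^2 * real n + a * (real n * 4))"
  have lo: "exp (- \<Lambda> * t) * indicator {cf} \<xi> \<le> semigroup_S a vt n t (indicator {cf}) \<xi>" if "\<xi> \<in> Omega n" for cf \<xi>
    unfolding \<Lambda>_def by (rule semigroup_lower) (use assms that in auto)
  have low: "exp (- \<Lambda> * t) * m cf \<le> pt a vt n m t cf" if "cf \<in> Omega n" for cf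
  proof -
    have "exp (- \<Lambda> * t) * m cf = (\<Sum>\<xi>\<in>Omega n. m \<xi> * (exp (- \<Lambda> * t) * indicator {cf} \<xi>))"
      using sum_indicator(1)[OF that, of "%\<xi>. m \<xi> * exp (- \<Lambda> * t)"] by (simp only: mult_ac)
    also have "... \<le> pt a vt n m t cf" unfolding pt_def by (intro sum_mono mult_left_mono lo M.p0)
    finally show ?thesis .
  qed
  show "pmfn n (pt a vt n m t)"
  proof
    show "0 \<le> pt a vt n m t cf" if "cf \<in> Omega n" for cf
      using low[OF that] M.p0[OF that] by (meson exp_ge_zero mult_nonneg_nonneg order_trans)
    show "(\<Sum>cf\<in>Omega n. pt a vt n m t cf) = 1"
      using EE_pt[where f = "%_. 1" and m = m] by (simp add: EE_def semigroup_const M.p1)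
  qed (use assms in simp)
  show "0 < pt a vt n m t cf" if "!!cf. cf \<in> Omega n ==> 0 < m cf" "cf \<in> Omega n"
    using low[OF that(2)] that(1)[OF that(2)] by (meson exp_gt_zero mult_pos_pos less_le_trans)
qed

lemma pt_lin: "pt a vt n (%\<xi>. c * m \<xi> + d * k \<xi>) t cf = c * pt a vt n m t cf + d * pt a vt n k t cf"
  unfolding pt_def by (simp add: sum.distrib sum_distrib_left algebra_simps)

lemma finite_measure_point:
  assumes "prob_space \<mu>" "sets \<mu> = Pow (Omega n)"
  shows "\<mu> = point_measure (Omega n) (%cf. ennreal (measure \<mu> {cf}))"
proof (rule measure_eqI_finite[OF assms(2) _ finite_Omega])
  interpret prob_space \<mu> by fact
  fix cf assume "cf \<in> Omega n"
  then show "emeasure \<mu> {cf} = emeasure (point_measure (Omega n) (%cf. ennreal (measure \<mu> {cf}))) {cf}"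
    by (simp add: emeasure_point_measure_finite finite_Omega emeasure_eq_measure)
qed (simp add: sets_point_measure)

lemma integral_prob:
  assumes "prob_space \<mu>" "sets \<mu> = Pow (Omega n)"
  shows "(\<integral>\<xi>. f \<xi> \<partial>\<mu>) = (\<Sum>\<xi>\<in>Omega n. measure \<mu> {\<xi>} * (f \<xi> :: real))"
  by (subst finite_measure_point[OF assms], subst lebesgue_integral_point_measure_finite) (auto simp: finite_Omega)

lemma prob_pmfn: assumes "prob_space \<mu>" "sets \<mu> = Pow (Omega n)" "n \<ge> 2" shows "pmfn n (%cf. measure \<mu> {cf})"
  by unfold_locales (use assms integral_prob[OF assms(1,2), of "%_. 1"] prob_space.prob_space[OF assms(1)] in auto)

definition nuw :: "real => real => nat => conf => real" where
  "nuw a vt n cf = gibbs_weight a vt n cf / part_fun a vt n / real (card (Omega n))"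

lemma nuw_pos: "nuw a vt n cf > 0"
  unfolding nuw_def gibbs_weight_def using part_fun_pos[of a vt n] finite_Omega[of n] Omega_ne[of n] by (simp add: card_gt_0_iff)

lemma measure_nu_g: "cf \<in> Omega n ==> measure (nu_g a vt n) {cf} = nuw a vt n cf"
  unfolding nu_g_point_measure measure_def nuw_def[symmetric] using nuw_pos[of a vt n cf]
  by (simp add: emeasure_point_measure_finite finite_Omega)

lemma sets_nu_g: "sets (nu_g a vt n) = Pow (Omega n)" by (simp add: nu_g_point_measure sets_point_measure)

lemma integral_nu_g: "(\<integral>cf. f cf \<partial>nu_g a vt n) = (\<Sum>cf\<in>Omega n. nuw a vt n cf * (f cf :: real))"
  unfolding integral_prob[OF prob_nu_g sets_nu_g] by (simp add: measure_nu_g)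

lemma sum_nuw: "(\<Sum>cf\<in>Omega n. nuw a vt n cf) = 1"
  using integral_nu_g[where f = "%_. 1"] prob_space.prob_space[OF prob_nu_g[of a vt n]] by simp

lemma dens_pt:
  assumes "prob_space \<mu>" "sets \<mu> = Pow (Omega n)" and p: "pmfn n (pt a vt n (%\<xi>. measure \<mu> {\<xi>}) t)" and e: "cf \<in> Omega n"
  shows "dens_at a vt n \<mu> t cf = pt a vt n (%\<xi>. measure \<mu> {\<xi>}) t cf / nuw a vt n cf"
proof -
  have "emeasure (law_at a vt n \<mu> t) {cf} = ennreal (pt a vt n (%\<xi>. measure \<mu> {\<xi>}) t cf)"
    unfolding law_at_def integral_prob[OF assms(1,2)] pt_def[symmetric]
    using e by (simp add: emeasure_point_measure_finite finite_Omega)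
  then have "measure (law_at a vt n \<mu> t) {cf} = pt a vt n (%\<xi>. measure \<mu> {\<xi>}) t cf"
    by (rule measure_eq_emeasure_eq_ennreal[OF pmfn.p0[OF p e]])
  then show ?thesis unfolding dens_at_eq_quotient[OF e] measure_nu_g[OF e] by simp
qed

section \<open>Free energy and carre du champ as finite sums\<close>

definition LW :: "real => real => nat => conf => real" where
  "LW a vt n cf = ln (nuw a vt n cf)"

definition FE :: "real => real => nat => (conf => real) => real" where
  "FE a vt n p = EE n p (%cf. ln (p cf)) - EE n p (LW a vt n) + 1/4 * EE n p (%cf. P0 n (fld n cf))"

definition CR :: "real => real => nat => (conf => real) => real" where
  "CR a vt n p = sqrt (real n) / 2 * (Xex n (LW a vt n) p + a * DG (gam vt n) n (LW a vt n) p)"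

lemma magnet_P0: assumes "n > 0" "cf \<in> Omega n" shows "sqrt (real n) * (magnet n cf)^2 = 1/4 * P0 n (fld n cf)"
proof -
  define S where "S = tsum n (fld n cf)"
  have "(\<Sum>i<n. centred cf i) = (\<Sum>i<n. fld n cf (int i) / 2)"
    by (rule sum.cong) (simp_all add: fld_nat centred_def spin_def)
  also have "... = S / 2" unfolding S_def tsum_cdiv[symmetric] unfolding tsum_nat unfolding tsum_def by (rule sum.cong) auto
  finally have m: "(magnet n cf)^2 = (real n powr (- 3/4))^2 * (S / 2)^2" by (simp only: magnet_def power_mult_distrib)
  have "sqrt (real n) * (real n powr (- 3/4))^2 = real n powr (1/2) * real n powr (- 3/2)"
    using assms(1) by (simp add: powr_half_sqrt powr_power)
  also have "... = real n powr (- 1)" unfolding powr_add[symmetric] by simp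
  also have "... = 1 / real n" using assms(1) by (simp add: powr_minus_divide)
  finally have "sqrt (real n) * (magnet n cf)^2 = 1 / real n * (S / 2)^2" unfolding m by (metis mult.assoc)
  then show ?thesis unfolding P0_eq[OF assms(1)] mg_def S_def[symmetric] using assms(1) by (simp add: power_divide power2_eq_square)
qed

lemma free_energy_FE:
  assumes n: "n > 0" and h: "!!cf. cf \<in> Omega n ==> h cf = p cf / nuw a vt n cf" and p: "!!cf. cf \<in> Omega n ==> 0 \<le> p cf"
  shows "free_energy n (nu_g a vt n) 1 h = FE a vt n p"
proof -
  have w: "nuw a vt n cf * h cf = p cf" if "cf \<in> Omega n" for cf using h[OF that] nuw_pos[of a vt n cf] by simp
  have "rel_entropy (nu_g a vt n) h = EE n p (%cf. ln (p cf) - LW a vt n cf)"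
    unfolding rel_entropy_def integral_nu_g EE_def
  proof (rule sum.cong[OF refl])
    fix cf assume e: "cf \<in> Omega n"
    show "nuw a vt n cf * (h cf * ln (h cf)) = p cf * (ln (p cf) - LW a vt n cf)"
      unfolding mult.assoc[symmetric] w[OF e] h[OF e] LW_def using nuw_pos[of a vt n cf] p[OF e] by (cases "p cf = 0") (simp_all add: ln_div)
  qed
  moreover have "sqrt (real n) * (\<integral>cf. (magnet n cf)^2 * h cf \<partial>nu_g a vt n) = 1/4 * EE n p (%cf. P0 n (fld n cf))"
    unfolding integral_nu_g EE_cmult[symmetric] unfolding EE_def sum_distrib_left
  proof (rule sum.cong[OF refl])
    fix cf assume e: "cf \<in> Omega n"
    have "sqrt (real n) * (nuw a vt n cf * ((magnet n cf)^2 * h cf)) = (nuw a vt n cf * h cf) * (sqrt (real n) * (magnet n cf)^2)" by simp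
    also have "... = p cf * (1/4 * P0 n (fld n cf))" unfolding w[OF e] magnet_P0[OF n e] ..
    finally show "sqrt (real n) * (nuw a vt n cf * ((magnet n cf)^2 * h cf)) = p cf * (1/4 * P0 n (fld n cf))" .
  qed
  ultimately show ?thesis unfolding free_energy_def FE_def EE_diff by simp
qed

text \<open>With \<open>k\<close> the density at the target,
  \<open>k - h - 2 * sqrt h * (sqrt k - sqrt h)\<close> is the square of
  \<open>sqrt k - sqrt h\<close>; the carre du champ is therefore the Dirichlet form of the square
  root of the density, written with tilts by \<open>LW\<close>.\<close>

lemma carre_CR:
  assumes n: "n > 0" and h: "!!cf. cf \<in> Omega n ==> h cf = p cf / nuw a vt n cf" and p: "!!cf. cf \<in> Omega n ==> 0 \<le> p cf"
  shows "carre a vt n (nu_g a vt n) h = CR a vt n p"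
proof -
  let ?w = "nuw a vt n" and ?c = "%cf i. crate (gam vt n) (fld n cf) i"
  define E where "E b cf = (sqrt (p (exc n cf b)) * exp ((LW a vt n cf - LW a vt n (exc n cf b)) / 2) - sqrt (p cf))^2" for b cf
  define F where "F b cf = (sqrt (p (flp n cf b)) * exp ((LW a vt n cf - LW a vt n (flp n cf b)) / 2) - sqrt (p cf))^2" for b cf
  have sw: "sqrt (?w cf) = exp (LW a vt n cf / 2)" for cf
  proof (rule real_sqrt_unique)
    show "(exp (LW a vt n cf / 2))^2 = ?w cf" unfolding exp_double[symmetric] LW_def using nuw_pos[of a vt n cf] by simp
  qed simp
  have sq: "?w cf * (h \<xi> - h cf - 2 * sqrt (h cf) * (sqrt (h \<xi>) - sqrt (h cf)))
      = (sqrt (p \<xi>) * exp ((LW a vt n cf - LW a vt n \<xi>) / 2) - sqrt (p cf))^2" if e: "cf \<in> Omega n" "\<xi> \<in> Omega n" for cf \<xi>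
  proof -
    have h0: "h cf \<ge> 0" "h \<xi> \<ge> 0" using e h p nuw_pos[of a vt n] by (simp_all add: less_imp_le)
    have "h \<xi> - h cf - 2 * sqrt (h cf) * (sqrt (h \<xi>) - sqrt (h cf)) = (sqrt (h \<xi>) - sqrt (h cf))^2"
      using h0 by (simp add: power2_eq_square algebra_simps)
    then have "?w cf * (h \<xi> - h cf - 2 * sqrt (h cf) * (sqrt (h \<xi>) - sqrt (h cf))) = (sqrt (?w cf) * (sqrt (h \<xi>) - sqrt (h cf)))^2"
      using nuw_pos[of a vt n cf] by (simp add: power_mult_distrib)
    also have "sqrt (?w cf) * (sqrt (h \<xi>) - sqrt (h cf)) = sqrt (p \<xi>) * exp ((LW a vt n cf - LW a vt n \<xi>) / 2) - sqrt (p cf)"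
      unfolding h[OF e(1)] h[OF e(2)] real_sqrt_divide sw by (simp add: right_diff_distrib diff_divide_distrib exp_diff)
    finally show ?thesis .
  qed
  have t: "?w cf * (1 / 2 * (gen a vt n h cf - 2 * sqrt (h cf) * gen a vt n (%\<xi>. sqrt (h \<xi>)) cf))
      = sqrt (real n) / 2 * ((real n)^2 * tsum n (%b. E b cf) + a * tsum n (%i. ?c cf i * F i cf))" if e: "cf \<in> Omega n" for cf
  proof -
    have 1: "tsum n (%b. E b cf) = ?w cf * (tsum n (%b. h (exc n cf b) - h cf) - 2 * sqrt (h cf) * tsum n (%b. sqrt (h (exc n cf b)) - sqrt (h cf)))"
      unfolding E_def sq[OF e exc_Omega[OF e n], symmetric] by (simp only: tsum_cmult tsum_diff)
    have 2: "tsum n (%i. ?c cf i * F i cf) = ?w cf * (tsum n (%i. ?c cf i * (h (flp n cf i) - h cf)) - 2 * sqrt (h cf) * tsum n (%i. ?c cf i * (sqrt (h (flp n cf i)) - sqrt (h cf))))"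
      unfolding F_def sq[OF e flp_Omega[OF e n], symmetric] tsum_cmult[symmetric] tsum_diff[symmetric] by (rule tsum_cong) (simp add: algebra_simps)
    show ?thesis unfolding gen_def gen_L_tsum 1 2 by (simp add: algebra_simps)
  qed
  have "carre a vt n (nu_g a vt n) h = (\<Sum>cf\<in>Omega n. sqrt (real n) / 2 * ((real n)^2 * tsum n (%b. E b cf) + a * tsum n (%i. ?c cf i * F i cf)))"
    unfolding carre_def integral_nu_g by (rule sum.cong[OF refl t])
  also have "... = CR a vt n p"
    unfolding CR_def Xex_def DG_def E_def[symmetric] F_def[symmetric] tsum_sum sum_distrib_left[symmetric] sum.distrib ..
  finally show ?thesis .
qed

lemma p_le1: assumes "pmfn n p" "cf \<in> Omega n" shows "p cf \<le> 1"
  using member_le_sum[OF assms(2), of p] pmfn.p0[OF assms(1)] pmfn.p1[OF assms(1)] finite_Omega by auto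

lemma EE_le_sum: assumes "pmfn n p" "!!cf. cf \<in> Omega n ==> 0 \<le> f cf" shows "EE n p f \<le> (\<Sum>cf\<in>Omega n. f cf)"
  unfolding EE_def using p_le1[OF assms(1)] assms(2) by (intro sum_mono mult_left_le_one_le pmfn.p0[OF assms(1)]) auto

lemma FE_bounds: assumes p: "pmfn n p"
  shows "0 \<le> FE a vt n p" "FE a vt n p \<le> (\<Sum>cf\<in>Omega n. \<bar>LW a vt n cf\<bar> + 1/4 * P0 n (fld n cf))"
proof -
  interpret pmfn n p by fact
  have P: "0 \<le> EE n p (%cf. P0 n (fld n cf))" by (rule EE_nonneg[OF p0 P_nonneg(1)])
  show "0 \<le> FE a vt n p"
    using gibbs_inequality[OF p, of "nuw a vt n"] nuw_pos[of a vt n] P unfolding FE_def LW_def[abs_def] sum_nuw by simp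
  have "EE n p (%cf. ln (p cf)) \<le> 0" unfolding EE_def
  proof (rule sum_nonpos)
    fix cf assume "cf \<in> Omega n"
    then show "p cf * ln (p cf) \<le> 0" using p0 p_le1[OF p] by (cases "p cf = 0") (auto simp: mult_le_0_iff less_le)
  qed
  moreover have "EE n p (%cf. - LW a vt n cf + 1/4 * P0 n (fld n cf)) \<le> EE n p (%cf. \<bar>LW a vt n cf\<bar> + 1/4 * P0 n (fld n cf))"
    by (rule EE_mono[OF p0]) auto
  moreover have "EE n p (%cf. - LW a vt n cf + 1/4 * P0 n (fld n cf)) = - EE n p (LW a vt n) + 1/4 * EE n p (%cf. P0 n (fld n cf))"
    by (simp only: EE_add EE_uminus EE_cmult)
  moreover have "EE n p (%cf. \<bar>LW a vt n cf\<bar> + 1/4 * P0 n (fld n cf)) \<le> (\<Sum>cf\<in>Omega n. \<bar>LW a vt n cf\<bar> + 1/4 * P0 n (fld n cf))"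
    using P_nonneg(1)[of n] by (intro EE_le_sum[OF p]) auto
  ultimately show "FE a vt n p \<le> (\<Sum>cf\<in>Omega n. \<bar>LW a vt n cf\<bar> + 1/4 * P0 n (fld n cf))" unfolding FE_def by linarith
qed

text \<open>The bound depends on \<open>n\<close>. It provides the dominating constant when initial
  laws are approximated, and it treats the finitely many small \<open>n\<close>.\<close>

lemma CR_bounds: assumes a: "a \<ge> 0" and n: "n \<ge> 2" and g: "0 \<le> gam vt n" "gam vt n \<le> 1"
  shows "\<exists>c. \<forall>p. pmfn n p --> 0 \<le> CR a vt n p \<and> CR a vt n p \<le> c"
proof -
  have n0: "n > 0" using n by simp
  let ?L = "LW a vt n"
  define X where "X = (real n)^2 * tsum n (%b. \<Sum>cf\<in>Omega n. 2 * (exp ((?L cf - ?L (exc n cf b)) / 2))^2 + 2)"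
  define D where "D = tsum n (%i. \<Sum>cf\<in>Omega n. 4 * (2 * (exp ((?L cf - ?L (flp n cf i)) / 2))^2 + 2))"
  have "0 \<le> CR a vt n p \<and> CR a vt n p \<le> sqrt (real n) / 2 * (X + a * D)" if p: "pmfn n p" for p
  proof -
    interpret pmfn n p by fact
    have sqb: "(sqrt (p \<xi>) * e - sqrt (p cf))^2 \<le> 2 * e^2 + 2" if "\<xi> \<in> Omega n" "cf \<in> Omega n" for \<xi> cf e
    proof -
      have "(sqrt (p \<xi>) * e - sqrt (p cf))^2 \<le> 2 * (sqrt (p \<xi>) * e)^2 + 2 * (sqrt (p cf))^2"
        using sq_add_le[of "sqrt (p \<xi>) * e" "- sqrt (p cf)"] by simp
      also have "... = 2 * (p \<xi> * e^2) + 2 * p cf" using p0[OF that(1)] p0[OF that(2)] by (simp add: power_mult_distrib)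
      also have "... \<le> 2 * (1 * e^2) + 2 * 1" using p_le1[OF p that(1)] p_le1[OF p that(2)] by (intro add_mono mult_left_mono mult_right_mono) auto
      finally show ?thesis by simp
    qed
    have "Xex n ?L p \<le> X" unfolding Xex_def X_def
      using sqb exc_Omega[OF _ n0] by (intro mult_left_mono tsum_mono sum_mono) auto
    moreover have "DG (gam vt n) n ?L p \<le> D" unfolding DG_def D_def
      using sqb flp_Omega[OF _ n0] crate_bounds[OF _ n0 g] by (intro tsum_mono sum_mono mult_mono) auto
    moreover have "0 \<le> Xex n ?L p" unfolding Xex_def by (intro mult_nonneg_nonneg tsum_nonneg sum_nonneg) auto
    moreover have "0 \<le> DG (gam vt n) n ?L p" unfolding DG_def
      using crate_bounds[OF _ n0 g] by (intro tsum_nonneg sum_nonneg mult_nonneg_nonneg) auto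
    ultimately show ?thesis unfolding CR_def using a
      by (intro conjI mult_nonneg_nonneg add_nonneg_nonneg mult_left_mono add_mono) auto
  qed
  then show ?thesis by blast
qed

text \<open>The limit 0 is the delicate case, as \<open>ln\<close> is discontinuous there; the
  modulus of \<open>y * ln y\<close> is at most \<open>2 * sqrt y\<close> on the unit
  interval.\<close>

lemma tendsto_xlnx:
  fixes x :: real assumes f: "f \<longlonglongrightarrow> x" and f0: "!!k. 0 \<le> f k"
  shows "(%k. f k * ln (f k)) \<longlonglongrightarrow> x * ln x"
proof (cases "x = 0")
  case False
  moreover have "x \<ge> 0" by (rule LIMSEQ_le_const[OF f]) (use f0 in auto)
  ultimately show ?thesis by (intro tendsto_intros f) auto
next
  case True
  have b: "\<bar>y * ln y\<bar> \<le> 2 * sqrt y" if y: "0 \<le> y" "y \<le> 1" for y :: real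
  proof (cases "y = 0")
    case False
    then have y0: "y > 0" using y by simp
    have "- ln y = 2 * ln (1 / sqrt y)" using y0 by (simp add: ln_div ln_sqrt)
    also have "... \<le> 2 * (1 / sqrt y - 1)" using y0 by (intro mult_left_mono ln_le_minus_one) auto
    finally have "- ln y \<le> 2 / sqrt y" by simp
    then have "y * (- ln y) \<le> y * (2 / sqrt y)" using y0 by (intro mult_left_mono) auto
    also have "... = 2 * (y / sqrt y)" by simp
    also have "y / sqrt y = sqrt y" using real_div_sqrt[of y] y by simp
    finally show ?thesis using y0 y by (simp add: abs_mult)
  qed simp
  have s: "(%k. 2 * sqrt (f k)) \<longlonglongrightarrow> 0" using tendsto_mult[OF tendsto_const[of 2] tendsto_real_sqrt[OF f]] True by simp
  have "\<forall>\<^sub>F k in sequentially. f k < 1" using order_tendstoD(2)[OF f, of 1] True by simp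
  then have "\<forall>\<^sub>F k in sequentially. norm (f k * ln (f k)) \<le> 2 * sqrt (f k)" by eventually_elim (use b f0 in auto)
  then have "(%k. f k * ln (f k)) \<longlonglongrightarrow> 0" by (rule Lim_null_comparison[OF _ s])
  then show ?thesis unfolding True by simp
qed

lemma FE_tendsto:
  assumes "!!cf. cf \<in> Omega n ==> (%k. P k cf) \<longlonglongrightarrow> p cf" "!!k cf. cf \<in> Omega n ==> 0 \<le> P k cf"
  shows "(%k. FE a vt n (P k)) \<longlonglongrightarrow> FE a vt n p"
  unfolding FE_def EE_def by (intro tendsto_intros tendsto_xlnx assms)

lemma CR_tendsto:
  assumes n: "n > 0" and P: "!!cf. cf \<in> Omega n ==> ((%k. P k cf) \<longlongrightarrow> p cf) F"
  shows "((%k. CR a vt n (P k)) \<longlongrightarrow> CR a vt n p) F"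
  unfolding CR_def Xex_def DG_def tsum_def
  by (intro tendsto_intros P exc_Omega flp_Omega n) 

lemma CR_continuous: assumes "n > 0" shows "continuous_on S (%t. CR a vt n (pt a vt n m t))"
  unfolding continuous_on_def by (intro ballI CR_tendsto[OF assms] DERIV_isCont[OF pt_deriv, unfolded isCont_def, THEN tendsto_within_subset]) auto

lemma (in bign) LW_eq: "cf \<in> Omega n ==> LW a vt n cf = Eg a vt n cf - lnZ - real n * ln 2"
proof -
  assume e: "cf \<in> Omega n"
  have S: "(\<Sum>cf\<in>Omega n. exp (Eg a vt n cf)) > 0" by (rule sum_pos[OF finite_Omega Omega_ne]) auto
  have "part_fun a vt n = (\<Sum>cf\<in>Omega n. gibbs_weight a vt n cf / real (card (Omega n)))"
    unfolding part_fun_def nu_half_def uniform_count_measure_def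
    using finite_Omega[of n] by (subst lebesgue_integral_point_measure_finite) auto
  also have "... = (\<Sum>cf\<in>Omega n. exp (Eg a vt n cf)) / 2 ^ n"
    unfolding sum_divide_distrib by (rule sum.cong) (simp_all add: gibbs card_Omega)
  finally have "ln (part_fun a vt n) = lnZ" unfolding lnZ_def by simp
  then show ?thesis unfolding LW_def nuw_def gibbs[OF e] card_Omega using part_fun_pos[of a vt n] by (simp add: ln_div ln_mult ln_realpow)
qed

lemma (in bign) FE_FF: assumes p: "pmfn n p" shows "FE a vt n p = FF p"
proof -
  have "EE n p (LW a vt n) = EE n p (%cf. Eg a vt n cf - (lnZ + real n * ln 2))" by (rule EE_cong) (simp add: LW_eq)
  also have "... = EE n p (Eg a vt n) - (lnZ + real n * ln 2)" unfolding EE_diff EE_const[OF pmfn.p1[OF p]] ..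
  finally show ?thesis unfolding FE_def FF_def Hh_def by simp
qed

definition (in bign) "cA = 2 + 4 * exp (3 * cV) * cV^2 + 8 * a * exp (4 + cB) * (cV^2 + cN^2)"

text \<open>The bracket is exactly the dissipation in \<open>static_estimate\<close>; this is why
  that estimate retains \<open>DG\<close> and half of \<open>P1\<close> besides
  \<open>Dex\<close>.\<close>

lemma (in bign) CR_le: assumes p: "pmfn n p"
  shows "CR a vt n p \<le> cA * (sqrt (real n) * (1/2 * Dex n p + a * DG (gam vt n) n (UU n) p + 1/2 * EE n p (%cf. P1 n (fld n cf)))) + cA * sqrt (real n)"
proof -
  interpret pmfn n p by fact
  define D1 where "D1 = Dex n p"
  define D2 where "D2 = DG (gam vt n) n (UU n) p"
  define P where "P = EE n p (%cf. P1 n (fld n cf))"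
  define e1 where "e1 = exp (3 * cV)"
  define e2 where "e2 = 8 * exp (4 + cB)"
  have nn: "D1 \<ge> 0" "D2 \<ge> 0" "P \<ge> 0" "e1 \<ge> 0" "e2 \<ge> 0"
    unfolding D1_def D2_def P_def e1_def e2_def DG_def using crate_bounds[OF _ n0 g0 g1]
    by (auto intro!: Dex_nonneg EE_nonneg[OF p0 P_nonneg(2)] tsum_nonneg sum_nonneg)
  have "Xex n (LW a vt n) p = Xex n (Eg a vt n) p"
    unfolding Xex_def using LW_eq exc_Omega[OF _ n0] by (intro arg_cong2[of _ _ _ _ "(*)"] tsum_cong sum.cong refl) auto
  moreover have "DG (gam vt n) n (LW a vt n) p = DG (gam vt n) n (Eg a vt n) p"
    unfolding DG_def using LW_eq flp_Omega[OF _ n0] by (intro tsum_cong sum.cong refl) auto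
  ultimately have "CR a vt n p \<le> sqrt (real n) / 2 * ((2 * D1 + e1 * (cV^2 * P + 4 * cV^2)) + a * (2 * D2 + e2 * (cV^2 * P + cN^2)))"
    unfolding CR_def using Xex_le[OF p] DG_le[OF p] a unfolding D1_def D2_def P_def e1_def e2_def by (intro mult_left_mono add_mono) auto
  also have "... \<le> sqrt (real n) / 2 * (cA * D1 + 2 * cA * (a * D2) + cA * P + 2 * cA)"
  proof (rule mult_left_mono)
    have cA: "cA = 2 + 4 * (e1 * cV^2) + a * (e2 * cV^2) + a * (e2 * cN^2)" unfolding cA_def e1_def e2_def by (simp add: algebra_simps)
    have x: "0 \<le> e1 * cV^2" "0 \<le> a * (e2 * cV^2)" "0 \<le> a * (e2 * cN^2)" using nn a by auto
    have c: "2 \<le> cA" "e1 * cV^2 + a * (e2 * cV^2) \<le> cA" unfolding cA using x by linarith+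
    have "4 * (e1 * cV^2) + a * (e2 * cN^2) \<le> cA" unfolding cA using x by linarith
    then have c3: "4 * (e1 * cV^2) + a * (e2 * cN^2) \<le> 2 * cA" using c(1) by linarith
    have "2 * D1 \<le> cA * D1" using c nn by (intro mult_right_mono) auto
    moreover have "2 * (a * D2) \<le> (2 * cA) * (a * D2)" using c nn a by (intro mult_right_mono) auto
    moreover have "(e1 * cV^2 + a * (e2 * cV^2)) * P \<le> cA * P" using c nn by (intro mult_right_mono) auto
    moreover have "(2 * D1 + e1 * (cV^2 * P + 4 * cV^2)) + a * (2 * D2 + e2 * (cV^2 * P + cN^2))
       = 2 * D1 + 2 * (a * D2) + (e1 * cV^2 + a * (e2 * cV^2)) * P + (4 * (e1 * cV^2) + a * (e2 * cN^2))" by (simp add: algebra_simps)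
    ultimately show "(2 * D1 + e1 * (cV^2 * P + 4 * cV^2)) + a * (2 * D2 + e2 * (cV^2 * P + cN^2)) \<le> cA * D1 + 2 * cA * (a * D2) + cA * P + 2 * cA"
      using c3 by linarith
  qed simp
  finally show ?thesis unfolding D1_def D2_def P_def by (simp add: algebra_simps)
qed

section \<open>Growth of the free energy\<close>

lemma gen_indicator: assumes "\<xi> \<in> Omega n"
  shows "gen a vt n f \<xi> = (\<Sum>cf\<in>Omega n. f cf * gen a vt n (indicator {cf}) \<xi>)"
  using gen_pow_indicator[OF assms, where k = 1 and f = f] by simp

lemma EE_gen_indicator: "(\<Sum>cf\<in>Omega n. EE n p (gen a vt n (indicator {cf})) * f cf) = EE n p (gen a vt n f)"
proof -
  have "EE n p (gen a vt n f) = (\<Sum>\<xi>\<in>Omega n. \<Sum>cf\<in>Omega n. p \<xi> * (f cf * gen a vt n (indicator {cf}) \<xi>))"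
    unfolding EE_def sum_distrib_left[symmetric] by (intro sum.cong refl arg_cong2[of _ _ _ _ "(*)"] gen_indicator)
  also have "... = (\<Sum>cf\<in>Omega n. EE n p (gen a vt n (indicator {cf})) * f cf)"
    unfolding EE_def sum_distrib_right by (subst sum.swap) (simp add: mult_ac)
  finally show ?thesis by simp
qed

text \<open>Differentiating the logarithm adds the derivative of the total mass, which is
  zero.\<close>

lemma entropy_deriv:
  assumes pos: "!!cf. cf \<in> Omega n ==> 0 < pt a vt n m t cf"
  shows "((%s. EE n (pt a vt n m s) (%cf. ln (pt a vt n m s cf))) has_real_derivative
     EE n (pt a vt n m t) (gen a vt n (%cf. ln (pt a vt n m t cf)))) (at t)"
proof -
  let ?p = "pt a vt n m"
  let ?d = "%cf. EE n (?p t) (gen a vt n (indicator {cf}))"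
  have "((%s. ?p s cf * ln (?p s cf)) has_real_derivative ?d cf * ln (?p t cf) + ?d cf * 1) (at t)" if e: "cf \<in> Omega n" for cf
    by (rule derivative_eq_intros pt_deriv[OF e] refl pos[OF e])+ (use pos[OF e] in \<open>simp add: field_simps\<close>)
  then have "((%s. EE n (?p s) (%cf. ln (?p s cf))) has_real_derivative (\<Sum>cf\<in>Omega n. ?d cf * ln (?p t cf) + ?d cf * 1)) (at t)"
    unfolding EE_def by (rule DERIV_sum)
  moreover have "(\<Sum>cf\<in>Omega n. ?d cf * ln (?p t cf) + ?d cf * 1) = EE n (?p t) (gen a vt n (%cf. ln (?p t cf)))"
    unfolding sum.distrib EE_gen_indicator by (simp add: EE_def gen_const)
  ultimately show ?thesis by simp
qed

text \<open>Gronwall's inequality with the dissipation kept on the left-hand side.\<close>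

lemma gronwall_dissipation:
  fixes y D :: "real => real"
  assumes t: "0 \<le> t" "t \<le> T" and c: "0 \<le> c" and b: "0 \<le> b" and A: "1 \<le> A"
    and y: "!!s. 0 \<le> s ==> s \<le> T ==> (y has_real_derivative y' s) (at s)" "!!s. 0 \<le> s ==> s \<le> T ==> y' s \<le> c * y s + b - D s / A"
    and D: "continuous_on UNIV D" "!!s. 0 \<le> s ==> 0 \<le> D s" and y0: "0 \<le> y t"
  shows "y t + integral {0..t} D \<le> A * (exp (c * T) * (y 0 + b * T))"
proof -
  define I where "I s = integral {0..s} D" for s
  \<comment> \<open>The dissipation is given its weight at the final time \<open>T\<close>, which is
    at most \<open>exp (- c * s) / A\<close> at every earlier \<open>s\<close>; this makes
    \<open>w\<close> decrease.\<close>
  define e where "e = exp (- c * T) / A"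
  define w where "w s = exp (- c * s) * y s - b * s + e * I s" for s
  have DI: "(I has_real_derivative D s) (at s within {0..T})" if "s \<in> {0..T}" for s
    unfolding I_def by (rule integral_has_real_derivative[OF continuous_on_subset[OF D(1)] that]) simp
  have "w t \<le> w 0"
  proof (cases "t = 0")
    case False
    show ?thesis
    proof (rule DERIV_nonpos_imp_decreasing_open[where f = w and a = 0 and b = t])
      show "0 \<le> t" by (rule t)
      fix s assume s: "0 < s" "s < t"
      then have "(I has_real_derivative D s) (at s)" using DI[of s] t at_within_Icc_at[of 0 s T] by auto
      then have "(w has_real_derivative (exp (- c * s) * (- c)) * y s + exp (- c * s) * y' s - b + e * D s) (at s)"
        unfolding w_def using y(1)[of s] s t by (auto intro!: derivative_eq_intros)
      moreover have "(exp (- c * s) * (- c)) * y s + exp (- c * s) * y' s - b + e * D s \<le> 0"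
      proof -
        have "exp (- c * s) * y' s \<le> exp (- c * s) * (c * y s + b - D s / A)" using y(2)[of s] s t by (intro mult_left_mono) auto
        moreover have "exp (- c * s) * b \<le> 1 * b" using b c s by (intro mult_right_mono) auto
        moreover have "e * D s \<le> exp (- c * s) * (D s / A)"
        proof -
          have "exp (- c * T) * (D s / A) \<le> exp (- c * s) * (D s / A)"
            using c s t D(2)[of s] A by (intro mult_right_mono) (auto intro: mult_left_mono)
          then show ?thesis unfolding e_def by simp
        qed
        moreover have "exp (- c * s) * (c * y s + b - D s / A) = exp (- c * s) * c * y s + exp (- c * s) * b - exp (- c * s) * (D s / A)" by (simp only: distrib_left right_diff_distrib mult.assoc)
        moreover have "(exp (- c * s) * (- c)) * y s = - (exp (- c * s) * c * y s)" by simp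
        ultimately show ?thesis by linarith
      qed
      ultimately show "\<exists>z. (w has_real_derivative z) (at s) \<and> z \<le> 0" by blast
    next
      have "continuous_on {0..t} y"
      proof (rule DERIV_continuous_on)
        fix s assume "s \<in> {0..t}"
        then have "0 \<le> s" "s \<le> T" using t by auto
        then show "(y has_real_derivative y' s) (at s within {0..t})" by (rule has_field_derivative_at_within[OF y(1)])
      qed
      moreover have "continuous_on {0..t} I"
        using DERIV_continuous_on[OF DI] by (rule continuous_on_subset) (use t in auto)
      ultimately show "continuous_on {0..t} w" unfolding w_def by (intro continuous_intros)
    qed
  qed simp
  then have 1: "exp (- c * t) * y t + e * I t \<le> y 0 + b * t" unfolding w_def I_def by simp
  have I0: "0 \<le> I t" unfolding I_def by (rule integral_nonneg) (use D(2) continuous_on_subset[OF D(1)] in \<open>auto intro!: integrable_continuous_interval\<close>)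
  have "e * (y t + I t) \<le> exp (- c * t) * y t + e * I t"
  proof -
    have "e \<le> exp (- c * T) / 1" unfolding e_def using A by (intro divide_left_mono) auto
    also have "... \<le> exp (- c * t)" using c t by (simp add: mult_left_mono)
    finally have "e * y t \<le> exp (- c * t) * y t" using y0 by (intro mult_right_mono) auto
    then show ?thesis by (simp add: distrib_left)
  qed
  also have "... \<le> y 0 + b * t" by (rule 1)
  also have "... \<le> y 0 + b * T" using b t by (intro add_left_mono mult_left_mono) auto
  finally have "A * exp (c * T) * (e * (y t + I t)) \<le> A * exp (c * T) * (y 0 + b * T)" using A by (intro mult_left_mono) auto
  moreover have "A * exp (c * T) * e = 1" unfolding e_def using A by (simp add: exp_minus)
  then have "A * exp (c * T) * (e * (y t + I t)) = y t + I t" by (metis mult.assoc mult_1)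
  ultimately show ?thesis unfolding I_def by (simp only: mult.assoc)
qed

text \<open>The conclusion of \<open>static_estimate\<close> as a predicate with
  \<open>\<kappa> = 248\<close>, so that its constants can be passed on without the block conditions
  behind them.\<close>

definition dissipative :: "real => real => nat => nat => real => real => real => bool" where
  "dissipative a vt n w K c0 c1 \<longleftrightarrow> (\<forall>p. pmfn n p --> (\<forall>cf\<in>Omega n. 0 < p cf) -->
      EE n p (gen_L a vt n (%cf. ln (p cf) - UU n cf + Phi n w 248 (a * gam vt n) K (fld n cf)))
      \<le> - (1/2) * Dex n p - a * DG (gam vt n) n (UU n) p - (1/2) * EE n p (%cf. P1 n (fld n cf))
        + c1 / sqrt (real n) * EE n p (%cf. Phi n w 248 (a * gam vt n) K (fld n cf)) + c0)"

lemma dissipativeD: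
  assumes "dissipative a vt n w K c0 c1" "pmfn n p" "!!cf. cf \<in> Omega n ==> 0 < p cf"
  shows "EE n p (gen_L a vt n (%cf. ln (p cf) - UU n cf + Phi n w 248 (a * gam vt n) K (fld n cf)))
      \<le> - (1/2) * Dex n p - a * DG (gam vt n) n (UU n) p - (1/2) * EE n p (%cf. P1 n (fld n cf))
        + c1 / sqrt (real n) * EE n p (%cf. Phi n w 248 (a * gam vt n) K (fld n cf)) + c0"
  using assms unfolding dissipative_def by blast

definition (in bign2) "k1 K = 994 + 2 * a + 16 * K"
definition (in bign2) "k2 K r = 992 * cQ2 + 2 * a + 1 + 4 * K * r"
definition (in bign2) "k3 = (1 + a) * (cQ2 + 4 * (1 + a))"
definition (in bign2) "C1 K c1 T = cA * (exp (2 * c1 * T) * (k1 K * (a + 2)))"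
definition (in bign2) "C2 K r c0 c1 T = cA * (exp (2 * c1 * T) * (k1 K * k3 + k2 K r + (c0 + 1) * T)) + (1 + a + cQ)"

lemma (in bign2) cA2: "cA \<ge> 2" unfolding cA_def using a by simp

text \<open>The generator carries \<open>sqrt n\<close>, so the rate \<open>c1 / sqrt n\<close>
  becomes \<open>c1\<close> and the constant \<open>c0\<close> becomes \<open>c0 * sqrt n\<close>.
  At time 0 the functional is bounded by the entropy (\<open>P_entropy\<close>,
  \<open>P0_entropy\<close>) and the entropy by the free energy (\<open>entropy_le_FF\<close>); at
  time \<open>t\<close> it dominates the free energy up to order \<open>sqrt n\<close>
  (\<open>FF_le\<close>).\<close>

lemma (in bign2) free_energy_estimate_pos:
  assumes m: "pmfn n m" "!!cf. cf \<in> Omega n ==> 0 < m cf" and t: "0 \<le> t" "t \<le> T" and K: "0 \<le> K" and c: "0 \<le> c0" "0 \<le> c1"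
    and w: "w > 0" "w \<le> n" "real n / real w \<le> r"
    and stat: "dissipative a vt n w K c0 c1"
  shows "FE a vt n (pt a vt n m t) + integral {0..t} (%s. CR a vt n (pt a vt n m s))
     \<le> C1 K c1 T * FE a vt n m + C2 K r c0 c1 T * sqrt (real n)"
proof -
  let ?p = "pt a vt n m"
  define N where "N = sqrt (real n)"
  have N1: "N \<ge> 1" unfolding N_def by (rule sqrt_n(2))
  define \<Phi> where "\<Phi> cf = Phi n w 248 (a * gam vt n) K (fld n cf)" for cf
  define y where "y s = Hh n (?p s) + EE n (?p s) (%cf. \<Phi> cf - UU n cf)" for s
  have a0: "a \<ge> 0" using a by simp
  have pm: "pmfn n (?p s)" if "s \<ge> 0" for s by (rule pt_pmfn(1)[OF a0 n2 g0 g1 that m(1)])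
  have pp: "0 < ?p s cf" if "s \<ge> 0" "cf \<in> Omega n" for s cf by (rule pt_pmfn(2)[OF a0 n2 g0 g1 that(1) m that(2)])
  have Phi_ge: "248 * P0 n (fld n cf) \<le> \<Phi> cf" for cf
    unfolding \<Phi>_def Phi_def using K a g0 P_nonneg(1,2,4)[of n "fld n cf"] P_nonneg(3)[of n w "fld n cf"] by simp
  have UU_P0: "UU n cf = P0 n (fld n cf) / 2" for cf unfolding UU_def P0_eq[OF n0] ..
  \<comment> \<open>The negative Curie--Weiss term is only \<open>P0 / 2\<close> and is absorbed by
    the \<open>248 * P0\<close> contained in \<open>\<Phi>\<close>.\<close>
  have low: "Hh n q + 1/2 * EE n q \<Phi> \<le> Hh n q + EE n q (%cf. \<Phi> cf - UU n cf)" "1/4 * EE n q (%cf. P0 n (fld n cf)) \<le> 1/2 * EE n q \<Phi>" if q: "pmfn n q" for q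
  proof -
    have "EE n q (%cf. 1/2 * \<Phi> cf) \<le> EE n q (%cf. \<Phi> cf - UU n cf)"
    proof (rule EE_mono[OF pmfn.p0[OF q]])
      fix cf show "1/2 * \<Phi> cf \<le> \<Phi> cf - UU n cf" using Phi_ge[of cf] P_nonneg(1)[of n "fld n cf"] unfolding UU_P0 by linarith
    qed simp
    then show "Hh n q + 1/2 * EE n q \<Phi> \<le> Hh n q + EE n q (%cf. \<Phi> cf - UU n cf)" unfolding EE_cmult by simp
    show "1/4 * EE n q (%cf. P0 n (fld n cf)) \<le> 1/2 * EE n q \<Phi>"
      unfolding EE_cmult[symmetric]
    proof (rule EE_mono[OF pmfn.p0[OF q]])
      fix cf show "1/4 * P0 n (fld n cf) \<le> 1/2 * \<Phi> cf" using Phi_ge[of cf] P_nonneg(1)[of n "fld n cf"] by linarith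
    qed simp
  qed
  define y' where "y' s = EE n (?p s) (gen a vt n (%cf. ln (?p s cf) + (\<Phi> cf - UU n cf)))" for s
  have yd: "(y has_real_derivative y' s) (at s)" if "0 \<le> s" for s
  proof -
    have "((%s. EE n (?p s) (%cf. ln (?p s cf)) + real n * ln 2 + EE n (?p s) (%cf. \<Phi> cf - UU n cf)) has_real_derivative
       EE n (?p s) (gen a vt n (%cf. ln (?p s cf))) + 0 + EE n (?p s) (gen a vt n (%cf. \<Phi> cf - UU n cf))) (at s)"
      by (intro DERIV_add DERIV_const entropy_deriv EE_pt_deriv pp that)
    moreover have "y' s = EE n (?p s) (gen a vt n (%cf. ln (?p s cf))) + 0 + EE n (?p s) (gen a vt n (%cf. \<Phi> cf - UU n cf))"
      unfolding y'_def gen_add[abs_def] EE_add by simp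
    ultimately show ?thesis unfolding y_def[abs_def] Hh_def by simp
  qed
  have y'le: "y' s \<le> 2 * c1 * y s + (c0 + 1) * N - CR a vt n (?p s) / cA" if s: "0 \<le> s" for s
  proof -
    define R where "R = 1/2 * Dex n (?p s) + a * DG (gam vt n) n (UU n) (?p s) + 1/2 * EE n (?p s) (%cf. P1 n (fld n cf))"
    define F where "F = EE n (?p s) \<Phi>"
    have "(%cf. ln (?p s cf) + (\<Phi> cf - UU n cf)) = (%cf. ln (?p s cf) - UU n cf + \<Phi> cf)" by (rule ext) simp
    then have "y' s = N * EE n (?p s) (gen_L a vt n (%cf. ln (?p s cf) - UU n cf + \<Phi> cf))"
      unfolding y'_def gen_def[abs_def] N_def by (simp only: EE_cmult)
    also have "... \<le> N * (- (1/2) * Dex n (?p s) - a * DG (gam vt n) n (UU n) (?p s) - (1/2) * EE n (?p s) (%cf. P1 n (fld n cf)) + c1 / N * F + c0)"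
      unfolding F_def N_def \<Phi>_def using dissipativeD[OF stat pm[OF s] pp[OF s]] by (intro mult_left_mono) auto
    also have "... = N * (- R + c1 / N * F + c0)" unfolding R_def by simp
    also have "... = - (N * R) + c1 * F + c0 * N" using N1 by (simp add: algebra_simps)
    finally have 1: "y' s \<le> - (N * R) + c1 * F + c0 * N" .
    have "CR a vt n (?p s) \<le> cA * (N * R) + cA * N" unfolding N_def R_def by (rule CR_le[OF pm[OF s]])
    then have "CR a vt n (?p s) / cA \<le> (cA * (N * R) + cA * N) / cA" using cA2 by (intro divide_right_mono) auto
    also have "... = N * R + N" using cA2 by (simp add: add_divide_distrib)
    finally have 2: "CR a vt n (?p s) / cA \<le> N * R + N" .
    have "F \<le> 2 * y s" using low(1)[OF pm[OF s]] Hh_nonneg[OF pm[OF s]] unfolding y_def F_def by argo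
    then have "c1 * F \<le> c1 * (2 * y s)" using c by (intro mult_left_mono) auto
    then have "c1 * F \<le> 2 * c1 * y s" by simp
    then show ?thesis using 1 2 by (simp only: distrib_right mult_1)
  qed
  have y0: "0 \<le> y s" if "0 \<le> s" for s
  proof -
    have "0 \<le> EE n (?p s) (%cf. P0 n (fld n cf))" by (rule EE_nonneg[OF pmfn.p0[OF pm[OF that]] P_nonneg(1)])
    then show ?thesis using low[OF pm[OF that]] Hh_nonneg[OF pm[OF that]] unfolding y_def by linarith
  qed
  have CR0: "0 \<le> CR a vt n (?p s)" if "0 \<le> s" for s using CR_bounds[OF a0 n2 g0 g1] pm[OF that] by blast
  have main: "y t + integral {0..t} (%s. CR a vt n (?p s)) \<le> cA * (exp (2 * c1 * T) * (y 0 + (c0 + 1) * N * T))"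
  proof (rule gronwall_dissipation[where y' = y'])
    show "0 \<le> t" "t \<le> T" by (rule t)+
    show "0 \<le> 2 * c1" "0 \<le> (c0 + 1) * N" "1 \<le> cA" using c N1 cA2 by simp_all
    show "continuous_on UNIV (%s. CR a vt n (?p s))" by (rule CR_continuous[OF n0])
    show "0 \<le> y t" by (rule y0[OF t(1)])
  qed (rule yd y'le CR0, assumption)+
  have "EE n (?p 0) f = EE n m f" for f unfolding EE_def by (rule sum.cong) (simp_all add: pt_0)
  then have y00: "y 0 = Hh n m + EE n m (%cf. \<Phi> cf - UU n cf)"
    unfolding y_def Hh_def by simp (simp add: EE_def pt_0)
  also have "... \<le> Hh n m + EE n m \<Phi>"
    by (intro add_left_mono EE_mono[OF pmfn.p0[OF m(1)]]) (simp_all add: UU_def)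
  also have "EE n m \<Phi> = 248 * EE n m (%cf. P0 n (fld n cf)) + a * gam vt n * EE n m (%cf. P1 n (fld n cf)) + EE n m (%cf. P3 n (fld n cf)) + K * EE n m (%cf. P2 n w (fld n cf))"
    unfolding \<Phi>_def Phi_def by (simp only: EE_add EE_cmult)
  also have "Hh n m + (248 * EE n m (%cf. P0 n (fld n cf)) + a * gam vt n * EE n m (%cf. P1 n (fld n cf)) + EE n m (%cf. P3 n (fld n cf)) + K * EE n m (%cf. P2 n w (fld n cf)))
     \<le> Hh n m + (248 * (4 * Hh n m + 4 * cQ2 * N) + a * (2 * Hh n m + 2) + (Hh n m + 1) + K * (16 * Hh n m + 4 * r))"
  proof (intro add_left_mono add_mono)
    have P1: "0 \<le> EE n m (%cf. P1 n (fld n cf))" by (rule EE_nonneg[OF pmfn.p0[OF m(1)] P_nonneg(2)])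
    show "248 * EE n m (%cf. P0 n (fld n cf)) \<le> 248 * (4 * Hh n m + 4 * cQ2 * N)" using P0_entropy[OF m(1)] unfolding N_def by simp
    have "a * gam vt n * EE n m (%cf. P1 n (fld n cf)) \<le> (a * 1) * EE n m (%cf. P1 n (fld n cf))"
      using a g1 P1 by (intro mult_right_mono mult_left_mono) auto
    also have "... \<le> (a * 1) * (2 * Hh n m + 2)" using a P_entropy(1)[OF m(1) w(1,2)] by (intro mult_left_mono) auto
    finally show "a * gam vt n * EE n m (%cf. P1 n (fld n cf)) \<le> a * (2 * Hh n m + 2)" by simp
    show "EE n m (%cf. P3 n (fld n cf)) \<le> Hh n m + 1" by (rule P_entropy(2)[OF m(1) w(1,2)])
    have "EE n m (%cf. P2 n w (fld n cf)) \<le> 16 * Hh n m + 4 * r" using P_entropy(3)[OF m(1) w(1,2)] w(3) by linarith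
    then show "K * EE n m (%cf. P2 n w (fld n cf)) \<le> K * (16 * Hh n m + 4 * r)" using K by (intro mult_left_mono) auto
  qed
  also have "... = k1 K * Hh n m + 992 * cQ2 * N + (2 * a + 1 + 4 * K * r)" unfolding k1_def by (simp add: algebra_simps)
  also have "... \<le> k1 K * Hh n m + k2 K r * N"
  proof -
    have "0 \<le> r" using w(3) by (meson divide_nonneg_nonneg of_nat_0_le_iff order_trans)
    then have "(2 * a + 1 + 4 * K * r) * 1 \<le> (2 * a + 1 + 4 * K * r) * N" using N1 a K by (intro mult_left_mono) auto
    then show ?thesis unfolding k2_def by (simp add: algebra_simps)
  qed
  also have "k1 K * Hh n m \<le> k1 K * ((a + 2) * FE a vt n m + k3 * N)"
    unfolding FE_FF[OF m(1)] k3_def N_def using entropy_le_FF[OF m(1)] a K unfolding k1_def by (intro mult_left_mono) auto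
  finally have y0le: "y 0 \<le> k1 K * ((a + 2) * FE a vt n m + k3 * N) + k2 K r * N" by simp
  have "FE a vt n (?p t) \<le> y t + (1 + a + cQ) * N"
    using FF_le[OF pm[OF t(1)]] low[OF pm[OF t(1)]] unfolding FE_FF[OF pm[OF t(1)]] y_def N_def by linarith
  then have "FE a vt n (?p t) + integral {0..t} (%s. CR a vt n (?p s)) \<le> cA * (exp (2 * c1 * T) * (y 0 + (c0 + 1) * N * T)) + (1 + a + cQ) * N"
    using main by linarith
  also have "... \<le> cA * (exp (2 * c1 * T) * ((k1 K * ((a + 2) * FE a vt n m + k3 * N) + k2 K r * N) + (c0 + 1) * N * T)) + (1 + a + cQ) * N"
    using y0le cA2 by (intro add_right_mono mult_left_mono) auto
  also have "... = C1 K c1 T * FE a vt n m + C2 K r c0 c1 T * N" unfolding C1_def C2_def by (simp add: algebra_simps)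
  finally show ?thesis unfolding N_def .
qed

text \<open>The entropy is differentiated along strictly positive laws, so the initial law is mixed
  with the uniform one and the weight of the mixture is sent to 0; the evolution is linear, and both
  sides are continuous in the masses.\<close>

lemma (in bign2) free_energy_estimate:
  assumes m: "pmfn n m" and t: "0 \<le> t" "t \<le> T" and K: "0 \<le> K" and c: "0 \<le> c0" "0 \<le> c1"
    and w: "w > 0" "w \<le> n" "real n / real w \<le> r"
    and stat: "dissipative a vt n w K c0 c1"
  shows "FE a vt n (pt a vt n m t) + integral {0..t} (%s. CR a vt n (pt a vt n m s))
     \<le> C1 K c1 T * FE a vt n m + C2 K r c0 c1 T * sqrt (real n)"
proof -
  interpret M: pmfn n m by fact
  define d where "d k = inverse (real (Suc (Suc k)))" for k
  have d: "0 < d k" "d k < 1" for k unfolding d_def by (auto simp: field_simps)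
  have d0: "d \<longlonglongrightarrow> 0" unfolding d_def by (rule LIMSEQ_Suc[OF LIMSEQ_inverse_real_of_nat])
  define u where "u = (%_ :: conf. 1 / 2 ^ n :: real)"
  define M where "M k = (%\<xi>. (1 - d k) * m \<xi> + d k * u \<xi>)" for k
  have Mk: "pmfn n (M k)" for k
  proof
    show "(\<Sum>cf\<in>Omega n. M k cf) = 1" unfolding M_def sum.distrib sum_distrib_left[symmetric] M.p1 by (simp add: u_def card_Omega)
  qed (use n2 d[of k] M.p0 in \<open>auto simp: M_def u_def intro!: add_nonneg_nonneg mult_nonneg_nonneg\<close>)
  have Mpos: "0 < M k cf" if "cf \<in> Omega n" for k cf
    unfolding M_def u_def using d[of k] M.p0[OF that] by (intro add_nonneg_pos mult_nonneg_nonneg mult_pos_pos) auto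
  have a0: "a \<ge> 0" using a by simp
  have lim: "(%k. pt a vt n (M k) s cf) \<longlonglongrightarrow> pt a vt n m s cf" for s cf
  proof -
    have "(%k. (1 - d k) * pt a vt n m s cf + d k * pt a vt n u s cf) \<longlonglongrightarrow> (1 - 0) * pt a vt n m s cf + 0 * pt a vt n u s cf"
      by (intro tendsto_intros d0)
    then show ?thesis unfolding M_def pt_lin by simp
  qed
  have pm: "pmfn n (pt a vt n q s)" if "pmfn n q" "0 \<le> s" for q s by (rule pt_pmfn(1)[OF a0 n2 g0 g1 that(2,1)])
  obtain B where B: "!!p. pmfn n p ==> 0 \<le> CR a vt n p \<and> CR a vt n p \<le> B" using CR_bounds[OF a0 n2 g0 g1] by blast
  have i1: "(%k. integral {0..t} (%s. CR a vt n (pt a vt n (M k) s))) \<longlonglongrightarrow> integral {0..t} (%s. CR a vt n (pt a vt n m s))"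
  proof (rule dominated_convergence(2)[where h = "%_. B"])
    show "(%s. CR a vt n (pt a vt n (M k) s)) integrable_on {0..t}" for k
      by (intro integrable_continuous_interval CR_continuous n0)
    show "norm (CR a vt n (pt a vt n (M k) s)) \<le> B" if "s \<in> {0..t}" for k s
      using B[OF pm[OF Mk[of k], of s]] that by auto
    show "(%k. CR a vt n (pt a vt n (M k) s)) \<longlonglongrightarrow> CR a vt n (pt a vt n m s)" for s
      by (intro CR_tendsto n0 lim)
  qed auto
  have i2: "(%k. FE a vt n (pt a vt n (M k) t)) \<longlonglongrightarrow> FE a vt n (pt a vt n m t)"
    by (intro FE_tendsto lim pmfn.p0[OF pm[OF Mk t(1)]])
  have i3: "(%k. FE a vt n (M k)) \<longlonglongrightarrow> FE a vt n m"
  proof (rule FE_tendsto)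
    show "(%k. M k cf) \<longlonglongrightarrow> m cf" for cf
    proof -
      have "(%k. (1 - d k) * m cf + d k * u cf) \<longlonglongrightarrow> (1 - 0) * m cf + 0 * u cf" by (intro tendsto_intros d0)
      then show ?thesis unfolding M_def by simp
    qed
  qed (use pmfn.p0[OF Mk] in blast)
  show ?thesis
  proof (rule LIMSEQ_le)
    show "(%k. FE a vt n (pt a vt n (M k) t) + integral {0..t} (%s. CR a vt n (pt a vt n (M k) s))) \<longlonglongrightarrow> FE a vt n (pt a vt n m t) + integral {0..t} (%s. CR a vt n (pt a vt n m s))"
      by (intro tendsto_add i1 i2)
    show "(%k. C1 K c1 T * FE a vt n (M k) + C2 K r c0 c1 T * sqrt (real n)) \<longlonglongrightarrow> C1 K c1 T * FE a vt n m + C2 K r c0 c1 T * sqrt (real n)"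
      by (intro tendsto_intros i3)
    show "\<exists>N. \<forall>k\<ge>N. FE a vt n (pt a vt n (M k) t) + integral {0..t} (%s. CR a vt n (pt a vt n (M k) s)) \<le> C1 K c1 T * FE a vt n (M k) + C2 K r c0 c1 T * sqrt (real n)"
      using free_energy_estimate_pos[OF Mk Mpos t K c w stat] by blast
  qed
qed

section \<open>Choice of scales and constants, and the theorem\<close>

lemma gam_bounds: assumes "n > 0" "\<bar>vt\<bar> \<le> c * sqrt (real n)"
  shows "\<bar>1 - 2 * gam vt n\<bar> \<le> c" "(1 - c) / 2 \<le> gam vt n" "gam vt n \<le> (1 + c) / 2"
proof -
  have "1 - 2 * (1 / 2 * (1 - x)) = x" for x :: real by (simp add: field_simps)
  then have "1 - 2 * gam vt n = vt / sqrt (real n)" unfolding gam_def .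
  moreover have "\<bar>vt / sqrt (real n)\<bar> \<le> c" using assms by (simp add: abs_divide divide_le_eq)
  ultimately show "\<bar>1 - 2 * gam vt n\<bar> \<le> c" by simp
  then show "(1 - c) / 2 \<le> gam vt n" "gam vt n \<le> (1 + c) / 2" by (simp_all add: abs_le_iff)
qed

lemma nat_floor_bounds: fixes x :: real assumes "x \<ge> 1"
  shows "real (nat \<lfloor>x\<rfloor>) \<le> x" "x / 2 \<le> real (nat \<lfloor>x\<rfloor>)" "0 < nat \<lfloor>x\<rfloor>"
proof -
  have f: "1 \<le> \<lfloor>x\<rfloor>" using assms by simp
  then show "0 < nat \<lfloor>x\<rfloor>" by simp
  have r: "real (nat \<lfloor>x\<rfloor>) = real_of_int \<lfloor>x\<rfloor>" using f by simp
  show "real (nat \<lfloor>x\<rfloor>) \<le> x" unfolding r by simp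
  have "1 \<le> real_of_int \<lfloor>x\<rfloor>" using f by linarith
  moreover have "x < real_of_int \<lfloor>x\<rfloor> + 1" by linarith
  ultimately show "x / 2 \<le> real (nat \<lfloor>x\<rfloor>)" unfolding r by linarith
qed

text \<open>\<open>l\<close> is the integer part of \<open>n powr (3/4)\<close>; the threshold 4096,
  the square of 64, makes this at most \<open>n / 8\<close>.\<close>

lemma mesoscopic_scale: assumes n: "n \<ge> 4096"
  shows "\<exists>l>0. real l \<le> real n / 8 \<and> (real l)^2 \<le> real n * sqrt (real n) \<and> (real n / real l)^2 \<le> 4 * sqrt (real n)"
proof -
  define N where "N = real n"
  define S where "S = sqrt N"
  have S: "S * S = N" "S > 0" unfolding S_def N_def using n by auto
  have "sqrt 4096 \<le> S" unfolding S_def N_def using n by (intro real_sqrt_le_mono) simp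
  moreover have "sqrt 4096 = (64::real)" by (rule real_sqrt_unique) auto
  ultimately have S64: "S \<ge> 64" by simp
  define X where "X = sqrt (N * S)"
  have X2: "X^2 = N * S" unfolding X_def using S unfolding N_def by simp
  have NS: "1 * 1 \<le> N * S" using n S64 unfolding N_def by (intro mult_mono) auto
  then have X1: "X \<ge> 1" unfolding X_def using real_sqrt_ge_1_iff by auto
  define l where "l = nat \<lfloor>X\<rfloor>"
  note l = nat_floor_bounds[OF X1, folded l_def]
  have "X^2 \<le> (N / 8)^2"
  proof -
    have "64 * (N * S) \<le> S * (N * S)" using S64 S n unfolding N_def by (intro mult_right_mono) auto
    also have "... = N^2" using S(1) by (simp add: power2_eq_square)
    finally show ?thesis unfolding X2 by (simp add: power_divide)
  qed
  then have "X \<le> N / 8" by (rule power2_le_imp_le) (simp add: N_def)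
  moreover have l2: "(real l)^2 \<le> N * S" unfolding X2[symmetric] using l(1) by (intro power_mono) auto
  moreover have "(N / real l)^2 \<le> 4 * S"
  proof -
    have "N * S / 4 \<le> (real l)^2" using power_mono[OF l(2), of 2] X1 X2 by (simp add: power_divide)
    then have "4 * S * (N * S / 4) \<le> 4 * S * (real l)^2" using S by (intro mult_left_mono) auto
    moreover have "4 * S * (N * S / 4) = N^2" using S(1) by (simp add: power2_eq_square)
    ultimately show ?thesis using l(3) by (simp add: power_divide divide_le_eq)
  qed
  ultimately show ?thesis using l(1,3) unfolding N_def S_def by (intro exI[of _ l]) auto
qed

text \<open>The order of choice matters: \<open>K\<close> depends only on \<open>a\<close>, the
  block fraction \<open>\<epsilon>\<close> is then taken small against \<open>K\<close>, and
  \<open>w\<close> is the integer part of \<open>\<epsilon> * n\<close>. Hence \<open>r\<close>,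
  \<open>c0\<close> and \<open>c1\<close> are uniform in \<open>n\<close>.\<close>

lemma static_parameters:
  fixes a vt :: real
  assumes a: "a > 0"
  shows "\<exists>K r c0 c1 n0. 0 \<le> K \<and> 0 \<le> c0 \<and> 0 \<le> c1 \<and> (\<forall>n\<ge>n0. bign2 a vt n \<and> (\<exists>w>0. w \<le> n \<and> real n / real w \<le> r \<and>
    dissipative a vt n w K c0 c1))"
proof -
  define \<beta> where "\<beta> = 1 / (42 * (a + 1))"
  define Cz where "Cz = 2 * (a^2 + 1)"
  define s where "s = 24 * a * Cz"
  define K where "K = 24 * a + 100 * (248 :: real) * a + 6 * a * s + 1"
  define D2 where "D2 = 16 * a * (14 * Cz)"
  define D3 where "D3 = 4 * a * (14 * K^2 + 5/2 + 6 * K)"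
  \<comment> \<open>Each summand is a lower bound required of \<open>1 / \<epsilon>\<close>: for
    \<open>q <= \<epsilon>\<close>, for the three smallness conditions of
    \<open>static_estimate\<close>, and for \<open>w <= n / 100\<close>.\<close>
  define D where "D = 4 / \<beta> + 400 * 248 + D2 + D3 + 100"
  define \<epsilon> where "\<epsilon> = 1 / D"
  define r where "r = 2 / \<epsilon>"
  define Cc where "Cc = 4 * a + 1 + 4 * K * r^2"
  define c1 where "c1 = a * (3200 * 248^2 / \<beta> + 80 * 248) + 4 * a * \<bar>vt\<bar>"
  define c0 where "c0 = 80 * 248 * a + 4 * a * (6 * Cc^2 + 6 * Cc + 24 * r * (a + 1 + 4 * K)) + 128 * a + (16 * a * 248 + 8 * a^2 + 1 + a + K * (8 * r^3 + 16 * a * r))"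
  \<comment> \<open>The summands ensure, in turn, a nonempty block of at least half its nominal
    size, \<open>gam\<close> within a quarter of \<open>1/2\<close>, the bound \<open>g36'\<close>,
    and the mesoscopic scale.\<close>
  define n0 where "n0 = nat \<lceil>2 / \<epsilon>\<rceil> + nat \<lceil>(2 * \<bar>vt\<bar>)^2\<rceil> + nat \<lceil>(a * \<bar>vt\<bar>)^2\<rceil> + 4096"
  have pos: "\<beta> > 0" "Cz > 0" "s \<ge> 0" "K \<ge> 0" unfolding \<beta>_def K_def s_def Cz_def using a by (auto simp: add_nonneg_pos)
  have D23: "D2 \<ge> 0" "D3 \<ge> 0" unfolding D2_def D3_def using a pos by auto
  have D100: "D \<ge> 100" unfolding D_def using D23 pos by simp
  have \<epsilon>: "\<epsilon> > 0" "\<epsilon> * D = 1" unfolding \<epsilon>_def using D100 by auto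
  have le1: "\<epsilon> * y \<le> 1" if "y \<le> D" for y using mult_left_mono[OF that, of \<epsilon>] \<epsilon> by simp
  have e: "\<epsilon> * (4 / \<beta>) \<le> 1" "\<epsilon> * (400 * 248) \<le> 1" "\<epsilon> * D2 \<le> 1" "\<epsilon> * D3 \<le> 1" "\<epsilon> * 100 \<le> 1"
    by (rule le1, use D23 pos in \<open>simp add: D_def\<close>)+
  have r0: "r \<ge> 0" unfolding r_def using \<epsilon> by simp
  have Cc0: "Cc \<ge> 0" unfolding Cc_def using a pos by simp
  have c10: "c1 \<ge> 0" unfolding c1_def using a pos by simp
  have c00: "c0 \<ge> 0" unfolding c0_def using a pos Cc0 r0 by simp
  have main: "bign2 a vt n \<and> (\<exists>w>0. w \<le> n \<and> real n / real w \<le> r \<and>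
    dissipative a vt n w K c0 c1)" if n: "n \<ge> n0" for n
  proof -
    define N where "N = real n"
    have n4: "n \<ge> 4096" and n3: "n \<ge> 3" using n unfolding n0_def by auto
    have N4: "N \<ge> 4096" using n4 unfolding N_def by simp
    have N1: "2 / \<epsilon> \<le> N" "(2 * \<bar>vt\<bar>)^2 \<le> N" "(a * \<bar>vt\<bar>)^2 \<le> N"
      unfolding N_def using n unfolding n0_def by (linarith, linarith, linarith)
    have t: "2 * \<bar>vt\<bar> \<le> sqrt N" "a * \<bar>vt\<bar> \<le> sqrt N" using N1 by (simp_all add: real_le_rsqrt)
    have g: "\<bar>1 - 2 * gam vt n\<bar> \<le> 1/2" "1/4 \<le> gam vt n" "gam vt n \<le> 3/4"
      using gam_bounds[of n vt "1/2"] t(1) n3 unfolding N_def by auto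
    have "\<bar>1 - 2 * gam vt n\<bar> \<le> 1 / a" using gam_bounds(1)[of n vt "1 / a"] t(2) n3 a unfolding N_def by (simp add: field_simps)
    then have "4 * a * \<bar>1 - 2 * gam vt n\<bar> \<le> 4 * a * (1 / a)" using a by (intro mult_left_mono) auto
    then have g36: "4 * a * \<bar>1 - 2 * gam vt n\<bar> \<le> 36" using a by simp
    moreover have "2 * a * \<bar>1 - 2 * gam vt n\<bar> \<le> 4 * a * \<bar>1 - 2 * gam vt n\<bar>" using a by (intro mult_right_mono) auto
    ultimately have b: "bign2 a vt n" by unfold_locales (use a n3 g in auto)
    obtain l where l: "l > 0" "real l \<le> N / 8" "(real l)^2 \<le> real n * sqrt (real n)" "(real n / real l)^2 \<le> 4 * sqrt (real n)"
      using mesoscopic_scale[OF n4] unfolding N_def by blast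
    have eN: "2 \<le> \<epsilon> * N" using N1(1) \<epsilon>(1) by (simp add: field_simps)
    then have eN1: "1 \<le> \<epsilon> * N" by simp
    define w where "w = nat \<lfloor>\<epsilon> * N\<rfloor>"
    note w = nat_floor_bounds[OF eN1, folded w_def]
    define e' where "e' = real w / real n"
    define q where "q = (2 * real w)^2 / (\<beta> * (real n)^2)"
    have e'le: "e' \<le> \<epsilon>" "0 \<le> e'" unfolding e'_def using w(1) n3 by (simp_all add: N_def divide_le_eq)
    have qle: "q \<le> \<epsilon>"
    proof -
      have "q = 4 / \<beta> * (e' * e')" unfolding q_def e'_def by (simp add: power2_eq_square)
      also have "... \<le> 4 / \<beta> * (\<epsilon> * \<epsilon>)" using e'le pos \<epsilon> by (intro mult_left_mono mult_mono) auto
      also have "... = \<epsilon> * (4 / \<beta>) * \<epsilon>" by simp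
      also have "... \<le> 1 * \<epsilon>" using e(1) \<epsilon>(1) by (intro mult_right_mono) auto
      finally show ?thesis by simp
    qed
    have wn: "real w \<le> N / 100"
    proof -
      have "\<epsilon> * N \<le> 1 / 100 * N" using e(5) N4 by (intro mult_right_mono) auto
      then show ?thesis using w(1) by simp
    qed
    have wl: "4 * w + 4 * l + 8 < n"
    proof -
      have "real (4 * w + 4 * l + 8) < N" using wn l(2) N4 by simp
      then show ?thesis unfolding N_def by linarith
    qed
    have rw: "real n / real w \<le> r"
    proof -
      have "N \<le> 2 / \<epsilon> * real w" using w(2) \<epsilon>(1) by (simp add: field_simps)
      then show ?thesis unfolding r_def N_def using w(3) by (simp add: divide_le_eq)
    qed
    have q1: "400 * q * 248 \<le> 1" using e(2) qle by linarith
    have q2: "4 * a * ((12 * q + 2 * e') * Cz) \<le> 1/4"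
    proof -
      have "4 * a * ((12 * q + 2 * e') * Cz) \<le> 4 * a * ((14 * \<epsilon>) * Cz)"
        using qle e'le a pos by (intro mult_left_mono mult_right_mono) auto
      also have "... = \<epsilon> * D2 / 4" unfolding D2_def by simp
      finally show ?thesis using e(3) by simp
    qed
    have q3: "4 * a * (12 * q * K^2 + 2 * e' * K^2 + 5/2 * e' + 6 * K * e') \<le> 1"
    proof -
      have "12 * q * K^2 \<le> 12 * \<epsilon> * K^2" "2 * e' * K^2 \<le> 2 * \<epsilon> * K^2" "5/2 * e' \<le> 5/2 * \<epsilon>" "6 * K * e' \<le> 6 * K * \<epsilon>"
        using qle e'le pos by (auto intro!: mult_left_mono mult_right_mono)
      then have "12 * q * K^2 + 2 * e' * K^2 + 5/2 * e' + 6 * K * e' \<le> 12 * \<epsilon> * K^2 + 2 * \<epsilon> * K^2 + 5/2 * \<epsilon> + 6 * K * \<epsilon>" by (intro add_mono)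
      also have "... = \<epsilon> * (14 * K^2 + 5/2 + 6 * K)" by (simp add: algebra_simps)
      finally have "4 * a * (12 * q * K^2 + 2 * e' * K^2 + 5/2 * e' + 6 * K * e') \<le> 4 * a * (\<epsilon> * (14 * K^2 + 5/2 + 6 * K))" using a by (intro mult_left_mono) auto
      also have "... = \<epsilon> * D3" unfolding D3_def by simp
      finally show ?thesis using e(4) by simp
    qed
    have g1: "gam vt n \<le> 1" using g by simp
    have "EE n p (gen_L a vt n (%cf. ln (p cf) - UU n cf + Phi n w 248 (a * gam vt n) K (fld n cf)))
      \<le> - (1/2) * Dex n p - a * DG (gam vt n) n (UU n) p - (1/2) * EE n p (%cf. P1 n (fld n cf))
        + c1 / sqrt (real n) * EE n p (%cf. Phi n w 248 (a * gam vt n) K (fld n cf)) + c0"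
      if p: "pmfn n p" and pp: "\<forall>cf\<in>Omega n. 0 < p cf" for p
      unfolding c1_def c0_def
      by (rule pmfn.static_estimate[OF p bspec[OF pp] n3 a g(2) g1 w(3) l(1) wl l(3,4) rw, folded \<beta>_def Cz_def, folded s_def, folded K_def, folded Cc_def, folded q_def e'_def, OF _ q1 q2 q3])
    then have "dissipative a vt n w K c0 c1" unfolding dissipative_def by blast
    moreover have "w \<le> n" using wl by simp
    ultimately show ?thesis using b w(3) rw by blast
  qed
  then show ?thesis using pos(4) c00 c10 by blast
qed

theorem theorem2p10:
  fixes a \<theta> :: real
  assumes "a > 0"
    and "LSI \<theta>"
  shows "\<exists>\<kappa>>0. \<forall>T>0. \<exists>C>0. \<forall>n. admissible \<theta> n \<longrightarrow>
    (\<forall>\<mu>. prob_space \<mu> \<and> sets \<mu> = Pow (Omega n) \<longrightarrow>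
      (\<forall>t\<in>{0..T}.
        free_energy n (nu_g a \<theta> n) \<kappa> (dens_at a \<theta> n \<mu> t)
          + integral {0..t} (\<lambda>s. carre a \<theta> n (nu_g a \<theta> n) (dens_at a \<theta> n \<mu> s))
        \<le> C * free_energy n (nu_g a \<theta> n) \<kappa> (dens_at a \<theta> n \<mu> 0) + C * sqrt (real n)))"
\<comment> \<open>\<open>\<kappa> = 1\<close> gives the magnetisation term \<open>1/4 * P0\<close>,
  enough to compensate the zero mode in \<open>entropy_le_FF\<close>.\<close>
proof (rule exI[of _ 1], intro conjI allI impI)
  fix T :: real assume T: "T > 0"
  have a0: "a \<ge> 0" using assms(1) by simp
  have adm: "n > 0" "n \<ge> 2" "0 \<le> gam \<theta> n" "gam \<theta> n \<le> 1" "sqrt (real n) \<ge> 1" if "admissible \<theta> n" for n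
  proof -
    have n: "3 \<le> n" "\<theta>^2 < real n" using that unfolding admissible_def by auto
    then show "n > 0" "n \<ge> 2" "sqrt (real n) \<ge> 1" by auto
    have "\<bar>\<theta>\<bar> \<le> 1 * sqrt (real n)" using n(2) by (simp add: real_le_rsqrt)
    then show "0 \<le> gam \<theta> n" "gam \<theta> n \<le> 1" using gam_bounds[of n \<theta> 1] n by auto
  qed
  obtain K r c0 c1 n0 where P: "0 \<le> K" "0 \<le> c0" "0 \<le> c1" and large: "!!n. n \<ge> n0 ==> bign2 a \<theta> n \<and> (\<exists>w>0. w \<le> n \<and> real n / real w \<le> r \<and>
    dissipative a \<theta> n w K c0 c1)"
    using static_parameters[OF assms(1), of \<theta>] by blast
  \<comment> \<open>For each fixed \<open>n\<close> the left-hand side is bounded on the time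
    interval. The finitely many bounds below \<open>n0\<close> are absorbed by
    \<open>C * sqrt n\<close>, since \<open>sqrt n >= 1\<close> and the initial free energy is
    nonnegative.\<close>
  have small: "\<exists>B. \<forall>m t. admissible \<theta> n --> pmfn n m --> t \<in> {0..T} -->
      FE a \<theta> n (pt a \<theta> n m t) + integral {0..t} (%s. CR a \<theta> n (pt a \<theta> n m s)) \<le> B" for n
  proof (cases "admissible \<theta> n")
    case True
    obtain c where c: "!!p. pmfn n p ==> 0 \<le> CR a \<theta> n p \<and> CR a \<theta> n p \<le> c"
      using CR_bounds[OF a0 adm(2,3,4)[OF True]] by blast
    define F where "F = (\<Sum>cf\<in>Omega n. \<bar>LW a \<theta> n cf\<bar> + 1/4 * P0 n (fld n cf))"
    have "FE a \<theta> n (pt a \<theta> n m t) + integral {0..t} (%s. CR a \<theta> n (pt a \<theta> n m s)) \<le> F + T * \<bar>c\<bar>"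
      if m: "pmfn n m" and t: "t \<in> {0..T}" for m t
    proof -
      have pm: "pmfn n (pt a \<theta> n m s)" if "s \<ge> 0" for s by (rule pt_pmfn(1)[OF a0 adm(2,3,4)[OF True] that m])
      have "integral {0..t} (%s. CR a \<theta> n (pt a \<theta> n m s)) \<le> integral {0..t} (%s. \<bar>c\<bar>)"
      proof (rule integral_le)
        show "(%s. CR a \<theta> n (pt a \<theta> n m s)) integrable_on {0..t}"
          by (rule integrable_continuous_interval[OF CR_continuous[OF adm(1)[OF True]]])
        fix s assume "s \<in> {0..t}"
        then have "CR a \<theta> n (pt a \<theta> n m s) \<le> c" using c[OF pm[of s]] by simp
        then show "CR a \<theta> n (pt a \<theta> n m s) \<le> \<bar>c\<bar>" by linarith
      qed (rule integrable_const_ivl)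
      also have "... \<le> T * \<bar>c\<bar>" using t by (simp add: mult_right_mono)
      finally show ?thesis using FE_bounds(2)[OF pm, of t a \<theta>] t unfolding F_def by simp
    qed
    then show ?thesis by blast
  qed simp
  then obtain B where B: "!!n m t. admissible \<theta> n ==> pmfn n m ==> t \<in> {0..T} ==>
      FE a \<theta> n (pt a \<theta> n m t) + integral {0..t} (%s. CR a \<theta> n (pt a \<theta> n m s)) \<le> B n" by metis
  define C where "C = 1 + \<bar>bign2.C1 a \<theta> K c1 T\<bar> + \<bar>bign2.C2 a \<theta> K r c0 c1 T\<bar> + (\<Sum>n<n0. \<bar>B n\<bar>)"
  have S0: "0 \<le> (\<Sum>n<n0. \<bar>B n\<bar>)" by (rule sum_nonneg) simp
  have C1C: "bign2.C1 a \<theta> K c1 T \<le> C" unfolding C_def using S0 by linarith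
  have C2C: "bign2.C2 a \<theta> K r c0 c1 T \<le> C" unfolding C_def using S0 by linarith
  show "\<exists>C>0. \<forall>n. admissible \<theta> n --> (\<forall>\<mu>. prob_space \<mu> \<and> sets \<mu> = Pow (Omega n) -->
      (\<forall>t\<in>{0..T}. free_energy n (nu_g a \<theta> n) 1 (dens_at a \<theta> n \<mu> t)
          + integral {0..t} (%s. carre a \<theta> n (nu_g a \<theta> n) (dens_at a \<theta> n \<mu> s))
        \<le> C * free_energy n (nu_g a \<theta> n) 1 (dens_at a \<theta> n \<mu> 0) + C * sqrt (real n)))"
  proof (intro exI[of _ C] conjI allI impI ballI)
    show "C > 0" unfolding C_def using S0 by linarith
    fix n \<mu> t assume n: "admissible \<theta> n" and \<mu>: "prob_space \<mu> \<and> sets \<mu> = Pow (Omega n)" and t: "t \<in> {0..T}"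
    define m where "m cf = measure \<mu> {cf}" for cf
    have m: "pmfn n m" unfolding m_def by (rule prob_pmfn) (use \<mu> adm[OF n] in auto)
    have pm: "pmfn n (pt a \<theta> n m s)" if "s \<ge> 0" for s by (rule pt_pmfn(1)[OF a0 adm(2,3,4)[OF n] that m])
    have dens: "dens_at a \<theta> n \<mu> s cf = pt a \<theta> n m s cf / nuw a \<theta> n cf" if "s \<ge> 0" "cf \<in> Omega n" for s cf
      using dens_pt[OF conjunct1[OF \<mu>] conjunct2[OF \<mu>] pm[OF that(1), unfolded m_def[abs_def]] that(2)] unfolding m_def .
    have fe: "free_energy n (nu_g a \<theta> n) 1 (dens_at a \<theta> n \<mu> s) = FE a \<theta> n (pt a \<theta> n m s)" if "s \<ge> 0" for s
      by (rule free_energy_FE[OF adm(1)[OF n] dens[OF that] pmfn.p0[OF pm[OF that]]])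
    have cr: "carre a \<theta> n (nu_g a \<theta> n) (dens_at a \<theta> n \<mu> s) = CR a \<theta> n (pt a \<theta> n m s)" if "s \<ge> 0" for s
      by (rule carre_CR[OF adm(1)[OF n] dens[OF that] pmfn.p0[OF pm[OF that]]])
    have int: "integral {0..t} (%s. carre a \<theta> n (nu_g a \<theta> n) (dens_at a \<theta> n \<mu> s)) = integral {0..t} (%s. CR a \<theta> n (pt a \<theta> n m s))"
      by (rule integral_cong) (simp add: cr)
    have fe0: "FE a \<theta> n (pt a \<theta> n m 0) = FE a \<theta> n m"
      unfolding FE_def EE_def by (intro arg_cong2[of _ _ _ _ "(+)"] arg_cong2[of _ _ _ _ "(-)"] arg_cong2[of _ _ _ _ "(*)"] sum.cong refl) (simp_all add: pt_0)
    have F0: "0 \<le> FE a \<theta> n m" by (rule FE_bounds(1)[OF m])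
    have "FE a \<theta> n (pt a \<theta> n m t) + integral {0..t} (%s. CR a \<theta> n (pt a \<theta> n m s)) \<le> C * FE a \<theta> n m + C * sqrt (real n)"
    proof (cases "n < n0")
      case True
      have "FE a \<theta> n (pt a \<theta> n m t) + integral {0..t} (%s. CR a \<theta> n (pt a \<theta> n m s)) \<le> \<bar>B n\<bar>" using B[OF n m t] by linarith
      also have "... \<le> (\<Sum>n<n0. \<bar>B n\<bar>)" using True by (intro member_le_sum) auto
      also have "... \<le> C * 1" unfolding C_def by simp
      also have "... \<le> C * sqrt (real n)" using adm(5)[OF n] S0 unfolding C_def by (intro mult_left_mono) auto
      also have "... \<le> C * FE a \<theta> n m + C * sqrt (real n)" using F0 S0 unfolding C_def by simp
      finally show ?thesis .
    next
      case False
      then have b: "bign2 a \<theta> n" using large[of n] by simp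
      obtain w where w: "w > 0" "w \<le> n" "real n / real w \<le> r" and st: "dissipative a \<theta> n w K c0 c1"
        using large[of n] False by auto
      have "FE a \<theta> n (pt a \<theta> n m t) + integral {0..t} (%s. CR a \<theta> n (pt a \<theta> n m s))
        \<le> bign2.C1 a \<theta> K c1 T * FE a \<theta> n m + bign2.C2 a \<theta> K r c0 c1 T * sqrt (real n)"
        by (rule bign2.free_energy_estimate[OF b m _ _ P w st]) (use t in auto)
      also have "... \<le> C * FE a \<theta> n m + C * sqrt (real n)"
        using F0 by (intro add_mono mult_right_mono C1C C2C) auto
      finally show ?thesis .
    qed
    then show "free_energy n (nu_g a \<theta> n) 1 (dens_at a \<theta> n \<mu> t)
          + integral {0..t} (%s. carre a \<theta> n (nu_g a \<theta> n) (dens_at a \<theta> n \<mu> s))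
        \<le> C * free_energy n (nu_g a \<theta> n) 1 (dens_at a \<theta> n \<mu> 0) + C * sqrt (real n)"
      using t by (simp only: int fe fe0 atLeastAtMost_iff order_refl)
  qed
qed simp

end
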